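(* Let $n\ge2$, $1\le k\le n-1$, $r\ge1$, and let $\mathcal T_h$ be a conforming simplicial mesh of a bounded domain $\Omega\subset\mathbb R^n$. For each $f\in\Delta_\ell(\mathcal T_h)$, $\ell=0,\dots,n-1$, choose a $t$-$n$ basis $\{\boldsymbol t_1^f,\dots,\boldsymbol t_\ell^f,\boldsymbol n_1^f,\dots,\boldsymbol n_{n-\ell}^f\}$ depending only on $f$; let $\{\mathrm dy_i^f\}$ be the corresponding basis of $\mathrm{Alt}^1$ and $\{\mathrm d\hat y_i^f\}$ its dual basis. Then the degrees of freedom (DoFs) (a) $\omega(\mathtt v)\in\mathbb X$, for $\mathtt v\in\Delta_0(\mathcal T_h)$; (b) $(\omega,\eta)_f$, for $\eta\in\mathbb P_{r-(\ell+1)}(f)\otimes\mathrm{span}\{\mathrm d\hat y^f_\sigma\otimes*\mathrm d\hat y^f_i:(\sigma,i)\text{ is free},\ i\in\mathscr N^f\}$, $f\in\Delta_\ell(\mathcal T_h)$, $\ell=1,\dots,n-1$; (c) $(\omega,\eta)_T$, for $\eta\in\mathbb B_r(\mathrm{div},T;\mathbb X)$, $T\in\mathcal T_h$, determine a finite element space $V_h\subset H(\mathrm{div},\Omega;\mathbb X)$. That is, for each $T\in\mathcal T_h$ the DoFs (a)--(c) attached to $T$ and its sub-simplices uniquely determine an element of $\mathbb P_r(T;\mathbb X)$ (unisolvence), and the space $V_h$ of all $\omega\in L^2(\Omega;\mathbb X)$ with $\omega|_T\in\mathbb P_r(T;\mathbb X)$ for all $T\in\mathcal T_h$ and with the DoFs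 (a) and (b) single-valued is contained in $H(\mathrm{div},\Omega;\mathbb X)$.
   Context: Forms. $\mathrm{Alt}^j$ is the space of alternating $j$-linear forms on $\mathbb R^n$ with the inner product for which $\{\mathrm dx_\sigma\}$ is orthonormal ($\mathrm dx_i$ the standard orthonormal basis of $\mathrm{Alt}^1$); $\mathrm{Alt}^{k,n-1}=\mathrm{Alt}^k\otimes\mathrm{Alt}^{n-1}$ has the tensor product inner product $\langle\cdot,\cdot\rangle$. The map $s^{k,n-1}:\mathrm{Alt}^{k,n-1}\to\mathrm{Alt}^{k-1}\otimes\mathrm{Alt}^n$ is $$s^{k,n-1}\omega(w_1,\dots,w_{k-1})(v_1,\dots,v_n)=\sum_{i=1}^n(-1)^{i-1}\omega(v_i,w_1,\dots,w_{k-1})(v_1,\dots,\widehat{v_i},\dots,v_n),$$ and $\mathbb X:=\ker(s^{k,n-1})$. $(\omega,\eta)_f=\int_f\langle\omega,\eta\rangle\,\mathrm dx_f$. Index notation. $\Sigma(1:j,1:n)$ is the set of increasing sequences of length $j$ in $\{1,\dots,n\}$, identified with subsets; $\sigma^c$ is the complement; $i+\tau=\tau\cup\{i\}$ for $i\notin\tau$. For a basis $\{\mathrm dy_i\}$ of $\mathrm{Alt}^1$: $\mathrm dy_\sigma=\mathrm dy_{\sigma(1)}\wedge\cdots\wedge \mathrm dy_{\sigma(k)}$, $*\mathrm dy_i=(-1)^{i-1}\mathrm dy_1\wedge\cdots\wedge\widehat{\mathrm dy_i}\wedge\cdots\wedge \mathrm dy_n$, and the dual basis $\{\mathrm d\hat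 y_i\}$ of $\mathrm{Alt}^1$ satisfies $\langle \mathrm d\hat y_i,\mathrm dy_j\rangle=\delta_{i,j}$. Free indices. For $\tau\in\Sigma(1:k-1,1:n)$ with $\tau^c=\{i_1<\dots<i_{n-k+1}\}$, the constraint sequence of $\tau$ is $\{(i_m+\tau,i_m)\}_{m=1}^{n-k+1}$ and $(i_1+\tau,i_1)$ is its pair index. An index $(\sigma,i)$, $\sigma\in\Sigma(1:k,1:n)$, $1\le i\le n$, is free if it is not the pair index of any constraint sequence. $t$-$n$ basis. $\Delta_\ell(T)$, $\Delta_\ell(\mathcal T_h)$ are the sets of $\ell$-dimensional sub-simplices of $T$, $\mathcal T_h$. A $t$-$n$ basis of $f$ (of dimension $\ell$) consists of $\ell$ linearly independent unit vectors $\boldsymbol t_i^f$ tangential to $f$ followed by $n-\ell$ linearly independent unit vectors $\boldsymbol n_j^f$ orthogonal to the tangent plane of $f$. The corresponding basis of $\mathrm{Alt}^1$ is $\mathrm dy_i^f(w)=\boldsymbol t_i^f\cdot w$ for $1\le i\le\ell$ and $\mathrm dy_i^f(w)=\boldsymbol n_{i-\ell}^f\cdot w$ for $\ell+1\le i\le n$; the latter range is written $i\in\mathscr N^f$. Spaces. A mesh is conforming if any two simplices intersect in the empty set or a common sub-simplex. $\mathbb P_r(f)$: polynomials of degree $\le r$ on $f$ ($\{0\}$ if $r<0$); $\mathbb P_r(T;\mathbb X)$: $\mathbb X$-valued polynomials of degree $\le r$. For $\omega=\sum_{\sigma,i}a_{\sigma,i}\,\mathrm dx_\sigma\otimes*\mathrm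 dx_i$, with matrix $\boldsymbol A=(a_{\sigma,i})$: $\mathrm{div}\,\omega$ is the row-wise divergence $\big(\sum_i\partial_{x_i}a_{\sigma,i}\big)_\sigma$, $\mathrm{tr}_F^{\mathrm{div}}\omega=\boldsymbol A\boldsymbol n_F|_F$ on an $(n-1)$-dimensional face $F$ with unit normal $\boldsymbol n_F$, $H(\mathrm{div},\Omega;\mathbb X)=\{\omega\in L^2(\Omega;\mathbb X):\mathrm{div}\,\omega\in L^2\}$, and $\mathbb B_r(\mathrm{div},T;\mathbb X)=\{\omega\in\mathbb P_r(T;\mathbb X):\mathrm{tr}_F^{\mathrm{div}}\omega=0\ \forall F\in\Delta_{n-1}(T)\}$. A DoF attached to $f$ is single-valued if its values computed from $\omega|_T$ and $\omega|_{T'}$ coincide for all $T,T'\in\mathcal T_h$ containing $f$. *)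

theory Defs
  imports "HOL-Analysis.Analysis"
begin

section \<open>Alternating forms\<close>

text \<open>
  The dimension \<open>n\<close> is \<open>CARD('n)\<close>; the well-order on \<open>'n\<close> identifies \<open>'n\<close> with \<open>{1, \<dots>, n}\<close> by
  \<open>pos\<close>. An increasing sequence in \<open>{1, \<dots>, n}\<close> is given by its set of entries.
  A \<open>j\<close>-linear form takes the list of its \<open>j\<close> arguments and is zero on lists of any other length, so
  that equality of forms is equality of functions.
\<close>

type_synonym 'n euc = "real^'n"
type_synonym 'n form = "'n euc list \<Rightarrow> real"
type_synonym 'n dform = "'n euc list \<Rightarrow> 'n euc list \<Rightarrow> real"
type_synonym 'n dform_field = "'n euc \<Rightarrow> 'n dform"

definition pos :: "'n::{finite,wellorder} \<Rightarrow> nat" where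
  "pos i = card {..i}"

definition Alt :: "nat \<Rightarrow> 'n::{finite,wellorder} form set" where
  "Alt j = {\<alpha>. (\<forall>ws. length ws \<noteq> j \<longrightarrow> \<alpha> ws = 0) \<and>
               (\<forall>ws i. length ws = j \<and> i < j \<longrightarrow> linear (\<lambda>v. \<alpha> (ws[i := v]))) \<and>
               (\<forall>ws i m. length ws = j \<and> i < m \<and> m < j \<and> ws ! i = ws ! m \<longrightarrow> \<alpha> ws = 0)}"

text \<open>\<open>\<alpha>\<^sub>1 \<and> \<dots> \<and> \<alpha>\<^sub>j\<close> for 1-forms, in the normalisation
  \<open>(\<alpha>\<^sub>1 \<and> \<dots> \<and> \<alpha>\<^sub>j)(w\<^sub>1, \<dots>, w\<^sub>j) = det (\<alpha>\<^sub>a(w\<^sub>b))\<close>.\<close>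
definition wedge :: "'n::{finite,wellorder} form list \<Rightarrow> 'n form" where
  "wedge \<alpha>s ws =
     (if length ws = length \<alpha>s
      then \<Sum>p | p permutes {..<length \<alpha>s}.
             of_int (sign p) * (\<Prod>a<length \<alpha>s. (\<alpha>s ! a) [ws ! p a])
      else 0)"

definition covector :: "('n::{finite,wellorder}) euc \<Rightarrow> 'n form" where
  "covector y ws = (if length ws = 1 then y \<bullet> hd ws else 0)"

abbreviation dx :: "'n::{finite,wellorder} \<Rightarrow> 'n form" where
  "dx i \<equiv> covector (axis i 1)"

definition wedge_set :: "('n::{finite,wellorder} \<Rightarrow> 'n form) \<Rightarrow> 'n set \<Rightarrow> 'n form" where
  "wedge_set dy \<sigma> = wedge (map dy (sorted_list_of_set \<sigma>))"

definition star :: "('n::{finite,wellorder} \<Rightarrow> 'n form) \<Rightarrow> 'n \<Rightarrow> 'n form" where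
  "star dy i ws = (- 1) ^ (pos i - 1) * wedge_set dy (UNIV - {i}) ws"

definition basis_vectors :: "'n::{finite,wellorder} set \<Rightarrow> 'n euc list" where
  "basis_vectors \<sigma> = map (\<lambda>i. axis i 1) (sorted_list_of_set \<sigma>)"

text \<open>The coefficient of \<open>\<alpha>\<close> at \<open>dx\<^sub>\<sigma>\<close> is the value of \<open>\<alpha>\<close> at \<open>basis_vectors \<sigma>\<close>; this is the inner
  product for which the \<open>dx\<^sub>\<sigma>\<close> are orthonormal, cf. \<open>Alt_inner_dx\<close> below.\<close>
definition Alt_inner :: "nat \<Rightarrow> 'n::{finite,wellorder} form \<Rightarrow> 'n form \<Rightarrow> real" where
  "Alt_inner j \<alpha> \<beta> = (\<Sum>\<sigma> | card \<sigma> = j. \<alpha> (basis_vectors \<sigma>) * \<beta> (basis_vectors \<sigma>))"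

lemma wedge_set_dx_basis_vectors:
  fixes \<sigma> \<rho> :: "'n::{finite,wellorder} set"
  assumes "card \<sigma> = card \<rho>"
  shows "wedge_set dx \<sigma> (basis_vectors \<rho>) = (if \<sigma> = \<rho> then 1 else 0)"
proof -
  define xs where "xs = sorted_list_of_set \<sigma>"
  define zs where "zs = sorted_list_of_set \<rho>"
  define j where "j = card \<rho>"
  have len: "length xs = j" "length zs = j" using assms by (simp_all add: xs_def zs_def j_def)
  have dist: "distinct zs" "distinct xs" and set: "set xs = \<sigma>" "set zs = \<rho>"
    by (simp_all add: xs_def zs_def)
  have "wedge_set dx \<sigma> (basis_vectors \<rho>) =
      (\<Sum>p | p permutes {..<j}. of_int (sign p) *
         (\<Prod>a<j. (map dx xs ! a) [map (\<lambda>i. axis i 1) zs ! p a]))"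
    using len by (simp add: wedge_set_def basis_vectors_def wedge_def xs_def zs_def)
  also have "\<dots> = (\<Sum>p | p permutes {..<j}. of_int (sign p) *
         (\<Prod>a<j. if xs ! a = zs ! p a then 1 else 0))"
  proof (intro sum.cong refl arg_cong2[where f = "(*)"] prod.cong)
    fix p a assume "p \<in> {p. p permutes {..<j}}" "a \<in> {..<j}"
    then have "p a < j" "a < j" using permutes_in_image[of p "{..<j}" a] by auto
    then show "(map dx xs ! a) [map (\<lambda>i. axis i 1) zs ! p a] =
        (if xs ! a = zs ! p a then 1 else 0)"
      using len by (simp add: covector_def inner_axis_axis)
  qed
  also have "\<dots> = (\<Sum>p | p permutes {..<j}. if p = id \<and> \<sigma> = \<rho> then 1 else 0)"
  proof (intro sum.cong refl)
    fix p assume "p \<in> {p. p permutes {..<j}}"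
    then have p: "p permutes {..<j}" by simp
    show "of_int (sign p) * (\<Prod>a<j. if xs ! a = zs ! p a then 1 else 0) =
        (if p = id \<and> \<sigma> = \<rho> then 1 else (0::real))"
    proof (cases "\<forall>a<j. xs ! a = zs ! p a")
      case True
      moreover have "zs ! p a \<in> set zs" if "a < j" for a
        using len permutes_in_image[OF p, of a] that by simp
      ultimately have "set xs \<subseteq> set zs" using len by (auto simp: set_conv_nth[of xs])
      then have eq: "\<sigma> = \<rho>" using set assms by (simp add: card_subset_eq)
      then have "xs = zs" by (simp add: xs_def zs_def)
      then have "p a = a" if "a < j" for a
        using True that dist len permutes_in_image[OF p, of a] nth_eq_iff_index_eq[of zs a "p a"]
        by auto
      then have "p = id" using p by (auto simp: permutes_def fun_eq_iff)
      then show ?thesis using True eq by (simp add: prod.neutral)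
    next
      case False
      then have "\<not> (p = id \<and> \<sigma> = \<rho>)" by (auto simp: xs_def zs_def)
      moreover have "(\<Prod>a<j. if xs ! a = zs ! p a then 1 else (0::real)) = 0"
        using False by (intro prod_zero) auto
      ultimately show ?thesis by auto
    qed
  qed
  also have "\<dots> = (if \<sigma> = \<rho> then 1 else 0)"
    by (cases "\<sigma> = \<rho>") (auto simp: finite_permutations permutes_id)
  finally show ?thesis .
qed

lemma Alt_inner_dx:
  fixes \<sigma> \<rho> :: "'n::{finite,wellorder} set"
  assumes "card \<sigma> = j" "card \<rho> = j"
  shows "Alt_inner j (wedge_set dx \<sigma>) (wedge_set dx \<rho>) = (if \<sigma> = \<rho> then 1 else 0)"
proof -
  have "Alt_inner j (wedge_set dx \<sigma>) (wedge_set dx \<rho>) =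
      (\<Sum>\<mu> | card \<mu> = j. if \<mu> = \<sigma> then (if \<sigma> = \<rho> then 1 else 0) else 0)"
    unfolding Alt_inner_def using assms
    by (intro sum.cong) (auto simp: wedge_set_dx_basis_vectors)
  then show ?thesis using assms by auto
qed

definition tensor :: "'n::{finite,wellorder} form \<Rightarrow> 'n form \<Rightarrow> 'n dform" where
  "tensor \<alpha> \<beta> ws vs = \<alpha> ws * \<beta> vs"

definition Alt2 :: "nat \<Rightarrow> nat \<Rightarrow> 'n::{finite,wellorder} dform set" where
  "Alt2 j m = {\<omega>. \<exists>(N::nat) \<alpha> \<beta>. (\<forall>a<N. \<alpha> a \<in> Alt j \<and> \<beta> a \<in> Alt m) \<and>
                     \<omega> = (\<lambda>ws vs. \<Sum>a<N. tensor (\<alpha> a) (\<beta> a) ws vs)}"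

definition Alt2_inner :: "nat \<Rightarrow> nat \<Rightarrow> 'n::{finite,wellorder} dform \<Rightarrow> 'n dform \<Rightarrow> real" where
  "Alt2_inner j m \<omega> \<eta> =
     (\<Sum>\<sigma> | card \<sigma> = j. \<Sum>\<rho> | card \<rho> = m.
        \<omega> (basis_vectors \<sigma>) (basis_vectors \<rho>) * \<eta> (basis_vectors \<sigma>) (basis_vectors \<rho>))"

text \<open>Lists are indexed from 0, which turns \<open>(- 1)\<^sup>i\<^sup>-\<^sup>1\<close> into \<open>(- 1)\<^sup>i\<close>.\<close>
definition s_map :: "'n::{finite,wellorder} dform \<Rightarrow> 'n dform" where
  "s_map \<omega> ws vs =
     (\<Sum>i<length vs. (- 1) ^ i * \<omega> (vs ! i # ws) (take i vs @ drop (Suc i) vs))"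

definition XX :: "nat \<Rightarrow> 'n::{finite,wellorder} dform set" where
  "XX k = {\<omega> \<in> Alt2 k (CARD('n) - 1). s_map \<omega> = (\<lambda>ws vs. 0)}"

text \<open>The coefficient \<open>a\<^sub>\<sigma>\<^sub>,\<^sub>i\<close> in \<open>\<omega> = \<Sum> a\<^sub>\<sigma>\<^sub>,\<^sub>i dx\<^sub>\<sigma> \<otimes> *dx\<^sub>i\<close> (an orthonormal expansion).\<close>
definition coef :: "nat \<Rightarrow> 'n::{finite,wellorder} dform \<Rightarrow> 'n set \<Rightarrow> 'n \<Rightarrow> real" where
  "coef k \<omega> \<sigma> i = Alt2_inner k (CARD('n) - 1) \<omega> (tensor (wedge_set dx \<sigma>) (star dx i))"

definition dual_family ::
    "('n::{finite,wellorder} \<Rightarrow> 'n form) \<Rightarrow> ('n \<Rightarrow> 'n form) \<Rightarrow> bool" where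
  "dual_family dy dyh \<longleftrightarrow>
     (\<forall>i. dyh i \<in> Alt 1) \<and> (\<forall>i j. Alt_inner 1 (dyh i) (dy j) = (if i = j then 1 else 0))"


section \<open>Free indices\<close>

definition constraint_seq :: "'n::{finite,wellorder} set \<Rightarrow> ('n set \<times> 'n) list" where
  "constraint_seq \<tau> = map (\<lambda>i. (insert i \<tau>, i)) (sorted_list_of_set (- \<tau>))"

definition pair_index :: "'n::{finite,wellorder} set \<Rightarrow> 'n set \<times> 'n" where
  "pair_index \<tau> = hd (constraint_seq \<tau>)"

definition free_index :: "nat \<Rightarrow> 'n::{finite,wellorder} set \<times> 'n \<Rightarrow> bool" where
  "free_index k \<sigma>i \<longleftrightarrow>
     card (fst \<sigma>i) = k \<and> (\<forall>\<tau>. card \<tau> = k - 1 \<longrightarrow> \<sigma>i \<noteq> pair_index \<tau>)"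


section \<open>Simplices, meshes and bases adapted to a face\<close>

definition subsimplices :: "nat \<Rightarrow> ('n::{finite,wellorder}) euc set \<Rightarrow> 'n euc set set" where
  "subsimplices l T = {f. f face_of T \<and> int l simplex f}"

definition mesh_subsimplices ::
    "nat \<Rightarrow> ('n::{finite,wellorder}) euc set set \<Rightarrow> 'n euc set set" where
  "mesh_subsimplices l \<T> = (\<Union>T\<in>\<T>. subsimplices l T)"

definition domain :: "('n::{finite,wellorder}) euc set \<Rightarrow> bool" where
  "domain \<Omega> \<longleftrightarrow> open \<Omega> \<and> connected \<Omega> \<and> \<Omega> \<noteq> {}"

definition conforming_mesh ::
    "('n::{finite,wellorder}) euc set set \<Rightarrow> 'n euc set \<Rightarrow> bool" where
  "conforming_mesh \<T> \<Omega> \<longleftrightarrow>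
     triangulation \<T> \<and> (\<forall>T\<in>\<T>. int CARD('n) simplex T) \<and> \<Union>\<T> = closure \<Omega>"

definition tangent_space :: "('n::{finite,wellorder}) euc set \<Rightarrow> 'n euc set" where
  "tangent_space f = span {x - y | x y. x \<in> f \<and> y \<in> f}"

definition tn_basis ::
    "nat \<Rightarrow> ('n::{finite,wellorder}) euc set \<Rightarrow> ('n \<Rightarrow> 'n euc) \<Rightarrow> bool" where
  "tn_basis l f y \<longleftrightarrow>
     (\<forall>i. norm (y i) = 1) \<and>
     (\<forall>i. pos i \<le> l \<longrightarrow> y i \<in> tangent_space f) \<and>
     (\<forall>i. l < pos i \<longrightarrow> (\<forall>u\<in>tangent_space f. y i \<bullet> u = 0)) \<and>
     inj_on y {i. pos i \<le> l} \<and> independent (y ` {i. pos i \<le> l}) \<and>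
     inj_on y {i. l < pos i} \<and> independent (y ` {i. l < pos i})"


section \<open>Integrals over faces\<close>

definition orthonormal_frame ::
    "nat \<Rightarrow> ('n::{finite,wellorder}) euc set \<Rightarrow> 'n euc \<times> (nat \<Rightarrow> 'n euc) \<Rightarrow> bool" where
  "orthonormal_frame l f pb \<longleftrightarrow>
     fst pb \<in> f \<and>
     (\<forall>i<l. \<forall>j<l. snd pb i \<bullet> snd pb j = (if i = j then 1 else 0)) \<and>
     span (snd pb ` {..<l}) = tangent_space f"

lemma orthonormal_frame_exists:
  fixes f :: "('n::{finite,wellorder}) euc set"
  assumes "int l simplex f"
  shows "\<exists>pb. orthonormal_frame l f pb"
proof -
  have "aff_dim f = int l" using assms by (rule aff_dim_simplex)
  then obtain p where p: "p \<in> f" by fastforce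
  have dim: "dim (tangent_space f) = l"
  proof -
    have "tangent_space f = span ((\<lambda>x. x - p) ` f)"
    proof (rule antisym)
      have "x - y \<in> span ((\<lambda>x. x - p) ` f)" if "x \<in> f" "y \<in> f" for x y
      proof -
        have "x - y = (x - p) - (y - p)" by simp
        then show ?thesis using that by (metis span_diff span_base image_eqI)
      qed
      then show "tangent_space f \<subseteq> span ((\<lambda>x. x - p) ` f)"
        unfolding tangent_space_def by (intro span_minimal) auto
      show "span ((\<lambda>x. x - p) ` f) \<subseteq> tangent_space f"
        unfolding tangent_space_def using p by (intro span_mono) auto
    qed
    moreover have "aff_dim f = int (dim ((\<lambda>x. - p + x) ` f))"
      using aff_dim_eq_dim[of p f] p by (simp add: hull_inc)
    ultimately show ?thesis using \<open>aff_dim f = int l\<close> by simp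
  qed
  obtain B where B: "B \<subseteq> tangent_space f" "pairwise orthogonal B"
      "\<And>x. x \<in> B \<Longrightarrow> norm x = 1" "independent B" "card B = dim (tangent_space f)"
      "span B = tangent_space f"
    using orthonormal_basis_subspace[of "tangent_space f"] by (auto simp: tangent_space_def)
  have "finite B" using B(4) by (rule independent_imp_finite)
  then obtain b where b: "bij_betw b {..<l} B"
    using ex_bij_betw_nat_finite[of B] B(5) dim by (auto simp: atLeast0LessThan)
  have "b i \<bullet> b j = (if i = j then 1 else 0)" if "i < l" "j < l" for i j
  proof (cases "i = j")
    case True then show ?thesis using b B(3) that by (auto simp: bij_betw_def norm_eq_1)
  next
    case False
    then have "b i \<noteq> b j" "b i \<in> B" "b j \<in> B"
      using b that by (auto simp: bij_betw_def inj_on_def)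
    then show ?thesis using B(2) False by (auto simp: pairwise_def orthogonal_def)
  qed
  moreover have "span (b ` {..<l}) = tangent_space f"
    using b B(6) by (simp add: bij_betw_def)
  ultimately have "orthonormal_frame l f (p, b)" using p by (simp add: orthonormal_frame_def)
  then show ?thesis ..
qed

text \<open>The \<open>l\<close>-dimensional Lebesgue measure on an \<open>l\<close>-simplex \<open>f\<close>: the image of Lebesgue measure on
  \<open>\<real>\<^sup>l\<close> under an isometric affine parametrisation of the affine hull of \<open>f\<close>. Two such
  parametrisations differ by an isometry of \<open>\<real>\<^sup>l\<close>, so the chosen frame does not matter.\<close>
definition face_measure :: "nat \<Rightarrow> ('n::{finite,wellorder}) euc set \<Rightarrow> 'n euc measure" where
  "face_measure l f =
     (let pb = (SOME pb. orthonormal_frame l f pb)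
      in restrict_space
           (distr (PiM {..<l} (\<lambda>_. lborel)) borel (\<lambda>c. fst pb + (\<Sum>i<l. c i *\<^sub>R snd pb i))) f)"

definition face_ip ::
    "nat \<Rightarrow> nat \<Rightarrow> ('n::{finite,wellorder}) euc set \<Rightarrow> 'n dform_field \<Rightarrow> 'n dform_field \<Rightarrow> real" where
  "face_ip k l f \<omega> \<eta> =
     integral\<^sup>L (face_measure l f) (\<lambda>x. Alt2_inner k (CARD('n) - 1) (\<omega> x) (\<eta> x))"

definition cell_ip ::
    "nat \<Rightarrow> ('n::{finite,wellorder}) euc set \<Rightarrow> 'n dform_field \<Rightarrow> 'n dform_field \<Rightarrow> real" where
  "cell_ip k T \<omega> \<eta> =
     integral\<^sup>L (lebesgue_on T) (\<lambda>x. Alt2_inner k (CARD('n) - 1) (\<omega> x) (\<eta> x))"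


section \<open>Polynomial spaces\<close>

text \<open>A polynomial on \<open>f\<close> is the restriction to \<open>f\<close> of a polynomial on \<open>\<real>\<^sup>n\<close>; restrictions are
  represented by their extension by zero. For \<open>r < 0\<close> there are no monomials, so the space is
  \<open>{0}\<close>.\<close>
definition PP :: "int \<Rightarrow> ('n::{finite,wellorder}) euc set \<Rightarrow> ('n euc \<Rightarrow> real) set" where
  "PP r f = {p. \<exists>c. p = (\<lambda>x. if x \<in> f
                 then \<Sum>\<alpha>::'n \<Rightarrow> nat | int (\<Sum>i\<in>UNIV. \<alpha> i) \<le> r. c \<alpha> * (\<Prod>i\<in>UNIV. x $ i ^ \<alpha> i)
                 else 0)}"

definition PPX :: "nat \<Rightarrow> int \<Rightarrow> ('n::{finite,wellorder}) euc set \<Rightarrow> 'n dform_field set" where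
  "PPX k r T = {\<omega>. (\<forall>x. \<omega> x \<in> XX k) \<and> (\<forall>ws vs. (\<lambda>x. \<omega> x ws vs) \<in> PP r T)}"

definition div_trace ::
    "nat \<Rightarrow> ('n::{finite,wellorder}) euc \<Rightarrow> 'n dform_field \<Rightarrow> 'n euc \<Rightarrow> 'n set \<Rightarrow> real" where
  "div_trace k \<nu> \<omega> x \<sigma> = (\<Sum>i\<in>UNIV. coef k (\<omega> x) \<sigma> i * \<nu> $ i)"

definition unit_normal :: "('n::{finite,wellorder}) euc set \<Rightarrow> 'n euc \<Rightarrow> bool" where
  "unit_normal F \<nu> \<longleftrightarrow> norm \<nu> = 1 \<and> (\<forall>u\<in>tangent_space F. \<nu> \<bullet> u = 0)"

definition BB_div :: "nat \<Rightarrow> int \<Rightarrow> ('n::{finite,wellorder}) euc set \<Rightarrow> 'n dform_field set" where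
  "BB_div k r T = {\<omega> \<in> PPX k r T.
     \<forall>F \<in> subsimplices (CARD('n) - 1) T. \<forall>\<nu>. unit_normal F \<nu> \<longrightarrow>
       (\<forall>x\<in>F. \<forall>\<sigma>. card \<sigma> = k \<longrightarrow> div_trace k \<nu> \<omega> x \<sigma> = 0)}"

definition face_tests ::
    "nat \<Rightarrow> int \<Rightarrow> nat \<Rightarrow> ('n::{finite,wellorder}) euc set \<Rightarrow> ('n \<Rightarrow> 'n form) \<Rightarrow> 'n dform_field set" where
  "face_tests k r l f dyh =
     {\<eta>. \<exists>q. (\<forall>\<sigma> i. q (\<sigma>, i) \<in> PP (r - (int l + 1)) f) \<and>
          \<eta> = (\<lambda>x ws vs. \<Sum>(\<sigma>, i) | free_index k (\<sigma>, i) \<and> l < pos i.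
                 q (\<sigma>, i) x * tensor (wedge_set dyh \<sigma>) (star dyh i) ws vs)}"


section \<open>Unisolvence\<close>

definition linear_functional_on ::
    "'n::{finite,wellorder} dform_field set \<Rightarrow> ('n dform_field \<Rightarrow> real) \<Rightarrow> bool" where
  "linear_functional_on V L \<longleftrightarrow>
     (\<forall>\<eta>\<in>V. \<forall>\<zeta>\<in>V. \<forall>a b.
        L (\<lambda>x ws vs. a * \<eta> x ws vs + b * \<zeta> x ws vs) = a * L \<eta> + b * L \<zeta>)"

text \<open>The map taking \<open>\<omega>\<close> in \<open>PPX k r T\<close> to its degrees of freedom is a bijection onto all possible
  values of the degrees of freedom: an element of \<open>XX k\<close> per vertex and a linear functional on each
  of the spaces of test functions.\<close>
definition unisolvent ::
    "nat \<Rightarrow> int \<Rightarrow> (('n::{finite,wellorder}) euc set \<Rightarrow> 'n \<Rightarrow> 'n form) \<Rightarrow> 'n euc set \<Rightarrow> bool" where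
  "unisolvent k r dyh T \<longleftrightarrow>
     (\<forall>c L M.
        (\<forall>v. {v} \<in> subsimplices 0 T \<longrightarrow> c v \<in> XX k) \<and>
        (\<forall>l\<in>{1..CARD('n) - 1}. \<forall>f\<in>subsimplices l T.
           linear_functional_on (face_tests k r l f (dyh f)) (L f)) \<and>
        linear_functional_on (BB_div k r T) M \<longrightarrow>
        (\<exists>!\<omega>. \<omega> \<in> PPX k r T \<and>
           (\<forall>v. {v} \<in> subsimplices 0 T \<longrightarrow> \<omega> v = c v) \<and>
           (\<forall>l\<in>{1..CARD('n) - 1}. \<forall>f\<in>subsimplices l T.
              \<forall>\<eta>\<in>face_tests k r l f (dyh f). face_ip k l f \<omega> \<eta> = L f \<eta>) \<and>
           (\<forall>\<eta>\<in>BB_div k r T. cell_ip k T \<omega> \<eta> = M \<eta>)))"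


section \<open>Function spaces on the domain\<close>

definition L2 :: "('n::{finite,wellorder}) euc set \<Rightarrow> ('n euc \<Rightarrow> real) set" where
  "L2 \<Omega> = {g. g \<in> borel_measurable (lebesgue_on \<Omega>) \<and> integrable (lebesgue_on \<Omega>) (\<lambda>x. (g x)\<^sup>2)}"

definition L2X :: "nat \<Rightarrow> ('n::{finite,wellorder}) euc set \<Rightarrow> 'n dform_field set" where
  "L2X k \<Omega> = {\<omega>. (AE x in lebesgue_on \<Omega>. \<omega> x \<in> XX k) \<and>
                   (\<forall>\<sigma> i. card \<sigma> = k \<longrightarrow> (\<lambda>x. coef k (\<omega> x) \<sigma> i) \<in> L2 \<Omega>)}"

definition partial_deriv ::
    "'n::{finite,wellorder} \<Rightarrow> ('n euc \<Rightarrow> real) \<Rightarrow> 'n euc \<Rightarrow> real" where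
  "partial_deriv i \<phi> x = frechet_derivative \<phi> (at x) (axis i 1)"

primrec C_diff :: "nat \<Rightarrow> (('n::{finite,wellorder}) euc \<Rightarrow> real) \<Rightarrow> bool" where
  "C_diff 0 \<phi> \<longleftrightarrow> continuous_on UNIV \<phi>"
| "C_diff (Suc m) \<phi> \<longleftrightarrow> (\<forall>x. \<phi> differentiable (at x)) \<and> (\<forall>i. C_diff m (partial_deriv i \<phi>))"

definition smooth_test :: "('n::{finite,wellorder}) euc set \<Rightarrow> ('n euc \<Rightarrow> real) set" where
  "smooth_test \<Omega> = {\<phi>. (\<forall>m. C_diff m \<phi>) \<and>
                         compact (closure {x. \<phi> x \<noteq> 0}) \<and> closure {x. \<phi> x \<noteq> 0} \<subseteq> \<Omega>}"

definition weak_div ::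
    "nat \<Rightarrow> ('n::{finite,wellorder}) euc set \<Rightarrow> 'n dform_field \<Rightarrow> ('n set \<Rightarrow> 'n euc \<Rightarrow> real) \<Rightarrow> bool" where
  "weak_div k \<Omega> \<omega> g \<longleftrightarrow>
     (\<forall>\<sigma>. card \<sigma> = k \<longrightarrow> (\<forall>\<phi>\<in>smooth_test \<Omega>.
        integral\<^sup>L (lebesgue_on \<Omega>) (\<lambda>x. \<Sum>i\<in>UNIV. coef k (\<omega> x) \<sigma> i * partial_deriv i \<phi> x) =
        - integral\<^sup>L (lebesgue_on \<Omega>) (\<lambda>x. g \<sigma> x * \<phi> x)))"

definition Hdiv :: "nat \<Rightarrow> ('n::{finite,wellorder}) euc set \<Rightarrow> 'n dform_field set" where
  "Hdiv k \<Omega> = {\<omega> \<in> L2X k \<Omega>. \<exists>g. (\<forall>\<sigma>. card \<sigma> = k \<longrightarrow> g \<sigma> \<in> L2 \<Omega>) \<and> weak_div k \<Omega> \<omega> g}"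

definition single_valued_dofs ::
    "nat \<Rightarrow> int \<Rightarrow> (('n::{finite,wellorder}) euc set \<Rightarrow> 'n \<Rightarrow> 'n form) \<Rightarrow> 'n euc set set \<Rightarrow>
     ('n euc set \<Rightarrow> 'n dform_field) \<Rightarrow> bool" where
  "single_valued_dofs k r dyh \<T> p \<longleftrightarrow>
     (\<forall>v. {v} \<in> mesh_subsimplices 0 \<T> \<longrightarrow>
        (\<forall>T\<in>\<T>. \<forall>T'\<in>\<T>. v \<in> T \<and> v \<in> T' \<longrightarrow> p T v = p T' v)) \<and>
     (\<forall>l\<in>{1..CARD('n) - 1}. \<forall>f\<in>mesh_subsimplices l \<T>.
        \<forall>T\<in>\<T>. \<forall>T'\<in>\<T>. f \<subseteq> T \<and> f \<subseteq> T' \<longrightarrow>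
          (\<forall>\<eta>\<in>face_tests k r l f (dyh f). face_ip k l f (p T) \<eta> = face_ip k l f (p T') \<eta>))"

text \<open>Elements of \<open>L\<^sup>2\<close> are determined up to null sets; \<open>p T\<close> is the polynomial representing the
  restriction of \<open>\<omega>\<close> to \<open>T\<close>, and the degrees of freedom are evaluated on it.\<close>
definition V_h ::
    "nat \<Rightarrow> int \<Rightarrow> (('n::{finite,wellorder}) euc set \<Rightarrow> 'n \<Rightarrow> 'n form) \<Rightarrow> 'n euc set set \<Rightarrow>
     'n euc set \<Rightarrow> 'n dform_field set" where
  "V_h k r dyh \<T> \<Omega> = {\<omega> \<in> L2X k \<Omega>. \<exists>p.
     (\<forall>T\<in>\<T>. p T \<in> PPX k r T \<and> (AE x in lebesgue_on (T \<inter> \<Omega>). \<omega> x = p T x)) \<and>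
     single_valued_dofs k r dyh \<T> p}"

end

theory Submission
  imports Defs "HOL-Library.Function_Algebras"
begin

text \<open>
  With \<open>dz\<^sub>i\<close> the basis dual to \<open>dy\<^sub>i\<close>, pairing with \<open>dz\<^sub>\<sigma> \<otimes> *dz\<^sub>i\<close> reads off the coefficient of a double
  form at \<open>dy\<^sub>\<sigma> \<otimes> *dy\<^sub>i\<close>; a form in the kernel of \<open>s\<close> is given by its free coefficients, the constraint
  of each \<open>\<tau>\<close> determining the one at its pair index. On a face, the coefficients with \<open>i\<close> in the normal
  range are exactly the components normal to the face, and since the pair index is the first of its
  constraint sequence, the free ones among them determine the others.

  If the degrees of freedom on a face and its subfaces vanish, then by induction on the dimension the
  normal components vanish on the boundary of the face, are therefore divisible by its bubble
  function, and vanish when tested against the quotient. This gives the normal continuity, and,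
  together with the interior degrees of freedom, the uniqueness part of unisolvence. Existence is
  triangular: bubble functions times forms with one prescribed free coefficient correct the degrees
  of freedom face by face, in order of increasing dimension.

  The weak divergence is computed without surface integrals. The indicator function of a cell is
  replaced by a smooth cutoff, whose gradient lives in layers along the facets. A shear maps the layer
  of one cell at a common facet to that of its neighbour, and in the limit the two contributions
  cancel by normal continuity.
\<close>

section \<open>Alternating forms\<close>

text \<open>Existence does not rest on a dimension count: \<open>BB_div\<close> is given only as a
  kernel of traces, and its dimension is never computed. Instead each block of degrees of freedom is
  inverted by a Riesz argument on its own space: on a face, for polynomials with the inner product
  weighted by the bubble function; in a cell, for \<open>BB_div\<close> itself, which is both trial
  and test space and whose elements have vanishing face degrees of freedom.

  The degrees of freedom read components in a basis attached to the face, whereas traces are taken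
  in the standard basis. The two are compared only through the vanishing of all rows at once, so
  normal continuity is obtained by showing that a difference vanishes.

  The layers grow like \<open>1 / \<epsilon>\<close>. What makes the limit work is that
  \<open>cut' \<epsilon> t * t\<close> is at most 1 and tends to 0 for fixed \<open>t\<close>: a
  flux that is zero on a facet is of the order of the barycentric coordinate vanishing there, so
  dominated convergence removes its layer integral.\<close>

lemma Alt_length: "\<alpha> \<in> Alt j \<Longrightarrow> length ws \<noteq> j \<Longrightarrow> \<alpha> ws = 0"
  by (simp add: Alt_def)

lemma Alt_linear: "\<alpha> \<in> Alt j \<Longrightarrow> length ws = j \<Longrightarrow> i < j \<Longrightarrow> linear (\<lambda>v. \<alpha> (ws[i := v]))"
  by (simp add: Alt_def)

lemma Alt_repeat:
  assumes \<alpha>: "\<alpha> \<in> Alt j" and "i < length ws" "m < length ws" "i \<noteq> m" "ws ! i = ws ! m"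
  shows "\<alpha> ws = 0"
proof (cases "length ws = j")
  case True
  have *: "\<And>i m. i < m \<Longrightarrow> m < j \<Longrightarrow> ws ! i = ws ! m \<Longrightarrow> \<alpha> ws = 0"
    using \<alpha> True unfolding Alt_def by blast
  show ?thesis using *[of i m] *[of m i] assms True by (cases "i < m") auto
qed (use Alt_length[OF \<alpha>] in auto)

lemma AltI:
  assumes "\<And>ws. length ws \<noteq> j \<Longrightarrow> \<alpha> ws = 0"
    and "\<And>ws i. length ws = j \<Longrightarrow> i < j \<Longrightarrow> linear (\<lambda>v. \<alpha> (ws[i := v]))"
    and "\<And>ws i m. length ws = j \<Longrightarrow> i < m \<Longrightarrow> m < j \<Longrightarrow> ws ! i = ws ! m \<Longrightarrow> \<alpha> ws = 0"
  shows "\<alpha> \<in> Alt j"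
  using assms unfolding Alt_def by blast

lemma Alt_zero: "(\<lambda>ws. 0) \<in> Alt j"
  by (rule AltI) (auto simp: linear_zero)

lemma Alt_add:
  assumes \<alpha>: "\<alpha> \<in> Alt j" and \<beta>: "\<beta> \<in> Alt j"
  shows "(\<lambda>ws. \<alpha> ws + \<beta> ws) \<in> Alt j"
proof (rule AltI)
  fix ws :: "'a euc list" and i m
  assume "length ws = j" "i < m" "m < j" "ws ! i = ws ! m"
  then show "\<alpha> ws + \<beta> ws = 0" using Alt_repeat[OF \<alpha>, of i ws m] Alt_repeat[OF \<beta>, of i ws m] by simp
qed (use assms in \<open>auto simp: Alt_length intro!: linear_compose_add Alt_linear\<close>)

lemma Alt_scale:
  assumes \<alpha>: "\<alpha> \<in> Alt j"
  shows "(\<lambda>ws. c * \<alpha> ws) \<in> Alt j"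
proof (rule AltI)
  fix ws :: "'a euc list" and i
  assume "length ws = j" "i < j"
  then show "linear (\<lambda>v. c * \<alpha> (ws[i := v]))"
    using linear_compose_scale_right[OF Alt_linear[OF \<alpha>], of ws i c] by simp
next
  fix ws :: "'a euc list" and i m
  assume "length ws = j" "i < m" "m < j" "ws ! i = ws ! m"
  then show "c * \<alpha> ws = 0" using Alt_repeat[OF \<alpha>, of i ws m] by simp
qed (use assms in \<open>auto simp: Alt_length\<close>)

lemma Alt_sum: "(\<And>a. a \<in> I \<Longrightarrow> \<alpha> a \<in> Alt j) \<Longrightarrow> (\<lambda>ws. \<Sum>a\<in>I. \<alpha> a ws) \<in> Alt j"
  by (induction I rule: infinite_finite_induct) (auto simp: Alt_zero Alt_add)

text \<open>Polarisation: with \<open>a + b\<close> in both slots the value is zero, and so are the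
  two pure terms of its expansion, which leaves the two mixed ones.\<close>

lemma Alt_swap:
  assumes \<alpha>: "\<alpha> \<in> Alt j"
  shows "\<alpha> (xs @ a # b # ys) = - \<alpha> (xs @ b # a # ys)"
proof (cases "length (xs @ a # b # ys) = j")
  case True
  define F where "F u v = \<alpha> (xs @ u # v # ys)" for u v
  have l1: "linear (\<lambda>u. F u v)" for v
    using Alt_linear[OF \<alpha>, of "xs @ v # v # ys" "length xs"] True by (simp add: F_def)
  have l2: "linear (\<lambda>v. F u v)" for u
    using Alt_linear[OF \<alpha>, of "xs @ u # u # ys" "Suc (length xs)"] True
    by (simp add: F_def list_update_append)
  have z: "F u u = 0" for u
    unfolding F_def by (rule Alt_repeat[OF \<alpha>, of "length xs" _ "Suc (length xs)"])
      (auto simp: nth_append)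
  have "0 = F (a + b) (a + b)" by (simp add: z)
  also have "\<dots> = F a a + F a b + (F b a + F b b)"
    using linear_add[OF l1] linear_add[OF l2] by simp
  finally show ?thesis by (simp add: z F_def)
qed (auto simp: Alt_length[OF \<alpha>])

lemma Alt_move:
  assumes \<alpha>: "\<alpha> \<in> Alt j"
  shows "\<alpha> (xs @ a # zs @ ys) = (- 1) ^ length zs * \<alpha> (xs @ zs @ a # ys)"
proof (induction zs arbitrary: xs)
  case (Cons z zs)
  have "\<alpha> (xs @ a # (z # zs) @ ys) = - \<alpha> ((xs @ [z]) @ a # zs @ ys)"
    using Alt_swap[OF \<alpha>, of xs a z "zs @ ys"] by simp
  also have "\<dots> = - ((- 1) ^ length zs * \<alpha> ((xs @ [z]) @ zs @ a # ys))"
    by (simp only: Cons.IH)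
  finally show ?case by simp
qed simp

text \<open>Sorting costs a sign. It is recorded only as a nonzero \<open>c\<close>, but quantified
  before the degree, the form and the prefix: one constant serves all forms, which
  \<open>s_map_constraint\<close> relies on. The prefix carries the induction past the entries
  smaller than \<open>x\<close>.\<close>

lemma Alt_insort:
  fixes z :: "'n::{finite,wellorder} \<Rightarrow> 'n euc" and x :: 'n
  shows "\<exists>c::real. c \<noteq> 0 \<and> (\<forall>j. \<forall>\<alpha>\<in>Alt j. \<forall>pre.
           \<alpha> (pre @ z x # map z s) = c * \<alpha> (pre @ map z (insort x s)))"
proof (induction s)
  case Nil
  show ?case by (intro exI[of _ 1]) simp
next
  case (Cons a s)
  then obtain c :: real where c: "c \<noteq> 0" "\<And>j \<alpha> pre. \<alpha> \<in> Alt j \<Longrightarrow>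
      \<alpha> (pre @ z x # map z s) = c * \<alpha> (pre @ map z (insort x s))" by blast
  show ?case
  proof (cases "x \<le> a")
    case True then show ?thesis by (intro exI[of _ 1]) simp
  next
    case False
    have "\<alpha> (pre @ z x # map z (a # s)) = - c * \<alpha> (pre @ map z (insort x (a # s)))"
      if "\<alpha> \<in> Alt j" for j \<alpha> pre
      using Alt_swap[OF that, of pre "z x" "z a" "map z s"] c(2)[OF that, of "pre @ [z a]"] False
      by simp
    then show ?thesis using c(1) by (intro exI[of _ "- c"]) auto
  qed
qed

lemma Alt_sort:
  fixes z :: "'n::{finite,wellorder} \<Rightarrow> 'n euc"
  assumes \<alpha>: "\<alpha> \<in> Alt j" and "\<alpha> (pre @ map z (sort xs)) = 0"
  shows "\<alpha> (pre @ map z xs) = 0"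
  using assms(2)
proof (induction xs arbitrary: pre)
  case (Cons x xs)
  obtain c :: real where c: "c \<noteq> 0"
      "\<alpha> (pre @ z x # map z (sort xs)) = c * \<alpha> (pre @ map z (insort x (sort xs)))"
    using Alt_insort[of z x "sort xs"] \<alpha> by meson
  then have "\<alpha> ((pre @ [z x]) @ map z (sort xs)) = 0" using Cons.prems by simp
  from Cons.IH[OF this] show ?case by simp
qed simp

text \<open>Multilinearity replaces the arguments one at a time by members of the spanning family;
  repetitions then give zero, and sorting reduces the rest to increasing lists. This is the main way
  in which forms are shown to vanish below.\<close>

lemma Alt_eq_0:
  fixes z :: "'n::{finite,wellorder} \<Rightarrow> 'n euc"
  assumes \<alpha>: "\<alpha> \<in> Alt j" and span: "span (range z) = UNIV"
    and zero: "\<And>\<sigma>. card \<sigma> = j \<Longrightarrow> \<alpha> (map z (sorted_list_of_set \<sigma>)) = 0"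
  shows "\<alpha> ws = 0"
proof -
  have basis: "\<alpha> (map z xs) = 0" for xs
  proof (cases "distinct xs \<and> length xs = j")
    case True
    then have "sort xs = sorted_list_of_set (set xs)"
      by (simp add: sorted_list_of_set_sort_remdups distinct_remdups_id)
    then show ?thesis
      using Alt_sort[OF \<alpha>, of "[]" z xs] zero[of "set xs"] True by (simp add: distinct_card)
  next
    case False
    then show ?thesis
      using Alt_length[OF \<alpha>, of "map z xs"] Alt_repeat[OF \<alpha>, of _ "map z xs"]
      by (auto simp: distinct_conv_nth)
  qed
  \<comment> \<open>The first \<open>m\<close> slots are arbitrary and the others hold members of
    the family; \<open>m = j\<close> is the claim.\<close>
  have "\<forall>ws. length ws = j \<and> (\<forall>i<j. m \<le> i \<longrightarrow> ws ! i \<in> range z) \<longrightarrow> \<alpha> ws = 0" if "m \<le> j" for m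
    using that
  proof (induction m)
    case 0
    have "\<alpha> ws = 0" if ws: "length ws = j" "\<forall>i<j. ws ! i \<in> range z" for ws
    proof -
      have "ws = map z (map (inv z) ws)"
        using ws by (intro nth_equalityI) (auto simp: f_inv_into_f)
      then show ?thesis using basis by metis
    qed
    then show ?case by simp
  next
    case (Suc m)
    show ?case
    proof (intro allI impI)
      fix ws :: "'n euc list" assume ws: "length ws = j \<and> (\<forall>i<j. Suc m \<le> i \<longrightarrow> ws ! i \<in> range z)"
      have "\<alpha> (ws[m := v]) = 0" if "v \<in> span (range z)" for v
      proof (rule linear_eq_0_on_span[OF _ _ that])
        show "linear (\<lambda>v. \<alpha> (ws[m := v]))" using Alt_linear[OF \<alpha>] ws Suc.prems by simp
        fix u assume u: "u \<in> range z"
        show "\<alpha> (ws[m := u]) = 0"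
          using Suc ws u by (auto simp: nth_list_update Suc_le_eq le_less intro!: Suc.IH[THEN spec, THEN mp])
      qed
      from this[of "ws ! m"] show "\<alpha> ws = 0" using span by simp
    qed
  qed
  from this[of j] show ?thesis using Alt_length[OF \<alpha>] by (cases "length ws = j") auto
qed

lemma Alt_Cons:
  assumes "\<alpha> \<in> Alt k" "1 \<le> k"
  shows "(\<lambda>ws. \<alpha> (v # ws)) \<in> Alt (k - 1)"
proof (rule AltI)
  fix ws :: "'a euc list" and i
  assume "length ws = k - 1" "i < k - 1"
  then show "linear (\<lambda>u. \<alpha> (v # ws[i := u]))"
    using Alt_linear[OF assms(1), of "v # ws" "Suc i"] assms(2) by simp
next
  fix ws :: "'a euc list" and i m
  assume "length ws = k - 1" "i < m" "m < k - 1" "ws ! i = ws ! m"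
  then show "\<alpha> (v # ws) = 0"
    using Alt_repeat[OF assms(1), of "Suc i" "v # ws" "Suc m"] by simp
qed (use assms in \<open>auto intro!: Alt_length\<close>)

section \<open>One-forms, wedge products and expansion in basis forms\<close>

lemma covector_Alt: "covector y \<in> Alt 1"
proof (rule AltI)
  fix ws :: "'a euc list" and i :: nat
  assume "length ws = 1" "i < 1"
  then have "(\<lambda>v. covector y (ws[i := v])) = (\<lambda>v. y \<bullet> v)"
    by (cases ws) (auto simp: covector_def)
  then show "linear (\<lambda>v. covector y (ws[i := v]))"
    by (simp add: bounded_linear.linear bounded_linear_inner_right)
qed (auto simp: covector_def)

lemma Alt1_covector:
  fixes \<alpha> :: "'n::{finite,wellorder} form"
  assumes "\<alpha> \<in> Alt 1"
  shows "\<exists>y. \<alpha> = covector y"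
proof -
  have lin: "linear (\<lambda>v. \<alpha> [v])" using Alt_linear[OF assms, of "[0]" 0] by simp
  have single: "\<alpha> [v] = (\<chi> i. \<alpha> [axis i 1]) \<bullet> v" for v
  proof -
    have "v = (\<Sum>i\<in>UNIV. v $ i *\<^sub>R axis i 1)"
      using basis_expansion[of v] by (simp add: scalar_mult_eq_scaleR)
    then have "\<alpha> [v] = \<alpha> [\<Sum>i\<in>UNIV. v $ i *\<^sub>R axis i 1]" by (rule arg_cong)
    also have "\<dots> = (\<Sum>i\<in>UNIV. v $ i * \<alpha> [axis i 1])"
      by (simp add: linear_sum[OF lin] linear_scale[OF lin])
    finally show ?thesis by (simp add: inner_vec_def mult.commute)
  qed
  have "\<alpha> ws = covector (\<chi> i. \<alpha> [axis i 1]) ws" for ws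
  proof (cases "length ws = 1")
    case True
    then obtain v where "ws = [v]" by (auto simp: length_Suc_conv)
    then have "covector (\<chi> i. \<alpha> [axis i 1]) ws = (\<chi> i. \<alpha> [axis i 1]) \<bullet> v"
      by (simp add: covector_def)
    then show ?thesis using single[of v] \<open>ws = [v]\<close> by metis
  qed (simp add: Alt_length[OF assms] covector_def)
  then show ?thesis by (metis ext)
qed

lemma wedge_Alt:
  fixes \<alpha>s :: "'n::{finite,wellorder} form list"
  assumes "\<And>\<alpha>. \<alpha> \<in> set \<alpha>s \<Longrightarrow> \<alpha> \<in> Alt 1"
  shows "wedge \<alpha>s \<in> Alt (length \<alpha>s)"
proof (rule AltI)
  define j where "j = length \<alpha>s"
  have lin1: "linear (\<lambda>v. (\<alpha>s ! a) [v])" if "a < j" for a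
    using Alt_linear[OF assms, of "\<alpha>s ! a" "[0]" 0] that by (simp add: j_def)
  fix ws :: "'n euc list" and i
  assume len: "length ws = length \<alpha>s" and i: "i < length \<alpha>s"
  have "linear (\<lambda>v. of_int (sign p) * (\<Prod>a<j. (\<alpha>s ! a) [ws[i := v] ! p a]))"
    if p: "p permutes {..<j}" for p
  proof -
    \<comment> \<open>The only factor of the product that reads slot \<open>i\<close>; all others
      are constant in \<open>v\<close>.\<close>
    define a0 where "a0 = inv p i"
    have a0: "a0 < j" "p a0 = i"
      using permutes_in_image[OF permutes_inv[OF p], of i] i permutes_inverses[OF p]
      by (auto simp: a0_def j_def)
    have "(\<Prod>a<j. (\<alpha>s ! a) [ws[i := v] ! p a]) =
        (\<Prod>a\<in>{..<j} - {a0}. (\<alpha>s ! a) [ws ! p a]) * (\<alpha>s ! a0) [v]" for v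
    proof -
      have "(\<Prod>a\<in>{..<j} - {a0}. (\<alpha>s ! a) [ws[i := v] ! p a]) =
          (\<Prod>a\<in>{..<j} - {a0}. (\<alpha>s ! a) [ws ! p a])"
        using a0 permutes_inj[OF p] by (intro prod.cong) (auto simp: inj_eq)
      then show ?thesis
        using a0 len i by (subst prod.remove[of _ a0]) (auto simp: j_def nth_list_update mult.commute)
    qed
    moreover have "linear (\<lambda>v. c * (\<alpha>s ! a0) [v])" for c
      using linear_compose_scale_right[OF lin1[OF a0(1)], of c] by simp
    ultimately show ?thesis by (simp flip: mult.assoc)
  qed
  then have "linear (\<lambda>v. \<Sum>p | p permutes {..<j}.
      of_int (sign p) * (\<Prod>a<j. (\<alpha>s ! a) [ws[i := v] ! p a]))"
    by (intro linear_compose_sum) auto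
  then show "linear (\<lambda>v. wedge \<alpha>s (ws[i := v]))"
    using len by (simp add: wedge_def j_def)
next
  fix ws :: "'n euc list" and i m
  assume len: "length ws = length \<alpha>s" and im: "i < m" "m < length \<alpha>s" and eq: "ws ! i = ws ! m"
  define j where "j = length \<alpha>s"
  define f where "f p = of_int (sign p) * (\<Prod>a<j. (\<alpha>s ! a) [ws ! p a])" for p :: "nat \<Rightarrow> nat"
  define q where "q = Transposition.transpose i m"
  have q: "q permutes {..<j}" using im by (auto simp: q_def j_def intro: permutes_swap_id)
  \<comment> \<open>Exchanging the two equal arguments keeps every product and flips its sign, so
    the permutation sum equals its own negative.\<close>
  have "f (q \<circ> p) = - f p" if p: "p permutes {..<j}" for p
  proof -
    have "sign (q \<circ> p) = - sign p"
      using im p q by (simp add: sign_compose permutes_imp_permutation[of "{..<j}"] q_def sign_swap_id)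
    moreover have "ws ! q b = ws ! b" for b using eq by (auto simp: q_def Transposition.transpose_def)
    ultimately show ?thesis by (simp add: f_def)
  qed
  then have "sum f {p. p permutes {..<j}} = (\<Sum>p | p permutes {..<j}. - f p)"
    by (subst setum_permutations_compose_left[OF q]) (auto intro: sum.cong)
  then show "wedge \<alpha>s ws = 0"
    using len by (simp add: wedge_def f_def j_def sum_negf)
qed (simp add: wedge_def)

lemma wedge_set_Alt:
  assumes "\<And>i. dy i \<in> Alt 1"
  shows "wedge_set dy \<sigma> \<in> Alt (card \<sigma>)"
  using wedge_Alt[of "map dy (sorted_list_of_set \<sigma>)"] assms
  by (auto simp: wedge_set_def)

lemma star_Alt:
  fixes dy :: "'n::{finite,wellorder} \<Rightarrow> 'n form"
  assumes "\<And>i. dy i \<in> Alt 1"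
  shows "star dy i \<in> Alt (CARD('n) - 1)"
  using Alt_scale[OF wedge_set_Alt[of dy "UNIV - {i}", OF assms]]
  by (simp add: star_def[abs_def] card_Diff_singleton)

lemma span_axis: "span (range (\<lambda>i. axis i 1 :: ('n::finite) euc)) = UNIV"
proof -
  have "(Basis :: 'n euc set) \<subseteq> range (\<lambda>i. axis i 1)" by (auto simp: Basis_vec_def)
  then show ?thesis using span_mono[of Basis "range (\<lambda>i. axis i 1 :: 'n euc)"] by auto
qed

lemma Alt_expand:
  fixes \<alpha> :: "'n::{finite,wellorder} form"
  assumes "\<alpha> \<in> Alt j"
  shows "\<alpha> ws = (\<Sum>\<sigma> | card \<sigma> = j. \<alpha> (basis_vectors \<sigma>) * wedge_set dx \<sigma> ws)"
proof -
  define \<beta> where "\<beta> = (\<lambda>ws. \<alpha> ws + - 1 * (\<Sum>\<sigma> | card \<sigma> = j. \<alpha> (basis_vectors \<sigma>) * wedge_set dx \<sigma> ws))"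
  have "\<beta> \<in> Alt j"
    unfolding \<beta>_def
    by (intro Alt_add assms Alt_scale Alt_sum) (use wedge_set_Alt[OF covector_Alt] in auto)
  then have "\<beta> ws = 0"
  proof (rule Alt_eq_0[OF _ span_axis])
    fix \<rho> :: "'n set" assume \<rho>: "card \<rho> = j"
    have "(\<Sum>\<sigma> | card \<sigma> = j. \<alpha> (basis_vectors \<sigma>) * wedge_set dx \<sigma> (basis_vectors \<rho>)) =
        (\<Sum>\<sigma> | card \<sigma> = j. if \<sigma> = \<rho> then \<alpha> (basis_vectors \<rho>) else 0)"
      using \<rho> by (intro sum.cong) (auto simp: wedge_set_dx_basis_vectors)
    then show "\<beta> (map (\<lambda>i. axis i 1) (sorted_list_of_set \<rho>)) = 0"
      using \<rho> by (simp add: \<beta>_def basis_vectors_def[symmetric])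
  qed
  then show ?thesis by (simp add: \<beta>_def)
qed

text \<open>Invariance of the determinant under transposition: the permutation sum is reindexed by
  inverses.\<close>

lemma wedge_set_transpose:
  fixes z :: "'n::{finite,wellorder} \<Rightarrow> 'n euc"
  assumes "card \<sigma> = card \<rho>"
  shows "wedge_set (\<lambda>i. covector (z i)) \<sigma> (basis_vectors \<rho>) =
    wedge_set dx \<rho> (map z (sorted_list_of_set \<sigma>))"
proof -
  define xs where "xs = sorted_list_of_set \<sigma>"
  define us where "us = sorted_list_of_set \<rho>"
  define j where "j = card \<rho>"
  have len: "length xs = j" "length us = j" using assms by (simp_all add: xs_def us_def j_def)
  define M where "M a b = z (xs ! a) \<bullet> axis (us ! b) 1" for a b
  have 1: "wedge_set (\<lambda>i. covector (z i)) \<sigma> (basis_vectors \<rho>) =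
     (\<Sum>p | p permutes {..<j}. of_int (sign p) * (\<Prod>a<j. M a (p a)))"
    unfolding wedge_set_def wedge_def basis_vectors_def xs_def[symmetric] us_def[symmetric]
    using len permutes_in_image[where S = "{..<j}"]
    by (auto simp: covector_def M_def intro!: sum.cong prod.cong)
  have 2: "wedge_set dx \<rho> (map z (sorted_list_of_set \<sigma>)) =
     (\<Sum>p | p permutes {..<j}. of_int (sign p) * (\<Prod>a<j. M (p a) a))"
    unfolding wedge_set_def wedge_def xs_def[symmetric] us_def[symmetric]
    using len permutes_in_image[where S = "{..<j}"]
    by (auto simp: covector_def M_def inner_commute intro!: sum.cong prod.cong)
  have "of_int (sign (inv p)) * (\<Prod>a<j. M (inv p a) a) = of_int (sign p) * (\<Prod>a<j. M a (p a))"
    if p: "p permutes {..<j}" for p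
  proof -
    have "(\<Prod>a<j. M (inv p a) a) = (\<Prod>a<j. M (inv p (p a)) (p a))"
      using prod.permute[OF p, of "\<lambda>a. M (inv p a) a"] by (simp add: o_def)
    then show ?thesis
      using p permutes_inverses[OF p] by (simp add: sign_inverse permutes_imp_permutation[of "{..<j}"])
  qed
  then show ?thesis
    unfolding 1 2 by (subst (2) sum_permutations_inverse) (auto intro: sum.cong)
qed

text \<open>Under the identification of 1-forms with vectors, pairing with a decomposable form is
  evaluation.\<close>
lemma Alt_pairing:
  fixes z :: "'n::{finite,wellorder} \<Rightarrow> 'n euc"
  assumes "\<alpha> \<in> Alt j" "card \<sigma> = j"
  shows "(\<Sum>\<rho> | card \<rho> = j. \<alpha> (basis_vectors \<rho>) * wedge_set (\<lambda>i. covector (z i)) \<sigma> (basis_vectors \<rho>))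
    = \<alpha> (map z (sorted_list_of_set \<sigma>))"
  using assms(2)
  by (subst (2) Alt_expand[OF assms(1)]) (auto simp: wedge_set_transpose intro!: sum.cong)

text \<open>The determinant sees the vectors only through their mutual inner products, which here
  are those of the standard basis.\<close>

lemma wedge_set_dual:
  fixes y z :: "'n::{finite,wellorder} \<Rightarrow> 'n euc"
  assumes dual: "\<And>i j. y i \<bullet> z j = (if i = j then 1 else 0)" and "card \<sigma> = card \<rho>"
  shows "wedge_set (\<lambda>i. covector (y i)) \<sigma> (map z (sorted_list_of_set \<rho>)) = (if \<sigma> = \<rho> then 1 else 0)"
proof -
  have "wedge_set (\<lambda>i. covector (y i)) \<sigma> (map z (sorted_list_of_set \<rho>)) =
      wedge_set dx \<sigma> (basis_vectors \<rho>)"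
    unfolding wedge_set_def wedge_def basis_vectors_def
    using assms(2) permutes_in_image[where S = "{..<card \<rho>}"]
    by (auto simp: covector_def dual inner_axis_axis intro!: sum.cong prod.cong)
  then show ?thesis using wedge_set_dx_basis_vectors[OF assms(2)] by simp
qed

section \<open>Double forms\<close>

lemma Alt2_slices:
  assumes "\<omega> \<in> Alt2 j m"
  shows "(\<lambda>ws. \<omega> ws vs) \<in> Alt j" "\<omega> ws \<in> Alt m"
proof -
  obtain N :: nat and \<alpha> \<beta> where N: "\<forall>a<N. \<alpha> a \<in> Alt j \<and> \<beta> a \<in> Alt m"
      "\<omega> = (\<lambda>ws vs. \<Sum>a<N. tensor (\<alpha> a) (\<beta> a) ws vs)"
    using assms by (auto simp: Alt2_def)
  have "(\<lambda>ws. \<Sum>a<N. \<beta> a vs * \<alpha> a ws) \<in> Alt j" using N by (intro Alt_sum Alt_scale) auto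
  then show "(\<lambda>ws. \<omega> ws vs) \<in> Alt j" using N by (simp add: tensor_def mult.commute)
  show "\<omega> ws \<in> Alt m" unfolding N(2) tensor_def using N by (intro Alt_sum Alt_scale) auto
qed

lemma Alt2_sumI:
  assumes "finite I" "\<And>a. a \<in> I \<Longrightarrow> \<alpha> a \<in> Alt j" "\<And>a. a \<in> I \<Longrightarrow> \<beta> a \<in> Alt m"
  shows "(\<lambda>ws vs. \<Sum>a\<in>I. \<alpha> a ws * \<beta> a vs) \<in> Alt2 j m"
proof -
  obtain h where h: "bij_betw h {..<card I} I"
    using ex_bij_betw_nat_finite[OF assms(1)] by (auto simp: atLeast0LessThan)
  have "(\<Sum>a\<in>I. \<alpha> a ws * \<beta> a vs) = (\<Sum>i<card I. tensor (\<alpha> (h i)) (\<beta> (h i)) ws vs)" for ws vs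
    unfolding tensor_def by (rule sum.reindex_bij_betw[OF h, symmetric])
  then show ?thesis using assms h bij_betwE[OF h] unfolding Alt2_def
    by (simp only: mem_Collect_eq)
      (rule exI[of _ "card I"], rule exI[of _ "\<lambda>i. \<alpha> (h i)"], rule exI[of _ "\<lambda>i. \<beta> (h i)"], auto)
qed

lemma double_form_expand:
  fixes \<omega> :: "'n::{finite,wellorder} dform"
  assumes "\<And>vs. (\<lambda>ws. \<omega> ws vs) \<in> Alt j" "\<And>ws. \<omega> ws \<in> Alt m"
  shows "\<omega> ws vs = (\<Sum>(\<sigma>, \<rho>) \<in> {\<sigma>. card \<sigma> = j} \<times> {\<rho>. card \<rho> = m}.
     \<omega> (basis_vectors \<sigma>) (basis_vectors \<rho>) * (wedge_set dx \<sigma> ws * wedge_set dx \<rho> vs))"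
proof -
  have "\<omega> ws vs = (\<Sum>\<sigma> | card \<sigma> = j. \<omega> (basis_vectors \<sigma>) vs * wedge_set dx \<sigma> ws)"
    by (rule Alt_expand[OF assms(1)])
  also have "\<dots> = (\<Sum>\<sigma> | card \<sigma> = j. \<Sum>\<rho> | card \<rho> = m.
      \<omega> (basis_vectors \<sigma>) (basis_vectors \<rho>) * (wedge_set dx \<sigma> ws * wedge_set dx \<rho> vs))"
  proof (intro sum.cong refl)
    fix \<sigma> :: "'n set"
    show "\<omega> (basis_vectors \<sigma>) vs * wedge_set dx \<sigma> ws = (\<Sum>\<rho> | card \<rho> = m.
      \<omega> (basis_vectors \<sigma>) (basis_vectors \<rho>) * (wedge_set dx \<sigma> ws * wedge_set dx \<rho> vs))"
      by (simp add: Alt_expand[OF assms(2), of "basis_vectors \<sigma>" vs] sum_distrib_left sum_distrib_right mult_ac)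
  qed
  finally show ?thesis by (simp add: sum.cartesian_product)
qed

text \<open>Replaces the existential tensor representation by two slicewise conditions: a function
  alternating in each group is a combination of the products of basis forms.\<close>

lemma Alt2_iff:
  fixes \<omega> :: "'n::{finite,wellorder} dform"
  shows "\<omega> \<in> Alt2 j m \<longleftrightarrow> (\<forall>vs. (\<lambda>ws. \<omega> ws vs) \<in> Alt j) \<and> (\<forall>ws. \<omega> ws \<in> Alt m)"
proof (intro iffI)
  assume *: "(\<forall>vs. (\<lambda>ws. \<omega> ws vs) \<in> Alt j) \<and> (\<forall>ws. \<omega> ws \<in> Alt m)"
  have "\<omega> = (\<lambda>ws vs. \<Sum>a\<in>{\<sigma>. card \<sigma> = j} \<times> {\<rho>. card \<rho> = m}.
      (\<omega> (basis_vectors (fst a)) (basis_vectors (snd a)) * wedge_set dx (fst a) ws) * wedge_set dx (snd a) vs)"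
    by (intro ext, subst double_form_expand[of \<omega> j m]) (use * in \<open>auto simp: case_prod_beta mult.assoc\<close>)
  also have "\<dots> \<in> Alt2 j m"
    by (intro Alt2_sumI Alt_scale) (use wedge_set_Alt[OF covector_Alt] in auto)
  finally show "\<omega> \<in> Alt2 j m" .
qed (use Alt2_slices in blast)

lemma XX_slices:
  assumes "\<omega> \<in> XX k"
  shows "(\<lambda>ws. \<omega> ws vs) \<in> Alt k" "(\<omega> :: 'n::{finite,wellorder} dform) ws \<in> Alt (CARD('n) - 1)"
  using assms Alt2_slices by (auto simp: XX_def)

section \<open>Alternation of \<open>s_map \<omega>\<close> in both groups of arguments\<close>

lemma nth_delete:
  assumes "i < length xs" "j < length xs - 1"
  shows "(take i xs @ drop (Suc i) xs) ! j = xs ! (if j < i then j else Suc j)"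
  using assms by (auto simp: nth_append min_def)

text \<open>Deleting slot \<open>j\<close> moves the later slots down by one, hence the shifted
  index of the updated slot.\<close>

lemma delete_update:
  assumes "i < length xs" "j < length xs" "i \<noteq> j"
  shows "take j (xs[i := v]) @ drop (Suc j) (xs[i := v]) =
    (take j xs @ drop (Suc j) xs)[(if i < j then i else i - 1) := v]"
proof (rule nth_equalityI)
  show "length (take j (xs[i := v]) @ drop (Suc j) (xs[i := v])) =
    length ((take j xs @ drop (Suc j) xs)[(if i < j then i else i - 1) := v])" by simp
  fix m assume "m < length (take j (xs[i := v]) @ drop (Suc j) (xs[i := v]))"
  then have m: "m < length xs - 1" using assms by auto
  have "(take j (xs[i := v]) @ drop (Suc j) (xs[i := v])) ! m = xs[i := v] ! (if m < j then m else Suc m)"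
    using assms m by (subst nth_delete) auto
  also have "\<dots> = (if (if i < j then i else i - 1) = m then v else xs ! (if m < j then m else Suc m))"
    using assms m by (auto simp: nth_list_update)
  also have "\<dots> = (take j xs @ drop (Suc j) xs)[(if i < j then i else i - 1) := v] ! m"
    using assms m nth_delete[of j xs m] by (auto simp: nth_list_update)
  finally show "(take j (xs[i := v]) @ drop (Suc j) (xs[i := v])) ! m =
    (take j xs @ drop (Suc j) xs)[(if i < j then i else i - 1) := v] ! m" .
qed

text \<open>If two arguments agree, deleting any third one leaves the repetition. Deleting one or
  the other of the pair gives the same list up to a move, and the signs of \<open>s_map\<close> make
  these two terms opposite.\<close>

lemma s_map_Alt_right:
  fixes \<omega> :: "'n::{finite,wellorder} dform"
  assumes l: "\<And>vs. (\<lambda>ws. \<omega> ws vs) \<in> Alt k" and r: "\<And>ws. \<omega> ws \<in> Alt m" and "1 \<le> k"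
  shows "s_map \<omega> ws \<in> Alt (Suc m)"
proof (rule AltI)
  fix vs :: "'n euc list" assume "length vs \<noteq> Suc m"
  then have "\<omega> (vs ! i # ws) (take i vs @ drop (Suc i) vs) = 0" if "i < length vs" for i
    using that by (intro Alt_length[OF r]) auto
  then show "s_map \<omega> ws vs = 0" by (simp add: s_map_def)
next
  fix vs :: "'n euc list" and i
  assume len: "length vs = Suc m" and i: "i < Suc m"
  have "linear (\<lambda>v. (- 1) ^ j * \<omega> (vs[i := v] ! j # ws)
          (take j (vs[i := v]) @ drop (Suc j) (vs[i := v])))" if j: "j < Suc m" for j
  proof -
    have "linear (\<lambda>v. \<omega> (vs[i := v] ! j # ws) (take j (vs[i := v]) @ drop (Suc j) (vs[i := v])))"
    proof (cases "i = j")
      case True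
      have "linear (\<lambda>v. \<omega> (v # ws) (take j vs @ drop (Suc j) vs))"
      \<comment> \<open>Only then has \<open>v # ws\<close> the \<open>k\<close> entries for which
        linearity is available; at any other length the form is zero by convention.\<close>
      proof (cases "length ws = k - 1")
        case True
        then show ?thesis using Alt_linear[OF l, of "0 # ws" 0] \<open>1 \<le> k\<close> by simp
      next
        case False
        then have "(\<lambda>v. \<omega> (v # ws) (take j vs @ drop (Suc j) vs)) = (\<lambda>v. 0)"
          using \<open>1 \<le> k\<close> by (intro ext Alt_length[OF l]) auto
        then show ?thesis by (simp add: linear_zero)
      qed
      then show ?thesis using True len j by simp
    next
      case False
      then show ?thesis
        using len i j Alt_linear[OF r, of "take j vs @ drop (Suc j) vs" "if i < j then i else i - 1"]
        by (subst delete_update) auto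
    qed
    from linear_compose_scale_right[OF this, of "(- 1) ^ j"] show ?thesis by simp
  qed
  then have "linear (\<lambda>v. \<Sum>j<Suc m. (- 1) ^ j * \<omega> (vs[i := v] ! j # ws)
          (take j (vs[i := v]) @ drop (Suc j) (vs[i := v])))"
    by (intro linear_compose_sum) auto
  then show "linear (\<lambda>v. s_map \<omega> ws (vs[i := v]))" using len by (simp add: s_map_def)
next
  fix vs :: "'n euc list" and a b
  assume len: "length vs = Suc m" and ab: "a < b" "b < Suc m" and eq: "vs ! a = vs ! b"
  let ?t = "\<lambda>i. (- 1) ^ i * \<omega> (vs ! i # ws) (take i vs @ drop (Suc i) vs)"
  have "?t i = 0" if "i < Suc m" "i \<noteq> a" "i \<noteq> b" for i
  proof -
    let ?h = "\<lambda>c. if c < i then c else c - 1"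
    have "\<omega> (vs ! i # ws) (take i vs @ drop (Suc i) vs) = 0"
    proof (rule Alt_repeat[OF r, of "?h a" _ "?h b"])
      show "(take i vs @ drop (Suc i) vs) ! ?h a = (take i vs @ drop (Suc i) vs) ! ?h b"
        using that ab len eq by (subst (1 2) nth_delete) auto
    qed (use that ab len in auto)
    then show ?thesis by simp
  qed
  then have "s_map \<omega> ws vs = (\<Sum>i\<in>{a, b}. ?t i)"
    unfolding s_map_def len using ab by (intro sum.mono_neutral_right) auto
  also have "\<dots> = ?t a + ?t b" using ab by simp
  also have "\<dots> = 0"
  proof -
    define u where "u = vs ! a"
    define xs where "xs = take a vs"
    define zs where "zs = drop (Suc a) (take b vs)"
    define ys where "ys = drop (Suc b) vs"
    have lz: "length zs = b - Suc a" and lx: "length xs = a" using ab len by (simp_all add: xs_def zs_def)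
    have tb: "take b vs = xs @ u # zs"
      using ab len id_take_nth_drop[of a "take b vs"] by (simp add: xs_def zs_def u_def min_def)
    have vs: "vs = (xs @ u # zs) @ u # ys"
      using ab len id_take_nth_drop[of b vs] eq tb by (simp add: ys_def u_def)
    have da: "drop (Suc a) vs = zs @ u # ys"
      by (subst vs) (simp add: lx)
    have "?t b = (- 1) ^ b * \<omega> (u # ws) (xs @ u # zs @ ys)"
      using eq tb by (simp add: u_def ys_def)
    also have "\<dots> = (- 1) ^ b * ((- 1) ^ length zs * \<omega> (u # ws) (xs @ zs @ u # ys))"
      by (subst Alt_move[OF r]) simp
    also have "\<dots> = (- 1) ^ (b + length zs) * \<omega> (u # ws) (xs @ zs @ u # ys)"
      by (simp add: power_add)
    \<comment> \<open>Moving \<open>u\<close> across \<open>zs\<close> costs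
      \<open>b - a - 1\<close> exchanges; together with the sign of slot \<open>b\<close> the parity
      is that of \<open>a + 1\<close>.\<close>
    also have "(- 1 :: real) ^ (b + length zs) = - ((- 1) ^ a)"
    proof -
      have "b + length zs = Suc a + 2 * length zs" using lz ab by simp
      then show ?thesis by (simp add: power_add power_mult)
    qed
    finally show ?thesis using da by (simp add: u_def xs_def)
  qed
  finally show "s_map \<omega> ws vs = 0" .
qed

lemma s_map_Alt_left:
  fixes \<omega> :: "'n::{finite,wellorder} dform"
  assumes "\<And>vs. (\<lambda>ws. \<omega> ws vs) \<in> Alt k" and "1 \<le> k"
  shows "(\<lambda>ws. s_map \<omega> ws vs) \<in> Alt (k - 1)"
  unfolding s_map_def by (intro Alt_sum Alt_scale Alt_Cons[where \<alpha> = "\<lambda>ws. \<omega> ws _"] assms)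

lemma sorted_list_of_set_set: "sorted xs \<Longrightarrow> distinct xs \<Longrightarrow> sorted_list_of_set (set xs) = xs"
  by (simp add: sorted_list_of_set_sort_remdups distinct_remdups_id sorted_sort_id)

lemma pos_less_iff: "pos i < pos j \<longleftrightarrow> i < (j :: 'n::{finite,wellorder})"
proof -
  have "pos i < pos j" if "i < j" for i j :: 'n
    unfolding pos_def using that by (intro psubset_card_mono) auto
  then show ?thesis by (metis less_irrefl less_trans linorder_neqE)
qed

lemma pos_ge_1: "1 \<le> pos (i :: 'n::{finite,wellorder})"
  unfolding pos_def by (simp add: Suc_le_eq card_gt_0_iff)

lemma pos_nth:
  assumes "m < CARD('n)"
  shows "pos (sorted_list_of_set (UNIV :: 'n::{finite,wellorder} set) ! m) = Suc m"
proof -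
  let ?e = "sorted_list_of_set (UNIV :: 'n set)"
  have len: "length ?e = CARD('n)" by simp
  have s: "sorted_wrt (<) ?e" by (simp add: strict_sorted_list_of_set)
  have "{..?e ! m} = (!) ?e ` {..m}"
  proof (intro equalityI subsetI)
    fix x assume x: "x \<in> {..?e ! m}"
    have "x \<in> set ?e" by simp
    then obtain i where i: "i < CARD('n)" "x = ?e ! i" using len by (metis in_set_conv_nth)
    then have "i \<le> m"
      using x sorted_wrt_nth_less[OF s, of m i] len by (cases "m < i") auto
    then show "x \<in> (!) ?e ` {..m}" using i by auto
  next
    fix x assume "x \<in> (!) ?e ` {..m}"
    then obtain i where "i \<le> m" "x = ?e ! i" by auto
    then show "x \<in> {..?e ! m}"
      using sorted_wrt_nth_less[OF s, of i m] len assms by (cases "i = m") auto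
  qed
  moreover have "inj_on ((!) ?e) {..m}"
    using assms by (intro inj_on_nth) auto
  ultimately show ?thesis unfolding pos_def by (simp add: card_image)
qed

text \<open>In the increasing enumeration slot \<open>m\<close>, counted from 0, holds the element
  of position \<open>m + 1\<close>, so the slot sign of \<open>s_map\<close> is exactly the sign of
  \<open>star\<close>.\<close>

lemma s_map_basis:
  fixes z :: "'n::{finite,wellorder} \<Rightarrow> 'n euc"
  shows "s_map \<omega> ws (map z (sorted_list_of_set UNIV)) =
    (\<Sum>i\<in>UNIV. (- 1) ^ (pos i - 1) * \<omega> (z i # ws) (map z (sorted_list_of_set (UNIV - {i}))))"
proof -
  define e where "e = sorted_list_of_set (UNIV :: 'n set)"
  have e: "length e = CARD('n)" "distinct e" "sorted e" "set e = UNIV" by (simp_all add: e_def)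
  have bij: "bij_betw ((!) e) {..<CARD('n)} UNIV"
    using bij_betw_nth[OF e(2) refl refl] e by simp
  have del: "take m e @ drop (Suc m) e = sorted_list_of_set (UNIV - {e ! m})" if m: "m < CARD('n)" for m
  proof -
    have split: "e = take m e @ e ! m # drop (Suc m) e" using m e by (intro id_take_nth_drop) simp
    have d: "distinct (take m e @ e ! m # drop (Suc m) e)"
      and s: "sorted (take m e @ e ! m # drop (Suc m) e)"
      and u: "set (take m e @ e ! m # drop (Suc m) e) = UNIV" using e split by metis+
    have "set (take m e @ drop (Suc m) e) = UNIV - {e ! m}" using d u by auto
    moreover have "sorted (take m e @ drop (Suc m) e)" "distinct (take m e @ drop (Suc m) e)"
      using d s by (auto simp: sorted_append)
    ultimately show ?thesis by (metis sorted_list_of_set_set)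
  qed
  have "s_map \<omega> ws (map z e) = (\<Sum>m<CARD('n). (- 1) ^ (pos (e ! m) - 1) *
      \<omega> (z (e ! m) # ws) (map z (sorted_list_of_set (UNIV - {e ! m}))))"
    unfolding s_map_def length_map e(1)
    using pos_nth[where 'n = 'n] e(1) del
    by (intro sum.cong) (auto simp: e_def[symmetric] take_map drop_map simp flip: map_append)
  also have "\<dots> = (\<Sum>i\<in>UNIV. (- 1) ^ (pos i - 1) * \<omega> (z i # ws) (map z (sorted_list_of_set (UNIV - {i}))))"
    by (rule sum.reindex_bij_betw[OF bij])
  finally show ?thesis by (simp add: e_def)
qed

text \<open>By \<open>Alt2_inner_dual\<close> below, \<open>basis_coef z \<omega> \<sigma> i\<close> is the coefficient of \<open>\<omega>\<close> at
  \<open>dy\<^sub>\<sigma> \<otimes> *dy\<^sub>i\<close>, where \<open>z\<close> is the basis dual to \<open>y\<close>.\<close>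
definition basis_coef :: "('n::{finite,wellorder} \<Rightarrow> 'n euc) \<Rightarrow> 'n dform \<Rightarrow> 'n set \<Rightarrow> 'n \<Rightarrow> real" where
  "basis_coef z \<omega> \<sigma> i =
     (- 1) ^ (pos i - 1) * \<omega> (map z (sorted_list_of_set \<sigma>)) (map z (sorted_list_of_set (UNIV - {i})))"

text \<open>\<open>Alt_pairing\<close> applied in each of the two factors; the sign of
  \<open>star\<close> supplies the sign in \<open>basis_coef\<close>.\<close>

lemma Alt2_inner_dual:
  fixes z :: "'n::{finite,wellorder} \<Rightarrow> 'n euc"
  assumes l: "\<And>vs. (\<lambda>ws. \<omega> ws vs) \<in> Alt k" and r: "\<And>ws. \<omega> ws \<in> Alt (CARD('n) - 1)"
    and \<sigma>: "card \<sigma> = k"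
  shows "Alt2_inner k (CARD('n) - 1) \<omega>
      (tensor (wedge_set (\<lambda>i. covector (z i)) \<sigma>) (star (\<lambda>i. covector (z i)) i)) =
    basis_coef z \<omega> \<sigma> i"
proof -
  let ?d = "\<lambda>i. covector (z i)"
  let ?R = "map z (sorted_list_of_set (UNIV - {i}))"
  have "Alt2_inner k (CARD('n) - 1) \<omega> (tensor (wedge_set ?d \<sigma>) (star ?d i)) =
     (- 1) ^ (pos i - 1) * (\<Sum>\<sigma>' | card \<sigma>' = k. (\<Sum>\<rho> | card \<rho> = CARD('n) - 1.
        \<omega> (basis_vectors \<sigma>') (basis_vectors \<rho>) * wedge_set ?d (UNIV - {i}) (basis_vectors \<rho>)) *
        wedge_set ?d \<sigma> (basis_vectors \<sigma>'))"
    by (simp add: Alt2_inner_def tensor_def star_def sum_distrib_left sum_distrib_right mult_ac)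
  also have "\<dots> = (- 1) ^ (pos i - 1) * (\<Sum>\<sigma>' | card \<sigma>' = k.
        \<omega> (basis_vectors \<sigma>') ?R * wedge_set ?d \<sigma> (basis_vectors \<sigma>'))"
    by (subst Alt_pairing[OF r]) (simp_all add: card_Diff_singleton)
  also have "\<dots> = (- 1) ^ (pos i - 1) * \<omega> (map z (sorted_list_of_set \<sigma>)) ?R"
    using Alt_pairing[OF l \<sigma>, of ?R z] by simp
  finally show ?thesis by (simp add: basis_coef_def)
qed

lemma coef_eq_basis_coef:
  fixes \<omega> :: "'n::{finite,wellorder} dform"
  assumes "\<And>vs. (\<lambda>ws. \<omega> ws vs) \<in> Alt k" "\<And>ws. \<omega> ws \<in> Alt (CARD('n) - 1)" "card \<sigma> = k"
  shows "coef k \<omega> \<sigma> i = basis_coef (\<lambda>i. axis i 1) \<omega> \<sigma> i"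
  unfolding coef_def by (rule Alt2_inner_dual[OF assms])

text \<open>Terms with \<open>i\<close> in \<tau> repeat a vector and drop out; in the others,
  sorting \<open>z i\<close> into place costs a nonzero factor. The weights depend on \<tau> and
  \<open>z\<close> alone, so they can be fixed before the form is constructed.\<close>

lemma s_map_constraint:
  fixes z :: "'n::{finite,wellorder} \<Rightarrow> 'n euc"
  shows "\<exists>c. (\<forall>i\<in>- \<tau>. c i \<noteq> (0::real)) \<and>
    (\<forall>k \<omega>. (\<forall>vs. (\<lambda>ws. \<omega> ws vs) \<in> Alt k) \<longrightarrow>
      s_map \<omega> (map z (sorted_list_of_set \<tau>)) (map z (sorted_list_of_set UNIV)) =
      (\<Sum>i\<in>- \<tau>. c i * basis_coef z \<omega> (insert i \<tau>) i))"
proof -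
  have "\<forall>i. \<exists>c::real. c \<noteq> 0 \<and> (\<forall>j. \<forall>\<alpha>\<in>Alt j. \<forall>pre.
      \<alpha> (pre @ z i # map z (sorted_list_of_set \<tau>)) = c * \<alpha> (pre @ map z (insort i (sorted_list_of_set \<tau>))))"
    using Alt_insort by blast
  then obtain c :: "'n \<Rightarrow> real" where c: "\<And>i. c i \<noteq> 0"
    and sgn: "\<And>i j \<alpha> pre. \<alpha> \<in> Alt j \<Longrightarrow>
      \<alpha> (pre @ z i # map z (sorted_list_of_set \<tau>)) = c i * \<alpha> (pre @ map z (insort i (sorted_list_of_set \<tau>)))"
    by metis
  have "s_map \<omega> (map z (sorted_list_of_set \<tau>)) (map z (sorted_list_of_set UNIV)) =
      (\<Sum>i\<in>- \<tau>. c i * basis_coef z \<omega> (insert i \<tau>) i)"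
    if l: "\<And>vs. (\<lambda>ws. \<omega> ws vs) \<in> Alt k" for k \<omega>
  proof -
    have "s_map \<omega> (map z (sorted_list_of_set \<tau>)) (map z (sorted_list_of_set UNIV)) =
        (\<Sum>i\<in>UNIV. if i \<in> - \<tau> then c i * basis_coef z \<omega> (insert i \<tau>) i else 0)"
      unfolding s_map_basis
    proof (intro sum.cong refl)
      fix i
      let ?R = "map z (sorted_list_of_set (UNIV - {i}))"
      show "(- 1) ^ (pos i - 1) * \<omega> (z i # map z (sorted_list_of_set \<tau>)) ?R =
          (if i \<in> - \<tau> then c i * basis_coef z \<omega> (insert i \<tau>) i else 0)"
      proof (cases "i \<in> \<tau>")
        case True
        then have "i \<in> set (sorted_list_of_set \<tau>)" by simp
        then obtain m where "m < length (sorted_list_of_set \<tau>)" "sorted_list_of_set \<tau> ! m = i"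
          by (metis in_set_conv_nth)
        then have "\<omega> (z i # map z (sorted_list_of_set \<tau>)) ?R = 0"
          by (intro Alt_repeat[OF l, of 0 _ "Suc m"]) auto
        then show ?thesis using True by simp
      next
        case False
        then have "\<omega> (z i # map z (sorted_list_of_set \<tau>)) ?R =
            c i * \<omega> (map z (sorted_list_of_set (insert i \<tau>))) ?R"
          using sgn[OF l, of "[]" i ?R] by simp
        then show ?thesis using False by (simp add: basis_coef_def)
      qed
    qed
    also have "\<dots> = (\<Sum>i\<in>- \<tau>. c i * basis_coef z \<omega> (insert i \<tau>) i)"
      by (simp add: sum.If_cases Collect_neg_eq)
    finally show ?thesis .
  qed
  then show ?thesis using c by blast
qed

text \<open>\<open>s_map \<omega>\<close> is an n-form in the second group, which only the full list
  of basis vectors can detect, and a (k-1)-form in the first. So one scalar constraint for each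
  \<tau> is enough.\<close>

lemma s_map_eq_0:
  fixes z :: "'n::{finite,wellorder} \<Rightarrow> 'n euc"
  assumes l: "\<And>vs. (\<lambda>ws. \<omega> ws vs) \<in> Alt k" and r: "\<And>ws. \<omega> ws \<in> Alt (CARD('n) - 1)" and k: "1 \<le> k"
    and z: "span (range z) = UNIV"
    and zero: "\<And>\<tau>. card \<tau> = k - 1 \<Longrightarrow>
      s_map \<omega> (map z (sorted_list_of_set \<tau>)) (map z (sorted_list_of_set UNIV)) = 0"
  shows "s_map \<omega> = (\<lambda>ws vs. 0)"
proof (intro ext)
  fix ws vs
  have n: "Suc (CARD('n) - 1) = CARD('n)" by simp
  have "s_map \<omega> ws vs = 0" if ws: "ws = map z (sorted_list_of_set \<tau>)" "card \<tau> = k - 1" for ws \<tau> vs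
  proof (rule Alt_eq_0[OF s_map_Alt_right[OF l r k] z])
    fix \<sigma> :: "'n set" assume "card \<sigma> = Suc (CARD('n) - 1)"
    then have "\<sigma> = UNIV" using n card_subset_eq[of UNIV \<sigma>] by simp
    then show "s_map \<omega> ws (map z (sorted_list_of_set \<sigma>)) = 0" using zero ws by simp
  qed
  note that = this
  show "s_map \<omega> ws vs = 0"
    by (rule Alt_eq_0[where \<alpha> = "\<lambda>ws. s_map \<omega> ws vs", OF s_map_Alt_left[OF l k] z]) (rule that[OF refl])
qed

section \<open>Free indices\<close>

lemma pair_index_eq:
  fixes \<tau> :: "'n::{finite,wellorder} set"
  assumes "card \<tau> < CARD('n)"
  shows "pair_index \<tau> = (insert (Min (- \<tau>)) \<tau>, Min (- \<tau>))" "- \<tau> \<noteq> {}"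
proof -
  show ne: "- \<tau> \<noteq> {}"
  proof
    assume "- \<tau> = {}"
    then have "\<tau> = UNIV" by auto
    then show False using assms by simp
  qed
  then have "sorted_list_of_set (- \<tau>) = Min (- \<tau>) # sorted_list_of_set (- \<tau> - {Min (- \<tau>)})"
    by (intro sorted_list_of_set_nonempty) auto
  then show "pair_index \<tau> = (insert (Min (- \<tau>)) \<tau>, Min (- \<tau>))"
    by (simp add: pair_index_def constraint_seq_def)
qed

lemma not_free_index:
  assumes "\<not> free_index k (\<sigma>, i)" "card \<sigma> = k" "1 \<le> k" "k \<le> CARD('n)"
  obtains \<tau> :: "'n::{finite,wellorder} set"
  where "card \<tau> = k - 1" "- \<tau> \<noteq> {}" "i = Min (- \<tau>)" "\<sigma> = insert i \<tau>"
proof -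
  obtain \<tau> :: "'n set" where \<tau>: "card \<tau> = k - 1" "(\<sigma>, i) = pair_index \<tau>"
    using assms by (auto simp: free_index_def)
  then have "card \<tau> < CARD('n)" using assms by simp
  from pair_index_eq[OF this] \<tau> show ?thesis by (intro that[of \<tau>]) auto
qed

text \<open>Removing \<open>j\<close> from \<open>insert j \<tau>\<close> recovers \<tau>, so this
  index could be the pair index of no other set, and for \<tau> itself that place is taken by the
  minimum of the complement.\<close>

lemma free_index_other:
  fixes \<tau> :: "'n::{finite,wellorder} set"
  assumes \<tau>: "card \<tau> = k - 1" and j: "j \<in> - \<tau>" "j \<noteq> Min (- \<tau>)" and k: "1 \<le> k" "k \<le> CARD('n)"
  shows "free_index k (insert j \<tau>, j)"
  unfolding free_index_def
proof (intro conjI allI impI notI)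
  show "card (fst (insert j \<tau>, j)) = k" using \<tau> j k by simp
  fix \<tau>' :: "'n set" assume \<tau>': "card \<tau>' = k - 1" and eq: "(insert j \<tau>, j) = pair_index \<tau>'"
  have p: "pair_index \<tau>' = (insert (Min (- \<tau>')) \<tau>', Min (- \<tau>'))" "- \<tau>' \<noteq> {}"
    using pair_index_eq[of \<tau>'] \<tau>' k by auto
  then have jm: "j = Min (- \<tau>')" and ins: "insert j \<tau> = insert j \<tau>'" using eq by auto
  have "j \<in> - \<tau>'" unfolding jm by (rule Min_in) (use p in auto)
  then have "\<tau>' = \<tau>" using ins j by auto
  then show False using jm j by simp
qed

text \<open>The pair index of \<open>\<tau>\<close> is the smallest of its constraint sequence, so if it lies in the normal
  range \<open>l < pos i\<close>, then so does the whole sequence.\<close>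
lemma free_normal_coefs_zero:
  fixes z :: "'n::{finite,wellorder} \<Rightarrow> 'n euc"
  assumes \<omega>: "\<omega> \<in> XX k" and k: "1 \<le> k" "k \<le> CARD('n)"
    and free: "\<And>\<sigma> i. free_index k (\<sigma>, i) \<Longrightarrow> l < pos i \<Longrightarrow> basis_coef z \<omega> \<sigma> i = 0"
    and "card \<sigma> = k" "l < pos i"
  shows "basis_coef z \<omega> \<sigma> i = 0"
proof (cases "free_index k (\<sigma>, i)")
  case False
  obtain \<tau> where \<tau>: "card \<tau> = k - 1" "- \<tau> \<noteq> {}" "i = Min (- \<tau>)" "\<sigma> = insert i \<tau>"
    using not_free_index[OF False] assms by blast
  obtain c where c: "\<forall>i\<in>- \<tau>. c i \<noteq> (0::real)"
    "s_map \<omega> (map z (sorted_list_of_set \<tau>)) (map z (sorted_list_of_set UNIV)) =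
      (\<Sum>i\<in>- \<tau>. c i * basis_coef z \<omega> (insert i \<tau>) i)"
    using s_map_constraint[of \<tau> z] XX_slices(1)[OF \<omega>] by blast
  have i: "i \<in> - \<tau>" unfolding \<tau>(3) by (rule Min_in) (use \<tau> in auto)
  have other: "basis_coef z \<omega> (insert j \<tau>) j = 0" if "j \<in> - \<tau>" "j \<noteq> i" for j
  proof -
    have "i \<le> j" using that \<tau> by (simp add: Min_le)
    then have "i < j" using that by auto
    then have "l < pos j" using \<open>l < pos i\<close> pos_less_iff less_trans by blast
    then show ?thesis using that \<tau> k by (intro free free_index_other) auto
  qed
  have "0 = (\<Sum>i\<in>- \<tau>. c i * basis_coef z \<omega> (insert i \<tau>) i)"
    using c(2) \<omega> by (simp add: XX_def)
  also have "\<dots> = c i * basis_coef z \<omega> (insert i \<tau>) i"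
    using i other by (subst sum.remove[of _ i]) auto
  finally show ?thesis using c(1) i \<tau>(4) by simp
qed (use assms in auto)

lemma dual_spans:
  fixes y z :: "'n::{finite,wellorder} \<Rightarrow> 'n euc"
  assumes dual: "\<And>i j. y i \<bullet> z j = (if i = j then 1 else 0)"
  shows "span (range z) = UNIV"
proof -
  have inj: "inj z"
  proof (rule injI)
    fix i j assume "z i = z j"
    then have "y i \<bullet> z i = y i \<bullet> z j" by simp
    then show "i = j" by (simp add: dual split: if_splits)
  qed
  have "independent (range z)"
    unfolding independent_explicit
  proof (intro conjI allI impI ballI)
    fix c v assume c: "(\<Sum>v\<in>range z. c v *\<^sub>R v) = 0" and "v \<in> range z"
    then obtain i where v: "v = z i" by auto
    have "0 = y i \<bullet> (\<Sum>j\<in>UNIV. c (z j) *\<^sub>R z j)" using c inj by (simp add: sum.reindex)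
    also have "\<dots> = (\<Sum>j\<in>UNIV. if j = i then c (z i) else 0)"
      unfolding inner_sum_right by (intro sum.cong) (auto simp: dual)
    finally show "c v = 0" by (simp add: v)
  qed auto
  then show ?thesis
    using card_eq_dim[of "range z" UNIV] inj by (auto simp: card_image)
qed

text \<open>The constraints decouple: every index of a constraint sequence other than the first is
  free, and each pair index occurs in one sequence only. Each constraint can therefore be solved
  separately for its pair index.\<close>

lemma exists_with_free_coefs:
  fixes y z :: "'n::{finite,wellorder} \<Rightarrow> 'n euc"
  assumes dual: "\<And>i j. y i \<bullet> z j = (if i = j then 1 else 0)" and k: "1 \<le> k" "k \<le> CARD('n)"
  shows "\<exists>\<omega>\<in>XX k. \<forall>\<sigma> i. free_index k (\<sigma>, i) \<longrightarrow> basis_coef z \<omega> \<sigma> i = B \<sigma> i"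
proof -
  have "\<exists>c. \<forall>\<tau>. (\<forall>i\<in>- \<tau>. c \<tau> i \<noteq> (0::real)) \<and>
    (\<forall>k \<omega>. (\<forall>vs. (\<lambda>ws. \<omega> ws vs) \<in> Alt k) \<longrightarrow>
      s_map \<omega> (map z (sorted_list_of_set \<tau>)) (map z (sorted_list_of_set UNIV)) =
      (\<Sum>i\<in>- \<tau>. c \<tau> i * basis_coef z \<omega> (insert i \<tau>) i))"
    by (intro choice allI s_map_constraint)
  then obtain c :: "'n set \<Rightarrow> 'n \<Rightarrow> real" where c: "\<And>\<tau> i. i \<in> - \<tau> \<Longrightarrow> c \<tau> i \<noteq> 0"
    and constraint: "\<And>\<tau> k \<omega>. (\<forall>vs. (\<lambda>ws. \<omega> ws vs) \<in> Alt k) \<Longrightarrow>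
      s_map \<omega> (map z (sorted_list_of_set \<tau>)) (map z (sorted_list_of_set UNIV)) =
      (\<Sum>i\<in>- \<tau>. c \<tau> i * basis_coef z \<omega> (insert i \<tau>) i)"
    by blast
  \<comment> \<open>A pair index \<open>(\<sigma>, i)\<close> comes from
    \<open>\<tau> = \<sigma> - {i}\<close>; its value is the solution of the constraint of
    \<tau>.\<close>
  define B' where "B' \<sigma> i = (if free_index k (\<sigma>, i) then B \<sigma> i else
     - (\<Sum>j\<in>- (\<sigma> - {i}) - {i}. c (\<sigma> - {i}) j * B (insert j (\<sigma> - {i})) j) / c (\<sigma> - {i}) i)" for \<sigma> i
  \<comment> \<open>Expanded in \<open>y\<close>, so that the dual vectors \<open>z\<close> read off
    the prescribed coefficients.\<close>
  define \<omega> where "\<omega> = (\<lambda>ws vs. \<Sum>a\<in>{\<sigma>. card \<sigma> = k} \<times> UNIV.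
     (B' (fst a) (snd a) * wedge_set (\<lambda>i. covector (y i)) (fst a) ws) * star (\<lambda>i. covector (y i)) (snd a) vs)"
  have "\<omega> \<in> Alt2 k (CARD('n) - 1)"
    unfolding \<omega>_def using wedge_set_Alt[OF covector_Alt] star_Alt[OF covector_Alt]
    by (intro Alt2_sumI Alt_scale) auto
  note sl = Alt2_slices[OF this]
  have coefs: "basis_coef z \<omega> \<sigma> i = B' \<sigma> i" if "card \<sigma> = k" for \<sigma> i
  proof -
    have "wedge_set (\<lambda>i. covector (y i)) \<sigma>' (map z (sorted_list_of_set \<sigma>)) = (if \<sigma>' = \<sigma> then 1 else 0)"
      if "card \<sigma>' = k" for \<sigma>' using wedge_set_dual[OF dual] that \<open>card \<sigma> = k\<close> by simp
    moreover have "star (\<lambda>i. covector (y i)) i' (map z (sorted_list_of_set (UNIV - {i}))) =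
        (if i' = i then (- 1) ^ (pos i - 1) else 0)" for i'
      unfolding star_def using wedge_set_dual[OF dual, of "UNIV - {i'}" "UNIV - {i}"]
      by (auto simp: card_Diff_singleton)
    ultimately have "\<omega> (map z (sorted_list_of_set \<sigma>)) (map z (sorted_list_of_set (UNIV - {i}))) =
      (\<Sum>a\<in>{\<sigma>. card \<sigma> = k} \<times> UNIV. if a = (\<sigma>, i) then B' \<sigma> i * (- 1) ^ (pos i - 1) else 0)"
      unfolding \<omega>_def by (intro sum.cong) (auto split: if_splits)
    also have "\<dots> = B' \<sigma> i * (- 1) ^ (pos i - 1)" using that by simp
    finally show ?thesis by (simp add: basis_coef_def flip: power_mult_distrib)
  qed
  have "s_map \<omega> = (\<lambda>ws vs. 0)"
  proof (rule s_map_eq_0[OF sl k(1) dual_spans[OF dual]])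
    fix \<tau> :: "'n set" assume \<tau>: "card \<tau> = k - 1"
    define i where "i = Min (- \<tau>)"
    have ne: "- \<tau> \<noteq> {}" and p: "pair_index \<tau> = (insert i \<tau>, i)"
      using pair_index_eq[of \<tau>] \<tau> k by (auto simp: i_def)
    then have i: "i \<in> - \<tau>" unfolding i_def by (intro Min_in) auto
    have card: "card (insert j \<tau>) = k" if "j \<in> - \<tau>" for j using that \<tau> k by simp
    have nf: "\<not> free_index k (insert i \<tau>, i)" using p \<tau> by (auto simp: free_index_def)
    have "(\<Sum>j\<in>- \<tau> - {i}. c \<tau> j * B' (insert j \<tau>) j) = (\<Sum>j\<in>- \<tau> - {i}. c \<tau> j * B (insert j \<tau>) j)"
      using free_index_other[OF \<tau> _ _ k] by (intro sum.cong) (auto simp: B'_def i_def)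
    moreover have "insert i \<tau> - {i} = \<tau>" using i by auto
    ultimately have "c \<tau> i * B' (insert i \<tau>) i + (\<Sum>j\<in>- \<tau> - {i}. c \<tau> j * B' (insert j \<tau>) j) = 0"
      using nf c[OF i] by (simp add: B'_def)
    then have "(\<Sum>j\<in>- \<tau>. c \<tau> j * B' (insert j \<tau>) j) = 0"
      using i by (subst sum.remove[of _ i]) auto
    then show "s_map \<omega> (map z (sorted_list_of_set \<tau>)) (map z (sorted_list_of_set UNIV)) = 0"
      using constraint[of \<omega> k \<tau>] sl coefs card by simp
  qed
  then have "\<omega> \<in> XX k" using \<open>\<omega> \<in> Alt2 k (CARD('n) - 1)\<close> by (simp add: XX_def)
  moreover have "basis_coef z \<omega> \<sigma> i = B \<sigma> i" if "free_index k (\<sigma>, i)" for \<sigma> i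
    using coefs[of \<sigma> i] that by (simp add: B'_def free_index_def)
  ultimately show ?thesis by blast
qed

text \<open>Represents the dual forms by vectors: pairing with wedge products of covectors is then
  evaluation at these vectors.\<close>

lemma dual_family_covector:
  fixes y :: "'n::{finite,wellorder} \<Rightarrow> 'n euc"
  assumes "dual_family (\<lambda>i. covector (y i)) dyh"
  obtains z where "dyh = (\<lambda>i. covector (z i))" "\<And>i j. y i \<bullet> z j = (if i = j then 1 else 0)"
proof -
  have "\<forall>i. \<exists>v. dyh i = covector v" using assms Alt1_covector by (auto simp: dual_family_def)
  then obtain z where z: "\<And>i. dyh i = covector (z i)" by metis
  have singletons: "{\<sigma>. card \<sigma> = Suc 0} = range (\<lambda>i::'n. {i})" by (auto simp: card_Suc_eq)
  have "Alt_inner 1 (covector u) (covector v) = u \<bullet> v" for u v :: "'n euc"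
  proof -
    have "Alt_inner 1 (covector u) (covector v) = (\<Sum>i\<in>UNIV. u $ i * v $ i)"
      unfolding Alt_inner_def One_nat_def singletons
      by (subst sum.reindex) (auto simp: inj_on_def basis_vectors_def covector_def inner_axis)
    then show ?thesis by (simp add: inner_vec_def)
  qed
  then have "y i \<bullet> z j = (if i = j then 1 else 0)" for i j
    using assms by (auto simp: dual_family_def z inner_commute)
  then show ?thesis using that z by blast
qed

section \<open>Normal traces\<close>

lemma covector_wedge_zero_iff:
  fixes y z :: "'n::{finite,wellorder} \<Rightarrow> 'n euc"
  assumes \<beta>: "\<beta> \<in> Alt (CARD('n) - 1)" and dual: "\<And>i j. y i \<bullet> z j = (if i = j then 1 else 0)"
  shows "(\<Sum>j\<in>UNIV. (- 1) ^ (pos j - 1) * \<beta> (basis_vectors (UNIV - {j})) * y i $ j) = 0 \<longleftrightarrow>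
    \<beta> (map z (sorted_list_of_set (UNIV - {i}))) = 0"
proof -
  text \<open>Both sides say that the \<open>n\<close>-form \<open>dy\<^sub>i \<and> \<beta>\<close> vanishes, tested on two different bases.\<close>
  define \<gamma> where "\<gamma> = s_map (tensor (covector (y i)) \<beta>) []"
  have "\<gamma> \<in> Alt (Suc (CARD('n) - 1))"
    unfolding \<gamma>_def
  proof (rule s_map_Alt_right[of _ 1])
    show "(\<lambda>ws. tensor (covector (y i)) \<beta> ws vs) \<in> Alt 1" for vs
      using Alt_scale[OF covector_Alt[of "y i"], of "\<beta> vs"] by (simp add: tensor_def mult.commute)
    show "tensor (covector (y i)) \<beta> ws \<in> Alt (CARD('n) - 1)" for ws
      using Alt_scale[OF \<beta>, of "covector (y i) ws"] by (simp add: tensor_def[abs_def])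
  qed simp
  then have \<gamma>: "\<gamma> \<in> Alt (CARD('n))" by simp
  have iff: "\<gamma> (map b (sorted_list_of_set UNIV)) = 0 \<longleftrightarrow> \<gamma> = (\<lambda>vs. 0)" if "span (range b) = UNIV"
    for b :: "'n \<Rightarrow> 'n euc"
  proof
    assume *: "\<gamma> (map b (sorted_list_of_set UNIV)) = 0"
    have "\<gamma> vs = 0" for vs
    proof (rule Alt_eq_0[OF \<gamma> that])
      fix \<sigma> :: "'n set" assume "card \<sigma> = CARD('n)"
      then have "\<sigma> = UNIV" using card_subset_eq[of UNIV \<sigma>] by simp
      then show "\<gamma> (map b (sorted_list_of_set \<sigma>)) = 0" using * by simp
    qed
    then show "\<gamma> = (\<lambda>vs. 0)" by blast
  qed simp
  have 1: "\<gamma> (map (\<lambda>i. axis i 1) (sorted_list_of_set UNIV)) =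
      (\<Sum>j\<in>UNIV. (- 1) ^ (pos j - 1) * \<beta> (basis_vectors (UNIV - {j})) * y i $ j)"
    unfolding \<gamma>_def s_map_basis
    by (auto simp: tensor_def covector_def inner_axis basis_vectors_def intro!: sum.cong)
  have "\<gamma> (map z (sorted_list_of_set UNIV)) = (\<Sum>j\<in>UNIV. if j = i then
      (- 1) ^ (pos i - 1) * \<beta> (map z (sorted_list_of_set (UNIV - {i}))) else 0)"
    unfolding \<gamma>_def s_map_basis
    by (intro sum.cong refl) (auto simp: tensor_def covector_def dual)
  then have 2: "\<gamma> (map z (sorted_list_of_set UNIV)) =
      (- 1) ^ (pos i - 1) * \<beta> (map z (sorted_list_of_set (UNIV - {i})))" by simp
  show ?thesis
    using iff[OF span_axis] iff[OF dual_spans[OF dual]] unfolding 1 2 by simp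
qed

text \<open>Links what the degrees of freedom see with the trace in direction \<open>y i\<close>.
  Only the vanishing of all rows together is compared, because the rows refer to \<open>z\<close> on
  one side and to the standard basis on the other.\<close>

lemma basis_coef_zero_iff:
  fixes y z :: "'n::{finite,wellorder} \<Rightarrow> 'n euc"
  assumes l: "\<And>vs. (\<lambda>ws. \<omega> ws vs) \<in> Alt k" and r: "\<And>ws. \<omega> ws \<in> Alt (CARD('n) - 1)"
    and dual: "\<And>i j. y i \<bullet> z j = (if i = j then 1 else 0)"
  shows "(\<forall>\<sigma>. card \<sigma> = k \<longrightarrow> basis_coef z \<omega> \<sigma> i = 0) \<longleftrightarrow>
    (\<forall>\<sigma>. card \<sigma> = k \<longrightarrow> (\<Sum>j\<in>UNIV. coef k \<omega> \<sigma> j * y i $ j) = 0)"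
proof -
  define R where "R = map z (sorted_list_of_set (UNIV - {i}))"
  \<comment> \<open>At \<open>basis_vectors \<sigma>\<close> this is row \<sigma> of the trace in
    direction \<open>y i\<close>.\<close>
  define t where "t ws = (\<Sum>j\<in>UNIV. ((- 1) ^ (pos j - 1) * y i $ j) * \<omega> ws (basis_vectors (UNIV - {j})))" for ws
  have t: "t \<in> Alt k" unfolding t_def by (intro Alt_sum Alt_scale l)
  have "(\<forall>\<sigma>. card \<sigma> = k \<longrightarrow> basis_coef z \<omega> \<sigma> i = 0) \<longleftrightarrow> (\<forall>ws. \<omega> ws R = 0)"
    using Alt_eq_0[OF l dual_spans[OF dual], of R] by (auto simp: basis_coef_def R_def)
  also have "\<dots> \<longleftrightarrow> (\<forall>ws. t ws = 0)"
    using covector_wedge_zero_iff[OF r dual] by (simp add: R_def t_def mult_ac)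
  also have "\<dots> \<longleftrightarrow> (\<forall>\<sigma>. card \<sigma> = k \<longrightarrow> t (basis_vectors \<sigma>) = 0)"
    using Alt_eq_0[OF t span_axis] by (auto simp: basis_vectors_def)
  also have "\<dots> \<longleftrightarrow> (\<forall>\<sigma>. card \<sigma> = k \<longrightarrow> (\<Sum>j\<in>UNIV. coef k \<omega> \<sigma> j * y i $ j) = 0)"
    by (simp add: coef_eq_basis_coef[OF l r] t_def basis_coef_def basis_vectors_def mult_ac)
  finally show ?thesis .
qed

lemma coefs_zero_imp_zero:
  fixes \<omega> :: "'n::{finite,wellorder} dform"
  assumes l: "\<And>vs. (\<lambda>ws. \<omega> ws vs) \<in> Alt k" and r: "\<And>ws. \<omega> ws \<in> Alt (CARD('n) - 1)"
    and zero: "\<And>\<sigma> i. card \<sigma> = k \<Longrightarrow> coef k \<omega> \<sigma> i = 0"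
  shows "\<omega> = (\<lambda>ws vs. 0)"
proof (intro ext)
  fix ws vs
  have "\<omega> ws vs = 0" if ws: "ws = basis_vectors \<sigma>" "card \<sigma> = k" for ws vs \<sigma>
  proof (rule Alt_eq_0[OF r span_axis])
    fix \<rho> :: "'n set" assume "card \<rho> = CARD('n) - 1"
    then have "card (- \<rho>) = 1" by (simp add: Compl_eq_Diff_UNIV card_Diff_subset Suc_leI)
    then obtain i where "- \<rho> = {i}" by (auto simp: card_Suc_eq)
    then have "\<rho> = UNIV - {i}" by auto
    then show "\<omega> ws (map (\<lambda>i. axis i 1) (sorted_list_of_set \<rho>)) = 0"
      using zero[of \<sigma> i] ws by (simp add: coef_eq_basis_coef[OF l r] basis_coef_def basis_vectors_def)
  qed
  note that = this
  show "\<omega> ws vs = 0"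
  proof (rule Alt_eq_0[where \<alpha> = "\<lambda>ws. \<omega> ws vs", OF l span_axis])
    fix \<sigma> :: "'n set" assume "card \<sigma> = k"
    then show "\<omega> (map (\<lambda>i. axis i 1) (sorted_list_of_set \<sigma>)) vs = 0"
      by (intro that[of _ \<sigma>]) (simp_all add: basis_vectors_def)
  qed
qed

section \<open>Polynomials in barycentric coordinates\<close>

text \<open>The polynomial behind an element of \<open>PP\<close>, on the whole space and not cut
  off to zero; continuity and derivatives refer to it.\<close>

definition Pol :: "int \<Rightarrow> (('n::{finite,wellorder}) euc \<Rightarrow> real) set" where
  "Pol r = {p. \<exists>c. p = (\<lambda>x. \<Sum>\<alpha>::'n \<Rightarrow> nat | int (\<Sum>i\<in>UNIV. \<alpha> i) \<le> r. c \<alpha> * (\<Prod>i\<in>UNIV. x $ i ^ \<alpha> i))}"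

lemma PP_iff: "q \<in> PP r f \<longleftrightarrow> (\<exists>p\<in>Pol r. q = (\<lambda>x. if x \<in> f then p x else 0))"
proof
  assume "q \<in> PP r f"
  then obtain c where "q = (\<lambda>x. if x \<in> f
      then \<Sum>\<alpha>::'a \<Rightarrow> nat | int (\<Sum>i\<in>UNIV. \<alpha> i) \<le> r. c \<alpha> * (\<Prod>i\<in>UNIV. x $ i ^ \<alpha> i) else 0)"
    unfolding PP_def by (elim CollectE exE)
  then show "\<exists>p\<in>Pol r. q = (\<lambda>x. if x \<in> f then p x else 0)"
    by (intro bexI[of _ "\<lambda>x. \<Sum>\<alpha>::'a \<Rightarrow> nat | int (\<Sum>i\<in>UNIV. \<alpha> i) \<le> r. c \<alpha> * (\<Prod>i\<in>UNIV. x $ i ^ \<alpha> i)"])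
      (simp_all only: Pol_def mem_Collect_eq, rule exI, rule refl)
next
  assume "\<exists>p\<in>Pol r. q = (\<lambda>x. if x \<in> f then p x else 0)"
  then obtain c where "q = (\<lambda>x. if x \<in> f
      then \<Sum>\<alpha>::'a \<Rightarrow> nat | int (\<Sum>i\<in>UNIV. \<alpha> i) \<le> r. c \<alpha> * (\<Prod>i\<in>UNIV. x $ i ^ \<alpha> i) else 0)"
    unfolding Pol_def by (elim bexE CollectE exE) (simp only:)
  then show "q \<in> PP r f" unfolding PP_def by (intro CollectI exI)
qed

lemma PP_I: "p \<in> Pol r \<Longrightarrow> (\<lambda>x. if x \<in> f then p x else 0) \<in> PP r f"
  by (auto simp: PP_iff)

lemma finite_multi_indices: "finite {\<alpha>::'n::finite \<Rightarrow> nat. int (\<Sum>i\<in>UNIV. \<alpha> i) \<le> r}"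
proof (rule finite_subset)
  show "finite {\<alpha>::'n \<Rightarrow> nat. \<forall>x. (x \<in> UNIV \<longrightarrow> \<alpha> x \<in> {..nat r}) \<and> (x \<notin> UNIV \<longrightarrow> \<alpha> x = 0)}"
    by (rule finite_set_of_finite_funs) auto
  have "int (\<alpha> j) \<le> r" if "int (\<Sum>i\<in>UNIV. \<alpha> i) \<le> r" for \<alpha> :: "'n \<Rightarrow> nat" and j
    using member_le_sum[of j UNIV \<alpha>] that by (simp del: of_nat_sum)
  then show "{\<alpha>::'n \<Rightarrow> nat. int (\<Sum>i\<in>UNIV. \<alpha> i) \<le> r}
    \<subseteq> {\<alpha>::'n \<Rightarrow> nat. \<forall>x. (x \<in> UNIV \<longrightarrow> \<alpha> x \<in> {..nat r}) \<and> (x \<notin> UNIV \<longrightarrow> \<alpha> x = 0)}"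
    by (auto simp: le_nat_iff simp del: of_nat_sum)
qed

lemma Pol_zero: "(\<lambda>x. 0) \<in> Pol r"
  unfolding Pol_def by (auto intro!: exI[of _ "\<lambda>_. 0"])

lemma Pol_add:
  assumes "p \<in> Pol r" "q \<in> Pol r"
  shows "(\<lambda>x. p x + q x) \<in> Pol r"
proof -
  obtain c d where "p = (\<lambda>x. \<Sum>\<alpha> | int (\<Sum>i\<in>UNIV. \<alpha> i) \<le> r. c \<alpha> * (\<Prod>i\<in>UNIV. x $ i ^ \<alpha> i))"
    "q = (\<lambda>x. \<Sum>\<alpha> | int (\<Sum>i\<in>UNIV. \<alpha> i) \<le> r. d \<alpha> * (\<Prod>i\<in>UNIV. x $ i ^ \<alpha> i))"
    using assms by (auto simp: Pol_def)
  then show ?thesis unfolding Pol_def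
    by (auto intro!: exI[of _ "\<lambda>\<alpha>. c \<alpha> + d \<alpha>"] simp: distrib_right sum.distrib)
qed

lemma Pol_scale:
  assumes "p \<in> Pol r"
  shows "(\<lambda>x. a * p x) \<in> Pol r"
proof -
  obtain c where "p = (\<lambda>x. \<Sum>\<alpha> | int (\<Sum>i\<in>UNIV. \<alpha> i) \<le> r. c \<alpha> * (\<Prod>i\<in>UNIV. x $ i ^ \<alpha> i))"
    using assms by (auto simp: Pol_def)
  then show ?thesis unfolding Pol_def
    by (auto intro!: exI[of _ "\<lambda>\<alpha>. a * c \<alpha>"] simp: sum_distrib_left mult.assoc)
qed

lemma Pol_sum: "(\<And>a. a \<in> I \<Longrightarrow> p a \<in> Pol r) \<Longrightarrow> (\<lambda>x. \<Sum>a\<in>I. p a x) \<in> Pol r"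
  by (induction I rule: infinite_finite_induct) (auto simp: Pol_zero Pol_add)

lemma Pol_monomial:
  assumes "int (\<Sum>i\<in>UNIV. \<alpha> i) \<le> r"
  shows "(\<lambda>x. \<Prod>i\<in>UNIV. x $ i ^ \<alpha> i) \<in> Pol r"
  unfolding Pol_def
proof (intro CollectI exI[of _ "\<lambda>\<beta>. if \<beta> = \<alpha> then 1 else 0"] ext)
  fix x :: "'a euc"
  have eq: "(\<Sum>\<beta> | int (\<Sum>i\<in>UNIV. \<beta> i) \<le> r. (if \<beta> = \<alpha> then 1 else 0) * (\<Prod>i\<in>UNIV. x $ i ^ \<beta> i)) =
     (\<Sum>\<beta> | int (\<Sum>i\<in>UNIV. \<beta> i) \<le> r. if \<beta> = \<alpha> then (\<Prod>i\<in>UNIV. x $ i ^ \<beta> i) else 0)"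
    by (intro sum.cong) auto
  show "(\<Prod>i\<in>UNIV. x $ i ^ \<alpha> i) = (\<Sum>\<beta> | int (\<Sum>i\<in>UNIV. \<beta> i) \<le> r.
      (if \<beta> = \<alpha> then 1 else 0) * (\<Prod>i\<in>UNIV. x $ i ^ \<beta> i))"
    unfolding eq using assms by (subst sum.delta[OF finite_multi_indices]) (simp_all del: of_nat_sum)
qed

lemma Pol_cases:
  assumes "p \<in> Pol r"
    and "\<And>\<alpha>. int (\<Sum>i\<in>UNIV. \<alpha> i) \<le> r \<Longrightarrow> Q (\<lambda>x. \<Prod>i\<in>UNIV. x $ i ^ \<alpha> i)"
    and "\<And>p q. Q p \<Longrightarrow> Q q \<Longrightarrow> Q (\<lambda>x. p x + q x)" and "\<And>p a. Q p \<Longrightarrow> Q (\<lambda>x. a * p x)" and "Q (\<lambda>x. 0)"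
  shows "Q p"
proof -
  obtain c where p: "p = (\<lambda>x. \<Sum>\<alpha> | int (\<Sum>i\<in>UNIV. \<alpha> i) \<le> r. c \<alpha> * (\<Prod>i\<in>UNIV. x $ i ^ \<alpha> i))"
    using assms(1) by (auto simp: Pol_def)
  have "Q (\<lambda>x. \<Sum>\<alpha>\<in>A. c \<alpha> * (\<Prod>i\<in>UNIV. x $ i ^ \<alpha> i))"
    if "finite A" "A \<subseteq> {\<alpha>. int (\<Sum>i\<in>UNIV. \<alpha> i) \<le> r}" for A
    using that by (induction A rule: finite_induct) (auto intro!: assms(2-5) simp del: of_nat_sum)
  then show ?thesis unfolding p using finite_multi_indices by blast
qed

lemma Pol_mono:
  assumes "p \<in> Pol r" "r \<le> s"
  shows "p \<in> Pol s"
  using assms(1) by (rule Pol_cases) (use assms(2) in \<open>auto intro!: Pol_monomial Pol_add Pol_scale Pol_zero simp del: of_nat_sum\<close>)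

lemma Pol_const: "0 \<le> r \<Longrightarrow> (\<lambda>x. a) \<in> Pol r"
  using Pol_scale[OF Pol_monomial[of "\<lambda>_. 0" r], of a] by simp

lemma Pol_mult_coord:
  assumes "p \<in> Pol r"
  shows "(\<lambda>x. x $ j * p x) \<in> Pol (r + 1)"
  using assms
proof (rule Pol_cases)
  fix \<alpha> :: "'a \<Rightarrow> nat" assume \<alpha>: "int (\<Sum>i\<in>UNIV. \<alpha> i) \<le> r"
  define \<beta> where "\<beta> = \<alpha>(j := Suc (\<alpha> j))"
  have "(\<Sum>i\<in>UNIV. \<beta> i) = Suc (\<Sum>i\<in>UNIV. \<alpha> i)"
    by (simp add: \<beta>_def sum.remove[of UNIV j])
  then have "(\<lambda>x. \<Prod>i\<in>UNIV. x $ i ^ \<beta> i) \<in> Pol (r + 1)"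
    using \<alpha> by (intro Pol_monomial) simp
  moreover have "(\<Prod>i\<in>UNIV. x $ i ^ \<beta> i) = x $ j * (\<Prod>i\<in>UNIV. x $ i ^ \<alpha> i)" for x :: "'a euc"
    by (simp add: \<beta>_def prod.remove[of UNIV j])
  ultimately show "(\<lambda>x. x $ j * (\<Prod>i\<in>UNIV. x $ i ^ \<alpha> i)) \<in> Pol (r + 1)" by simp
next
  fix p q assume "(\<lambda>x. x $ j * p x) \<in> Pol (r + 1)" "(\<lambda>x. x $ j * q x) \<in> Pol (r + 1)"
  from Pol_add[OF this] show "(\<lambda>x. x $ j * (p x + q x)) \<in> Pol (r + 1)" by (simp add: distrib_left)
next
  fix p a assume "(\<lambda>x. x $ j * p x) \<in> Pol (r + 1)"
  from Pol_scale[OF this, of a] show "(\<lambda>x. x $ j * (a * p x)) \<in> Pol (r + 1)" by (simp add: mult_ac)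
qed (simp add: Pol_zero)

lemma Pol_mult_affine:
  assumes "p \<in> Pol r"
  shows "(\<lambda>x. (a + g \<bullet> x) * p x) \<in> Pol (r + 1)"
proof -
  have "(\<lambda>x. a * p x + (\<Sum>j\<in>UNIV. g $ j * (x $ j * p x))) \<in> Pol (r + 1)"
    by (intro Pol_add Pol_scale Pol_sum Pol_mult_coord assms Pol_mono[OF assms]) auto
  then show ?thesis by (simp add: inner_vec_def algebra_simps sum_distrib_left)
qed

lemma Pol_mult_affine_power:
  assumes "p \<in> Pol r"
  shows "(\<lambda>x. (a + g \<bullet> x) ^ m * p x) \<in> Pol (r + int m)"
proof (induction m)
  case (Suc m)
  from Pol_mult_affine[OF this, of a g] show ?case by (simp add: mult.assoc ac_simps)
qed (simp add: assms)

lemma Pol_mult_affine_prod: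
  assumes "finite K" "p \<in> Pol r"
  shows "(\<lambda>x. (\<Prod>v\<in>K. (a v + g v \<bullet> x) ^ m v) * p x) \<in> Pol (r + int (\<Sum>v\<in>K. m v))"
  using assms(1)
proof (induction K rule: finite_induct)
  case (insert w K)
  from Pol_mult_affine_power[OF insert.IH, of "a w" "g w" "m w"] insert.hyps show ?case
    by (simp add: mult.assoc ac_simps)
qed (simp add: assms)

lemma Pol_continuous: "p \<in> Pol r \<Longrightarrow> continuous_on A p"
  by (erule Pol_cases) (auto intro!: continuous_intros)

lemma PP_zero: "(\<lambda>x. 0) \<in> PP r f"
  using PP_I[OF Pol_zero[of r], of f] by simp

lemma PP_scale: assumes "p \<in> PP r f" shows "(\<lambda>x. a * p x) \<in> PP r f"
proof -
  obtain p' where p: "p' \<in> Pol r" "p = (\<lambda>x. if x \<in> f then p' x else 0)" using assms by (auto simp: PP_iff)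
  have "(\<lambda>x. a * p x) = (\<lambda>x. if x \<in> f then a * p' x else 0)" using p by auto
  then show ?thesis using PP_I[OF Pol_scale[OF p(1), of a], of f] by simp
qed

lemma PP_add: assumes "p \<in> PP r f" "q \<in> PP r f" shows "(\<lambda>x. p x + q x) \<in> PP r f"
proof -
  obtain p' q' where p: "p' \<in> Pol r" "p = (\<lambda>x. if x \<in> f then p' x else 0)"
    "q' \<in> Pol r" "q = (\<lambda>x. if x \<in> f then q' x else 0)" using assms by (auto simp: PP_iff)
  have "(\<lambda>x. p x + q x) = (\<lambda>x. if x \<in> f then p' x + q' x else 0)" using p by auto
  then show ?thesis using PP_I[OF Pol_add[OF p(1,3)], of f] by simp
qed

lemma PP_restrict:
  assumes "p \<in> PP r T" "f \<subseteq> T"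
  shows "(\<lambda>x. if x \<in> f then p x else 0) \<in> PP r f"
proof -
  obtain p' where "p' \<in> Pol r" "p = (\<lambda>x. if x \<in> T then p' x else 0)" using assms by (auto simp: PP_iff)
  then show ?thesis using assms(2) by (auto simp: PP_iff fun_eq_iff intro!: bexI[of _ p'])
qed

text \<open>Coefficients of a multivariate polynomial are determined by its values at positive arguments;
  the exponents in \<open>S\<close> need only be pairwise distinct on \<open>K\<close>, which is what the induction on \<open>K\<close>
  preserves.\<close>
lemma positive_polynomial_zero:
  fixes c :: "('a \<Rightarrow> nat) \<Rightarrow> real"
  assumes "finite K" "finite S"
    and "\<And>\<alpha> \<beta>. \<alpha> \<in> S \<Longrightarrow> \<beta> \<in> S \<Longrightarrow> (\<forall>v\<in>K. \<alpha> v = \<beta> v) \<Longrightarrow> \<alpha> = \<beta>"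
    and "\<And>t. (\<forall>v\<in>K. 0 < t v) \<Longrightarrow> (\<Sum>\<alpha>\<in>S. c \<alpha> * (\<Prod>v\<in>K. t v ^ \<alpha> v)) = 0"
    and "\<alpha> \<in> S"
  shows "c \<alpha> = 0"
  using assms
proof (induction K arbitrary: S \<alpha> rule: finite_induct)
  case empty
  then have "S = {\<alpha>}" by blast
  then show ?case using empty(3)[of "\<lambda>_. 1"] by simp
next
  case (insert w K)
  define N where "N = Max ((\<lambda>\<alpha>. \<alpha> w) ` S)"
  have N: "\<beta> w \<le> N" if "\<beta> \<in> S" for \<beta> using that insert.prems(1) by (simp add: N_def)
  show ?case
  proof (rule insert.IH[of "{\<beta> \<in> S. \<beta> w = \<alpha> w}"])
    show "\<beta> = \<gamma>" if "\<beta> \<in> {\<beta> \<in> S. \<beta> w = \<alpha> w}" "\<gamma> \<in> {\<beta> \<in> S. \<beta> w = \<alpha> w}" "\<forall>v\<in>K. \<beta> v = \<gamma> v" for \<beta> \<gamma>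
      using that insert.prems(2)[of \<beta> \<gamma>] by auto
    fix t :: "'a \<Rightarrow> real" assume t: "\<forall>v\<in>K. 0 < t v"
    \<comment> \<open>The coefficient of degree \<open>m\<close> in the variable at
      \<open>w\<close>, with the other variables frozen at \<open>t\<close>; it is zero because the
      polynomial in \<open>s\<close> has infinitely many roots.\<close>
    define d where "d m = (\<Sum>\<beta> | \<beta> \<in> S \<and> \<beta> w = m. c \<beta> * (\<Prod>v\<in>K. t v ^ \<beta> v))" for m
    have "(\<Sum>m\<le>N. d m * s ^ m) = 0" if "0 < s" for s
    proof -
      have "(\<Sum>m\<le>N. d m * s ^ m) = (\<Sum>m\<le>N. \<Sum>\<beta> | \<beta> \<in> S \<and> \<beta> w = m. c \<beta> * (s ^ \<beta> w * (\<Prod>v\<in>K. t v ^ \<beta> v)))"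
        unfolding d_def sum_distrib_right by (intro sum.cong refl) (auto simp: mult_ac)
      also have "\<dots> = (\<Sum>\<beta>\<in>S. c \<beta> * (s ^ \<beta> w * (\<Prod>v\<in>K. t v ^ \<beta> v)))"
        using N insert.prems(1) by (intro sum.group) auto
      also have "\<dots> = (\<Sum>\<beta>\<in>S. c \<beta> * (\<Prod>v\<in>insert w K. (t(w := s)) v ^ \<beta> v))"
      proof (intro sum.cong refl)
        fix \<beta>
        have "(\<Prod>v\<in>K. (t(w := s)) v ^ \<beta> v) = (\<Prod>v\<in>K. t v ^ \<beta> v)"
          using insert.hyps by (intro prod.cong) auto
        then show "c \<beta> * (s ^ \<beta> w * (\<Prod>v\<in>K. t v ^ \<beta> v)) =
            c \<beta> * (\<Prod>v\<in>insert w K. (t(w := s)) v ^ \<beta> v)" using insert.hyps by simp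
      qed
      also have "\<dots> = 0" using t that insert.hyps by (intro insert.prems(3)) auto
      finally show ?thesis .
    qed
    then have "{0<..} \<subseteq> {s. (\<Sum>m\<le>N. d m * s ^ m) = 0}" by auto
    moreover have "infinite {0::real<..}" by (rule infinite_Ioi)
    ultimately have "infinite {s. (\<Sum>m\<le>N. d m * s ^ m) = 0}" using finite_subset by blast
    then have "d (\<alpha> w) = 0" using polyfun_finite_roots[of d N] N insert.prems(4) by auto
    then show "(\<Sum>\<beta> | \<beta> \<in> S \<and> \<beta> w = \<alpha> w. c \<beta> * (\<Prod>v\<in>K. t v ^ \<beta> v)) = 0" by (simp add: d_def)
  qed (use insert.prems in auto)
qed

text \<open>\<open>a v + g v \<bullet> x\<close> is the barycentric coordinate of the vertex
  \<open>v\<close>, extended to the whole space. Hence \<open>g v\<close> is its gradient, a normal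
  of the facet opposite \<open>v\<close>.\<close>

locale barycentric =
  fixes C :: "('n::{finite,wellorder}) euc set" and a :: "'n euc \<Rightarrow> real" and g :: "'n euc \<Rightarrow> 'n euc"
  assumes indep: "\<not> affine_dependent C" and card_C: "card C = Suc CARD('n)"
    and vertex: "\<And>v w. v \<in> C \<Longrightarrow> w \<in> C \<Longrightarrow> a v + g v \<bullet> w = (if v = w then 1 else 0)"
begin

definition lam :: "'n euc \<Rightarrow> 'n euc \<Rightarrow> real" where
  "lam v x = a v + g v \<bullet> x"

lemma finite_C: "finite C"
  using indep by (rule aff_independent_finite)

lemma finite_sub: "K \<subseteq> C \<Longrightarrow> finite K"
  using finite_C finite_subset by blast

lemma lam_vertex: "v \<in> C \<Longrightarrow> w \<in> C \<Longrightarrow> lam v w = (if v = w then 1 else 0)"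
  using vertex by (simp add: lam_def)

lemma lam_comb:
  assumes "K \<subseteq> C" "sum u K = 1" "w \<in> C"
  shows "lam w (\<Sum>v\<in>K. u v *\<^sub>R v) = (if w \<in> K then u w else 0)"
proof -
  have "lam w (\<Sum>v\<in>K. u v *\<^sub>R v) = (\<Sum>v\<in>K. u v * lam w v)"
    using assms(2) by (simp add: lam_def inner_sum_right algebra_simps sum.distrib flip: sum_distrib_left)
  also have "\<dots> = (\<Sum>v\<in>K. if v = w then u w else 0)"
    using assms by (intro sum.cong) (auto simp: lam_vertex)
  finally show ?thesis using finite_sub[OF assms(1)] by simp
qed

lemma lam_affine: "s + t = 1 \<Longrightarrow> lam v (s *\<^sub>R x + t *\<^sub>R y) = s * lam v x + t * lam v y"
proof -
  assume "s + t = 1"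
  then have "a v = s * a v + t * a v" by (simp flip: distrib_right)
  then show ?thesis by (simp add: lam_def inner_add_right distrib_left)
qed

lemma barycentric: "(\<Sum>v\<in>C. lam v x) = 1" "(\<Sum>v\<in>C. lam v x *\<^sub>R v) = x"
proof -
  have "affine hull C = UNIV"
    using affine_independent_span_eq[OF indep] card_C by simp
  then have "x \<in> {y. \<exists>u. sum u C = 1 \<and> (\<Sum>v\<in>C. u v *\<^sub>R v) = y}"
    using affine_hull_finite[OF finite_C] by auto
  then obtain u where u: "sum u C = 1" "(\<Sum>v\<in>C. u v *\<^sub>R v) = x" by blast
  have "lam w x = u w" if "w \<in> C" for w using lam_comb[OF _ u(1) that] u(2) that by simp
  then show "(\<Sum>v\<in>C. lam v x) = 1" "(\<Sum>v\<in>C. lam v x *\<^sub>R v) = x" using u by simp_all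
qed

lemma hull_eq:
  assumes K: "K \<subseteq> C"
  shows "convex hull K = {x. (\<forall>v\<in>C. 0 \<le> lam v x) \<and> (\<forall>v\<in>C - K. lam v x = 0)}" (is "_ = ?R")
proof
  show "convex hull K \<subseteq> ?R"
  proof (rule hull_minimal)
    show "K \<subseteq> ?R" using K by (auto simp: lam_vertex subset_iff)
    show "convex ?R" by (auto simp: convex_def lam_affine)
  qed
  show "?R \<subseteq> convex hull K"
  proof
    fix x assume x: "x \<in> ?R"
    have "x = (\<Sum>v\<in>K. lam v x *\<^sub>R v)"
      using x K finite_C barycentric(2)[of x] by (subst sum.mono_neutral_left[of C]) auto
    moreover have "(\<Sum>v\<in>K. lam v x) = 1"
      using x K finite_C barycentric(1)[of x] by (subst sum.mono_neutral_left[of C]) auto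
    ultimately show "x \<in> convex hull K"
      using x K finite_sub[OF K] by (auto simp: convex_hull_finite intro!: exI[of _ "\<lambda>v. lam v x"])
  qed
qed

lemma grad_sum: "(\<Sum>v\<in>C. g v \<bullet> u) = 0" "(\<Sum>v\<in>C. (g v \<bullet> u) *\<^sub>R v) = u"
  using barycentric[of u] barycentric[of 0]
  by (simp_all add: lam_def sum.distrib scaleR_add_left)

text \<open>Since the numbers \<open>g v \<bullet> u\<close> sum to 0, every \<open>u\<close> is the
  sum of \<open>(g v \<bullet> u) *\<^sub>R (v - w)\<close> for a fixed \<open>w\<close> in
  \<open>K\<close>, and \<nu> annihilates the terms with \<open>v\<close> in \<open>K\<close>. So
  the normals of a face are spanned by normals of the facets containing it.\<close>

lemma normal_expand:
  assumes "K \<subseteq> C" "K \<noteq> {}" and "\<And>v w. v \<in> K \<Longrightarrow> w \<in> K \<Longrightarrow> \<nu> \<bullet> (v - w) = 0"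
  shows "\<exists>c. \<nu> = (\<Sum>v\<in>C - K. c v *\<^sub>R g v)"
proof -
  obtain w where w: "w \<in> K" using assms by auto
  have "\<nu> \<bullet> u = (\<Sum>v\<in>C - K. (\<nu> \<bullet> (v - w)) *\<^sub>R g v) \<bullet> u" for u
  proof -
    have "\<nu> \<bullet> u = \<nu> \<bullet> ((\<Sum>v\<in>C. (g v \<bullet> u) *\<^sub>R v) - (\<Sum>v\<in>C. g v \<bullet> u) *\<^sub>R w)"
      by (simp add: grad_sum)
    also have "(\<Sum>v\<in>C. (g v \<bullet> u) *\<^sub>R v) - (\<Sum>v\<in>C. g v \<bullet> u) *\<^sub>R w = (\<Sum>v\<in>C. (g v \<bullet> u) *\<^sub>R (v - w))"
      by (simp add: scaleR_diff_right sum_subtractf scaleR_sum_left)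
    also have "\<nu> \<bullet> \<dots> = (\<Sum>v\<in>C. (g v \<bullet> u) * (\<nu> \<bullet> (v - w)))"
      by (simp add: inner_sum_right)
    also have "\<dots> = (\<Sum>v\<in>C - K. (g v \<bullet> u) * (\<nu> \<bullet> (v - w)))"
      using assms finite_C w by (intro sum.mono_neutral_right) auto
    finally show ?thesis by (simp add: inner_sum_left mult.commute)
  qed
  then have "\<nu> = (\<Sum>v\<in>C - K. (\<nu> \<bullet> (v - w)) *\<^sub>R g v)"
    by (metis vector_eq_rdot)
  then show ?thesis by (rule exI[of _ "\<lambda>v. \<nu> \<bullet> (v - w)"])
qed

lemma tangent_space_hull:
  assumes K: "K \<subseteq> C" and \<nu>: "\<And>u. u \<in> tangent_space (convex hull K) \<Longrightarrow> \<nu> \<bullet> u = 0"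
    and "v \<in> K" "w \<in> K"
  shows "\<nu> \<bullet> (v - w) = 0"
  using assms hull_subset[of K convex] unfolding tangent_space_def
  by (intro \<nu>[unfolded tangent_space_def] span_base) blast

lemma tangent_space_mono: "f \<subseteq> F \<Longrightarrow> tangent_space f \<subseteq> tangent_space F"
  unfolding tangent_space_def by (intro span_mono) blast

lemma grad_normal:
  assumes K: "K \<subseteq> C" and v: "v \<in> C - K" and u: "u \<in> tangent_space (convex hull K)"
  shows "g v \<bullet> u = 0"
  using u unfolding tangent_space_def
proof (rule span_induct)
  show "subspace {u. g v \<bullet> u = 0}" by (simp add: subspace_hyperplane)
  fix u assume "u \<in> {x - y |x y. x \<in> convex hull K \<and> y \<in> convex hull K}"
  then obtain x y where "u = x - y" "x \<in> convex hull K" "y \<in> convex hull K" by auto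
  then have "u = x - y" "lam v x = 0" "lam v y = 0" using v by (auto simp: hull_eq[OF K])
  then show "g v \<bullet> u = 0" by (simp add: lam_def inner_diff_right)
qed

lemma grad_nonzero: "v \<in> C \<Longrightarrow> g v \<noteq> 0"
proof
  assume v: "v \<in> C" "g v = 0"
  have "card (C - {v}) \<noteq> 0" using v card_C finite_C by simp
  then have "C - {v} \<noteq> {}" by (metis card.empty)
  then obtain w where "w \<in> C" "w \<noteq> v" by auto
  then show False using vertex[of v v] vertex[of v w] v by simp
qed

lemma subsimplices_hull:
  "subsimplices l (convex hull C) = {convex hull K |K. K \<subseteq> C \<and> card K = Suc l}"
proof (intro equalityI subsetI)
  fix f assume "f \<in> subsimplices l (convex hull C)"
  then have f: "f face_of convex hull C" "int l simplex f" by (auto simp: subsimplices_def)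
  then obtain K where K: "K \<subseteq> C" "f = convex hull K"
    using face_of_convex_hull_affine_independent[OF indep] by auto
  have "aff_dim (convex hull K) = int (card K) - 1"
    unfolding aff_dim_convex_hull
    using aff_dim_affine_independent[OF affine_independent_subset[OF indep K(1)]] by simp
  then have "card K = Suc l" using aff_dim_simplex[OF f(2)] K by simp
  then show "f \<in> {convex hull K |K. K \<subseteq> C \<and> card K = Suc l}" using K by auto
next
  fix f assume "f \<in> {convex hull K |K. K \<subseteq> C \<and> card K = Suc l}"
  then obtain K where K: "K \<subseteq> C" "card K = Suc l" "f = convex hull K" by auto
  have "f face_of convex hull C" using face_of_convex_hull_affine_independent[OF indep] K by auto
  moreover have "int l simplex f"
    unfolding simplex_def using K indep affine_independent_subset[of C K] by auto
  ultimately show "f \<in> subsimplices l (convex hull C)" by (simp add: subsimplices_def)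
qed

section \<open>Bernstein form on a simplex and its faces\<close>

definition exponents :: "'n euc set \<Rightarrow> nat \<Rightarrow> ('n euc \<Rightarrow> nat) set" where
  "exponents K d = {\<alpha>. (\<forall>v. v \<notin> K \<longrightarrow> \<alpha> v = 0) \<and> (\<Sum>v\<in>K. \<alpha> v) = d}"

lemma finite_exponents: "finite K \<Longrightarrow> finite (exponents K d)"
proof (rule finite_subset)
  assume K: "finite K"
  show "finite {\<alpha>. \<forall>x. (x \<in> K \<longrightarrow> \<alpha> x \<in> {..d}) \<and> (x \<notin> K \<longrightarrow> \<alpha> x = 0)}"
    by (rule finite_set_of_finite_funs) (auto simp: K)
  show "exponents K d \<subseteq> {\<alpha>. \<forall>x. (x \<in> K \<longrightarrow> \<alpha> x \<in> {..d}) \<and> (x \<notin> K \<longrightarrow> \<alpha> x = 0)}"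
    using member_le_sum[of _ K] K by (auto simp: exponents_def)
qed

text \<open>Homogeneous polynomials of degree \<open>r\<close> in the barycentric coordinates, that
  is, the Bernstein form without binomial factors.\<close>

definition Bern :: "nat \<Rightarrow> ('n euc \<Rightarrow> real) set" where
  "Bern r = {p. \<exists>c. \<forall>x. p x = (\<Sum>\<alpha>\<in>exponents C r. c \<alpha> * (\<Prod>v\<in>C. lam v x ^ \<alpha> v))}"

lemma Bern_add: "p \<in> Bern r \<Longrightarrow> q \<in> Bern r \<Longrightarrow> (\<lambda>x. p x + q x) \<in> Bern r"
proof -
  assume "p \<in> Bern r" "q \<in> Bern r"
  then obtain c d where "\<forall>x. p x = (\<Sum>\<alpha>\<in>exponents C r. c \<alpha> * (\<Prod>v\<in>C. lam v x ^ \<alpha> v))"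
    "\<forall>x. q x = (\<Sum>\<alpha>\<in>exponents C r. d \<alpha> * (\<Prod>v\<in>C. lam v x ^ \<alpha> v))" by (auto simp: Bern_def)
  then show ?thesis unfolding Bern_def
    by (auto intro!: exI[of _ "\<lambda>\<alpha>. c \<alpha> + d \<alpha>"] simp: distrib_right sum.distrib)
qed

lemma Bern_scale: "p \<in> Bern r \<Longrightarrow> (\<lambda>x. b * p x) \<in> Bern r"
proof -
  assume "p \<in> Bern r"
  then obtain c where "\<forall>x. p x = (\<Sum>\<alpha>\<in>exponents C r. c \<alpha> * (\<Prod>v\<in>C. lam v x ^ \<alpha> v))"
    by (auto simp: Bern_def)
  then show ?thesis unfolding Bern_def
    by (auto intro!: exI[of _ "\<lambda>\<alpha>. b * c \<alpha>"] simp: sum_distrib_left mult.assoc)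
qed

lemma Bern_zero: "(\<lambda>x. 0) \<in> Bern r"
  unfolding Bern_def by (auto intro!: exI[of _ "\<lambda>_. 0"])

lemma Bern_sum: "(\<And>i. i \<in> I \<Longrightarrow> p i \<in> Bern r) \<Longrightarrow> (\<lambda>x. \<Sum>i\<in>I. p i x) \<in> Bern r"
  by (induction I rule: infinite_finite_induct) (auto simp: Bern_zero Bern_add)

lemma Bern_monomial:
  assumes "\<alpha> \<in> exponents C r"
  shows "(\<lambda>x. \<Prod>v\<in>C. lam v x ^ \<alpha> v) \<in> Bern r"
  unfolding Bern_def
proof (intro CollectI exI[of _ "\<lambda>\<beta>. if \<beta> = \<alpha> then 1 else 0"] allI)
  fix x
  have "(\<Sum>\<beta>\<in>exponents C r. (if \<beta> = \<alpha> then 1 else 0) * (\<Prod>v\<in>C. lam v x ^ \<beta> v)) =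
      (\<Sum>\<beta>\<in>exponents C r. if \<beta> = \<alpha> then (\<Prod>v\<in>C. lam v x ^ \<alpha> v) else 0)"
    by (intro sum.cong) auto
  then show "(\<Prod>v\<in>C. lam v x ^ \<alpha> v) =
      (\<Sum>\<beta>\<in>exponents C r. (if \<beta> = \<alpha> then 1 else 0) * (\<Prod>v\<in>C. lam v x ^ \<beta> v))"
    using assms finite_exponents[OF finite_C] by simp
qed

lemma Bern_mult_lam:
  assumes "p \<in> Bern r" "w \<in> C"
  shows "(\<lambda>x. lam w x * p x) \<in> Bern (Suc r)"
proof -
  obtain c where c: "\<And>x. p x = (\<Sum>\<alpha>\<in>exponents C r. c \<alpha> * (\<Prod>v\<in>C. lam v x ^ \<alpha> v))"
    using assms by (auto simp: Bern_def)
  have up: "(\<lambda>x. \<Prod>v\<in>C. lam v x ^ (\<alpha>(w := Suc (\<alpha> w))) v) \<in> Bern (Suc r)" if "\<alpha> \<in> exponents C r" for \<alpha>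
    using that assms(2) finite_C
    by (intro Bern_monomial) (auto simp: exponents_def sum.remove[of C w])
  have eq: "(\<Prod>v\<in>C. lam v x ^ (\<alpha>(w := Suc (\<alpha> w))) v) = lam w x * (\<Prod>v\<in>C. lam v x ^ \<alpha> v)" for \<alpha> x
    using assms(2) finite_C by (simp add: prod.remove[of C w])
  have "(\<lambda>x. \<Sum>\<alpha>\<in>exponents C r. c \<alpha> * (\<Prod>v\<in>C. lam v x ^ (\<alpha>(w := Suc (\<alpha> w))) v)) \<in> Bern (Suc r)"
    by (intro Bern_sum Bern_scale up)
  then show ?thesis unfolding eq c by (simp add: sum_distrib_left mult_ac)
qed

lemma Bern_mult_coord:
  assumes "p \<in> Bern r"
  shows "(\<lambda>x. x $ i * p x) \<in> Bern (Suc r)"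
proof -
  have coord: "x $ i = (\<Sum>v\<in>C. lam v x * v $ i)" for x
    using arg_cong[OF barycentric(2), of "\<lambda>y. y $ i" x] by simp
  have "x $ i * p x = (\<Sum>v\<in>C. v $ i * (lam v x * p x))" for x
    by (subst coord) (simp add: sum_distrib_left sum_distrib_right mult_ac)
  moreover have "(\<lambda>x. \<Sum>v\<in>C. v $ i * (lam v x * p x)) \<in> Bern (Suc r)"
    by (intro Bern_sum Bern_scale Bern_mult_lam assms)
  ultimately show ?thesis by presburger
qed

text \<open>Degree elevation: multiply by the sum of the barycentric coordinates, which is
  1.\<close>

lemma Bern_mono:
  assumes "p \<in> Bern r" "r \<le> s"
  shows "p \<in> Bern s"
  using assms(2)
proof (induction s rule: dec_induct)
  case base
  show ?case by (rule assms)
next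
  case (step s)
  then have "(\<lambda>x. \<Sum>v\<in>C. lam v x * p x) \<in> Bern (Suc s)" by (intro Bern_sum Bern_mult_lam)
  then show ?case by (simp add: barycentric(1) flip: sum_distrib_right)
qed

text \<open>A Cartesian coordinate is a linear combination of barycentric ones, so a monomial is
  homogeneous of its own degree and is then elevated to degree \<open>r\<close>.\<close>

lemma Pol_Bern:
  assumes "p \<in> Pol (int r)"
  shows "p \<in> Bern r"
  using assms
proof (rule Pol_cases)
  fix \<alpha> :: "'n \<Rightarrow> nat" assume \<alpha>: "int (\<Sum>i\<in>UNIV. \<alpha> i) \<le> int r"
  have power: "(\<lambda>x. x $ i ^ m * p x) \<in> Bern (m + d)" if "p \<in> Bern d" for i m d p
    by (induction m) (use that Bern_mult_coord in \<open>auto simp: mult.assoc\<close>)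
  have mon: "(\<lambda>x. \<Prod>i\<in>I. x $ i ^ \<alpha> i) \<in> Bern (\<Sum>i\<in>I. \<alpha> i)" if "finite I" for I
    using that
  proof (induction I rule: finite_induct)
    case empty
    then show ?case using Bern_monomial[of "\<lambda>_. 0" 0] by (simp add: exponents_def)
  next
    case (insert i I)
    then show ?case using power[OF insert.IH, of i "\<alpha> i"] by simp
  qed
  have "(\<Sum>i\<in>UNIV. \<alpha> i) \<le> r" using \<alpha> by (simp only: of_nat_le_iff)
  then show "(\<lambda>x. \<Prod>i\<in>UNIV. x $ i ^ \<alpha> i) \<in> Bern r" by (rule Bern_mono[OF mon[OF finite]])
qed (auto intro: Bern_add Bern_scale Bern_zero)

text \<open>A monomial containing the coordinate of a vertex outside \<open>K\<close> vanishes on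
  the face; the remaining ones have their exponents supported in \<open>K\<close>.\<close>

lemma Bern_on_face:
  assumes K: "K \<subseteq> C" and x: "x \<in> convex hull K"
  shows "(\<Sum>\<alpha>\<in>exponents C r. c \<alpha> * (\<Prod>v\<in>C. lam v x ^ \<alpha> v)) =
    (\<Sum>\<alpha>\<in>exponents K r. c \<alpha> * (\<Prod>v\<in>K. lam v x ^ \<alpha> v))"
proof -
  have sub: "exponents K r \<subseteq> exponents C r"
  proof
    fix \<alpha> assume \<alpha>: "\<alpha> \<in> exponents K r"
    then have "(\<Sum>v\<in>C. \<alpha> v) = (\<Sum>v\<in>K. \<alpha> v)"
      using K finite_C by (intro sum.mono_neutral_right) (auto simp: exponents_def)
    then show "\<alpha> \<in> exponents C r" using \<alpha> K by (auto simp: exponents_def)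
  qed
  have zero: "(\<Prod>v\<in>C. lam v x ^ \<alpha> v) = 0" if \<alpha>: "\<alpha> \<in> exponents C r - exponents K r" for \<alpha>
  proof -
    have "\<exists>v\<in>C - K. \<alpha> v \<noteq> 0"
    proof (rule ccontr)
      assume *: "\<not> (\<exists>v\<in>C - K. \<alpha> v \<noteq> 0)"
      then have "(\<Sum>v\<in>C. \<alpha> v) = (\<Sum>v\<in>K. \<alpha> v)"
        using K finite_C by (intro sum.mono_neutral_right) auto
      moreover have "\<alpha> v = 0" if "v \<notin> K" for v
        using that \<alpha> * by (cases "v \<in> C") (auto simp: exponents_def)
      ultimately show False using \<alpha> by (auto simp: exponents_def)
    qed
    then obtain v where "v \<in> C - K" "\<alpha> v \<noteq> 0" by auto
    then show ?thesis using x finite_C by (intro prod_zero) (auto simp: hull_eq[OF K])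
  qed
  have "(\<Sum>\<alpha>\<in>exponents C r. c \<alpha> * (\<Prod>v\<in>C. lam v x ^ \<alpha> v)) =
      (\<Sum>\<alpha>\<in>exponents K r. c \<alpha> * (\<Prod>v\<in>C. lam v x ^ \<alpha> v))"
    using sub zero finite_exponents[OF finite_C] by (intro sum.mono_neutral_right) auto
  also have "\<dots> = (\<Sum>\<alpha>\<in>exponents K r. c \<alpha> * (\<Prod>v\<in>K. lam v x ^ \<alpha> v))"
    using K finite_C by (intro sum.cong refl arg_cong2[where f = "(*)"] prod.mono_neutral_right)
      (auto simp: exponents_def)
  finally show ?thesis .
qed

text \<open>Homogeneity extends the vanishing from the face to all positive arguments: divide
  \<open>t\<close> by its sum \<open>s\<close> to get the coordinates of a point of the face, and
  take out the factor \<open>s ^ r\<close>.\<close>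

lemma Bern_unique:
  assumes K: "K \<subseteq> C" "K \<noteq> {}"
    and zero: "\<And>x. x \<in> convex hull K \<Longrightarrow> (\<Sum>\<alpha>\<in>exponents K r. c \<alpha> * (\<Prod>v\<in>K. lam v x ^ \<alpha> v)) = 0"
    and "\<alpha> \<in> exponents K r"
  shows "c \<alpha> = 0"
proof (rule positive_polynomial_zero[of K "exponents K r"])
  show "finite K" "finite (exponents K r)" using finite_sub[OF K(1)] finite_exponents by auto
  show "\<beta> = \<gamma>" if "\<beta> \<in> exponents K r" "\<gamma> \<in> exponents K r" "\<forall>v\<in>K. \<beta> v = \<gamma> v" for \<beta> \<gamma>
  proof
    fix v show "\<beta> v = \<gamma> v" using that by (cases "v \<in> K") (auto simp: exponents_def)
  qed
  fix t :: "'n euc \<Rightarrow> real" assume t: "\<forall>v\<in>K. 0 < t v"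
  define s where "s = sum t K"
  have s: "0 < s" unfolding s_def using t K finite_sub by (intro sum_pos) auto
  define x where "x = (\<Sum>v\<in>K. (t v / s) *\<^sub>R v)"
  have u1: "(\<Sum>v\<in>K. t v / s) = 1" using s by (simp add: s_def flip: sum_divide_distrib)
  have lam: "lam w x = (if w \<in> K then t w / s else 0)" if "w \<in> C" for w
    unfolding x_def by (rule lam_comb[OF K(1) u1 that])
  then have "x \<in> convex hull K" using t s K by (auto simp: hull_eq[OF K(1)] less_imp_le)
  from zero[OF this] have "0 = s ^ r * (\<Sum>\<alpha>\<in>exponents K r. c \<alpha> * (\<Prod>v\<in>K. lam v x ^ \<alpha> v))" by simp
  also have "\<dots> = (\<Sum>\<alpha>\<in>exponents K r. c \<alpha> * (\<Prod>v\<in>K. t v ^ \<alpha> v))"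
    unfolding sum_distrib_left
  proof (intro sum.cong refl)
    fix \<alpha> assume \<alpha>: "\<alpha> \<in> exponents K r"
    have "(\<Prod>v\<in>K. lam v x ^ \<alpha> v) = (\<Prod>v\<in>K. t v ^ \<alpha> v / s ^ \<alpha> v)"
      using lam K by (intro prod.cong) (auto simp: power_divide)
    also have "\<dots> = (\<Prod>v\<in>K. t v ^ \<alpha> v) / s ^ r"
      using \<alpha> by (simp add: prod_dividef exponents_def flip: power_sum)
    finally show "s ^ r * (c \<alpha> * (\<Prod>v\<in>K. lam v x ^ \<alpha> v)) = c \<alpha> * (\<Prod>v\<in>K. t v ^ \<alpha> v)"
      using s by simp
  qed
  finally show "(\<Sum>\<alpha>\<in>exponents K r. c \<alpha> * (\<Prod>v\<in>K. t v ^ \<alpha> v)) = 0" by simp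
qed (rule assms)

section \<open>Face bubble functions\<close>

definition bubble :: "'n euc set \<Rightarrow> 'n euc \<Rightarrow> real" where
  "bubble K x = (\<Prod>v\<in>K. lam v x)"

text \<open>In Bernstein form, vanishing on the facet opposite \<open>v\<close> kills all terms without the factor
  \<open>lam v\<close>.\<close>
lemma bubble_factor:
  assumes K: "K \<subseteq> C" "K \<noteq> {}" and r: "1 \<le> r"
    and p: "p \<in> PP (int r) (convex hull K)"
    and zero: "\<And>v x. v \<in> K \<Longrightarrow> x \<in> convex hull (K - {v}) \<Longrightarrow> p x = 0"
  shows "\<exists>q\<in>PP (int r - int (card K)) (convex hull K). \<forall>x\<in>convex hull K. p x = bubble K x * q x"
proof -
  obtain P where P: "P \<in> Pol (int r)" "p = (\<lambda>x. if x \<in> convex hull K then P x else 0)"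
    using p by (auto simp: PP_iff)
  obtain c where c: "\<And>x. P x = (\<Sum>\<alpha>\<in>exponents C r. c \<alpha> * (\<Prod>v\<in>C. lam v x ^ \<alpha> v))"
    using Pol_Bern[OF P(1)] by (auto simp: Bern_def)
  have c0: "c \<alpha> = 0" if \<alpha>: "\<alpha> \<in> exponents K r" and v: "v \<in> K" "\<alpha> v = 0" for \<alpha> v
  proof (rule Bern_unique[of "K - {v}"])
    show "K - {v} \<subseteq> C" using K by auto
    have sum: "(\<Sum>u\<in>K - {v}. \<alpha> u) = r"
      using \<alpha> v finite_sub[OF K(1)] sum.remove[of K v \<alpha>] by (simp add: exponents_def)
    \<comment> \<open>Exponents on the empty set sum to 0, but here they sum to \<open>r\<close>,
      which is at least 1.\<close>
    then show "K - {v} \<noteq> {}" using r by (metis not_one_le_zero sum.empty)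
    show "\<alpha> \<in> exponents (K - {v}) r" using \<alpha> v sum by (auto simp: exponents_def)
    fix x assume x: "x \<in> convex hull (K - {v})"
    moreover have "x \<in> convex hull K" using x hull_mono[of "K - {v}" K convex] by auto
    ultimately have "P x = 0" using zero[OF v(1), of x] P(2) by simp
    then show "(\<Sum>\<alpha>\<in>exponents (K - {v}) r. c \<alpha> * (\<Prod>v\<in>K - {v}. lam v x ^ \<alpha> v)) = 0"
      using Bern_on_face[OF _ x, where r = r and c = c] K c by auto
  qed
  \<comment> \<open>These monomials contain each coordinate at least once, so one factor per vertex
    can be taken out. If \<open>r\<close> is smaller than \<open>card K\<close>, then
    \<open>S\<close> is empty and the quotient is 0, in accordance with the negative degree.\<close>
  define S where "S = {\<alpha> \<in> exponents K r. \<forall>v\<in>K. 1 \<le> \<alpha> v}"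
  define Q where "Q = (\<lambda>x. \<Sum>\<alpha>\<in>S. c \<alpha> * (\<Prod>v\<in>K. (a v + g v \<bullet> x) ^ (\<alpha> v - 1)))"
  have "Q \<in> Pol (int r - int (card K))"
    unfolding Q_def
  proof (intro Pol_sum Pol_scale)
    fix \<alpha> assume "\<alpha> \<in> S"
    then have "(\<Sum>v\<in>K. \<alpha> v) = r" "\<And>v. v \<in> K \<Longrightarrow> 1 \<le> \<alpha> v" by (auto simp: S_def exponents_def)
    then have "(\<Sum>v\<in>K. \<alpha> v - 1 + 1) = r"
      using sum.cong[OF refl, of K "\<lambda>v. \<alpha> v - 1 + 1" \<alpha>] by (metis le_add_diff_inverse2)
    then have "(\<Sum>v\<in>K. \<alpha> v - 1) + card K = r" by (simp only: sum.distrib sum_constant) simp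
    then have "int (\<Sum>v\<in>K. \<alpha> v - 1) = int r - int (card K)" by linarith
    then show "(\<lambda>x. \<Prod>v\<in>K. (a v + g v \<bullet> x) ^ (\<alpha> v - 1)) \<in> Pol (int r - int (card K))"
      using Pol_mult_affine_prod[OF finite_sub[OF K(1)] Pol_const[of 0 1], of a g "\<lambda>v. \<alpha> v - 1"]
      by simp
  qed
  then have "(\<lambda>x. if x \<in> convex hull K then Q x else 0) \<in> PP (int r - int (card K)) (convex hull K)"
    by (rule PP_I)
  moreover have "p x = bubble K x * Q x" if x: "x \<in> convex hull K" for x
  proof -
    have "p x = (\<Sum>\<alpha>\<in>exponents K r. c \<alpha> * (\<Prod>v\<in>K. lam v x ^ \<alpha> v))"
      using P(2) x c Bern_on_face[OF K(1) x, where r = r and c = c] by simp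
    also have "\<dots> = (\<Sum>\<alpha>\<in>S. c \<alpha> * (\<Prod>v\<in>K. lam v x ^ \<alpha> v))"
      using finite_exponents[OF finite_sub[OF K(1)]] c0
      by (intro sum.mono_neutral_right) (auto simp: S_def Suc_le_eq)
    also have "\<dots> = bubble K x * Q x"
      unfolding Q_def sum_distrib_left
    proof (intro sum.cong refl)
      fix \<alpha> assume \<alpha>: "\<alpha> \<in> S"
      have "(\<Prod>v\<in>K. lam v x ^ \<alpha> v) = (\<Prod>v\<in>K. lam v x * lam v x ^ (\<alpha> v - 1))"
      proof (intro prod.cong refl)
        fix v assume "v \<in> K"
        then have "\<alpha> v = Suc (\<alpha> v - 1)" using \<alpha> by (auto simp: S_def)
        then show "lam v x ^ \<alpha> v = lam v x * lam v x ^ (\<alpha> v - 1)" by (metis power_Suc)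
      qed
      then show "c \<alpha> * (\<Prod>v\<in>K. lam v x ^ \<alpha> v) =
          bubble K x * (c \<alpha> * (\<Prod>v\<in>K. (a v + g v \<bullet> x) ^ (\<alpha> v - 1)))"
        by (simp add: bubble_def prod.distrib lam_def)
    qed
    finally show ?thesis .
  qed
  ultimately show ?thesis by (intro bexI) auto
qed

lemma bubble_mult_Pol:
  assumes "finite K" "q \<in> Pol d"
  shows "(\<lambda>x. bubble K x * q x) \<in> Pol (d + int (card K))"
  using Pol_mult_affine_prod[OF assms, of a g "\<lambda>_. 1"] by (simp add: bubble_def lam_def)

lemma bubble_zero_on_face:
  assumes "K \<subseteq> C" "L \<subseteq> C" "\<not> K \<subseteq> L" "x \<in> convex hull L"
  shows "bubble K x = 0"
  using assms finite_sub[OF assms(1)] unfolding bubble_def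
  by (intro prod_zero) (auto simp: hull_eq[OF assms(2)])

lemma bubble_nonneg: "K \<subseteq> C \<Longrightarrow> L \<subseteq> C \<Longrightarrow> x \<in> convex hull L \<Longrightarrow> 0 \<le> bubble K x"
  unfolding bubble_def by (intro prod_nonneg) (auto simp: hull_eq)

text \<open>Move towards the barycenter, which makes all barycentric coordinates positive.\<close>
lemma zero_by_density:
  assumes K: "K \<subseteq> C" "K \<noteq> {}" and q: "continuous_on UNIV q"
    and zero: "\<And>x. x \<in> convex hull K \<Longrightarrow> bubble K x * q x = 0"
    and x: "x \<in> convex hull K"
  shows "q x = 0"
proof -
  have finK: "finite K" and cK: "0 < card K" using finite_sub[OF K(1)] K(2) by (auto simp: card_gt_0_iff)
  define b where "b = (\<Sum>v\<in>K. (1 / real (card K)) *\<^sub>R v)"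
  have lb: "lam w b = (if w \<in> K then 1 / real (card K) else 0)" if "w \<in> C" for w
    unfolding b_def using cK by (intro lam_comb[OF K(1) _ that]) simp
  define h where "h t = q ((1 - t) *\<^sub>R x + t *\<^sub>R b)" for t
  have h0: "h t = 0" if t: "0 < t" "t < 1" for t
  proof -
    let ?y = "(1 - t) *\<^sub>R x + t *\<^sub>R b"
    have ly: "lam w ?y = (1 - t) * lam w x + t * lam w b" for w by (rule lam_affine) simp
    have pos: "0 < lam w ?y" if "w \<in> K" for w
      using that x t K cK unfolding ly by (intro add_nonneg_pos) (auto simp: lb hull_eq[OF K(1)])
    moreover have "lam w ?y = 0" if "w \<in> C - K" for w
      using that x unfolding ly by (auto simp: lb hull_eq[OF K(1)])
    ultimately have "?y \<in> convex hull K" using K by (auto simp: hull_eq[OF K(1)]) (metis DiffI less_eq_real_def)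
    moreover have "bubble K ?y \<noteq> 0" using pos finK by (simp add: bubble_def) (metis less_irrefl)
    ultimately show ?thesis using zero[of ?y] by (simp add: h_def)
  qed
  have "continuous_on UNIV h" unfolding h_def
    by (intro continuous_on_compose2[OF q] continuous_intros) auto
  then have "(h \<longlongrightarrow> h 0) (at_right 0)"
    by (intro tendsto_mono[OF at_le[of "{0<..}" UNIV]])
      (simp_all add: continuous_on_eq_continuous_at isCont_def)
  moreover have "(h \<longlongrightarrow> 0) (at_right 0)"
    by (rule tendsto_eventually) (use h0 in \<open>auto simp: eventually_at_right[of 0 1] intro!: exI[of _ 1]\<close>)
  ultimately have "h 0 = 0" by (rule tendsto_unique[rotated 1]) simp_all
  then show ?thesis by (simp add: h_def)
qed

end

text \<open>The edges from \<open>v\<close> are independent, so some linear \<open>l\<close> equals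
  -1 on all of them; then \<open>1 + l (x - v)\<close> is 1 at \<open>v\<close> and 0 at the other
  vertices.\<close>

lemma barycentric_exists:
  fixes T :: "('n::{finite,wellorder}) euc set"
  assumes "int CARD('n) simplex T"
  obtains C a g where "barycentric C a g" "T = convex hull C"
proof -
  obtain C where C: "\<not> affine_dependent C" "int (card C) = int CARD('n) + 1" "T = convex hull C"
    using assms by (auto simp: simplex_def)
  have "\<exists>a g. \<forall>w\<in>C. a + g \<bullet> w = (if v = w then 1 else (0::real))" if v: "v \<in> C" for v
  proof -
    have "independent ((\<lambda>x. x - v) ` (C - {v}))"
      using affine_dependent_iff_dependent2[OF v] C(1)
      by (simp add: image_def)
    then obtain l :: "'n euc \<Rightarrow> real" where l: "linear l" "\<forall>x\<in>(\<lambda>x. x - v) ` (C - {v}). l x = - 1"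
      using linear_independent_extend[of _ "\<lambda>_. - 1"] by metis
    obtain u where u: "\<And>x. l x = u \<bullet> x"
      using l(1) by (metis inner_commute adjoint_works inner_real_def mult.left_neutral)
    show ?thesis
    proof (intro exI ballI)
      fix w assume "w \<in> C"
      then show "(1 - u \<bullet> v) + u \<bullet> w = (if v = w then 1 else 0)"
        using bspec[OF l(2), of "w - v"] u by (cases "v = w") (auto simp: inner_diff_right)
    qed
  qed
  then obtain a g where ag: "\<And>v w. v \<in> C \<Longrightarrow> w \<in> C \<Longrightarrow> a v + g v \<bullet> w = (if v = w then 1 else (0::real))"
    by metis
  have "barycentric C a g" by standard (use C ag in auto)
  then show ?thesis using that C(3) by blast
qed

section \<open>Measures of full support\<close>

text \<open>What the face measures and Lebesgue measure on a cell have in common: continuous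
  functions are integrable, and a nonnegative one with zero integral vanishes on \<open>f\<close>.
  Measurability of the identity covers both sigma-algebras.\<close>

definition full_support :: "('a::metric_space) measure \<Rightarrow> 'a set \<Rightarrow> bool" where
  "full_support \<mu> f \<longleftrightarrow> space \<mu> = f \<and> finite_measure \<mu> \<and> (\<lambda>x. x) \<in> borel_measurable \<mu> \<and>
     (\<forall>x\<in>f. \<forall>e>0. emeasure \<mu> (ball x e \<inter> f) \<noteq> 0)"

lemma full_support_measurable:
  assumes "full_support \<mu> f" "continuous_on UNIV q"
  shows "q \<in> borel_measurable \<mu>"
proof -
  have "(\<lambda>x. x) \<in> borel_measurable \<mu>" using assms(1) by (simp add: full_support_def)
  from measurable_compose[OF this borel_measurable_continuous_onI[OF assms(2)]] show ?thesis by simp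
qed

lemma full_support_integrable:
  fixes q :: "'a::metric_space \<Rightarrow> real"
  assumes \<mu>: "full_support \<mu> f" and f: "compact f" and q: "continuous_on UNIV q"
  shows "integrable \<mu> q"
proof -
  interpret finite_measure \<mu> using \<mu> by (simp add: full_support_def)
  have "bounded (q ` f)"
    using q f by (meson compact_continuous_image compact_imp_bounded continuous_on_subset subset_UNIV)
  then obtain B where "\<And>x. x \<in> f \<Longrightarrow> norm (q x) \<le> B" by (auto simp: bounded_iff)
  then show ?thesis
    using \<mu> full_support_measurable[OF \<mu> q]
    by (intro integrable_const_bound[of _ B]) (auto simp: full_support_def)
qed

lemma full_support_zero:
  fixes q :: "'a::metric_space \<Rightarrow> real"
  assumes \<mu>: "full_support \<mu> f" and f: "compact f" and q: "continuous_on UNIV q"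
    and nonneg: "\<And>x. x \<in> f \<Longrightarrow> 0 \<le> q x" and zero: "integral\<^sup>L \<mu> q = 0" and x: "x \<in> f"
  shows "q x = 0"
proof (rule ccontr)
  assume "q x \<noteq> 0"
  then have pos: "0 < q x" using nonneg[OF x] by simp
  have sp: "space \<mu> = f" using \<mu> by (simp add: full_support_def)
  have "open {x. 0 < q x}" using q by (intro open_Collect_less) auto
  then obtain e where e: "0 < e" "ball x e \<subseteq> {x. 0 < q x}"
    using pos open_contains_ball by (metis mem_Collect_eq)
  have AE: "AE x in \<mu>. q x = 0"
    using integral_nonneg_eq_0_iff_AE[OF full_support_integrable[OF \<mu> f q]] nonneg sp zero by auto
  have [measurable]: "q \<in> borel_measurable \<mu>" by (rule full_support_measurable[OF \<mu> q])
  have S: "{x \<in> space \<mu>. \<not> q x = 0} \<in> sets \<mu>" by measurable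
  then have "emeasure \<mu> {x \<in> space \<mu>. \<not> q x = 0} = 0" using AE AE_iff_measurable[OF S refl] by blast
  moreover have "emeasure \<mu> (ball x e \<inter> f) \<le> emeasure \<mu> {x \<in> space \<mu>. \<not> q x = 0}"
    using e(2) sp by (intro emeasure_mono[OF _ S]) force
  ultimately have "emeasure \<mu> (ball x e \<inter> f) = 0" by (metis le_zero_eq)
  then show False using \<mu> x e(1) unfolding full_support_def by blast
qed

lemma tangent_space_affine_hull:
  assumes "p \<in> f" "u \<in> tangent_space f"
  shows "p + u \<in> affine hull f"
proof -
  let ?W = "(\<lambda>x. - p + x) ` (affine hull f)"
  have W: "subspace ?W" using assms(1) by (intro affine_diffs_subspace) (auto simp: hull_inc)
  have "{x - y |x y. x \<in> f \<and> y \<in> f} \<subseteq> ?W"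
  proof
    fix v assume "v \<in> {x - y |x y. x \<in> f \<and> y \<in> f}"
    then obtain x y where v: "v = (- p + x) - (- p + y)" "x \<in> f" "y \<in> f" by auto
    then show "v \<in> ?W" unfolding v(1) by (intro subspace_diff[OF W] imageI hull_inc)
  qed
  then have "u \<in> ?W" using assms(2) span_minimal[OF _ W] unfolding tangent_space_def by blast
  then show ?thesis by auto
qed

text \<open>Pull back along the isometric chart \<phi>. Inner products with the frame recover the
  chart coordinates, so the bounded face has its preimage in a cube, and a small cube around a
  relatively interior point is mapped into a given ball and the face.\<close>

lemma full_support_face_measure:
  fixes f :: "('n::{finite,wellorder}) euc set"
  assumes f: "int l simplex f"
  shows "full_support (face_measure l f) f"
proof -
  define pb where "pb = (SOME pb. orthonormal_frame l f pb)"
  obtain p b where pb_eq: "pb = (p, b)" by (cases pb)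
  have "orthonormal_frame l f pb"
    unfolding pb_def using orthonormal_frame_exists[OF f] by (rule someI_ex)
  then have p: "p \<in> f" and ortho: "\<And>i j. i < l \<Longrightarrow> j < l \<Longrightarrow> b i \<bullet> b j = (if i = j then 1 else 0)"
    and span: "span (b ` {..<l}) = tangent_space f"
    by (auto simp: orthonormal_frame_def pb_eq)
  define M where "M = Pi\<^sub>M {..<l} (\<lambda>_. lborel :: real measure)"
  define \<phi> where "\<phi> = (\<lambda>c. p + (\<Sum>i<l. c i *\<^sub>R b i))"
  have fm: "face_measure l f = restrict_space (distr M borel \<phi>) f"
    unfolding face_measure_def pb_def[symmetric] by (simp add: pb_eq M_def \<phi>_def)
  have \<phi>: "\<phi> \<in> borel_measurable M" unfolding \<phi>_def M_def by measurable
  have comp: "compact f" and conv: "convex f" using f compact_simplex convex_simplex by auto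
  have fb: "f \<in> sets borel" using comp by (simp add: compact_imp_closed borel_closed)
  have em: "emeasure (face_measure l f) A = emeasure M (\<phi> -` A \<inter> space M)" if "A \<subseteq> f" "A \<in> sets borel" for A
    unfolding fm using that \<phi> fb by (subst emeasure_restrict_space) (auto simp: emeasure_distr)
  interpret product_sigma_finite "\<lambda>_::nat. lborel :: real measure" by standard
  have coord: "(\<phi> c - p) \<bullet> b i = c i" if "i < l" for c i
  proof -
    have "(\<phi> c - p) \<bullet> b i = (\<Sum>j<l. c j * (b j \<bullet> b i))" by (simp add: \<phi>_def inner_sum_left)
    also have "\<dots> = (\<Sum>j<l. if j = i then c i else 0)"
      using that by (intro sum.cong) (auto simp: ortho)
    finally show ?thesis using that by simp
  qed
  obtain R where R: "\<And>x. x \<in> f \<Longrightarrow> norm (x - p) \<le> R"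
  proof -
    have "bounded ((\<lambda>x. x - p) ` f)" using comp compact_imp_bounded bounded_translation_minus by blast
    then show ?thesis using that by (auto simp: bounded_iff)
  qed
  have "\<phi> -` f \<inter> space M \<subseteq> Pi\<^sub>E {..<l} (\<lambda>_. {- R..R})"
  proof
    fix c assume c: "c \<in> \<phi> -` f \<inter> space M"
    have "\<bar>c i\<bar> \<le> R" if "i < l" for i
    proof -
      have "\<bar>(\<phi> c - p) \<bullet> b i\<bar> \<le> norm (\<phi> c - p) * norm (b i)" by (rule Cauchy_Schwarz_ineq2)
      also have "norm (b i) = 1" using ortho[OF that that] by (simp add: norm_eq_1)
      finally show ?thesis using coord[OF that] R[of "\<phi> c"] c by auto
    qed
    then show "c \<in> Pi\<^sub>E {..<l} (\<lambda>_. {- R..R})"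
      using c by (auto simp: M_def space_PiM PiE_iff abs_le_iff) (smt (verit))+
  qed
  then have "emeasure M (\<phi> -` f \<inter> space M) \<le> emeasure M (Pi\<^sub>E {..<l} (\<lambda>_. {- R..R}))"
    by (intro emeasure_mono) (auto simp: M_def intro!: sets_PiM_I_finite)
  also have "\<dots> = (\<Prod>i<l. emeasure lborel {- R..R})"
    unfolding M_def by (rule emeasure_PiM) auto
  also have "\<dots> < \<infinity>"
    by (simp add: emeasure_lborel_Icc_eq power_less_top_ennreal)
  finally have "emeasure M (\<phi> -` f \<inter> space M) < \<infinity>" .
  then have fin: "finite_measure (face_measure l f)"
    using em[OF subset_refl fb] by (intro finite_measureI) (auto simp: fm space_restrict_space)
  have rep: "u = (\<Sum>i<l. (u \<bullet> b i) *\<^sub>R b i)" if "u \<in> tangent_space f" for u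
    using that unfolding span[symmetric]
  proof (rule span_induct)
    show "subspace {u. u = (\<Sum>i<l. (u \<bullet> b i) *\<^sub>R b i)}"
      unfolding subspace_def
      by (auto simp: inner_add_left scaleR_add_left sum.distrib simp flip: scaleR_scaleR scaleR_sum_right)
    fix u assume "u \<in> b ` {..<l}"
    then obtain j where j: "j < l" "u = b j" by auto
    then have "(\<Sum>i<l. (u \<bullet> b i) *\<^sub>R b i) = (\<Sum>i<l. if i = j then b j else 0)"
      by (intro sum.cong) (auto simp: ortho)
    then show "u = (\<Sum>i<l. (u \<bullet> b i) *\<^sub>R b i)" using j by simp
  qed
  have "emeasure (face_measure l f) (ball x e \<inter> f) \<noteq> 0" if x: "x \<in> f" and e: "0 < e" for x e
  proof -
    \<comment> \<open>Around \<open>x\<close> itself a cube may leave the face, so a relatively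
      interior point near \<open>x\<close> is used.\<close>
    have "x \<in> closure (rel_interior f)"
      using x convex_closure_rel_interior[OF conv] closure_subset by blast
    then obtain y where y: "y \<in> rel_interior f" "dist y x < e" using e by (auto simp: closure_approachable)
    then obtain d where d: "0 < d" "ball y d \<inter> affine hull f \<subseteq> f" "y \<in> f"
      by (auto simp: rel_interior_ball)
    \<comment> \<open>The \<open>l\<close> coordinate errors add up to less than the available
      radius; \<open>l + 1\<close> in place of \<open>l\<close> makes this strict and covers
      \<open>l = 0\<close>.\<close>
    define \<delta> where "\<delta> = min d (e - dist y x) / (real l + 1)"
    have \<delta>: "0 < \<delta>" using d y by (simp add: \<delta>_def)
    define c0 where "c0 i = (y - p) \<bullet> b i" for i
    define B where "B = Pi\<^sub>E {..<l} (\<lambda>i. {c0 i - \<delta><..<c0 i + \<delta>})"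
    have "y - p \<in> tangent_space f" unfolding tangent_space_def using d p by (intro span_base) auto
    then have y_eq: "y - p = (\<Sum>i<l. c0 i *\<^sub>R b i)" unfolding c0_def by (rule rep)
    have "\<phi> c \<in> ball x e \<inter> f" if c: "c \<in> B" for c
    proof -
      have "(\<Sum>i<l. c i *\<^sub>R b i) \<in> tangent_space f"
        unfolding span[symmetric] by (intro span_sum span_scale span_base) auto
      then have aff: "\<phi> c \<in> affine hull f" unfolding \<phi>_def by (rule tangent_space_affine_hull[OF p])
      have "norm (\<phi> c - y) = norm (\<Sum>i<l. (c i - c0 i) *\<^sub>R b i)"
        using y_eq by (simp add: \<phi>_def scaleR_diff_left sum_subtractf algebra_simps)
      also have "\<dots> \<le> (\<Sum>i<l. \<delta>)"
      proof (rule sum_norm_le)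
        fix i assume i: "i \<in> {..<l}"
        then have "norm (b i) = 1" using ortho[of i i] by (simp add: norm_eq_1)
        moreover have "\<bar>c i - c0 i\<bar> \<le> \<delta>" using c i by (auto simp: B_def PiE_iff abs_le_iff) force+
        ultimately show "norm ((c i - c0 i) *\<^sub>R b i) \<le> \<delta>" by simp
      qed
      also have "\<dots> < (real l + 1) * \<delta>" using \<delta> by (simp add: algebra_simps)
      also have "\<dots> = min d (e - dist y x)" by (simp add: \<delta>_def)
      finally have "dist (\<phi> c) y < min d (e - dist y x)" by (simp add: dist_norm)
      then show ?thesis
        using aff d(2) dist_triangle[of "\<phi> c" x y] by (auto simp: dist_commute subset_iff)
    qed
    moreover have "B \<subseteq> space M" by (auto simp: B_def M_def space_PiM)
    ultimately have "B \<subseteq> \<phi> -` (ball x e \<inter> f) \<inter> space M" by auto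
    moreover have "\<phi> -` (ball x e \<inter> f) \<inter> space M \<in> sets M"
      using \<phi> fb by (intro measurable_sets[OF \<phi>]) auto
    ultimately have "emeasure M B \<le> emeasure (face_measure l f) (ball x e \<inter> f)"
      using fb by (subst em) (auto intro: emeasure_mono)
    moreover have "emeasure M B = (\<Prod>i<l. emeasure lborel {c0 i - \<delta><..<c0 i + \<delta>})"
      unfolding M_def B_def by (rule emeasure_PiM) auto
    moreover have "(\<Prod>i<l. emeasure lborel {c0 i - \<delta><..<c0 i + \<delta>}) \<noteq> 0"
      using \<delta> by (simp add: prod_zero_iff)
    ultimately show ?thesis by auto
  qed
  moreover have "(\<lambda>x. x) \<in> borel_measurable (face_measure l f)"
    unfolding fm by (intro measurable_restrict_space1) simp
  ultimately show ?thesis using fin by (simp add: full_support_def fm space_restrict_space)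
qed

text \<open>With \<open>n + 1\<close> affinely independent vertices the relative interior is the
  interior, so a ball around any point of the cell meets a nonempty open part of it.\<close>

lemma (in barycentric) full_support_cell: "full_support (lebesgue_on (convex hull C)) (convex hull C)"
proof -
  let ?T = "convex hull C"
  have "compact ?T" by (rule finite_imp_compact_convex_hull[OF finite_C])
  then have lm: "?T \<in> lmeasurable" by (rule lmeasurable_compact)
  have fin: "finite_measure (lebesgue_on ?T)" using lm by (rule finite_measure_lebesgue_on)
  have "affine hull ?T = UNIV"
    using affine_independent_span_eq[OF indep] card_C by (simp add: affine_hull_convex_hull)
  then have int: "rel_interior ?T = interior ?T" by (rule rel_interior_interior)
  have "emeasure (lebesgue_on ?T) (ball x e \<inter> ?T) \<noteq> 0" if x: "x \<in> ?T" and e: "0 < e" for x e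
  proof
    assume zero: "emeasure (lebesgue_on ?T) (ball x e \<inter> ?T) = 0"
    have "x \<in> closure (interior ?T)"
      using x convex_closure_rel_interior[of ?T] closure_subset int by (metis convex_convex_hull subset_iff)
    then have ne: "ball x e \<inter> interior ?T \<noteq> {}" using e
      by (metis Int_commute closure_iff_nhds_not_empty centre_in_ball open_ball subset_refl)
    have T: "?T \<in> sets lebesgue" using lm by auto
    have "emeasure lebesgue (ball x e \<inter> interior ?T) \<le> emeasure lebesgue (ball x e \<inter> ?T)"
      using T interior_subset by (intro emeasure_mono) auto
    also have "\<dots> = 0" using zero T by (subst (asm) emeasure_restrict_space) auto
    finally have "negligible (ball x e \<inter> interior ?T)"
      by (simp add: negligible_iff_null_sets null_sets_def)
    then show False using ne open_not_negligible[of "ball x e \<inter> interior ?T"] by auto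
  qed
  moreover have "(\<lambda>x. x) \<in> borel_measurable (lebesgue_on ?T)"
    by (intro measurable_restrict_space1 measurable_completion) simp
  ultimately show ?thesis using fin by (simp add: full_support_def)
qed

section \<open>Riesz representation in finite dimensions\<close>

text \<open>Gram-Schmidt over a basis, one vector at a time. The functional varies in the induction
  because the hypothesis is also applied to \<open>B e\<close>, to project the new vector
  \<open>e\<close>. The abstract vector space admits function spaces with pointwise
  operations.\<close>

lemma (in vector_space) riesz:
  assumes V: "subspace V" "V \<subseteq> span G" "finite G"
    and B_add: "\<And>u v w. u \<in> V \<Longrightarrow> v \<in> V \<Longrightarrow> w \<in> V \<Longrightarrow> B (u + v) w = B u w + (B v w :: 'a)"
    and B_scale: "\<And>c u w. u \<in> V \<Longrightarrow> w \<in> V \<Longrightarrow> B (scale c u) w = c * B u w"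
    and B_sym: "\<And>u w. u \<in> V \<Longrightarrow> w \<in> V \<Longrightarrow> B u w = B w u"
    and B_pos: "\<And>u. u \<in> V \<Longrightarrow> B u u = 0 \<Longrightarrow> u = 0"
    and L_add: "\<And>u v. u \<in> V \<Longrightarrow> v \<in> V \<Longrightarrow> L (u + v) = L u + L v"
    and L_scale: "\<And>c u. u \<in> V \<Longrightarrow> L (scale c u) = c * L u"
  shows "\<exists>u\<in>V. \<forall>v\<in>V. B u v = L v"
proof -
  obtain b where b: "b \<subseteq> V" "independent b" "V \<subseteq> span b" using maximal_independent_subset[of V] by auto
  have "finite b" using independent_span_bound[OF V(3) b(2)] b(1) V(2) by auto
  have span_V: "span S \<subseteq> V" if "S \<subseteq> V" for S using that V(1) by (rule span_minimal)
  have "\<exists>u\<in>span S. \<forall>v\<in>span S. B u v = L v"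
    if "finite S" "S \<subseteq> V" "\<And>u v. u \<in> V \<Longrightarrow> v \<in> V \<Longrightarrow> L (u + v) = L u + L v"
      "\<And>c u. u \<in> V \<Longrightarrow> L (scale c u) = c * L u" for S L
    using that
  proof (induction S arbitrary: L rule: finite_induct)
    case empty
    have "L (scale 0 0) = 0 * L 0" "B (scale 0 0) 0 = 0 * B 0 0"
      using empty V(1) by (intro empty B_scale; simp add: subspace_0)+
    then show ?case by simp
  next
    case (insert e S)
    have e: "e \<in> V" and S: "S \<subseteq> V" "span S \<subseteq> V" using insert.prems(1) span_V by auto
    have "B e (u + v) = B e u + B e v" if "u \<in> V" "v \<in> V" for u v
      using that e B_add B_sym subspace_add[OF V(1)] by metis
    moreover have "B e (scale c u) = c * B e u" if "u \<in> V" for c u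
      using that e B_scale B_sym subspace_scale[OF V(1)] by metis
    \<comment> \<open>\<open>p\<close> is the \<open>B\<close>-orthogonal projection of
      \<open>e\<close> to the old span, and \<open>h = e - p\<close> is the new orthogonal
      direction.\<close>
    ultimately obtain p where p: "p \<in> span S" "\<forall>v\<in>span S. B p v = B e v"
      using insert.IH[of "B e"] S by blast
    obtain u where u: "u \<in> span S" "\<forall>v\<in>span S. B u v = L v"
      using insert.IH[OF S(1) insert.prems(2,3)] by blast
    define h where "h = e - p"
    have pV: "p \<in> V" and uV: "u \<in> V" using p u S by auto
    have hV: "h \<in> V" unfolding h_def using e pV V(1) by (rule subspace_diff[rotated])
    have ortho: "B h v = 0" if "v \<in> span S" for v
    proof -
      have vV: "v \<in> V" using that S by auto
      have "B e v = B (h + p) v" by (simp add: h_def)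
      then show ?thesis using B_add[OF hV pV vV] p(2) that by simp
    qed
    have split: "\<exists>c s. s \<in> span S \<and> v = s + scale c h" if v: "v \<in> span (insert e S)" for v
    proof -
      obtain c where c: "v - scale c e \<in> span S" using span_breakdown_eq[THEN iffD1, OF v] by blast
      have "v = (v - scale c e + scale c p) + scale c h" by (simp add: h_def scale_right_diff_distrib)
      moreover have "v - scale c e + scale c p \<in> span S" using c p(1) by (intro span_add span_scale)
      ultimately show ?thesis by blast
    qed
    \<comment> \<open>If \<open>B h h = 0\<close>, then \<open>h = 0\<close>: the vector
      \<open>e\<close> adds nothing and any coefficient will do.\<close>
    define c0 where "c0 = (if B h h = 0 then 0 else L h / B h h)"
    have c0: "c0 * B h h = L h"
    proof (cases "B h h = 0")
      case True
      then have "h = 0" using B_pos hV by blast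
      moreover have "L (scale 0 0) = 0 * L 0" using V(1) by (intro insert.prems(3)) (simp add: subspace_0)
      ultimately show ?thesis using True by (simp add: c0_def)
    qed (simp add: c0_def)
    define w where "w = u + scale c0 h"
    have "w \<in> span (insert e S)"
    proof -
      have "h \<in> span (insert e S)"
        unfolding h_def using p(1) span_mono[of S "insert e S"] by (intro span_diff) (auto intro: span_base)
      then show ?thesis unfolding w_def
        using u(1) span_mono[of S "insert e S"] by (intro span_add span_scale) auto
    qed
    moreover have "B w v = L v" if v: "v \<in> span (insert e S)" for v
    proof -
      obtain c s where cs: "s \<in> span S" "v = s + scale c h" using split[OF v] by blast
      have sV: "s \<in> V" and chV: "scale c h \<in> V" and c0hV: "scale c0 h \<in> V"
        using cs S hV subspace_scale[OF V(1)] by auto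
      have right: "B x v = B x s + c * B x h" if "x \<in> V" for x
      proof -
        have "B x v = B (s + scale c h) x" unfolding cs(2) using that sV chV subspace_add[OF V(1)] by (intro B_sym) auto
        also have "\<dots> = B s x + c * B h x" using that by (simp add: B_add[OF sV chV] B_scale[OF hV])
        finally show ?thesis using B_sym[OF that sV] B_sym[OF that hV] by simp
      qed
      have vV: "v \<in> V" unfolding cs(2) using sV chV subspace_add[OF V(1)] by auto
      have "B w v = B u v + c0 * B h v" unfolding w_def using uV c0hV hV vV by (simp add: B_add B_scale)
      also have "\<dots> = L s + c * B u h + c0 * (c * B h h)"
        using right[OF uV] right[OF hV] u(2) cs(1) ortho by simp
      also have "B u h = 0" using ortho[OF u(1)] B_sym[OF uV hV] by simp
      also have "L s + c * 0 + c0 * (c * B h h) = L s + c * (c0 * B h h)" by (simp add: mult_ac)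
      also have "\<dots> = L v" unfolding cs(2) c0 using insert.prems(2)[OF sV chV] insert.prems(3)[OF hV] by simp
      finally show ?thesis .
    qed
    ultimately show ?case by blast
  qed
  from this[OF \<open>finite b\<close> b(1) L_add L_scale] show ?thesis
    using span_V[OF b(1)] b(3) by blast
qed

section \<open>Fields of double forms\<close>

lemma s_map_lin:
  "s_map (\<lambda>ws vs. a * \<omega> ws vs + b * \<zeta> ws vs) = (\<lambda>ws vs. a * s_map \<omega> ws vs + b * s_map \<zeta> ws vs)"
  by (intro ext) (simp add: s_map_def sum.distrib distrib_left sum_distrib_left mult_ac)

lemma XX_lin:
  assumes "\<omega> \<in> XX k" "\<zeta> \<in> XX k"
  shows "(\<lambda>ws vs. a * \<omega> ws vs + b * \<zeta> ws vs) \<in> XX k"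
  using assms s_map_lin[of a \<omega> b \<zeta>] unfolding XX_def Alt2_iff
  by (auto intro!: Alt_add Alt_scale)

lemma XX_zero: "(\<lambda>ws vs. 0) \<in> XX k"
  by (auto simp: XX_def Alt2_iff Alt_zero s_map_def fun_eq_iff)

lemma XX_lincomb:
  "finite I \<Longrightarrow> (\<And>p. p \<in> I \<Longrightarrow> E p \<in> XX k) \<Longrightarrow> (\<lambda>ws vs. \<Sum>p\<in>I. c p * E p ws vs) \<in> XX k"
proof (induction I rule: finite_induct)
  case (insert p I)
  then show ?case using XX_lin[of "E p" k "\<lambda>ws vs. \<Sum>p\<in>I. c p * E p ws vs" "c p" 1] by simp
qed (simp add: XX_zero)

lemma PPX_lin:
  assumes "\<omega> \<in> PPX k r T" "\<zeta> \<in> PPX k r T"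
  shows "(\<lambda>x ws vs. a * \<omega> x ws vs + b * \<zeta> x ws vs) \<in> PPX k r T"
  using assms unfolding PPX_def by (auto intro!: XX_lin PP_add PP_scale)

lemma PPX_zero: "(\<lambda>x ws vs. 0) \<in> PPX k r T"
  by (simp add: PPX_def XX_zero PP_zero)

lemma PPX_restrict:
  assumes "\<omega> \<in> PPX k r T" "f \<subseteq> T"
  shows "(\<lambda>x ws vs. if x \<in> f then \<omega> x ws vs else 0) \<in> PPX k r f"
proof -
  have "(\<lambda>ws vs. if x \<in> f then \<omega> x ws vs else 0) \<in> XX k" for x
    using assms XX_zero by (cases "x \<in> f") (auto simp: PPX_def)
  then show ?thesis using PP_restrict[OF _ assms(2)] assms(1) unfolding PPX_def by fast
qed

lemma PPX_XX: "\<omega> \<in> PPX k r T \<Longrightarrow> \<omega> x \<in> XX k"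
  by (simp add: PPX_def)

lemma PPX_PP: "\<omega> \<in> PPX k r T \<Longrightarrow> (\<lambda>x. \<omega> x ws vs) \<in> PP r T"
  by (simp add: PPX_def)

lemma PPX_outside: "\<omega> \<in> PPX k r T \<Longrightarrow> x \<notin> T \<Longrightarrow> \<omega> x = (\<lambda>ws vs. 0)"
proof (intro ext)
  fix ws vs assume "\<omega> \<in> PPX k r T" "x \<notin> T"
  from PPX_PP[OF this(1), of ws vs] obtain p where "(\<lambda>x. \<omega> x ws vs) = (\<lambda>x. if x \<in> T then p x else 0)"
    by (auto simp: PP_iff)
  from fun_cong[OF this, of x] show "\<omega> x ws vs = 0" using \<open>x \<notin> T\<close> by simp
qed

lemma basis_coef_PP: "\<omega> \<in> PPX k r T \<Longrightarrow> (\<lambda>x. basis_coef z (\<omega> x) \<sigma> i) \<in> PP r T"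
  unfolding basis_coef_def by (intro PP_scale PPX_PP)

lemma basis_coef_lin:
  "basis_coef z (\<lambda>ws vs. a * \<omega> ws vs + b * \<zeta> ws vs) \<sigma> i = a * basis_coef z \<omega> \<sigma> i + b * basis_coef z \<zeta> \<sigma> i"
  by (simp add: basis_coef_def algebra_simps)

lemma basis_coef_sum:
  "basis_coef z (\<lambda>ws vs. \<Sum>p\<in>I. c p * E p ws vs) \<sigma> i = (\<Sum>p\<in>I. c p * basis_coef z (E p) \<sigma> i)"
  by (simp add: basis_coef_def sum_distrib_left mult_ac)

lemma coef_zero [simp]: "coef k (\<lambda>ws vs. 0) \<sigma> i = 0"
  by (simp add: coef_def Alt2_inner_def)

lemma Alt2_inner_lin_right:
  "Alt2_inner j m \<omega> (\<lambda>ws vs. a * \<eta> ws vs + b * \<zeta> ws vs) = a * Alt2_inner j m \<omega> \<eta> + b * Alt2_inner j m \<omega> \<zeta>"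
  by (simp add: Alt2_inner_def algebra_simps sum.distrib sum_distrib_left)

lemma Alt2_inner_sym: "Alt2_inner j m \<omega> \<eta> = Alt2_inner j m \<eta> \<omega>"
  by (simp add: Alt2_inner_def mult.commute)

lemma Alt2_inner_lin_left:
  "Alt2_inner j m (\<lambda>ws vs. a * \<eta> ws vs + b * \<zeta> ws vs) \<omega> = a * Alt2_inner j m \<eta> \<omega> + b * Alt2_inner j m \<zeta> \<omega>"
  using Alt2_inner_lin_right[of j m \<omega>] by (simp add: Alt2_inner_sym)

lemma Alt2_inner_zero [simp]: "Alt2_inner j m \<omega> (\<lambda>ws vs. 0) = 0"
  by (simp add: Alt2_inner_def)

lemma Alt2_inner_sum_right:
  "finite I \<Longrightarrow> Alt2_inner j m \<omega> (\<lambda>ws vs. \<Sum>p\<in>I. c p * \<tau> p ws vs) = (\<Sum>p\<in>I. c p * Alt2_inner j m \<omega> (\<tau> p))"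
proof (induction I rule: finite_induct)
  case (insert p I)
  then show ?case
    using Alt2_inner_lin_right[of j m \<omega> "c p" "\<tau> p" 1 "\<lambda>ws vs. \<Sum>p\<in>I. c p * \<tau> p ws vs"] by simp
qed simp

lemma Alt2_inner_self_zero:
  fixes \<omega> :: "'n::{finite,wellorder} dform"
  assumes "\<omega> \<in> Alt2 j m" and zero: "Alt2_inner j m \<omega> \<omega> = 0"
  shows "\<omega> = (\<lambda>ws vs. 0)"
proof -
  have "\<omega> (basis_vectors \<sigma>) (basis_vectors \<rho>) = 0" if "card \<sigma> = j" "card \<rho> = m" for \<sigma> \<rho>
  proof -
    have "(\<Sum>\<rho> | card \<rho> = m. \<omega> (basis_vectors \<sigma>) (basis_vectors \<rho>) * \<omega> (basis_vectors \<sigma>) (basis_vectors \<rho>)) = 0"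
      using zero that(1) unfolding Alt2_inner_def
      by (subst (asm) sum_nonneg_eq_0_iff) (auto intro!: sum_nonneg)
    then show ?thesis using that(2) by (subst (asm) sum_nonneg_eq_0_iff) auto
  qed
  note zero = this
  show ?thesis
  proof (intro ext)
    fix ws vs
    show "\<omega> ws vs = 0"
      by (subst double_form_expand[OF Alt2_slices[OF assms(1)]], intro sum.neutral) (auto simp: zero)
  qed
qed

section \<open>Continuous extensions and integrals\<close>

text \<open>Integrands are extended by zero and so jump at the boundary of the face; only their
  agreement on \<open>f\<close> with a continuous function is meaningful.\<close>

definition cont_ext :: "'a::metric_space set \<Rightarrow> ('a \<Rightarrow> real) \<Rightarrow> bool" where
  "cont_ext f h \<longleftrightarrow> (\<exists>G. continuous_on UNIV G \<and> (\<forall>x\<in>f. h x = G x))"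

lemma cont_ext_continuous: "continuous_on UNIV h \<Longrightarrow> cont_ext f h"
  by (auto simp: cont_ext_def)

lemma cont_ext_add: "cont_ext f h \<Longrightarrow> cont_ext f g \<Longrightarrow> cont_ext f (\<lambda>x. h x + g x)"
proof -
  assume "cont_ext f h" "cont_ext f g"
  then obtain H G where "continuous_on UNIV H" "\<forall>x\<in>f. h x = H x" "continuous_on UNIV G" "\<forall>x\<in>f. g x = G x"
    by (auto simp: cont_ext_def)
  then show ?thesis unfolding cont_ext_def
    by (intro exI[of _ "\<lambda>x. H x + G x"]) (auto intro: continuous_on_add)
qed

lemma cont_ext_mult: "cont_ext f h \<Longrightarrow> cont_ext f g \<Longrightarrow> cont_ext f (\<lambda>x. h x * g x)"
proof -
  assume "cont_ext f h" "cont_ext f g"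
  then obtain H G where "continuous_on UNIV H" "\<forall>x\<in>f. h x = H x" "continuous_on UNIV G" "\<forall>x\<in>f. g x = G x"
    by (auto simp: cont_ext_def)
  then show ?thesis unfolding cont_ext_def
    by (intro exI[of _ "\<lambda>x. H x * G x"]) (auto intro: continuous_on_mult)
qed

lemma cont_ext_sum: "(\<And>i. i \<in> I \<Longrightarrow> cont_ext f (h i)) \<Longrightarrow> cont_ext f (\<lambda>x. \<Sum>i\<in>I. h i x)"
  by (induction I rule: infinite_finite_induct) (auto intro: cont_ext_add cont_ext_continuous)

lemma cont_ext_PP: "p \<in> PP r T \<Longrightarrow> f \<subseteq> T \<Longrightarrow> cont_ext f p"
proof -
  assume "p \<in> PP r T" "f \<subseteq> T"
  then obtain p' where "p' \<in> Pol r" "\<forall>x\<in>f. p x = p' x" by (auto simp: PP_iff subset_iff)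
  then show ?thesis unfolding cont_ext_def using Pol_continuous by blast
qed

lemma integrable_cont_ext:
  assumes "full_support \<mu> f" "compact f" "cont_ext f h"
  shows "integrable \<mu> h"
proof -
  obtain G where G: "continuous_on UNIV G" "\<forall>x\<in>f. h x = G x" using assms(3) by (auto simp: cont_ext_def)
  have "integrable \<mu> h \<longleftrightarrow> integrable \<mu> G"
    using G assms(1) by (intro Bochner_Integration.integrable_cong) (auto simp: full_support_def)
  then show ?thesis using full_support_integrable[OF assms(1,2) G(1)] by simp
qed

lemma integral_zero_cont_ext:
  assumes "full_support \<mu> f" "compact f" "cont_ext f h"
    and "\<And>x. x \<in> f \<Longrightarrow> 0 \<le> h x" "integral\<^sup>L \<mu> h = 0" "x \<in> f"
  shows "h x = 0"
proof -
  obtain G where G: "continuous_on UNIV G" "\<forall>x\<in>f. h x = G x" using assms(3) by (auto simp: cont_ext_def)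
  have "integral\<^sup>L \<mu> G = integral\<^sup>L \<mu> h"
    using G assms(1) by (intro Bochner_Integration.integral_cong) (auto simp: full_support_def)
  then have zero: "integral\<^sup>L \<mu> G = 0" using assms(5) by metis
  have "G x = 0"
  proof (rule full_support_zero[OF assms(1,2) G(1) _ zero assms(6)])
    fix x assume "x \<in> f" then show "0 \<le> G x" using assms(4) G(2) by metis
  qed
  then show ?thesis using G assms(6) by simp
qed

section \<open>Test spaces of the face degrees of freedom\<close>

definition test_indices :: "nat \<Rightarrow> nat \<Rightarrow> ('n::{finite,wellorder} set \<times> 'n) set" where
  "test_indices k l = {p. free_index k p \<and> l < pos (snd p)}"

definition test_form :: "('n::{finite,wellorder} \<Rightarrow> 'n form) \<Rightarrow> 'n set \<times> 'n \<Rightarrow> 'n dform" where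
  "test_form dyh p = tensor (wedge_set dyh (fst p)) (star dyh (snd p))"

lemma face_tests_iff:
  "\<eta> \<in> face_tests k r l f dyh \<longleftrightarrow> (\<exists>q. (\<forall>p. q p \<in> PP (r - (int l + 1)) f) \<and>
     \<eta> = (\<lambda>x ws vs. \<Sum>p\<in>test_indices k l. q p x * test_form dyh p ws vs))"
proof -
  have "(\<Sum>(\<sigma>, i) | free_index k (\<sigma>, i) \<and> l < pos i. q (\<sigma>, i) x * tensor (wedge_set dyh \<sigma>) (star dyh i) ws vs) =
     (\<Sum>p\<in>test_indices k l. q p x * test_form dyh p ws vs)" for q :: "_ \<Rightarrow> 'a euc \<Rightarrow> real" and x ws vs
    by (rule sum.cong) (auto simp: test_indices_def test_form_def)
  then show ?thesis unfolding face_tests_def by simp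
qed

lemma test_sum_in_face_tests:
  assumes "I \<subseteq> test_indices k l" "\<And>p. p \<in> I \<Longrightarrow> q p \<in> PP (r - (int l + 1)) f"
  shows "(\<lambda>x ws vs. \<Sum>p\<in>I. q p x * test_form dyh p ws vs) \<in> face_tests k r l f dyh"
proof -
  define q' where "q' p = (if p \<in> I then q p else (\<lambda>x. 0))" for p
  have "(\<Sum>p\<in>I. q p x * test_form dyh p ws vs) = (\<Sum>p\<in>test_indices k l. q' p x * test_form dyh p ws vs)"
    for x ws vs
  proof -
    have "(\<Sum>p\<in>I. q p x * test_form dyh p ws vs) = (\<Sum>p\<in>I. q' p x * test_form dyh p ws vs)"
      by (intro sum.cong) (auto simp: q'_def)
    also have "\<dots> = (\<Sum>p\<in>test_indices k l. q' p x * test_form dyh p ws vs)"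
      using assms(1) by (intro sum.mono_neutral_left) (auto simp: q'_def)
    finally show ?thesis .
  qed
  then show ?thesis unfolding face_tests_iff
    using assms(2) PP_zero by (intro exI[of _ q']) (auto simp: q'_def fun_eq_iff)
qed

lemma test_in_face_tests:
  assumes "p \<in> test_indices k l" "u \<in> PP (r - (int l + 1)) f"
  shows "(\<lambda>x ws vs. u x * test_form dyh p ws vs) \<in> face_tests k r l f dyh"
  using test_sum_in_face_tests[of "{p}" k l "\<lambda>_. u" r f dyh] assms by simp

lemma linear_functional_zero:
  "linear_functional_on V L \<Longrightarrow> \<eta> \<in> V \<Longrightarrow> L (\<lambda>x ws vs. 0) = 0"
  unfolding linear_functional_on_def by (drule bspec, assumption, drule bspec, assumption, drule spec[of _ 0], drule spec[of _ 0]) simp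

lemma linear_functional_lin:
  "linear_functional_on V L \<Longrightarrow> \<eta> \<in> V \<Longrightarrow> \<zeta> \<in> V \<Longrightarrow>
    L (\<lambda>x ws vs. a * \<eta> x ws vs + b * \<zeta> x ws vs) = a * L \<eta> + b * L \<zeta>"
  unfolding linear_functional_on_def by blast

lemma linear_functional_tests_sum:
  assumes L: "linear_functional_on (face_tests k r l f dyh) L"
    and q: "\<And>p. p \<in> test_indices k l \<Longrightarrow> q p \<in> PP (r - (int l + 1)) f"
  shows "L (\<lambda>x ws vs. \<Sum>p\<in>test_indices k l. q p x * test_form dyh p ws vs) =
    (\<Sum>p\<in>test_indices k l. L (\<lambda>x ws vs. q p x * test_form dyh p ws vs))"
proof -
  have "L (\<lambda>x ws vs. \<Sum>p\<in>I. q p x * test_form dyh p ws vs) =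
      (\<Sum>p\<in>I. L (\<lambda>x ws vs. q p x * test_form dyh p ws vs))"
    if "finite I" "I \<subseteq> test_indices k l" for I
    using that
  proof (induction I rule: finite_induct)
    case empty
    have "(\<lambda>x ws vs. 0) \<in> face_tests k r l f dyh" using test_sum_in_face_tests[of "{}" k l] by simp
    then show ?case using linear_functional_zero[OF L] by simp
  next
    case (insert p I)
    have 1: "(\<lambda>x ws vs. q p x * test_form dyh p ws vs) \<in> face_tests k r l f dyh"
      using insert.prems q by (intro test_in_face_tests) auto
    have 2: "(\<lambda>x ws vs. \<Sum>p\<in>I. q p x * test_form dyh p ws vs) \<in> face_tests k r l f dyh"
      using insert.prems q by (intro test_sum_in_face_tests) auto
    show ?case using linear_functional_lin[OF L 1 2, of 1 1] insert by simp
  qed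
  from this[OF finite subset_refl] show ?thesis .
qed

text \<open>Hence the face degrees of freedom are the moments of the free normal
  coefficients.\<close>

lemma Alt2_inner_test:
  fixes \<omega> :: "'n::{finite,wellorder} dform"
  assumes \<omega>: "\<omega> \<in> XX k" and dyh: "dyh = (\<lambda>i. covector (z i))"
  shows "Alt2_inner k (CARD('n) - 1) \<omega> (\<lambda>ws vs. \<Sum>p\<in>test_indices k l. q p * test_form dyh p ws vs) =
    (\<Sum>p\<in>test_indices k l. q p * basis_coef z \<omega> (fst p) (snd p))"
proof -
  have "Alt2_inner k (CARD('n) - 1) \<omega> (test_form dyh p) = basis_coef z \<omega> (fst p) (snd p)"
    if "p \<in> test_indices k l" for p
    unfolding test_form_def dyh using that
    by (intro Alt2_inner_dual XX_slices[OF \<omega>]) (auto simp: test_indices_def free_index_def)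
  then show ?thesis by (simp add: Alt2_inner_sum_right)
qed

section \<open>Bases adapted to a face\<close>

lemma card_pos:
  assumes "l \<le> CARD('n)"
  shows "card {i::'n::{finite,wellorder}. pos i \<le> l} = l" "card {i::'n. l < pos i} = CARD('n) - l"
proof -
  have inj: "inj (pos :: 'n \<Rightarrow> nat)" by (metis injI less_irrefl linorder_neqE pos_less_iff)
  have "pos i \<le> CARD('n)" for i :: 'n unfolding pos_def by (intro card_mono) auto
  then have "range (pos :: 'n \<Rightarrow> nat) \<subseteq> {1..CARD('n)}" using pos_ge_1 by auto
  then have range: "range (pos :: 'n \<Rightarrow> nat) = {1..CARD('n)}"
    by (intro card_subset_eq) (auto simp: card_image inj)
  have "{i::'n. pos i \<le> l} = pos -` {1..l}" using pos_ge_1 by auto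
  then have "card {i::'n. pos i \<le> l} = card (pos -` {1..l} :: 'n set)" by simp
  also have "\<dots> = card ({1..l} \<inter> range (pos :: 'n \<Rightarrow> nat))"
    using card_image[of pos "pos -` {1..l} :: 'n set"] inj inj_on_subset
    by (metis image_vimage_eq subset_UNIV)
  also have "{1..l} \<inter> range (pos :: 'n \<Rightarrow> nat) = {1..l}" using range assms by auto
  finally show *: "card {i::'n. pos i \<le> l} = l" by simp
  have "{i::'n. l < pos i} = - {i. pos i \<le> l}" by auto
  then show "card {i::'n. l < pos i} = CARD('n) - l"
    using * by (simp add: Compl_eq_Diff_UNIV card_Diff_subset)
qed

text \<open>A dimension count: \<open>l\<close> independent tangents bound the dimension of the
  orthogonal complement by \<open>n - l\<close>, and the \<open>n - l\<close> independent normals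
  fill it.\<close>

lemma tn_basis_normal_span:
  fixes f :: "('n::{finite,wellorder}) euc set"
  assumes tn: "tn_basis l f y" and l: "l \<le> CARD('n)"
    and \<nu>: "\<And>u. u \<in> tangent_space f \<Longrightarrow> \<nu> \<bullet> u = 0"
  shows "\<nu> \<in> span (y ` {i. l < pos i})"
proof -
  define N where "N = {v \<in> UNIV. \<forall>u\<in>tangent_space f. orthogonal u v}"
  have sub: "subspace (tangent_space f)" by (simp add: tangent_space_def)
  have dim: "dim N + dim (tangent_space f) = CARD('n)"
    using dim_subspace_orthogonal_to_vectors[OF sub subspace_UNIV] by (simp add: N_def)
  have "card (y ` {i. pos i \<le> l}) = l"
    using tn card_pos(1)[OF l] by (simp add: tn_basis_def card_image)
  moreover have "card (y ` {i. pos i \<le> l}) \<le> dim (tangent_space f)"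
    using tn by (intro independent_card_le_dim) (auto simp: tn_basis_def)
  ultimately have dimN: "dim N \<le> CARD('n) - l" using dim by simp
  have "card (y ` {i. l < pos i}) = CARD('n) - l"
    using tn card_pos(2)[OF l] by (simp add: tn_basis_def card_image)
  moreover have "y ` {i. l < pos i} \<subseteq> N"
    using tn by (auto simp: N_def tn_basis_def orthogonal_def inner_commute)
  ultimately have "N \<subseteq> span (y ` {i. l < pos i})"
    using tn dimN by (intro card_ge_dim_independent) (auto simp: tn_basis_def)
  moreover have "\<nu> \<in> N" using \<nu> by (auto simp: N_def orthogonal_def inner_commute)
  ultimately show ?thesis by blast
qed

text \<open>Row \<open>\<sigma>\<close> of \<open>A \<nu>\<close> in the notation of the divergence trace, for an arbitrary vector \<open>\<nu>\<close>.\<close>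
definition row_trace :: "nat \<Rightarrow> 'n::{finite,wellorder} dform \<Rightarrow> 'n set \<Rightarrow> 'n euc \<Rightarrow> real" where
  "row_trace k \<omega> \<sigma> \<nu> = (\<Sum>j\<in>UNIV. coef k \<omega> \<sigma> j * \<nu> $ j)"

lemma row_trace_linear: "linear (row_trace k \<omega> \<sigma>)"
  unfolding row_trace_def by (intro linearI) (auto simp: algebra_simps sum.distrib sum_distrib_left)

lemma row_trace_span:
  assumes "\<nu> \<in> span B" "\<And>v. v \<in> B \<Longrightarrow> row_trace k \<omega> \<sigma> v = 0"
  shows "row_trace k \<omega> \<sigma> \<nu> = 0"
  using linear_eq_0_on_span[OF row_trace_linear _ assms(1)] assms(2) by blast

lemma row_trace_zero [simp]: "row_trace k (\<lambda>ws vs. 0) \<sigma> \<nu> = 0"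
  by (simp add: row_trace_def)

lemma div_trace_eq: "div_trace k \<nu> \<omega> x \<sigma> = row_trace k (\<omega> x) \<sigma> \<nu>"
  by (simp add: div_trace_def row_trace_def)

lemma face_ip_cong:
  assumes "\<And>x. x \<in> f \<Longrightarrow> \<omega> x = \<omega>' x" "full_support (face_measure l f) f"
  shows "face_ip k l f \<omega> \<eta> = face_ip k l f \<omega>' \<eta>"
  unfolding face_ip_def using assms
  by (intro Bochner_Integration.integral_cong) (auto simp: full_support_def)

section \<open>Unisolvence\<close>

text \<open>The bases \<open>y\<close>, their dual vectors \<open>z\<close> and the forms
  \<open>dyh\<close> are indexed by the face as a set, not by the cell, so neighbouring cells share
  them.\<close>

locale element = barycentric C a g
  for C :: "('n::{finite,wellorder}) euc set" and a :: "'n euc \<Rightarrow> real" and g :: "'n euc \<Rightarrow> 'n euc" +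
  fixes k r :: nat and y z :: "'n euc set \<Rightarrow> 'n \<Rightarrow> 'n euc" and dyh :: "'n euc set \<Rightarrow> 'n \<Rightarrow> 'n form"
  assumes k: "1 \<le> k" "k \<le> CARD('n) - 1" and r: "1 \<le> r"
    and tn: "\<And>K l. K \<subseteq> C \<Longrightarrow> card K = Suc l \<Longrightarrow> l \<le> CARD('n) - 1 \<Longrightarrow>
      tn_basis l (convex hull K) (y (convex hull K))"
    and dyh: "\<And>K l. K \<subseteq> C \<Longrightarrow> card K = Suc l \<Longrightarrow> l \<le> CARD('n) - 1 \<Longrightarrow>
      dyh (convex hull K) = (\<lambda>i. covector (z (convex hull K) i))"
    and dual: "\<And>K l i j. K \<subseteq> C \<Longrightarrow> card K = Suc l \<Longrightarrow> l \<le> CARD('n) - 1 \<Longrightarrow>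
      y (convex hull K) i \<bullet> z (convex hull K) j = (if i = j then 1 else 0)"
begin

lemma k_le: "k \<le> CARD('n)"
  using k by simp

lemma simplex_hull: "K \<subseteq> C \<Longrightarrow> card K = Suc l \<Longrightarrow> int l simplex (convex hull K)"
  unfolding simplex_def using indep affine_independent_subset[of C K] by auto

lemma compact_hull: "K \<subseteq> C \<Longrightarrow> compact (convex hull K)"
  by (intro finite_imp_compact_convex_hull finite_sub)

lemma face_full_support:
  "K \<subseteq> C \<Longrightarrow> card K = Suc l \<Longrightarrow> full_support (face_measure l (convex hull K)) (convex hull K)"
  by (intro full_support_face_measure simplex_hull)

lemma sub_hull: "K \<subseteq> C \<Longrightarrow> convex hull K \<subseteq> convex hull C"
  by (rule hull_mono)

lemma face_ip_test:
  assumes K: "K \<subseteq> C" "card K = Suc l" "l \<le> CARD('n) - 1" and \<omega>: "\<And>x. \<omega> x \<in> XX k"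
  shows "face_ip k l (convex hull K) \<omega>
      (\<lambda>x ws vs. \<Sum>p\<in>test_indices k l. q p x * test_form (dyh (convex hull K)) p ws vs) =
    (\<integral>x. (\<Sum>p\<in>test_indices k l. q p x * basis_coef (z (convex hull K)) (\<omega> x) (fst p) (snd p))
      \<partial>face_measure l (convex hull K))"
  unfolding face_ip_def using Alt2_inner_test[OF \<omega> dyh[OF K]] by simp

lemma face_ip_lin:
  assumes K: "K \<subseteq> C" "card K = Suc l" "l \<le> CARD('n) - 1"
    and \<omega>: "\<omega> \<in> PPX k d T" "\<zeta> \<in> PPX k d T" "convex hull K \<subseteq> T"
    and \<eta>: "\<eta> \<in> face_tests k e l (convex hull K) (dyh (convex hull K))"
  shows "face_ip k l (convex hull K) (\<lambda>x ws vs. s * \<omega> x ws vs + t * \<zeta> x ws vs) \<eta> =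
    s * face_ip k l (convex hull K) \<omega> \<eta> + t * face_ip k l (convex hull K) \<zeta> \<eta>"
proof -
  let ?f = "convex hull K"
  obtain q where q: "\<And>p. q p \<in> PP (e - (int l + 1)) ?f"
    "\<eta> = (\<lambda>x ws vs. \<Sum>p\<in>test_indices k l. q p x * test_form (dyh ?f) p ws vs)"
    using \<eta> unfolding face_tests_iff by blast
  have int: "integrable (face_measure l ?f)
      (\<lambda>x. \<Sum>p\<in>test_indices k l. q p x * basis_coef (z ?f) (\<omega> x) (fst p) (snd p))"
    if "\<omega> \<in> PPX k d T" for \<omega>
    using that \<omega>(3) q(1) K
    by (intro integrable_cont_ext[OF face_full_support compact_hull] cont_ext_sum cont_ext_mult)
      (auto intro: cont_ext_PP basis_coef_PP)
  have "face_ip k l ?f (\<lambda>x ws vs. s * \<omega> x ws vs + t * \<zeta> x ws vs) \<eta> =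
     (\<integral>x. s * (\<Sum>p\<in>test_indices k l. q p x * basis_coef (z ?f) (\<omega> x) (fst p) (snd p)) +
       t * (\<Sum>p\<in>test_indices k l. q p x * basis_coef (z ?f) (\<zeta> x) (fst p) (snd p)) \<partial>face_measure l ?f)"
    unfolding q(2) using PPX_XX[OF PPX_lin[OF \<omega>(1,2)]]
    by (subst face_ip_test[OF K])
      (simp_all add: basis_coef_lin distrib_left sum.distrib sum_distrib_left mult_ac)
  also have "\<dots> = s * face_ip k l ?f \<omega> \<eta> + t * face_ip k l ?f \<zeta> \<eta>"
    unfolding q(2) using int[OF \<omega>(1)] int[OF \<omega>(2)] PPX_XX[OF \<omega>(1)] PPX_XX[OF \<omega>(2)]
    by (simp add: face_ip_test[OF K])
  finally show ?thesis .
qed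

lemma test_index_card: "p \<in> test_indices k l \<Longrightarrow> card (fst p) = k"
  by (simp add: test_indices_def free_index_def)

lemma normal_coefs_zero_iff:
  assumes K: "K \<subseteq> C" "card K = Suc l" "l \<le> CARD('n) - 1" and \<omega>: "\<omega> \<in> XX k"
  shows "(\<forall>\<sigma>. card \<sigma> = k \<longrightarrow> basis_coef (z (convex hull K)) \<omega> \<sigma> i = 0) \<longleftrightarrow>
    (\<forall>\<sigma>. card \<sigma> = k \<longrightarrow> row_trace k \<omega> \<sigma> (y (convex hull K) i) = 0)"
  unfolding row_trace_def by (rule basis_coef_zero_iff[OF XX_slices[OF \<omega>] dual[OF K]])

text \<open>By induction on the dimension of the face: a normal of a face is normal to its subfaces, so the
  normal components vanish on the boundary and are divisible by the bubble; testing against the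
  quotient kills the free ones, and the constraints kill the remaining ones.\<close>
lemma normal_trace_vanishes:
  assumes K: "K \<subseteq> C" and D: "D \<in> PPX k (int r) (convex hull K)"
    and vert: "\<And>v. v \<in> K \<Longrightarrow> D v = (\<lambda>ws vs. 0)"
    and dofs: "\<And>L l \<eta>. L \<subseteq> K \<Longrightarrow> card L = Suc l \<Longrightarrow> 1 \<le> l \<Longrightarrow> l \<le> CARD('n) - 1 \<Longrightarrow>
      \<eta> \<in> face_tests k (int r) l (convex hull L) (dyh (convex hull L)) \<Longrightarrow>
      face_ip k l (convex hull L) D \<eta> = 0"
    and "L \<subseteq> K" "L \<noteq> {}" "card L \<le> CARD('n)"
    and "\<And>u. u \<in> tangent_space (convex hull L) \<Longrightarrow> \<nu> \<bullet> u = 0"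
    and "x \<in> convex hull L" "card \<sigma> = k"
  shows "row_trace k (D x) \<sigma> \<nu> = 0"
  using assms(5-10)
proof (induction "card L" arbitrary: L \<nu> x \<sigma> rule: less_induct)
  case less
  have LC: "L \<subseteq> C" and finL: "finite L" using less.prems(1) K finite_sub by auto
  then obtain l where cL: "card L = Suc l" using less.prems(2) by (metis card_0_eq not0_implies_Suc)
  show ?case
  proof (cases "l = 0")
    case True
    then obtain v where "L = {v}" using cL by (auto simp: card_Suc_eq)
    then have "x = v" "v \<in> K" using less.prems by auto
    then show ?thesis using vert by simp
  next
    case False
    then have l: "1 \<le> l" "l \<le> CARD('n) - 1" using cL less.prems(3) by auto
    let ?f = "convex hull L"
    have fK: "?f \<subseteq> convex hull K" using less.prems(1) by (rule hull_mono)
    have XX: "D x \<in> XX k" for x using PPX_XX[OF D] .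
    note tnf = tn[OF LC cL l(2)]
    have y_normal: "y ?f i \<bullet> u = 0" if "l < pos i" "u \<in> tangent_space ?f" for i u
      using tnf that by (auto simp: tn_basis_def)
    have divides: "\<exists>q\<in>PP (int r - (int l + 1)) ?f. \<forall>x\<in>?f. basis_coef (z ?f) (D x) \<sigma> i = bubble L x * q x"
      if i: "l < pos i" and \<sigma>: "card \<sigma> = k" for i \<sigma>
    proof -
      have "\<exists>q\<in>PP (int r - int (card L)) ?f. \<forall>x\<in>?f.
          (if x \<in> ?f then basis_coef (z ?f) (D x) \<sigma> i else 0) = bubble L x * q x"
      proof (rule bubble_factor[OF LC less.prems(2) r PP_restrict[OF basis_coef_PP[OF D] fK]])
        fix v x assume v: "v \<in> L" and x: "x \<in> convex hull (L - {v})"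
        \<comment> \<open>The dimension \<open>l\<close> is at least 1, so the opposite facet is a
          genuine face, to which the induction hypothesis applies.\<close>
        have "L - {v} \<noteq> {}"
        proof
          assume "L - {v} = {}"
          then have "card L \<le> card {v}" using v by (intro card_mono) auto
          then show False using cL l by simp
        qed
        then have "row_trace k (D x) \<sigma>' (y ?f i) = 0" if "card \<sigma>' = k" for \<sigma>'
          using less.prems v x that y_normal[OF i] finL card_Diff1_le[of L v]
            tangent_space_mono[OF hull_mono[of "L - {v}" L convex]]
          by (intro less.hyps[of "L - {v}"]) (auto simp: card_gt_0_iff)
        then show "(if x \<in> ?f then basis_coef (z ?f) (D x) \<sigma> i else 0) = 0"
          using normal_coefs_zero_iff[OF LC cL l(2) XX] \<sigma> by auto
      qed
      then show ?thesis using cL by (simp add: algebra_simps)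
    qed
    have free: "basis_coef (z ?f) (D x) \<sigma> i = 0"
      if fi: "free_index k (\<sigma>, i)" and i: "l < pos i" and x: "x \<in> ?f" for \<sigma> i x
    proof -
      have p: "(\<sigma>, i) \<in> test_indices k l" using that by (simp add: test_indices_def)
      then have \<sigma>: "card \<sigma> = k" using test_index_card by force
      obtain q where q: "q \<in> PP (int r - (int l + 1)) ?f"
        "\<And>x. x \<in> ?f \<Longrightarrow> basis_coef (z ?f) (D x) \<sigma> i = bubble L x * q x"
        using divides[OF i \<sigma>] by blast
      \<comment> \<open>The test field has the single component \<open>(\<sigma>, i)\<close>,
        weighted by the quotient \<open>q\<close> itself; the degree of freedom becomes the integral
        of the bubble times the square of \<open>q\<close>.\<close>
      define q' where "q' p = (if p = (\<sigma>, i) then q else (\<lambda>x. 0))" for p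
      have "(\<lambda>x ws vs. \<Sum>p\<in>test_indices k l. q' p x * test_form (dyh ?f) p ws vs)
          \<in> face_tests k (int r) l ?f (dyh ?f)"
        using q(1) PP_zero by (intro test_sum_in_face_tests) (auto simp: q'_def)
      from dofs[OF less.prems(1) cL l this]
      have "0 = (\<integral>x. (\<Sum>p\<in>test_indices k l. q' p x * basis_coef (z ?f) (D x) (fst p) (snd p)) \<partial>face_measure l ?f)"
        using face_ip_test[OF LC cL l(2) XX] by simp
      also have "\<dots> = (\<integral>x. bubble L x * (q x)\<^sup>2 \<partial>face_measure l ?f)"
      proof (intro Bochner_Integration.integral_cong refl)
        fix x assume "x \<in> space (face_measure l ?f)"
        then have x: "x \<in> ?f" using face_full_support[OF LC cL] by (simp add: full_support_def)
        have "(\<Sum>p\<in>test_indices k l. q' p x * basis_coef (z ?f) (D x) (fst p) (snd p)) =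
            (\<Sum>p\<in>test_indices k l. if p = (\<sigma>, i) then q x * basis_coef (z ?f) (D x) \<sigma> i else 0)"
          by (intro sum.cong) (auto simp: q'_def)
        also have "\<dots> = q x * basis_coef (z ?f) (D x) \<sigma> i" using p by simp
        finally show "(\<Sum>p\<in>test_indices k l. q' p x * basis_coef (z ?f) (D x) (fst p) (snd p)) = bubble L x * (q x)\<^sup>2"
          using q(2)[OF x] by (simp add: power2_eq_square)
      qed
      finally have zero: "(\<integral>x. bubble L x * (q x)\<^sup>2 \<partial>face_measure l ?f) = 0" by simp
      have "cont_ext ?f (\<lambda>x. bubble L x * (q x)\<^sup>2)"
        unfolding power2_eq_square
        by (intro cont_ext_mult cont_ext_PP[OF q(1)] cont_ext_continuous)
          (auto simp: bubble_def lam_def intro!: continuous_intros)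
      from integral_zero_cont_ext[OF face_full_support[OF LC cL] compact_hull[OF LC] this _ zero x]
      have "bubble L x * (q x)\<^sup>2 = 0" using bubble_nonneg[OF LC LC] by simp
      then show ?thesis using q(2)[OF x] by simp
    qed
    have "basis_coef (z ?f) (D x) \<sigma> i = 0" if "l < pos i" "card \<sigma> = k" for \<sigma> i
      by (rule free_normal_coefs_zero[OF XX k(1) k_le free]) (use that less.prems in auto)
    then have "row_trace k (D x) \<sigma> (y ?f i) = 0" if "l < pos i" for i
      using normal_coefs_zero_iff[OF LC cL l(2) XX] that less.prems(6) by blast
    moreover have "\<nu> \<in> span (y ?f ` {i. l < pos i})"
      using less.prems(4) l by (intro tn_basis_normal_span[OF tnf]) auto
    ultimately show ?thesis using row_trace_span by blast
  qed
qed

end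

section \<open>Finite-dimensional spaces of functions and fields\<close>

interpretation scalar_fields: vector_space "\<lambda>(c::real) p x. c * p x"
  by unfold_locales (auto simp: fun_eq_iff algebra_simps)

interpretation form_fields: vector_space "\<lambda>(c::real) (\<eta> :: 'n::{finite,wellorder} dform_field) x ws vs. c * \<eta> x ws vs"
  by unfold_locales (intro ext; simp add: distrib_left distrib_right)+

lemma PP_subspace: "scalar_fields.subspace (PP r f)"
  unfolding scalar_fields.subspace_def plus_fun_def zero_fun_def
  by (auto intro: PP_zero PP_add PP_scale)

lemma PP_finite_span:
  "\<exists>G. finite G \<and> PP r (f :: ('n::{finite,wellorder}) euc set) \<subseteq> scalar_fields.span G"
proof (intro exI conjI subsetI)
  let ?G = "(\<lambda>\<alpha> x. if x \<in> f then \<Prod>i\<in>UNIV. x $ i ^ \<alpha> i else 0) ` {\<alpha>::'n \<Rightarrow> nat. int (\<Sum>i\<in>UNIV. \<alpha> i) \<le> r}"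
  show "finite ?G" using finite_multi_indices by blast
  fix p assume "p \<in> PP r f"
  then obtain P where P: "P \<in> Pol r" "p = (\<lambda>x. if x \<in> f then P x else 0)" by (auto simp: PP_iff)
  show "p \<in> scalar_fields.span ?G"
    unfolding P(2) using P(1)
  proof (rule Pol_cases)
    fix p q assume "(\<lambda>x. if x \<in> f then p x else 0) \<in> scalar_fields.span ?G"
      "(\<lambda>x. if x \<in> f then q x else 0) \<in> scalar_fields.span ?G"
    from scalar_fields.span_add[OF this]
    show "(\<lambda>x. if x \<in> f then p x + q x else 0) \<in> scalar_fields.span ?G"
      by (rule back_subst[where P = "\<lambda>h. h \<in> scalar_fields.span ?G"]) (auto simp: fun_eq_iff)
  next
    fix p and c :: real assume "(\<lambda>x. if x \<in> f then p x else 0) \<in> scalar_fields.span ?G"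
    from scalar_fields.span_scale[OF this, of c]
    show "(\<lambda>x. if x \<in> f then c * p x else 0) \<in> scalar_fields.span ?G"
      by (rule back_subst[where P = "\<lambda>h. h \<in> scalar_fields.span ?G"]) (auto simp: fun_eq_iff)
  next
    show "(\<lambda>x. if x \<in> f then 0 else 0) \<in> scalar_fields.span ?G"
      using scalar_fields.span_zero[of ?G] by (simp add: zero_fun_def)
  qed (auto intro!: scalar_fields.span_base)
qed

text \<open>The generators, monomials times products of basis forms, span more than the fields with
  values in \<open>XX k\<close>; for \<open>riesz\<close> a finite spanning set of a larger space
  suffices.\<close>

lemma PPX_finite_span:
  "\<exists>G. finite G \<and> PPX k r (T :: ('n::{finite,wellorder}) euc set) \<subseteq> form_fields.span G"
proof (intro exI conjI subsetI)
  let ?w = "\<lambda>\<sigma> \<rho> ws vs. wedge_set dx \<sigma> ws * wedge_set dx \<rho> vs"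
  let ?G = "(\<lambda>(\<alpha>, \<sigma>, \<rho>) x ws vs. (if x \<in> T then \<Prod>i\<in>UNIV. x $ i ^ \<alpha> i else 0) * ?w \<sigma> \<rho> ws vs) `
    ({\<alpha>::'n \<Rightarrow> nat. int (\<Sum>i\<in>UNIV. \<alpha> i) \<le> r} \<times> (UNIV :: ('n set \<times> 'n set) set))"
  show "finite ?G" by (intro finite_imageI finite_cartesian_product finite_multi_indices finite)
  have part: "(\<lambda>x ws vs. p x * ?w \<sigma> \<rho> ws vs) \<in> form_fields.span ?G" if p: "p \<in> PP r T" for p \<sigma> \<rho>
  proof -
    obtain P where P: "P \<in> Pol r" "p = (\<lambda>x. if x \<in> T then P x else 0)" using p by (auto simp: PP_iff)
    show ?thesis
      unfolding P(2) using P(1)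
    proof (rule Pol_cases)
      fix \<alpha> :: "'n \<Rightarrow> nat" assume "int (\<Sum>i\<in>UNIV. \<alpha> i) \<le> r"
      then show "(\<lambda>x ws vs. (if x \<in> T then \<Prod>i\<in>UNIV. x $ i ^ \<alpha> i else 0) * ?w \<sigma> \<rho> ws vs) \<in> form_fields.span ?G"
        by (intro form_fields.span_base image_eqI[of _ _ "(\<alpha>, \<sigma>, \<rho>)"]) auto
    next
      fix p q assume "(\<lambda>x ws vs. (if x \<in> T then p x else 0) * ?w \<sigma> \<rho> ws vs) \<in> form_fields.span ?G"
        "(\<lambda>x ws vs. (if x \<in> T then q x else 0) * ?w \<sigma> \<rho> ws vs) \<in> form_fields.span ?G"
      from form_fields.span_add[OF this]
      show "(\<lambda>x ws vs. (if x \<in> T then p x + q x else 0) * ?w \<sigma> \<rho> ws vs) \<in> form_fields.span ?G"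
        by (rule back_subst[where P = "\<lambda>h. h \<in> form_fields.span ?G"]) (intro ext, simp add: distrib_right)
    next
      fix p and c :: real assume "(\<lambda>x ws vs. (if x \<in> T then p x else 0) * ?w \<sigma> \<rho> ws vs) \<in> form_fields.span ?G"
      from form_fields.span_scale[OF this, of c]
      show "(\<lambda>x ws vs. (if x \<in> T then c * p x else 0) * ?w \<sigma> \<rho> ws vs) \<in> form_fields.span ?G"
        by (rule back_subst[where P = "\<lambda>h. h \<in> form_fields.span ?G"]) (intro ext, simp add: distrib_right)
    next
      show "(\<lambda>x ws vs. (if x \<in> T then 0 else 0) * ?w \<sigma> \<rho> ws vs) \<in> form_fields.span ?G"
        using form_fields.span_zero[of ?G] by (simp add: zero_fun_def)
    qed
  qed
  fix \<omega> assume \<omega>: "\<omega> \<in> PPX k r T"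
  have fin: "(\<lambda>x ws vs. \<Sum>(\<sigma>, \<rho>)\<in>I. \<omega> x (basis_vectors \<sigma>) (basis_vectors \<rho>) * ?w \<sigma> \<rho> ws vs) \<in> form_fields.span ?G"
    if "finite I" for I
    using that
  proof (induction I rule: finite_induct)
    case empty
    then show ?case using form_fields.span_zero[of ?G] by (simp add: zero_fun_def)
  next
    case (insert a I)
    obtain \<sigma> \<rho> where a: "a = (\<sigma>, \<rho>)" by (cases a)
    from form_fields.span_add[OF part[OF PPX_PP[OF \<omega>, of "basis_vectors \<sigma>" "basis_vectors \<rho>"], of \<sigma> \<rho>] insert.IH]
    show ?case
      by (rule back_subst[where P = "\<lambda>h. h \<in> form_fields.span ?G"])
        (use insert.hyps a in \<open>auto simp: fun_eq_iff\<close>)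
  qed
  have eq: "\<omega> = (\<lambda>x ws vs. \<Sum>(\<sigma>, \<rho>)\<in>{\<sigma>. card \<sigma> = k} \<times> {\<rho>. card \<rho> = CARD('n) - 1}.
      \<omega> x (basis_vectors \<sigma>) (basis_vectors \<rho>) * ?w \<sigma> \<rho> ws vs)"
    by (intro ext double_form_expand XX_slices[OF PPX_XX[OF \<omega>]])
  show "\<omega> \<in> form_fields.span ?G"
    by (rule ssubst[where P = "\<lambda>h. h \<in> form_fields.span ?G", OF eq]) (rule fin[OF finite])
qed

context element
begin

section \<open>Existence: corrections attached to faces\<close>

lemma bubble_continuous: "continuous_on UNIV (bubble K)"
  unfolding bubble_def lam_def by (intro continuous_intros)

text \<open>The weighted product is definite: the bubble is nonnegative on the face, so a zero
  integral forces the bubble times \<open>u\<close> to vanish, and by density \<open>u\<close>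
  itself.\<close>

lemma bubble_riesz:
  assumes K: "K \<subseteq> C" "card K = Suc l"
    and \<Lambda>: "\<And>u v. u \<in> PP d (convex hull K) \<Longrightarrow> v \<in> PP d (convex hull K) \<Longrightarrow> \<Lambda> (\<lambda>x. u x + v x) = \<Lambda> u + \<Lambda> v"
      "\<And>c u. u \<in> PP d (convex hull K) \<Longrightarrow> \<Lambda> (\<lambda>x. c * u x) = c * \<Lambda> u"
  shows "\<exists>q\<in>PP d (convex hull K). \<forall>u\<in>PP d (convex hull K).
    (\<integral>x. bubble K x * q x * u x \<partial>face_measure l (convex hull K)) = \<Lambda> u"
proof -
  let ?f = "convex hull K" and ?\<mu> = "face_measure l (convex hull K)"
  have Kne: "K \<noteq> {}" using K by auto
  have fs: "full_support ?\<mu> ?f" and cf: "compact ?f" using face_full_support[OF K] compact_hull[OF K(1)] by auto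
  obtain G where G: "finite G" "PP d ?f \<subseteq> scalar_fields.span G" using PP_finite_span by blast
  have int: "integrable ?\<mu> (\<lambda>x. bubble K x * q x * u x)" if "q \<in> PP d ?f" "u \<in> PP d ?f" for q u
    using that by (intro integrable_cont_ext[OF fs cf] cont_ext_mult cont_ext_PP
        cont_ext_continuous[OF bubble_continuous]) auto
  show ?thesis
  proof (rule scalar_fields.riesz[OF PP_subspace G(2,1)])
    fix u v w :: "'n euc \<Rightarrow> real" assume "u \<in> PP d ?f" "v \<in> PP d ?f" "w \<in> PP d ?f"
    then show "(\<integral>x. bubble K x * (u + v) x * w x \<partial>?\<mu>) = (\<integral>x. bubble K x * u x * w x \<partial>?\<mu>) + (\<integral>x. bubble K x * v x * w x \<partial>?\<mu>)"
      using Bochner_Integration.integral_add[OF int[of u w] int[of v w]] by (simp add: algebra_simps)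
  next
    fix c and u w :: "'n euc \<Rightarrow> real"
    have "(\<integral>x. bubble K x * (c * u x) * w x \<partial>?\<mu>) = (\<integral>x. c * (bubble K x * u x * w x) \<partial>?\<mu>)"
      by (simp add: mult_ac)
    then show "(\<integral>x. bubble K x * (c * u x) * w x \<partial>?\<mu>) = c * (\<integral>x. bubble K x * u x * w x \<partial>?\<mu>)" by simp
  next
    fix u w :: "'n euc \<Rightarrow> real"
    show "(\<integral>x. bubble K x * u x * w x \<partial>?\<mu>) = (\<integral>x. bubble K x * w x * u x \<partial>?\<mu>)" by (simp add: mult_ac)
  next
    fix u assume u: "u \<in> PP d ?f" and zero: "(\<integral>x. bubble K x * u x * u x \<partial>?\<mu>) = 0"
    obtain U where U: "U \<in> Pol d" "u = (\<lambda>x. if x \<in> ?f then U x else 0)" using u by (auto simp: PP_iff)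
    have ce: "cont_ext ?f (\<lambda>x. bubble K x * u x * u x)"
      using u by (intro cont_ext_mult cont_ext_PP cont_ext_continuous[OF bubble_continuous]) auto
    have "bubble K x * U x = 0" if x: "x \<in> ?f" for x
    proof -
      have "0 \<le> bubble K x * u x * u x" if "x \<in> ?f" for x
        using bubble_nonneg[OF K(1) K(1) that] by (simp add: mult.assoc)
      from integral_zero_cont_ext[OF fs cf ce this zero x] show ?thesis using U(2) x by auto
    qed
    from zero_by_density[OF K(1) Kne Pol_continuous[OF U(1)] this]
    show "u = 0" using U(2) by (auto simp: fun_eq_iff)
  next
    fix u v assume "u \<in> PP d ?f" "v \<in> PP d ?f"
    from \<Lambda>(1)[OF this] show "\<Lambda> (u + v) = \<Lambda> u + \<Lambda> v" by (simp add: plus_fun_def)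
  qed (rule \<Lambda>(2))
qed

text \<open>The correction is a sum of bubble times \<open>Q p\<close> times \<open>E p\<close>,
  where the constant form \<open>E p\<close> has free coefficient 1 at \<open>p\<close> and 0 at all
  other free indices. The test form at \<open>p\<close> then sees only \<open>Q p\<close>, and the
  system splits into scalar problems for \<open>bubble_riesz\<close>. The bubble keeps the
  correction away from faces not containing \<open>K\<close>.\<close>

lemma face_correction:
  assumes K: "K \<subseteq> C" "card K = Suc l" "1 \<le> l" "l \<le> CARD('n) - 1"
    and L: "linear_functional_on (face_tests k (int r) l (convex hull K) (dyh (convex hull K))) L"
  shows "\<exists>\<beta>\<in>PPX k (int r) (convex hull C). (\<forall>x. bubble K x = 0 \<longrightarrow> \<beta> x = (\<lambda>ws vs. 0)) \<and>
    (\<forall>\<eta>\<in>face_tests k (int r) l (convex hull K) (dyh (convex hull K)). face_ip k l (convex hull K) \<beta> \<eta> = L \<eta>)"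
proof -
  let ?T = "convex hull C" and ?f = "convex hull K" and ?\<mu> = "face_measure l (convex hull K)"
  let ?\<tau> = "test_form (dyh ?f)"
  let ?I = "test_indices k l :: ('n set \<times> 'n) set"
  \<comment> \<open>The bubble of an \<open>l\<close>-dimensional face has degree
    \<open>l + 1\<close>, so its product with a polynomial of degree \<open>d\<close> stays within
    degree \<open>r\<close>.\<close>
  define d where "d = int r - (int l + 1)"
  have finK: "finite K" using K finite_sub by auto
  have fs: "full_support ?\<mu> ?f" and cf: "compact ?f" using face_full_support[OF K(1,2)] compact_hull[OF K(1)] by auto
  have "\<forall>p\<in>?I. \<exists>Q. Q \<in> Pol d \<and> (\<forall>u\<in>PP d ?f. (\<integral>x. bubble K x * Q x * u x \<partial>?\<mu>) = L (\<lambda>x ws vs. u x * ?\<tau> p ws vs))"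
  proof
    fix p assume p: "p \<in> ?I"
    have tst: "(\<lambda>x ws vs. u x * ?\<tau> p ws vs) \<in> face_tests k (int r) l ?f (dyh ?f)" if "u \<in> PP d ?f" for u
      using test_in_face_tests[OF p] that by (simp add: d_def)
    obtain q where q: "q \<in> PP d ?f" "\<And>u. u \<in> PP d ?f \<Longrightarrow>
        (\<integral>x. bubble K x * q x * u x \<partial>?\<mu>) = L (\<lambda>x ws vs. u x * ?\<tau> p ws vs)"
    proof -
      have "L (\<lambda>x ws vs. (u x + v x) * ?\<tau> p ws vs) = L (\<lambda>x ws vs. u x * ?\<tau> p ws vs) + L (\<lambda>x ws vs. v x * ?\<tau> p ws vs)"
        if "u \<in> PP d ?f" "v \<in> PP d ?f" for u v
      proof -
        have eq: "(\<lambda>x ws vs. (u x + v x) * ?\<tau> p ws vs) = (\<lambda>x ws vs. 1 * (u x * ?\<tau> p ws vs) + 1 * (v x * ?\<tau> p ws vs))"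
          by (intro ext) (simp add: distrib_right)
        show ?thesis unfolding eq linear_functional_lin[OF L tst[OF that(1)] tst[OF that(2)]] by simp
      qed
      moreover have "L (\<lambda>x ws vs. (c * u x) * ?\<tau> p ws vs) = c * L (\<lambda>x ws vs. u x * ?\<tau> p ws vs)"
        if "u \<in> PP d ?f" for c u
      proof -
        have eq: "(\<lambda>x ws vs. (c * u x) * ?\<tau> p ws vs) = (\<lambda>x ws vs. c * (u x * ?\<tau> p ws vs) + 0 * (u x * ?\<tau> p ws vs))"
          by (intro ext) simp
        show ?thesis unfolding eq linear_functional_lin[OF L tst[OF that] tst[OF that]] by simp
      qed
      ultimately show ?thesis
        using bubble_riesz[OF K(1,2), of d "\<lambda>u. L (\<lambda>x ws vs. u x * ?\<tau> p ws vs)"] that by blast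
    qed
    \<comment> \<open>The correction is a field on the whole cell, so the polynomial behind the
      restriction \<open>q\<close> is kept.\<close>
    obtain Q where Q: "Q \<in> Pol d" "q = (\<lambda>x. if x \<in> ?f then Q x else 0)" using q(1) by (auto simp: PP_iff)
    have "(\<integral>x. bubble K x * Q x * u x \<partial>?\<mu>) = (\<integral>x. bubble K x * q x * u x \<partial>?\<mu>)" for u
      using fs Q(2) by (intro Bochner_Integration.integral_cong) (auto simp: full_support_def)
    then show "\<exists>Q. Q \<in> Pol d \<and> (\<forall>u\<in>PP d ?f. (\<integral>x. bubble K x * Q x * u x \<partial>?\<mu>) = L (\<lambda>x ws vs. u x * ?\<tau> p ws vs))"
      using Q(1) q(2) by auto
  qed
  from bchoice[OF this] obtain Q where Q: "\<And>p. p \<in> ?I \<Longrightarrow> Q p \<in> Pol d" and Qint: "\<And>p u. p \<in> ?I \<Longrightarrow> u \<in> PP d ?f \<Longrightarrow>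
      (\<integral>x. bubble K x * Q p x * u x \<partial>?\<mu>) = L (\<lambda>x ws vs. u x * ?\<tau> p ws vs)"
    by blast
  have "\<forall>p. \<exists>E\<in>XX k. \<forall>\<sigma> i. free_index k (\<sigma>, i) \<longrightarrow> basis_coef (z ?f) E \<sigma> i = (if (\<sigma>, i) = p then 1 else 0)"
    by (intro allI exists_with_free_coefs[OF dual[OF K(1,2,4)] k(1) k_le])
  then obtain E where E: "\<And>p. E p \<in> XX k" and Ec: "\<And>p \<sigma> i. free_index k (\<sigma>, i) \<Longrightarrow>
      basis_coef (z ?f) (E p) \<sigma> i = (if (\<sigma>, i) = p then 1 else 0)"
    by metis
  define \<beta> where "\<beta> = (\<lambda>x ws vs. if x \<in> ?T then \<Sum>p\<in>?I. (bubble K x * Q p x) * E p ws vs else 0)"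
  have bQ: "(\<lambda>x. bubble K x * Q p x) \<in> Pol (int r)" if "p \<in> ?I" for p
    using bubble_mult_Pol[OF finK Q[OF that]] K(2) by (simp add: d_def)
  have \<beta>XX: "\<beta> x \<in> XX k" for x
    unfolding \<beta>_def by (cases "x \<in> ?T") (simp_all add: XX_zero XX_lincomb[OF _ E])
  have "(\<lambda>x. \<beta> x ws vs) \<in> PP (int r) ?T" for ws vs
  proof -
    have "(\<lambda>x. \<Sum>p\<in>?I. E p ws vs * (bubble K x * Q p x)) \<in> Pol (int r)"
      by (intro Pol_sum Pol_scale bQ)
    from PP_I[OF this, of ?T] show ?thesis
      by (rule back_subst[where P = "\<lambda>h. h \<in> PP (int r) ?T"]) (auto simp: \<beta>_def mult.commute intro!: sum.cong)
  qed
  then have "\<beta> \<in> PPX k (int r) ?T" using \<beta>XX by (simp add: PPX_def)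
  moreover have "\<beta> x = (\<lambda>ws vs. 0)" if "bubble K x = 0" for x
    using that by (auto simp: \<beta>_def fun_eq_iff)
  moreover have "face_ip k l ?f \<beta> \<eta> = L \<eta>" if \<eta>: "\<eta> \<in> face_tests k (int r) l ?f (dyh ?f)" for \<eta>
  proof -
    obtain q where q: "\<And>p. q p \<in> PP d ?f" "\<eta> = (\<lambda>x ws vs. \<Sum>p\<in>?I. q p x * ?\<tau> p ws vs)"
      using \<eta> unfolding face_tests_iff d_def by blast
    have coefs: "basis_coef (z ?f) (\<beta> x) (fst p) (snd p) = bubble K x * Q p x" if x: "x \<in> ?f" and p: "p \<in> ?I" for x p
    proof -
      have "x \<in> ?T" using x sub_hull[OF K(1)] by auto
      then have "basis_coef (z ?f) (\<beta> x) (fst p) (snd p) =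
          (\<Sum>p'\<in>?I. (bubble K x * Q p' x) * basis_coef (z ?f) (E p') (fst p) (snd p))"
        by (simp add: \<beta>_def basis_coef_sum)
      also have "\<dots> = (\<Sum>p'\<in>?I. if p' = p then bubble K x * Q p x else 0)"
        using p by (intro sum.cong) (auto simp: Ec test_indices_def)
      finally show ?thesis using p by simp
    qed
    have "face_ip k l ?f \<beta> \<eta> = (\<integral>x. (\<Sum>p\<in>?I. q p x * basis_coef (z ?f) (\<beta> x) (fst p) (snd p)) \<partial>?\<mu>)"
      unfolding q(2) by (rule face_ip_test[OF K(1,2,4) \<beta>XX])
    also have "\<dots> = (\<integral>x. (\<Sum>p\<in>?I. bubble K x * Q p x * q p x) \<partial>?\<mu>)"
      using fs coefs by (intro Bochner_Integration.integral_cong sum.cong) (auto simp: full_support_def mult_ac)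
    also have "\<dots> = (\<Sum>p\<in>?I. \<integral>x. bubble K x * Q p x * q p x \<partial>?\<mu>)"
      using q(1) Pol_continuous[OF Q]
      by (intro Bochner_Integration.integral_sum integrable_cont_ext[OF fs cf] cont_ext_mult
          cont_ext_continuous[OF bubble_continuous] cont_ext_continuous cont_ext_PP[OF q(1)]) auto
    also have "\<dots> = (\<Sum>p\<in>?I. L (\<lambda>x ws vs. q p x * ?\<tau> p ws vs))"
      using Qint q(1) by (intro sum.cong) auto
    also have "\<dots> = L \<eta>"
      unfolding q(2) using q(1) by (intro linear_functional_tests_sum[OF L, symmetric]) (simp add: d_def)
    finally show ?thesis .
  qed
  ultimately show ?thesis by blast
qed

lemma subsimplex_cases:
  assumes "f \<in> subsimplices l (convex hull C)"
  obtains K where "K \<subseteq> C" "card K = Suc l" "f = convex hull K"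
  using assms unfolding subsimplices_hull by blast

lemma vertex_iff: "{v} \<in> subsimplices 0 (convex hull C) \<longleftrightarrow> v \<in> C"
proof
  assume "{v} \<in> subsimplices 0 (convex hull C)"
  then obtain K where "K \<subseteq> C" "card K = Suc 0" "{v} = convex hull K" by (rule subsimplex_cases)
  then show "v \<in> C" by (auto simp: card_Suc_eq)
next
  assume "v \<in> C"
  then show "{v} \<in> subsimplices 0 (convex hull C)"
    unfolding subsimplices_hull by (auto intro!: exI[of _ "{v}"])
qed

text \<open>Linear interpolation, admissible because \<open>r\<close> is at least 1.\<close>

lemma vertex_interpolation:
  assumes c: "\<And>v. v \<in> C \<Longrightarrow> c v \<in> XX k"
  shows "\<exists>\<omega>\<in>PPX k (int r) (convex hull C). \<forall>v\<in>C. \<omega> v = c v"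
proof (intro bexI ballI)
  let ?T = "convex hull C"
  define \<omega> where "\<omega> = (\<lambda>x ws vs. if x \<in> ?T then \<Sum>v\<in>C. lam v x * c v ws vs else 0)"
  have "\<omega> x \<in> XX k" for x
    unfolding \<omega>_def by (cases "x \<in> ?T") (simp_all add: XX_zero XX_lincomb[OF finite_C c])
  moreover have "(\<lambda>x. \<omega> x ws vs) \<in> PP (int r) ?T" for ws vs
  proof -
    have "(\<lambda>x. lam v x) \<in> Pol (int r)" for v
      using Pol_mono[OF Pol_mult_affine[OF Pol_const[of 0 1], of "a v" "g v"], of "int r"] r by (simp add: lam_def)
    then have "(\<lambda>x. \<Sum>v\<in>C. c v ws vs * lam v x) \<in> Pol (int r)" by (intro Pol_sum Pol_scale)
    from PP_I[OF this, of ?T] show ?thesis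
      by (rule back_subst[where P = "\<lambda>h. h \<in> PP (int r) ?T"]) (auto simp: \<omega>_def mult.commute intro!: sum.cong)
  qed
  ultimately show "\<omega> \<in> PPX k (int r) ?T" by (simp add: PPX_def)
  fix v assume v: "v \<in> C"
  then have "v \<in> ?T" by (rule hull_inc)
  have "(\<Sum>u\<in>C. lam u v * c u ws vs) = (\<Sum>u\<in>C. if u = v then c v ws vs else 0)" for ws vs
    using v by (intro sum.cong) (auto simp: lam_vertex)
  then show "\<omega> v = c v" using v \<open>v \<in> ?T\<close> finite_C by (simp add: \<omega>_def)
qed

text \<open>Induction on the dimension \<open>m\<close>. The correction of a face vanishes on all
  faces of smaller dimension and on the others of its own dimension, since none of these contains
  it; so the values already fixed survive and the new corrections do not interact.\<close>

lemma face_interpolation: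
  assumes c: "\<And>v. v \<in> C \<Longrightarrow> c v \<in> XX k"
    and L: "\<And>l K. 1 \<le> l \<Longrightarrow> l \<le> CARD('n) - 1 \<Longrightarrow> K \<subseteq> C \<Longrightarrow> card K = Suc l \<Longrightarrow>
      linear_functional_on (face_tests k (int r) l (convex hull K) (dyh (convex hull K))) (L (convex hull K))"
    and "m \<le> CARD('n) - 1"
  shows "\<exists>\<omega>\<in>PPX k (int r) (convex hull C). (\<forall>v\<in>C. \<omega> v = c v) \<and>
    (\<forall>l K \<eta>. 1 \<le> l \<and> l \<le> m \<and> K \<subseteq> C \<and> card K = Suc l \<and>
      \<eta> \<in> face_tests k (int r) l (convex hull K) (dyh (convex hull K)) \<longrightarrow>
      face_ip k l (convex hull K) \<omega> \<eta> = L (convex hull K) \<eta>)"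
  using assms(3)
proof (induction m)
  case 0
  then show ?case using vertex_interpolation[OF c] by auto
next
  case (Suc m)
  then obtain \<omega> where \<omega>: "\<omega> \<in> PPX k (int r) (convex hull C)" and \<omega>v: "\<And>v. v \<in> C \<Longrightarrow> \<omega> v = c v"
    and \<omega>f: "\<And>l K \<eta>. 1 \<le> l \<Longrightarrow> l \<le> m \<Longrightarrow> K \<subseteq> C \<Longrightarrow> card K = Suc l \<Longrightarrow>
      \<eta> \<in> face_tests k (int r) l (convex hull K) (dyh (convex hull K)) \<Longrightarrow>
      face_ip k l (convex hull K) \<omega> \<eta> = L (convex hull K) \<eta>"
    by fastforce
  let ?F = "{K. K \<subseteq> C \<and> card K = Suc (Suc m)}"
  have finF: "finite ?F" using finite_C by simp
  let ?l = "Suc m"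
  have l: "1 \<le> ?l" "?l \<le> CARD('n) - 1" using Suc.prems by auto
  \<comment> \<open>Each correction is to supply the residual that the field built so far leaves on
    its face.\<close>
  have "\<forall>K\<in>?F. \<exists>\<beta>. \<beta> \<in> PPX k (int r) (convex hull C) \<and> (\<forall>x. bubble K x = 0 \<longrightarrow> \<beta> x = (\<lambda>ws vs. 0)) \<and>
      (\<forall>\<eta>\<in>face_tests k (int r) ?l (convex hull K) (dyh (convex hull K)).
        face_ip k ?l (convex hull K) \<beta> \<eta> = L (convex hull K) \<eta> - face_ip k ?l (convex hull K) \<omega> \<eta>)"
  proof
    fix K assume "K \<in> ?F"
    then have K: "K \<subseteq> C" "card K = Suc ?l" by auto
    have "linear_functional_on (face_tests k (int r) ?l (convex hull K) (dyh (convex hull K)))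
        (\<lambda>\<eta>. L (convex hull K) \<eta> - face_ip k ?l (convex hull K) \<omega> \<eta>)"
      unfolding linear_functional_on_def
    proof (intro ballI allI)
      fix \<eta> \<zeta> s t
      assume \<eta>: "\<eta> \<in> face_tests k (int r) ?l (convex hull K) (dyh (convex hull K))"
        and \<zeta>: "\<zeta> \<in> face_tests k (int r) ?l (convex hull K) (dyh (convex hull K))"
      have "integrable (face_measure ?l (convex hull K)) (\<lambda>x. Alt2_inner k (CARD('n) - 1) (\<omega> x) (\<eta> x))"
        if "\<eta> \<in> face_tests k (int r) ?l (convex hull K) (dyh (convex hull K))" for \<eta>
      proof -
        obtain q where q: "\<And>p. q p \<in> PP (int r - (int ?l + 1)) (convex hull K)"
          "\<eta> = (\<lambda>x ws vs. \<Sum>p\<in>test_indices k ?l. q p x * test_form (dyh (convex hull K)) p ws vs)"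
          using \<open>\<eta> \<in> _\<close> unfolding face_tests_iff by blast
        show ?thesis
          unfolding q(2) Alt2_inner_test[OF PPX_XX[OF \<omega>] dyh[OF K l(2)]]
          by (intro integrable_cont_ext[OF face_full_support[OF K] compact_hull[OF K(1)]] cont_ext_sum
              cont_ext_mult cont_ext_PP[OF q(1)] cont_ext_PP[OF basis_coef_PP[OF \<omega>]] sub_hull[OF K(1)]) auto
      qed
      from this[OF \<eta>] this[OF \<zeta>]
      have "face_ip k ?l (convex hull K) \<omega> (\<lambda>x ws vs. s * \<eta> x ws vs + t * \<zeta> x ws vs) =
          s * face_ip k ?l (convex hull K) \<omega> \<eta> + t * face_ip k ?l (convex hull K) \<omega> \<zeta>"
        by (simp add: face_ip_def Alt2_inner_lin_right)
      then show "L (convex hull K) (\<lambda>x ws vs. s * \<eta> x ws vs + t * \<zeta> x ws vs) -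
          face_ip k ?l (convex hull K) \<omega> (\<lambda>x ws vs. s * \<eta> x ws vs + t * \<zeta> x ws vs) =
          s * (L (convex hull K) \<eta> - face_ip k ?l (convex hull K) \<omega> \<eta>) +
          t * (L (convex hull K) \<zeta> - face_ip k ?l (convex hull K) \<omega> \<zeta>)"
        using linear_functional_lin[OF L[OF l K] \<eta> \<zeta>] by (simp add: algebra_simps)
    qed
    from face_correction[OF K l this]
    show "\<exists>\<beta>. \<beta> \<in> PPX k (int r) (convex hull C) \<and> (\<forall>x. bubble K x = 0 \<longrightarrow> \<beta> x = (\<lambda>ws vs. 0)) \<and>
      (\<forall>\<eta>\<in>face_tests k (int r) ?l (convex hull K) (dyh (convex hull K)).
        face_ip k ?l (convex hull K) \<beta> \<eta> = L (convex hull K) \<eta> - face_ip k ?l (convex hull K) \<omega> \<eta>)" by blast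
  qed
  from bchoice[OF this] obtain \<beta> where \<beta>: "\<And>K. K \<in> ?F \<Longrightarrow> \<beta> K \<in> PPX k (int r) (convex hull C)"
    and \<beta>0: "\<And>K x. K \<in> ?F \<Longrightarrow> bubble K x = 0 \<Longrightarrow> \<beta> K x = (\<lambda>ws vs. 0)"
    and \<beta>f: "\<And>K \<eta>. K \<in> ?F \<Longrightarrow> \<eta> \<in> face_tests k (int r) ?l (convex hull K) (dyh (convex hull K)) \<Longrightarrow>
        face_ip k ?l (convex hull K) (\<beta> K) \<eta> = L (convex hull K) \<eta> - face_ip k ?l (convex hull K) \<omega> \<eta>"
    by blast
  have sumPPX: "(\<lambda>x ws vs. \<Sum>K\<in>I. \<beta> K x ws vs) \<in> PPX k (int r) (convex hull C)" if "finite I" "I \<subseteq> ?F" for I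
    using that
  proof (induction I rule: finite_induct)
    case (insert K I)
    then show ?case using PPX_lin[OF \<beta>[of K] insert.IH, of 1 1] by simp
  qed (simp add: PPX_zero)
  define \<omega>' where "\<omega>' = (\<lambda>x ws vs. \<omega> x ws vs + (\<Sum>K\<in>?F. \<beta> K x ws vs))"
  have \<omega>': "\<omega>' \<in> PPX k (int r) (convex hull C)"
    using PPX_lin[OF \<omega> sumPPX[OF finF subset_refl], of 1 1] by (simp add: \<omega>'_def)
  have \<beta>_other: "\<beta> K x = (\<lambda>ws vs. 0)"
    if "K \<in> ?F" "M \<subseteq> C" "card M \<le> Suc (Suc m)" "K \<noteq> M" "x \<in> convex hull M" for K M x
  proof (rule \<beta>0[OF that(1)], rule bubble_zero_on_face[of K M])
    show "\<not> K \<subseteq> M"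
    proof
      assume "K \<subseteq> M"
      then have "K = M" using that finite_sub[of M] by (intro card_seteq) auto
      then show False using that by simp
    qed
  qed (use that in auto)
  have on_lower: "\<omega>' x = \<omega> x" if "M \<subseteq> C" "card M \<le> Suc m" "x \<in> convex hull M" for M x
  proof -
    have "\<beta> K x = (\<lambda>ws vs. 0)" if "K \<in> ?F" for K
      using \<open>card M \<le> Suc m\<close> that by (intro \<beta>_other[OF that \<open>M \<subseteq> C\<close> _ _ \<open>x \<in> convex hull M\<close>]) auto
    then show ?thesis by (simp add: \<omega>'_def)
  qed
  have on_face: "\<omega>' x = (\<lambda>ws vs. 1 * \<omega> x ws vs + 1 * \<beta> M x ws vs)" if M: "M \<in> ?F" "x \<in> convex hull M" for M x
  proof (intro ext)
    fix ws vs
    have "(\<Sum>K\<in>?F. \<beta> K x ws vs) = (\<Sum>K\<in>?F. if K = M then \<beta> M x ws vs else 0)"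
      using \<beta>_other[of _ M x] M by (intro sum.cong) auto
    then show "\<omega>' x ws vs = 1 * \<omega> x ws vs + 1 * \<beta> M x ws vs" using M finF by (simp add: \<omega>'_def)
  qed
  show ?case
  proof (intro bexI[OF _ \<omega>'] conjI ballI allI impI)
    fix v assume v: "v \<in> C"
    then show "\<omega>' v = c v" using on_lower[of "{v}" v] \<omega>v by simp
  next
    fix l K \<eta>
    assume *: "1 \<le> l \<and> l \<le> Suc m \<and> K \<subseteq> C \<and> card K = Suc l \<and>
      \<eta> \<in> face_tests k (int r) l (convex hull K) (dyh (convex hull K))"
    then have K: "K \<subseteq> C" "card K = Suc l" by auto
    show "face_ip k l (convex hull K) \<omega>' \<eta> = L (convex hull K) \<eta>"
    proof (cases "l \<le> m")
      case True
      then have "face_ip k l (convex hull K) \<omega>' \<eta> = face_ip k l (convex hull K) \<omega> \<eta>"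
        using on_lower[of K] K by (intro face_ip_cong face_full_support[OF K]) auto
      then show ?thesis using \<omega>f[of l K \<eta>] * True by simp
    next
      case False
      then have l_eq: "l = Suc m" using * by simp
      then have KF: "K \<in> ?F" using K by simp
      have "face_ip k l (convex hull K) \<omega>' \<eta> =
          face_ip k l (convex hull K) (\<lambda>x ws vs. 1 * \<omega> x ws vs + 1 * \<beta> K x ws vs) \<eta>"
        using on_face[OF KF] by (intro face_ip_cong face_full_support[OF K])
      also have "\<dots> = 1 * face_ip k l (convex hull K) \<omega> \<eta> + 1 * face_ip k l (convex hull K) (\<beta> K) \<eta>"
        using * l l_eq by (intro face_ip_lin[OF K _ \<omega> \<beta>[OF KF] sub_hull[OF K(1)]]) auto
      also have "\<dots> = L (convex hull K) \<eta>" using \<beta>f[OF KF] * l_eq by simp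
      finally show ?thesis .
    qed
  qed
qed

text \<open>By \<open>normal_expand\<close> a normal of a face combines gradients \<open>g v\<close>
  with \<open>v\<close> outside it, and each \<open>g v\<close> is normal to a facet containing the
  face, where the trace vanishes.\<close>

lemma bubble_normal_trace:
  assumes \<beta>: "\<beta> \<in> BB_div k (int r) (convex hull C)"
    and L: "L \<subseteq> C" "L \<noteq> {}" and \<nu>: "\<And>u. u \<in> tangent_space (convex hull L) \<Longrightarrow> \<nu> \<bullet> u = 0"
    and x: "x \<in> convex hull L" and \<sigma>: "card \<sigma> = k"
  shows "row_trace k (\<beta> x) \<sigma> \<nu> = 0"
proof -
  obtain c where c: "\<nu> = (\<Sum>v\<in>C - L. c v *\<^sub>R g v)"
    using normal_expand[OF L, of \<nu>] tangent_space_hull[OF L(1), of \<nu>] \<nu> by blast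
  have "row_trace k (\<beta> x) \<sigma> (g v) = 0" if v: "v \<in> C - L" for v
  proof -
    let ?F = "convex hull (C - {v})"
    have F: "?F \<in> subsimplices (CARD('n) - 1) (convex hull C)"
      unfolding subsimplices_hull using v card_C finite_C by (auto intro!: exI[of _ "C - {v}"])
    have xF: "x \<in> ?F" using x v L(1) hull_mono[of L "C - {v}" convex] by auto
    have "unit_normal ?F (g v /\<^sub>R norm (g v))"
      unfolding unit_normal_def using grad_nonzero[of v] grad_normal[of "C - {v}" v] v by auto
    then have "row_trace k (\<beta> x) \<sigma> (g v /\<^sub>R norm (g v)) = 0"
      using \<beta> F xF \<sigma> by (auto simp: BB_div_def div_trace_eq)
    then have "inverse (norm (g v)) * row_trace k (\<beta> x) \<sigma> (g v) = 0"
      by (simp add: linear_scale[OF row_trace_linear])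
    then show ?thesis using grad_nonzero[of v] v by simp
  qed
  then show ?thesis unfolding c by (simp add: linear_sum[OF row_trace_linear] linear_scale[OF row_trace_linear])
qed

text \<open>At a vertex the tangent space is zero, so every axis direction is normal and all
  coefficients vanish.\<close>

lemma bubble_vertex:
  assumes \<beta>: "\<beta> \<in> BB_div k (int r) (convex hull C)" and v: "v \<in> C"
  shows "\<beta> v = (\<lambda>ws vs. 0)"
proof (rule coefs_zero_imp_zero)
  have XX: "\<beta> v \<in> XX k" using \<beta> PPX_XX by (auto simp: BB_div_def)
  show "(\<lambda>ws. \<beta> v ws vs) \<in> Alt k" "\<beta> v ws \<in> Alt (CARD('n) - 1)" for ws vs
    using XX_slices[OF XX] by auto
  fix \<sigma> :: "'n set" and i assume \<sigma>: "card \<sigma> = k"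
  have "axis i 1 \<bullet> u = 0" if "u \<in> tangent_space (convex hull {v})" for u
    using that by (auto simp: tangent_space_def)
  then have "row_trace k (\<beta> v) \<sigma> (axis i 1) = 0"
    using v by (intro bubble_normal_trace[OF \<beta>, of "{v}" "axis i 1" v \<sigma>]) (simp_all add: \<sigma>)
  moreover have "row_trace k (\<beta> v) \<sigma> (axis i 1) = (\<Sum>j\<in>UNIV. if j = i then coef k (\<beta> v) \<sigma> i else 0)"
    unfolding row_trace_def by (intro sum.cong) (auto simp: axis_def)
  ultimately show "coef k (\<beta> v) \<sigma> i = 0" by simp
qed

text \<open>The tested coefficients are governed by normal traces. Interior corrections thus leave
  the face degrees of freedom unchanged.\<close>

lemma bubble_face_dofs:
  assumes \<beta>: "\<beta> \<in> BB_div k (int r) (convex hull C)"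
    and K: "K \<subseteq> C" "card K = Suc l" "l \<le> CARD('n) - 1"
    and \<eta>: "\<eta> \<in> face_tests k d l (convex hull K) (dyh (convex hull K))"
  shows "face_ip k l (convex hull K) \<beta> \<eta> = 0"
proof -
  let ?f = "convex hull K"
  have XX: "\<beta> x \<in> XX k" for x using \<beta> PPX_XX by (auto simp: BB_div_def)
  obtain q where q: "\<eta> = (\<lambda>x ws vs. \<Sum>p\<in>test_indices k l. q p x * test_form (dyh ?f) p ws vs)"
    using \<eta> unfolding face_tests_iff by blast
  have "basis_coef (z ?f) (\<beta> x) (fst p) (snd p) = 0" if x: "x \<in> ?f" and p: "p \<in> test_indices k l" for x p
  proof -
    have "y ?f (snd p) \<bullet> u = 0" if "u \<in> tangent_space ?f" for u
      using tn[OF K] p that by (auto simp: tn_basis_def test_indices_def)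
    then have "\<forall>\<sigma>. card \<sigma> = k \<longrightarrow> row_trace k (\<beta> x) \<sigma> (y ?f (snd p)) = 0"
      using K x by (intro allI impI bubble_normal_trace[OF \<beta>, of K]) auto
    then show ?thesis using normal_coefs_zero_iff[OF K XX] test_index_card[OF p] by blast
  qed
  then have "(\<integral>x. (\<Sum>p\<in>test_indices k l. q p x * basis_coef (z ?f) (\<beta> x) (fst p) (snd p)) \<partial>face_measure l ?f) =
      (\<integral>x. 0 \<partial>face_measure l ?f)"
    using face_full_support[OF K(1,2)]
    by (intro Bochner_Integration.integral_cong) (auto simp: full_support_def)
  then show ?thesis unfolding q by (simp add: face_ip_test[OF K XX])
qed

section \<open>The interior degrees of freedom\<close>

lemma cell_integrable:
  assumes "\<omega> \<in> PPX k d (convex hull C)" "\<eta> \<in> PPX k e (convex hull C)"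
  shows "cont_ext (convex hull C) (\<lambda>x. Alt2_inner k (CARD('n) - 1) (\<omega> x) (\<eta> x))"
    and "integrable (lebesgue_on (convex hull C)) (\<lambda>x. Alt2_inner k (CARD('n) - 1) (\<omega> x) (\<eta> x))"
proof -
  show "cont_ext (convex hull C) (\<lambda>x. Alt2_inner k (CARD('n) - 1) (\<omega> x) (\<eta> x))"
    unfolding Alt2_inner_def
    by (intro cont_ext_sum cont_ext_mult cont_ext_PP[OF PPX_PP[OF assms(1)]] cont_ext_PP[OF PPX_PP[OF assms(2)]] subset_refl)
  then show "integrable (lebesgue_on (convex hull C)) (\<lambda>x. Alt2_inner k (CARD('n) - 1) (\<omega> x) (\<eta> x))"
    by (intro integrable_cont_ext[OF full_support_cell compact_hull]) auto
qed

lemma cell_ip_sym: "cell_ip k T \<omega> \<eta> = cell_ip k T \<eta> \<omega>"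
  by (simp add: cell_ip_def Alt2_inner_sym)

lemma cell_ip_lin:
  assumes "\<omega> \<in> PPX k d (convex hull C)" "\<zeta> \<in> PPX k d (convex hull C)" "\<eta> \<in> PPX k e (convex hull C)"
  shows "cell_ip k (convex hull C) (\<lambda>x ws vs. s * \<omega> x ws vs + t * \<zeta> x ws vs) \<eta> =
    s * cell_ip k (convex hull C) \<omega> \<eta> + t * cell_ip k (convex hull C) \<zeta> \<eta>"
  using cell_integrable(2)[OF assms(1,3)] cell_integrable(2)[OF assms(2,3)]
  by (simp add: cell_ip_def Alt2_inner_lin_left)

lemma cell_ip_self_zero:
  assumes \<omega>: "\<omega> \<in> PPX k d (convex hull C)" and zero: "cell_ip k (convex hull C) \<omega> \<omega> = 0"
  shows "\<omega> = (\<lambda>x ws vs. 0)"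
proof
  fix x
  show "\<omega> x = (\<lambda>ws vs. 0)"
  proof (cases "x \<in> convex hull C")
    case True
    have "Alt2_inner k (CARD('n) - 1) (\<omega> x) (\<omega> x) = 0"
      by (rule integral_zero_cont_ext[OF full_support_cell compact_hull[OF subset_refl] cell_integrable(1)[OF \<omega> \<omega>] _
            zero[unfolded cell_ip_def] True]) (auto simp: Alt2_inner_def intro!: sum_nonneg)
    then show ?thesis using PPX_XX[OF \<omega>, of x] by (intro Alt2_inner_self_zero) (auto simp: XX_def)
  qed (rule PPX_outside[OF \<omega>])
qed

lemma BB_lin:
  assumes "\<omega> \<in> BB_div k d T" "\<zeta> \<in> BB_div k d T"
  shows "(\<lambda>x ws vs. s * \<omega> x ws vs + t * \<zeta> x ws vs) \<in> BB_div k d T"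
proof -
  have "div_trace k \<nu> (\<lambda>x ws vs. s * \<omega> x ws vs + t * \<zeta> x ws vs) x \<sigma> =
      s * div_trace k \<nu> \<omega> x \<sigma> + t * div_trace k \<nu> \<zeta> x \<sigma>" for \<nu> x \<sigma>
    by (simp add: div_trace_def coef_def Alt2_inner_lin_left algebra_simps sum.distrib sum_distrib_left)
  then show ?thesis using assms PPX_lin by (auto simp: BB_div_def)
qed

text \<open>\<open>BB_div\<close> is both trial and test space, and the cell inner product is
  definite on it.\<close>

lemma cell_riesz:
  assumes M: "linear_functional_on (BB_div k (int r) (convex hull C)) M"
  shows "\<exists>\<beta>\<in>BB_div k (int r) (convex hull C). \<forall>\<eta>\<in>BB_div k (int r) (convex hull C).
    cell_ip k (convex hull C) \<beta> \<eta> = M \<eta>"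
proof -
  let ?T = "convex hull C" and ?B = "BB_div k (int r) (convex hull C)"
  have sub: "?B \<subseteq> PPX k (int r) ?T" by (auto simp: BB_div_def)
  obtain G where G: "finite G" "PPX k (int r) ?T \<subseteq> form_fields.span G" using PPX_finite_span by blast
  have BG: "?B \<subseteq> form_fields.span G" using sub G(2) by blast
  have zero: "(\<lambda>x ws vs. 0) \<in> ?B" by (simp add: BB_div_def PPX_zero div_trace_def)
  have add: "\<omega> + \<zeta> = (\<lambda>x ws vs. 1 * \<omega> x ws vs + 1 * \<zeta> x ws vs)" for \<omega> \<zeta> :: "'n dform_field"
    by (simp add: fun_eq_iff)
  have scale: "(\<lambda>x ws vs. c * \<omega> x ws vs) = (\<lambda>x ws vs. c * \<omega> x ws vs + 0 * \<omega> x ws vs)" for c and \<omega> :: "'n dform_field"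
    by (simp add: fun_eq_iff)
  have "form_fields.subspace ?B"
    unfolding form_fields.subspace_def
  proof (intro conjI ballI allI)
    show "0 \<in> ?B" using zero by (simp add: zero_fun_def)
    show "\<omega> + \<zeta> \<in> ?B" if "\<omega> \<in> ?B" "\<zeta> \<in> ?B" for \<omega> \<zeta> unfolding add by (rule BB_lin[OF that])
    show "(\<lambda>x ws vs. c * \<omega> x ws vs) \<in> ?B" if "\<omega> \<in> ?B" for c \<omega> unfolding scale by (rule BB_lin[OF that that])
  qed
  then show ?thesis
  proof (rule form_fields.riesz[OF _ BG G(1)])
    fix u v w assume "u \<in> ?B" "v \<in> ?B" "w \<in> ?B"
    then show "cell_ip k ?T (u + v) w = cell_ip k ?T u w + cell_ip k ?T v w"
      unfolding add using sub by (subst cell_ip_lin) auto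
  next
    fix c u w assume "u \<in> ?B" "w \<in> ?B"
    then show "cell_ip k ?T (\<lambda>x ws vs. c * u x ws vs) w = c * cell_ip k ?T u w"
      using sub cell_ip_lin[of u "int r" u w "int r" c 0] by auto
  next
    fix u w show "cell_ip k ?T u w = cell_ip k ?T w u" by (rule cell_ip_sym)
  next
    fix u assume "u \<in> ?B" "cell_ip k ?T u u = 0"
    then show "u = 0" using cell_ip_self_zero[of u "int r"] sub by (auto simp: zero_fun_def)
  next
    fix u v assume "u \<in> ?B" "v \<in> ?B"
    then show "M (u + v) = M u + M v" unfolding add by (subst linear_functional_lin[OF M]) auto
  next
    fix c u assume "u \<in> ?B"
    then show "M (\<lambda>x ws vs. c * u x ws vs) = c * M u" using linear_functional_lin[OF M, of u u c 0] by simp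
  qed
qed

text \<open>The traces vanish on every facet, so \<open>D\<close> belongs to \<open>BB_div\<close>
  and may be tested against itself.\<close>

lemma dofs_determine:
  assumes D: "D \<in> PPX k (int r) (convex hull C)"
    and vert: "\<And>v. v \<in> C \<Longrightarrow> D v = (\<lambda>ws vs. 0)"
    and dofs: "\<And>L l \<eta>. L \<subseteq> C \<Longrightarrow> card L = Suc l \<Longrightarrow> 1 \<le> l \<Longrightarrow> l \<le> CARD('n) - 1 \<Longrightarrow>
      \<eta> \<in> face_tests k (int r) l (convex hull L) (dyh (convex hull L)) \<Longrightarrow>
      face_ip k l (convex hull L) D \<eta> = 0"
    and cell: "\<And>\<eta>. \<eta> \<in> BB_div k (int r) (convex hull C) \<Longrightarrow> cell_ip k (convex hull C) D \<eta> = 0"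
  shows "D = (\<lambda>x ws vs. 0)"
proof -
  have "D \<in> BB_div k (int r) (convex hull C)"
    unfolding BB_div_def
  proof (intro CollectI conjI ballI allI impI D)
    fix F \<nu> x and \<sigma> :: "'n set"
    assume F: "F \<in> subsimplices (CARD('n) - 1) (convex hull C)" and \<nu>: "unit_normal F \<nu>"
      and x: "x \<in> F" and \<sigma>: "card \<sigma> = k"
    obtain K where K: "K \<subseteq> C" "card K = Suc (CARD('n) - 1)" "F = convex hull K"
      using F by (rule subsimplex_cases)
    \<comment> \<open>\<open>normal_trace_vanishes\<close> speaks of fields on a single face, hence
      the restriction to the facet.\<close>
    define D' where "D' = (\<lambda>x ws vs. if x \<in> convex hull K then D x ws vs else 0)"
    have D'_eq: "D' x = D x" if "x \<in> convex hull K" for x using that by (simp add: D'_def)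
    have "row_trace k (D' x) \<sigma> \<nu> = 0"
    proof (rule normal_trace_vanishes[OF K(1)])
      show "D' \<in> PPX k (int r) (convex hull K)" unfolding D'_def by (rule PPX_restrict[OF D sub_hull[OF K(1)]])
      show "D' v = (\<lambda>ws vs. 0)" if "v \<in> K" for v using D'_eq[of v] hull_inc[of v K] vert that K(1) by auto
      show "K \<subseteq> K" "K \<noteq> {}" "card K \<le> CARD('n)" "card \<sigma> = k" "x \<in> convex hull K"
        using K x \<sigma> by auto
      show "\<nu> \<bullet> u = 0" if "u \<in> tangent_space (convex hull K)" for u
        using \<nu> that K(3) by (simp add: unit_normal_def)
      fix L l \<eta>
      assume *: "L \<subseteq> K" "card L = Suc l" "1 \<le> l" "l \<le> CARD('n) - 1"
        "\<eta> \<in> face_tests k (int r) l (convex hull L) (dyh (convex hull L))"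
      have "face_ip k l (convex hull L) D' \<eta> = face_ip k l (convex hull L) D \<eta>"
        using * K(1) hull_mono[OF *(1), of convex] D'_eq by (intro face_ip_cong face_full_support) auto
      then show "face_ip k l (convex hull L) D' \<eta> = 0" using dofs * K(1) by auto
    qed
    then show "div_trace k \<nu> D x \<sigma> = 0" using D'_eq x K(3) by (simp add: div_trace_eq)
  qed
  then show ?thesis using cell_ip_self_zero[OF D] cell by blast
qed

theorem unisolvent: "unisolvent k (int r) dyh (convex hull C)"
  unfolding unisolvent_def
proof (intro allI impI, elim conjE)
  let ?T = "convex hull C"
  fix c :: "'n euc \<Rightarrow> 'n dform" and L M
  assume c: "\<forall>v. {v} \<in> subsimplices 0 ?T \<longrightarrow> c v \<in> XX k"
    and L: "\<forall>l\<in>{1..CARD('n) - 1}. \<forall>f\<in>subsimplices l ?T. linear_functional_on (face_tests k (int r) l f (dyh f)) (L f)"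
    and M: "linear_functional_on (BB_div k (int r) ?T) M"
  have face: "convex hull K \<in> subsimplices l ?T" if "K \<subseteq> C" "card K = Suc l" for K l
    using that unfolding subsimplices_hull by auto
  obtain \<omega> where \<omega>: "\<omega> \<in> PPX k (int r) ?T" and \<omega>v: "\<And>v. v \<in> C \<Longrightarrow> \<omega> v = c v"
    and \<omega>f: "\<And>l K \<eta>. 1 \<le> l \<Longrightarrow> l \<le> CARD('n) - 1 \<Longrightarrow> K \<subseteq> C \<Longrightarrow> card K = Suc l \<Longrightarrow>
      \<eta> \<in> face_tests k (int r) l (convex hull K) (dyh (convex hull K)) \<Longrightarrow>
      face_ip k l (convex hull K) \<omega> \<eta> = L (convex hull K) \<eta>"
    using face_interpolation[of c L "CARD('n) - 1"] c L face by (fastforce simp: vertex_iff)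
  \<comment> \<open>The interior correction has to supply what the face part \<omega> leaves of
    \<open>M\<close>.\<close>
  have "linear_functional_on (BB_div k (int r) ?T) (\<lambda>\<eta>. M \<eta> - cell_ip k ?T \<omega> \<eta>)"
    unfolding linear_functional_on_def
  proof (intro ballI allI)
    fix \<eta> \<zeta> s t assume \<eta>: "\<eta> \<in> BB_div k (int r) ?T" and \<zeta>: "\<zeta> \<in> BB_div k (int r) ?T"
    then have "cell_ip k ?T (\<lambda>x ws vs. s * \<eta> x ws vs + t * \<zeta> x ws vs) \<omega> = s * cell_ip k ?T \<eta> \<omega> + t * cell_ip k ?T \<zeta> \<omega>"
      using \<omega> by (intro cell_ip_lin) (auto simp: BB_div_def)
    then show "M (\<lambda>x ws vs. s * \<eta> x ws vs + t * \<zeta> x ws vs) - cell_ip k ?T \<omega> (\<lambda>x ws vs. s * \<eta> x ws vs + t * \<zeta> x ws vs) =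
        s * (M \<eta> - cell_ip k ?T \<omega> \<eta>) + t * (M \<zeta> - cell_ip k ?T \<omega> \<zeta>)"
      using linear_functional_lin[OF M \<eta> \<zeta>] by (simp add: cell_ip_sym[of ?T \<omega>] algebra_simps)
  qed
  from cell_riesz[OF this] obtain \<beta> where \<beta>: "\<beta> \<in> BB_div k (int r) ?T"
    and \<beta>c: "\<And>\<eta>. \<eta> \<in> BB_div k (int r) ?T \<Longrightarrow> cell_ip k ?T \<beta> \<eta> = M \<eta> - cell_ip k ?T \<omega> \<eta>" by blast
  have \<beta>P: "\<beta> \<in> PPX k (int r) ?T" using \<beta> by (simp add: BB_div_def)
  define \<omega>' where "\<omega>' = (\<lambda>x ws vs. 1 * \<omega> x ws vs + 1 * \<beta> x ws vs)"
  let ?dofs = "\<lambda>\<omega>. \<omega> \<in> PPX k (int r) ?T \<and> (\<forall>v. {v} \<in> subsimplices 0 ?T \<longrightarrow> \<omega> v = c v) \<and>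
    (\<forall>l\<in>{1..CARD('n) - 1}. \<forall>f\<in>subsimplices l ?T. \<forall>\<eta>\<in>face_tests k (int r) l f (dyh f). face_ip k l f \<omega> \<eta> = L f \<eta>) \<and>
    (\<forall>\<eta>\<in>BB_div k (int r) ?T. cell_ip k ?T \<omega> \<eta> = M \<eta>)"
  show "\<exists>!\<omega>. ?dofs \<omega>"
  proof (rule ex1I[of _ \<omega>'])
    show "?dofs \<omega>'"
    proof (intro conjI allI impI ballI)
      show "\<omega>' \<in> PPX k (int r) ?T" unfolding \<omega>'_def by (rule PPX_lin[OF \<omega> \<beta>P])
      show "\<omega>' v = c v" if "{v} \<in> subsimplices 0 ?T" for v
        using that \<omega>v bubble_vertex[OF \<beta>, of v] by (simp add: vertex_iff \<omega>'_def)
      show "cell_ip k ?T \<omega>' \<eta> = M \<eta>" if "\<eta> \<in> BB_div k (int r) ?T" for \<eta>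
        using that \<beta>c[OF that] cell_ip_lin[OF \<omega> \<beta>P, of \<eta> "int r" 1 1] by (simp add: \<omega>'_def BB_div_def)
      fix l f \<eta> assume l: "l \<in> {1..CARD('n) - 1}" and f: "f \<in> subsimplices l ?T"
        and \<eta>: "\<eta> \<in> face_tests k (int r) l f (dyh f)"
      obtain K where K: "K \<subseteq> C" "card K = Suc l" "f = convex hull K" using f by (rule subsimplex_cases)
      have "face_ip k l f \<omega>' \<eta> = 1 * face_ip k l f \<omega> \<eta> + 1 * face_ip k l f \<beta> \<eta>"
        unfolding \<omega>'_def K(3) using l \<eta> K(3) by (intro face_ip_lin[OF K(1,2) _ \<omega> \<beta>P sub_hull[OF K(1)]]) auto
      then show "face_ip k l f \<omega>' \<eta> = L f \<eta>"
        using bubble_face_dofs[OF \<beta> K(1,2)] \<omega>f K l \<eta> by simp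
    qed
    fix \<zeta> assume \<zeta>: "?dofs \<zeta>"
    have \<omega>': "?dofs \<omega>'" by fact
    define D where "D = (\<lambda>x ws vs. 1 * \<zeta> x ws vs + (- 1) * \<omega>' x ws vs)"
    have "D = (\<lambda>x ws vs. 0)"
    proof (rule dofs_determine)
      show "D \<in> PPX k (int r) ?T" unfolding D_def using \<zeta> \<omega>' by (intro PPX_lin) auto
      show "D v = (\<lambda>ws vs. 0)" if "v \<in> C" for v using \<zeta> \<omega>' that by (auto simp: D_def vertex_iff)
      show "cell_ip k ?T D \<eta> = 0" if "\<eta> \<in> BB_div k (int r) ?T" for \<eta>
      proof -
        have "cell_ip k ?T D \<eta> = 1 * cell_ip k ?T \<zeta> \<eta> + (- 1) * cell_ip k ?T \<omega>' \<eta>"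
          unfolding D_def using \<zeta> \<omega>' that by (intro cell_ip_lin[of _ "int r" _ _ "int r"]) (auto simp: BB_div_def)
        then show ?thesis using \<zeta> \<omega>' that by simp
      qed
      fix K l \<eta>
      assume K: "K \<subseteq> C" "card K = Suc l" and l: "1 \<le> l" "l \<le> CARD('n) - 1"
        and \<eta>: "\<eta> \<in> face_tests k (int r) l (convex hull K) (dyh (convex hull K))"
      have "face_ip k l (convex hull K) D \<eta> = 1 * face_ip k l (convex hull K) \<zeta> \<eta> + (- 1) * face_ip k l (convex hull K) \<omega>' \<eta>"
        unfolding D_def using \<zeta> \<omega>' l \<eta> by (intro face_ip_lin[OF K _ _ _ sub_hull[OF K(1)]]) auto
      then show "face_ip k l (convex hull K) D \<eta> = 0" using \<zeta> \<omega>' face[OF K] l \<eta> by simp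
    qed
    then show "\<zeta> = \<omega>'" by (auto simp: D_def fun_eq_iff)
  qed
qed

end

section \<open>Continuously differentiable functions\<close>

text \<open>The gradient is carried along as a vector field, so that its components can be
  integrated.\<close>

definition C1 :: "('n::finite euc \<Rightarrow> real) \<Rightarrow> ('n euc \<Rightarrow> 'n euc) \<Rightarrow> bool" where
  "C1 f G \<longleftrightarrow> (\<forall>x. (f has_derivative (\<lambda>h. G x \<bullet> h)) (at x)) \<and> continuous_on UNIV G"

lemma C1_continuous: "C1 f G \<Longrightarrow> continuous_on A f"
  unfolding C1_def by (meson continuous_at_imp_continuous_on has_derivative_continuous)

lemma C1_grad_continuous: "C1 f G \<Longrightarrow> continuous_on A G"
  unfolding C1_def using continuous_on_subset by blast

lemma C1_affine: "C1 (\<lambda>x. a + g \<bullet> x) (\<lambda>x. g)"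
  unfolding C1_def by (auto intro!: derivative_eq_intros)

lemma C1_const: "C1 (\<lambda>x. a) (\<lambda>x. 0)"
  unfolding C1_def by (auto intro!: derivative_eq_intros)

lemma C1_add: "C1 f F \<Longrightarrow> C1 g G \<Longrightarrow> C1 (\<lambda>x. f x + g x) (\<lambda>x. F x + G x)"
proof -
  assume fF: "C1 f F" and gG: "C1 g G"
  have "((\<lambda>x. f x + g x) has_derivative (\<lambda>h. (F x + G x) \<bullet> h)) (at x)" for x
    using has_derivative_add[of f "\<lambda>h. F x \<bullet> h" "at x" g "\<lambda>h. G x \<bullet> h"] fF gG
    by (simp add: C1_def inner_add_left)
  then show ?thesis unfolding C1_def
    using C1_grad_continuous[OF fF] C1_grad_continuous[OF gG] by (auto intro!: continuous_intros)
qed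

lemma C1_mult: "C1 f F \<Longrightarrow> C1 g G \<Longrightarrow> C1 (\<lambda>x. f x * g x) (\<lambda>x. f x *\<^sub>R G x + g x *\<^sub>R F x)"
proof -
  assume fF: "C1 f F" and gG: "C1 g G"
  have "((\<lambda>x. f x * g x) has_derivative (\<lambda>h. (f x *\<^sub>R G x + g x *\<^sub>R F x) \<bullet> h)) (at x)" for x
    using has_derivative_mult[of f "\<lambda>h. F x \<bullet> h" x UNIV g "\<lambda>h. G x \<bullet> h"] fF gG
    by (simp add: C1_def inner_add_left mult.commute)
  then show ?thesis unfolding C1_def
    using C1_continuous[OF fF] C1_continuous[OF gG] C1_grad_continuous[OF fF] C1_grad_continuous[OF gG]
    by (auto intro!: continuous_intros)
qed

lemma C1_scale: "C1 f F \<Longrightarrow> C1 (\<lambda>x. c * f x) (\<lambda>x. c *\<^sub>R F x)"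
  using C1_mult[OF C1_const[of c]] by simp

lemma C1_sum:
  "(\<And>i. i \<in> I \<Longrightarrow> C1 (f i) (F i)) \<Longrightarrow> C1 (\<lambda>x. \<Sum>i\<in>I. f i x) (\<lambda>x. \<Sum>i\<in>I. F i x)"
  by (induction I rule: infinite_finite_induct) (auto intro: C1_const C1_add)

lemma C1_prod:
  assumes "\<And>i. i \<in> I \<Longrightarrow> C1 (f i) (F i)"
  shows "C1 (\<lambda>x. \<Prod>i\<in>I. f i x) (\<lambda>x. \<Sum>i\<in>I. (\<Prod>j\<in>I - {i}. f j x) *\<^sub>R F i x)"
  unfolding C1_def
proof (intro conjI allI)
  fix x
  have "((\<lambda>x. \<Prod>i\<in>I. f i x) has_derivative (\<lambda>h. \<Sum>i\<in>I. (F i x \<bullet> h) * (\<Prod>j\<in>I - {i}. f j x))) (at x)"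
    using assms by (intro has_derivative_prod) (auto simp: C1_def)
  then show "((\<lambda>x. \<Prod>i\<in>I. f i x) has_derivative (\<lambda>h. (\<Sum>i\<in>I. (\<Prod>j\<in>I - {i}. f j x) *\<^sub>R F i x) \<bullet> h)) (at x)"
    by (simp add: inner_sum_left mult.commute)
  show "continuous_on UNIV (\<lambda>x. \<Sum>i\<in>I. (\<Prod>j\<in>I - {i}. f j x) *\<^sub>R F i x)"
    using assms by (intro continuous_intros C1_continuous[of "f _"] C1_grad_continuous[of "f _"]) auto
qed

lemma C1_compose_real:
  assumes f: "C1 f F" and s: "\<And>t. (s has_real_derivative s' t) (at t)" "continuous_on UNIV s'"
  shows "C1 (\<lambda>x. s (f x)) (\<lambda>x. s' (f x) *\<^sub>R F x)"
  unfolding C1_def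
proof (intro conjI allI)
  fix x
  have "((\<lambda>x. s (f x)) has_derivative (\<lambda>h. (F x \<bullet> h) * s' (f x))) (at x)"
    using f by (intro DERIV_compose_FDERIV[OF s(1)]) (simp add: C1_def)
  then show "((\<lambda>x. s (f x)) has_derivative (\<lambda>h. (s' (f x) *\<^sub>R F x) \<bullet> h)) (at x)"
    by (simp add: mult.commute)
  show "continuous_on UNIV (\<lambda>x. s' (f x) *\<^sub>R F x)"
    using C1_continuous[OF f] C1_grad_continuous[OF f]
    by (intro continuous_intros continuous_on_compose2[OF s(2)]) auto
qed

text \<open>Chain rule: the derivative of the shear is
  \<open>h + (g \<bullet> h) *\<^sub>R u\<close>, whose adjoint sends \<open>F\<close> to
  \<open>F + (F \<bullet> u) *\<^sub>R g\<close>.\<close>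

lemma C1_compose_shear:
  assumes f: "C1 f F"
  shows "C1 (\<lambda>x. f (x + (a + g \<bullet> x) *\<^sub>R u))
    (\<lambda>x. F (x + (a + g \<bullet> x) *\<^sub>R u) + (F (x + (a + g \<bullet> x) *\<^sub>R u) \<bullet> u) *\<^sub>R g)"
  unfolding C1_def
proof (intro conjI allI)
  fix x
  let ?A = "\<lambda>x. x + (a + g \<bullet> x) *\<^sub>R u"
  have A: "(?A has_derivative (\<lambda>h. h + (g \<bullet> h) *\<^sub>R u)) (at x)"
    by (auto intro!: derivative_eq_intros)
  have "(f has_derivative (\<lambda>h. F (?A x) \<bullet> h)) (at (?A x))" using f by (simp add: C1_def)
  from has_derivative_compose[OF A this]
  show "((\<lambda>x. f (?A x)) has_derivative (\<lambda>h. (F (?A x) + (F (?A x) \<bullet> u) *\<^sub>R g) \<bullet> h)) (at x)"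
    by (simp add: inner_add_left inner_add_right mult.commute)
  show "continuous_on UNIV (\<lambda>x. F (?A x) + (F (?A x) \<bullet> u) *\<^sub>R g)"
    by (intro continuous_intros continuous_on_compose2[OF C1_grad_continuous[OF f, of UNIV]]) auto
qed

lemma Pol_C1:
  fixes p :: "('n::{finite,wellorder}) euc \<Rightarrow> real"
  assumes "p \<in> Pol r"
  shows "\<exists>G. C1 p G"
  using assms
proof (rule Pol_cases)
  fix \<alpha> :: "'n \<Rightarrow> nat"
  have coord: "C1 (\<lambda>x. x $ i) (\<lambda>x. axis i 1)" for i :: 'n
    using C1_affine[of 0 "axis i 1"] by (simp add: inner_axis')
  have "\<exists>G. C1 (\<lambda>x. x $ i ^ m) G" for i :: 'n and m
  proof (induction m)
    case 0 then show ?case using C1_const[of 1] by auto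
  next
    case (Suc m) then show ?case using C1_mult[OF coord, of "\<lambda>x. x $ i ^ m"] by auto
  qed
  then have "\<exists>G. \<forall>i. C1 (\<lambda>x. x $ i ^ \<alpha> i) (G i)" by (intro choice allI)
  then obtain G where G: "\<And>i. C1 (\<lambda>x. x $ i ^ \<alpha> i) (G i)" by blast
  show "\<exists>G. C1 (\<lambda>x. \<Prod>i\<in>UNIV. x $ i ^ \<alpha> i) G"
    by (rule exI, rule C1_prod[of UNIV "\<lambda>i x. x $ i ^ \<alpha> i" G, OF G])
next
  fix p q :: "'n euc \<Rightarrow> real" assume "\<exists>G. C1 p G" "\<exists>G. C1 q G"
  then show "\<exists>G. C1 (\<lambda>x. p x + q x) G" using C1_add by blast
next
  fix p :: "'n euc \<Rightarrow> real" and a assume "\<exists>G. C1 p G"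
  then show "\<exists>G. C1 (\<lambda>x. a * p x) G" using C1_scale by blast
next
  show "\<exists>G. C1 (\<lambda>x::'n euc. 0) G" using C1_const by blast
qed

lemma C1_lipschitz:
  assumes f: "C1 f F" and S: "convex S" "\<And>x. x \<in> S \<Longrightarrow> norm (F x) \<le> N" and xy: "x \<in> S" "y \<in> S"
  shows "\<bar>f x - f y\<bar> \<le> N * norm (x - y)"
proof -
  have "norm (f x - f y) \<le> N * norm (x - y)"
  proof (rule differentiable_bound[OF S(1)])
    show "(f has_derivative (\<lambda>h. F x \<bullet> h)) (at x within S)" for x
      using f by (auto simp: C1_def intro: has_derivative_at_withinI)
    show "onorm (\<lambda>h. F x \<bullet> h) \<le> N" if "x \<in> S" for x
    proof (rule onorm_le)
      fix h
      have "norm (F x \<bullet> h) \<le> norm (F x) * norm h" by (simp add: Cauchy_Schwarz_ineq2)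
      also have "\<dots> \<le> N * norm h" using S(2)[OF that] by (intro mult_right_mono) auto
      finally show "norm (F x \<bullet> h) \<le> N * norm h" .
    qed
  qed (use xy in auto)
  then show ?thesis by simp
qed

lemma integrable_compact_support:
  fixes f :: "'a::euclidean_space \<Rightarrow> real"
  assumes "continuous_on UNIV f" "compact S" "\<And>x. x \<notin> S \<Longrightarrow> f x = 0"
  shows "integrable lborel f"
proof -
  have "integrable lborel (\<lambda>x. indicator S x *\<^sub>R f x)"
    using assms continuous_on_subset by (intro borel_integrable_compact) blast+
  moreover have "(\<lambda>x. indicator S x *\<^sub>R f x) = f"
    using assms(3) by (intro ext) (auto simp: indicator_def)
  ultimately show ?thesis by simp
qed

lemma bounded_on_compact:
  fixes f :: "'a::metric_space \<Rightarrow> 'b::real_normed_vector"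
  assumes "continuous_on UNIV f" "compact S"
  obtains N where "0 \<le> N" "\<And>x. x \<in> S \<Longrightarrow> norm (f x) \<le> N"
proof -
  have "bounded (f ` S)"
    using assms by (meson compact_continuous_image compact_imp_bounded continuous_on_subset subset_UNIV)
  then obtain N where N: "\<And>x. x \<in> S \<Longrightarrow> norm (f x) \<le> N" by (auto simp: bounded_iff)
  show ?thesis by (rule that[of "max 0 N"]) (use N in \<open>auto intro: max.coboundedI2\<close>)
qed

text \<open>The integral of a difference quotient vanishes by translation invariance.\<close>
lemma integral_partial_zero:
  fixes f :: "('n::finite) euc \<Rightarrow> real"
  assumes f: "C1 f F" and S: "compact S" and zero: "\<And>x. x \<notin> S \<Longrightarrow> f x = 0" "\<And>x. x \<notin> S \<Longrightarrow> F x = 0"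
  shows "(\<integral>x. F x \<bullet> e \<partial>lborel) = 0"
proof -
  obtain N where N: "0 \<le> N" "\<And>x. x \<in> S \<Longrightarrow> norm (F x) \<le> N"
    using bounded_on_compact[OF C1_grad_continuous[OF f] S] by blast
  have N': "norm (F x) \<le> N" for x using N zero(2)[of x] by (cases "x \<in> S") auto
  define t where "t m = 1 / real (Suc m)" for m
  have t: "0 < t m" "t m \<le> 1" for m by (auto simp: t_def)
  have t0: "t \<longlonglongrightarrow> 0" unfolding t_def using LIMSEQ_inverse_real_of_nat by (simp add: inverse_eq_divide)
  define q where "q m x = (f (t m *\<^sub>R e + x) - f x) / t m" for m x
  obtain B where B: "\<And>x. x \<in> S \<Longrightarrow> norm x \<le> B" using compact_imp_bounded[OF S] by (auto simp: bounded_iff)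
  \<comment> \<open>The steps \<open>t m\<close> are at most 1, so the supports of all difference
    quotients lie in this ball, which carries the dominating function.\<close>
  define R where "R = B + norm e"
  have fi: "integrable lborel f" by (rule integrable_compact_support[OF C1_continuous[OF f] S zero(1)])
  have fc: "f \<in> borel_measurable borel" using C1_continuous[OF f] by (rule borel_measurable_continuous_onI)
  have shift: "(\<integral>x. f (c + x) \<partial>lborel) = (\<integral>x. f x \<partial>lborel)" "integrable lborel (\<lambda>x. f (c + x))" for c
  proof -
    have "(\<integral>x. f x \<partial>lborel) = (\<integral>x. f x \<partial>distr lborel borel ((+) c))" by (simp add: lborel_distr_plus)
    also have "\<dots> = (\<integral>x. f (c + x) \<partial>lborel)" using fc by (intro integral_distr) auto
    finally show "(\<integral>x. f (c + x) \<partial>lborel) = (\<integral>x. f x \<partial>lborel)" by simp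
    have "integrable (distr lborel borel ((+) c)) f" using fi by (simp add: lborel_distr_plus)
    then show "integrable lborel (\<lambda>x. f (c + x))" using fc by (subst (asm) integrable_distr_eq) auto
  qed
  have "(\<integral>x. q m x \<partial>lborel) = 0" for m
    using shift fi by (simp add: q_def)
  moreover have "(\<lambda>m. \<integral>x. q m x \<partial>lborel) \<longlonglongrightarrow> (\<integral>x. F x \<bullet> e \<partial>lborel)"
  proof (rule integral_dominated_convergence[where w = "\<lambda>x. indicator (cball 0 R) x *\<^sub>R (N * norm e)"])
    show "(\<lambda>x. F x \<bullet> e) \<in> borel_measurable lborel"
    proof -
      have "continuous_on UNIV (\<lambda>x. F x \<bullet> e)"
        by (intro continuous_intros C1_grad_continuous[OF f])
      from borel_measurable_continuous_onI[OF this] show ?thesis by simp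
    qed
    show "q m \<in> borel_measurable lborel" for m
      unfolding q_def using fc by measurable
    show "integrable lborel (\<lambda>x. indicator (cball 0 R) x *\<^sub>R (N * norm e))"
      by (intro borel_integrable_compact) auto
    show "AE x in lborel. (\<lambda>m. q m x) \<longlonglongrightarrow> F x \<bullet> e"
    proof (intro AE_I2)
      fix x
      have "((\<lambda>s. f (x + s *\<^sub>R e)) has_derivative (\<lambda>s. F x \<bullet> (s *\<^sub>R e))) (at 0)"
      proof (rule has_derivative_compose[of "\<lambda>s. x + s *\<^sub>R e"])
        show "((\<lambda>s. x + s *\<^sub>R e) has_derivative (\<lambda>s. s *\<^sub>R e)) (at 0)"
          by (auto intro!: derivative_eq_intros)
        show "(f has_derivative (\<lambda>h. F x \<bullet> h)) (at (x + 0 *\<^sub>R e))" using f by (simp add: C1_def)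
      qed
      then have "((\<lambda>s. f (x + s *\<^sub>R e)) has_real_derivative (F x \<bullet> e)) (at 0)"
        by (simp add: has_field_derivative_def mult_commute_abs)
      then have "((\<lambda>s. (f (x + s *\<^sub>R e) - f x) / s) \<longlongrightarrow> F x \<bullet> e) (at 0)"
        by (simp add: DERIV_def)
      moreover have "filterlim t (at 0) sequentially"
        using t0 t(1) by (auto simp: filterlim_at less_imp_neq[symmetric])
      ultimately show "(\<lambda>m. q m x) \<longlonglongrightarrow> F x \<bullet> e"
        unfolding q_def by (auto dest: filterlim_compose simp: add.commute)
    qed
    show "AE x in lborel. norm (q m x) \<le> indicator (cball 0 R) x *\<^sub>R (N * norm e)" for m
    proof (intro AE_I2)
      fix x
      show "norm (q m x) \<le> indicator (cball 0 R) x *\<^sub>R (N * norm e)"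
      proof (cases "x \<in> cball 0 R")
        case True
        have "\<bar>f (t m *\<^sub>R e + x) - f x\<bar> \<le> N * norm (t m *\<^sub>R e + x - x)"
          by (rule C1_lipschitz[OF f convex_UNIV N']) auto
        then show ?thesis using True t(1)[of m] by (simp add: q_def field_simps)
      next
        case False
        have "B \<le> R" by (simp add: R_def)
        then have "x \<notin> S" using B[of x] False by auto
        moreover have "t m *\<^sub>R e + x \<notin> S"
        proof
          assume "t m *\<^sub>R e + x \<in> S"
          then have "norm (t m *\<^sub>R e + x) \<le> B" by (rule B)
          moreover have "norm x \<le> norm (t m *\<^sub>R e + x) + norm (t m *\<^sub>R e)"
            by (metis norm_triangle_ineq4 add_diff_cancel_left')
          moreover have "norm (t m *\<^sub>R e) \<le> norm e" using t[of m] by (simp add: mult_left_le_one_le)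
          ultimately show False using False by (simp add: R_def)
        qed
        ultimately show ?thesis using zero False by (simp add: q_def)
      qed
    qed
  qed
  ultimately show ?thesis using LIMSEQ_unique[of "\<lambda>m. 0 :: real"] by simp
qed

section \<open>Cutoff functions\<close>

text \<open>Zero for nonpositive \<open>t\<close>, tending to 1 for each positive \<open>t\<close>
  as \<epsilon> tends to 0. Squaring the positive part makes it continuously differentiable at
  0.\<close>

definition cut :: "real \<Rightarrow> real \<Rightarrow> real" where
  "cut \<epsilon> t = (max 0 t)\<^sup>2 / (\<epsilon>\<^sup>2 + (max 0 t)\<^sup>2)"

definition cut' :: "real \<Rightarrow> real \<Rightarrow> real" where
  "cut' \<epsilon> t = 2 * \<epsilon>\<^sup>2 * max 0 t / (\<epsilon>\<^sup>2 + (max 0 t)\<^sup>2)\<^sup>2"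

lemma pos_part_square_deriv: "((\<lambda>t. (max 0 t)\<^sup>2) has_real_derivative 2 * max 0 t) (at (t::real))"
proof -
  consider "t < 0" | "t = 0" | "0 < t" by linarith
  then show ?thesis
  proof cases
    case 1
    have "((\<lambda>t. (max 0 t)\<^sup>2) has_real_derivative 0) (at t)"
      by (rule has_field_derivative_transform_within_open[of "\<lambda>_. 0" _ _ "{..<0}"]) (use 1 in auto)
    then show ?thesis using 1 by simp
  next
    case 3
    have "((\<lambda>t. (max 0 t)\<^sup>2) has_real_derivative 2 * t) (at t)"
      by (rule has_field_derivative_transform_within_open[of "\<lambda>t. t\<^sup>2" _ _ "{0<..}"])
        (use 3 in \<open>auto intro!: derivative_eq_intros\<close>)
    then show ?thesis using 3 by simp
  next
    case 2
    have "((\<lambda>h. (max 0 h)\<^sup>2 / h) \<longlongrightarrow> 0) (at (0::real))"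
    proof (rule Lim_null_comparison)
      show "\<forall>\<^sub>F h in at 0. norm ((max 0 h)\<^sup>2 / h) \<le> \<bar>h\<bar>"
        by (intro always_eventually allI) (auto simp: max_def power2_eq_square abs_if)
      show "((\<lambda>h. \<bar>h\<bar>) \<longlongrightarrow> 0) (at (0::real))" by (auto intro!: tendsto_eq_intros)
    qed
    then show ?thesis using 2 by (simp add: DERIV_def)
  qed
qed

lemma cut_deriv:
  assumes "0 < \<epsilon>"
  shows "(cut \<epsilon> has_real_derivative cut' \<epsilon> t) (at t)"
proof -
  have ne: "\<epsilon>\<^sup>2 + (max 0 t)\<^sup>2 \<noteq> 0" using assms by (metis add_pos_nonneg less_irrefl zero_le_power2 zero_less_power)
  have "((\<lambda>t. (max 0 t)\<^sup>2 / (\<epsilon>\<^sup>2 + (max 0 t)\<^sup>2)) has_real_derivative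
      ((2 * max 0 t) * (\<epsilon>\<^sup>2 + (max 0 t)\<^sup>2) - (max 0 t)\<^sup>2 * (0 + 2 * max 0 t)) / ((\<epsilon>\<^sup>2 + (max 0 t)\<^sup>2) * (\<epsilon>\<^sup>2 + (max 0 t)\<^sup>2))) (at t)"
    by (intro DERIV_divide DERIV_add DERIV_const pos_part_square_deriv ne)
  then show ?thesis
    by (simp add: cut_def[abs_def] cut'_def power2_eq_square algebra_simps)
qed

lemma cut'_continuous:
  assumes "0 < \<epsilon>"
  shows "continuous_on UNIV (cut' \<epsilon>)"
proof -
  have "\<epsilon>\<^sup>2 + (max 0 t)\<^sup>2 \<noteq> 0" for t :: real
    using assms by (metis add_pos_nonneg less_irrefl zero_le_power2 zero_less_power)
  then show ?thesis unfolding cut'_def[abs_def] by (intro continuous_intros) auto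
qed

lemma cut_bounds: "0 \<le> cut \<epsilon> t" "cut \<epsilon> t \<le> 1"
  by (auto simp: cut_def divide_le_eq_1 add_nonneg_eq_0_iff less_le)

lemma cut_nonpos: "t \<le> 0 \<Longrightarrow> cut \<epsilon> t = 0" "t \<le> 0 \<Longrightarrow> cut' \<epsilon> t = 0"
  by (auto simp: cut_def cut'_def)

lemma cut'_nonneg: "0 \<le> cut' \<epsilon> t"
  by (auto simp: cut'_def)

text \<open>From \<open>2 * (\<epsilon> * t) \<le> \<epsilon>\<^sup>2 + t\<^sup>2\<close>, squared.
  The bound is uniform in \<epsilon> and yields the dominating function in
  \<open>layer_vanish\<close>.\<close>

lemma cut'_bound:
  assumes "0 < \<epsilon>" "0 \<le> t"
  shows "cut' \<epsilon> t * t \<le> 1"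
proof -
  have "2 * (\<epsilon> * t) \<le> \<epsilon>\<^sup>2 + t\<^sup>2" using sum_squares_bound[of \<epsilon> t] by (simp add: mult.assoc)
  then have "(2 * (\<epsilon> * t))\<^sup>2 \<le> (\<epsilon>\<^sup>2 + t\<^sup>2)\<^sup>2" using assms by (intro power_mono) auto
  moreover have "2 * \<epsilon>\<^sup>2 * t * t \<le> (2 * (\<epsilon> * t))\<^sup>2"
    using zero_le_power2[of "\<epsilon> * t"] by (simp add: power2_eq_square mult_ac)
  ultimately have le: "2 * \<epsilon>\<^sup>2 * t * t \<le> (\<epsilon>\<^sup>2 + t\<^sup>2)\<^sup>2" by linarith
  have "0 < (\<epsilon>\<^sup>2 + t\<^sup>2)\<^sup>2" using assms by (intro zero_less_power add_pos_nonneg) auto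
  then have "2 * \<epsilon>\<^sup>2 * t * t / (\<epsilon>\<^sup>2 + t\<^sup>2)\<^sup>2 \<le> 1" using le by (simp add: divide_le_eq_1)
  then show ?thesis using assms by (simp add: cut'_def)
qed

lemma cut_tendsto:
  assumes "0 < t" "\<epsilon> \<longlonglongrightarrow> 0"
  shows "(\<lambda>m. cut (\<epsilon> m) t) \<longlonglongrightarrow> 1" "(\<lambda>m. cut' (\<epsilon> m) t * t) \<longlonglongrightarrow> 0"
proof -
  have "(\<lambda>m. (max 0 t)\<^sup>2 / ((\<epsilon> m)\<^sup>2 + (max 0 t)\<^sup>2)) \<longlonglongrightarrow> (max 0 t)\<^sup>2 / (0\<^sup>2 + (max 0 t)\<^sup>2)"
    using assms by (intro tendsto_intros) auto
  then show "(\<lambda>m. cut (\<epsilon> m) t) \<longlonglongrightarrow> 1" using assms by (simp add: cut_def)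
  have "(\<lambda>m. 2 * (\<epsilon> m)\<^sup>2 * max 0 t / ((\<epsilon> m)\<^sup>2 + (max 0 t)\<^sup>2)\<^sup>2 * t) \<longlonglongrightarrow>
      2 * 0\<^sup>2 * max 0 t / (0\<^sup>2 + (max 0 t)\<^sup>2)\<^sup>2 * t"
    using assms by (intro tendsto_intros) auto
  then show "(\<lambda>m. cut' (\<epsilon> m) t * t) \<longlonglongrightarrow> 0" by (simp add: cut'_def)
qed

section \<open>Cutoff of a cell and its boundary layers\<close>

context barycentric
begin

definition chi :: "real \<Rightarrow> 'n euc \<Rightarrow> real" where
  "chi \<epsilon> x = (\<Prod>v\<in>C. cut \<epsilon> (lam v x))"

text \<open>The coefficient of \<open>g v\<close> in the gradient of \<open>chi\<close>; it
  concentrates at the facet opposite \<open>v\<close> as \<epsilon> tends to 0.\<close>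

definition layer :: "real \<Rightarrow> 'n euc \<Rightarrow> 'n euc \<Rightarrow> real" where
  "layer \<epsilon> v x = cut' \<epsilon> (lam v x) * (\<Prod>w\<in>C - {v}. cut \<epsilon> (lam w x))"

lemma C1_lam: "C1 (lam v) (\<lambda>x. g v)"
  unfolding lam_def[abs_def] by (rule C1_affine)

lemma lam_continuous: "continuous_on A (lam v)"
  by (rule C1_continuous[OF C1_lam])

lemma compact_cell: "compact (convex hull C)"
  by (rule finite_imp_compact_convex_hull[OF finite_C])

lemma cell_eq: "convex hull C = {x. \<forall>v\<in>C. 0 \<le> lam v x}"
  using hull_eq[OF subset_refl] by simp

lemma C1_chi:
  assumes "0 < \<epsilon>"
  shows "C1 (chi \<epsilon>) (\<lambda>x. \<Sum>v\<in>C. layer \<epsilon> v x *\<^sub>R g v)"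
proof -
  have "C1 (\<lambda>x. cut \<epsilon> (lam v x)) (\<lambda>x. cut' \<epsilon> (lam v x) *\<^sub>R g v)" for v
    by (rule C1_compose_real[OF C1_lam cut_deriv[OF assms] cut'_continuous[OF assms]])
  from C1_prod[of C, OF this] show ?thesis
    by (simp add: chi_def[abs_def] layer_def mult.commute)
qed

lemma layer_continuous: "0 < \<epsilon> \<Longrightarrow> continuous_on A (layer \<epsilon> v)"
proof -
  assume \<epsilon>: "0 < \<epsilon>"
  have "continuous_on UNIV (cut \<epsilon>)"
    using cut_deriv[OF \<epsilon>] by (meson DERIV_isCont continuous_at_imp_continuous_on)
  then show ?thesis unfolding layer_def[abs_def]
    by (intro continuous_intros continuous_on_compose2[OF cut'_continuous[OF \<epsilon>] lam_continuous]
        continuous_on_compose2[OF _ lam_continuous]) auto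
qed

lemma layer_outside: "v \<in> C \<Longrightarrow> x \<notin> convex hull C \<Longrightarrow> layer \<epsilon> v x = 0"
proof -
  assume v: "v \<in> C" and "x \<notin> convex hull C"
  then obtain u where u: "u \<in> C" "lam u x < 0" by (auto simp: cell_eq not_le)
  show ?thesis
  proof (cases "u = v")
    case True then show ?thesis using u by (simp add: layer_def cut_nonpos)
  next
    case False
    then have "(\<Prod>w\<in>C - {v}. cut \<epsilon> (lam w x)) = 0"
      using u finite_C by (intro prod_zero) (auto intro!: bexI[of _ u] simp: cut_nonpos)
    then show ?thesis by (simp add: layer_def)
  qed
qed

lemma chi_outside: "x \<notin> convex hull C \<Longrightarrow> chi \<epsilon> x = 0"
proof -
  assume "x \<notin> convex hull C"
  then obtain u where "u \<in> C" "lam u x < 0" by (auto simp: cell_eq not_le)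
  then show ?thesis using finite_C unfolding chi_def
    by (intro prod_zero) (auto intro!: bexI[of _ u] simp: cut_nonpos)
qed

lemma chi_bounds: "0 \<le> chi \<epsilon> x" "chi \<epsilon> x \<le> 1"
  unfolding chi_def by (auto intro!: prod_nonneg prod_le_1 simp: cut_bounds)

lemma layer_bounds: "0 \<le> layer \<epsilon> v x" "layer \<epsilon> v x \<le> cut' \<epsilon> (lam v x)"
proof -
  have *: "0 \<le> (\<Prod>w\<in>C - {v}. cut \<epsilon> (lam w x))" "(\<Prod>w\<in>C - {v}. cut \<epsilon> (lam w x)) \<le> 1"
    by (auto intro!: prod_nonneg prod_le_1 simp: cut_bounds)
  show "0 \<le> layer \<epsilon> v x" unfolding layer_def using * cut'_nonneg by simp
  show "layer \<epsilon> v x \<le> cut' \<epsilon> (lam v x)"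
    unfolding layer_def using * cut'_nonneg by (simp add: mult_left_le)
qed

lemma layer_integrable:
  assumes "0 < \<epsilon>" "v \<in> C" "continuous_on UNIV B"
  shows "integrable lborel (\<lambda>x. layer \<epsilon> v x * B x)"
  using assms layer_outside
  by (intro integrable_compact_support[OF _ compact_cell] continuous_intros layer_continuous) auto

lemma chi_integrable:
  assumes "0 < \<epsilon>" "continuous_on UNIV B"
  shows "integrable lborel (\<lambda>x. chi \<epsilon> x * B x)"
  using assms chi_outside C1_continuous[OF C1_chi[OF assms(1)]]
  by (intro integrable_compact_support[OF _ compact_cell] continuous_intros) auto

text \<open>The divergence theorem with the indicator function of the cell replaced by \<open>chi \<epsilon>\<close>; the
  boundary integrals become integrals over layers.\<close>
lemma cell_divergence:
  assumes \<epsilon>: "0 < \<epsilon>" and F: "\<And>i. C1 (F i) (G i)"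
  shows "(\<integral>x. chi \<epsilon> x * (\<Sum>i\<in>UNIV. G i x $ i) \<partial>lborel) =
    - (\<Sum>v\<in>C. \<integral>x. layer \<epsilon> v x * (\<Sum>i\<in>UNIV. g v $ i * F i x) \<partial>lborel)"
proof -
  have Fc: "continuous_on UNIV (F i)" and Gc: "continuous_on UNIV (G i)" for i
    using F C1_continuous C1_grad_continuous by blast+
  have z: "(\<integral>x. (chi \<epsilon> x *\<^sub>R G i x + F i x *\<^sub>R (\<Sum>v\<in>C. layer \<epsilon> v x *\<^sub>R g v)) \<bullet> axis i 1 \<partial>lborel) = 0" for i
    using chi_outside layer_outside
    by (intro integral_partial_zero[OF C1_mult[OF C1_chi[OF \<epsilon>] F] compact_cell]) auto
  have split: "(chi \<epsilon> x *\<^sub>R G i x + F i x *\<^sub>R (\<Sum>v\<in>C. layer \<epsilon> v x *\<^sub>R g v)) \<bullet> axis i 1 =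
      chi \<epsilon> x * G i x $ i + (\<Sum>v\<in>C. layer \<epsilon> v x * (g v $ i * F i x))" for x i
    by (simp add: inner_axis inner_add_left sum_distrib_left mult_ac)
  have i1: "integrable lborel (\<lambda>x. chi \<epsilon> x * G i x $ i)" for i
    using Gc by (intro chi_integrable[OF \<epsilon>] continuous_intros)
  have i2: "integrable lborel (\<lambda>x. layer \<epsilon> v x * (g v $ i * F i x))" if "v \<in> C" for v i
    using Fc that by (intro layer_integrable[OF \<epsilon>] continuous_intros)
  have each: "(\<integral>x. chi \<epsilon> x * G i x $ i \<partial>lborel) +
      (\<Sum>v\<in>C. \<integral>x. layer \<epsilon> v x * (g v $ i * F i x) \<partial>lborel) = 0" for i
    using z[of i] i1 i2 unfolding split by simp
  have "(\<integral>x. chi \<epsilon> x * (\<Sum>i\<in>UNIV. G i x $ i) \<partial>lborel) = (\<Sum>i\<in>UNIV. \<integral>x. chi \<epsilon> x * G i x $ i \<partial>lborel)"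
    using i1 by (simp add: sum_distrib_left)
  also have "\<dots> = (\<Sum>i\<in>UNIV. - (\<Sum>v\<in>C. \<integral>x. layer \<epsilon> v x * (g v $ i * F i x) \<partial>lborel))"
    using each by (intro sum.cong) (auto simp: eq_neg_iff_add_eq_0)
  also have "\<dots> = - (\<Sum>v\<in>C. \<Sum>i\<in>UNIV. \<integral>x. layer \<epsilon> v x * (g v $ i * F i x) \<partial>lborel)"
    by (subst sum.swap) (simp add: sum_negf)
  also have "(\<Sum>v\<in>C. \<Sum>i\<in>UNIV. \<integral>x. layer \<epsilon> v x * (g v $ i * F i x) \<partial>lborel) =
      (\<Sum>v\<in>C. \<integral>x. layer \<epsilon> v x * (\<Sum>i\<in>UNIV. g v $ i * F i x) \<partial>lborel)"
    using i2 by (intro sum.cong refl) (simp add: sum_distrib_left)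
  finally show ?thesis .
qed

lemma AE_lam_nonzero: "AE x in lborel. \<forall>v\<in>C. lam v x \<noteq> 0"
proof -
  have "AE x in lborel. lam v x \<noteq> 0" if v: "v \<in> C" for v
  proof -
    have "negligible {x. g v \<bullet> x = - a v}" using grad_nonzero[OF v] by (intro negligible_hyperplane) auto
    then have "AE x in lebesgue. x \<notin> {x. g v \<bullet> x = - a v}"
      by (intro AE_not_in) (simp add: negligible_iff_null_sets)
    then show ?thesis unfolding AE_completion_iff by (rule AE_mp) (auto simp: lam_def)
  qed
  then show ?thesis using finite_C by (simp add: AE_finite_all)
qed

text \<open>Dominated convergence: \<open>chi\<close> tends to the indicator of the cell off the
  null set where some coordinate is zero.\<close>

lemma chi_limit:
  assumes D: "continuous_on UNIV D" and \<epsilon>: "\<epsilon> \<longlonglongrightarrow> 0" "\<And>m. 0 < \<epsilon> m"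
  shows "(\<lambda>m. \<integral>x. chi (\<epsilon> m) x * D x \<partial>lborel) \<longlonglongrightarrow> (\<integral>x. indicator (convex hull C) x * D x \<partial>lborel)"
proof (rule integral_dominated_convergence[where w = "\<lambda>x. indicator (convex hull C) x *\<^sub>R \<bar>D x\<bar>"])
  have Dm: "D \<in> borel_measurable borel" using D by (rule borel_measurable_continuous_onI)
  have T: "convex hull C \<in> sets borel" using compact_cell by (simp add: borel_compact)
  show "(\<lambda>x. indicator (convex hull C) x * D x) \<in> borel_measurable lborel" using Dm T by measurable
  show "(\<lambda>x. chi (\<epsilon> m) x * D x) \<in> borel_measurable lborel" for m
    using chi_integrable[OF \<epsilon>(2) D] by (rule borel_measurable_integrable)
  show "integrable lborel (\<lambda>x. indicator (convex hull C) x *\<^sub>R \<bar>D x\<bar>)"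
    using D compact_cell by (intro borel_integrable_compact continuous_intros) (auto intro: continuous_on_subset)
  show "AE x in lborel. norm (chi (\<epsilon> m) x * D x) \<le> indicator (convex hull C) x *\<^sub>R \<bar>D x\<bar>" for m
  proof (intro AE_I2)
    fix x
    show "norm (chi (\<epsilon> m) x * D x) \<le> indicator (convex hull C) x *\<^sub>R \<bar>D x\<bar>"
      using chi_bounds[of "\<epsilon> m" x] chi_outside[of x]
      by (cases "x \<in> convex hull C") (auto simp: abs_mult mult_left_le_one_le)
  qed
  show "AE x in lborel. (\<lambda>m. chi (\<epsilon> m) x * D x) \<longlonglongrightarrow> indicator (convex hull C) x * D x"
    using AE_lam_nonzero
  proof (rule AE_mp, intro AE_I2 impI)
    fix x assume ne: "\<forall>v\<in>C. lam v x \<noteq> 0"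
    have "(\<lambda>m. chi (\<epsilon> m) x) \<longlonglongrightarrow> indicator (convex hull C) x"
    proof (cases "x \<in> convex hull C")
      case True
      then have "0 < lam v x" if "v \<in> C" for v using ne that by (auto simp: cell_eq less_le)
      then have "(\<lambda>m. \<Prod>v\<in>C. cut (\<epsilon> m) (lam v x)) \<longlonglongrightarrow> (\<Prod>v\<in>C. 1)"
        by (intro tendsto_prod cut_tendsto(1) \<epsilon>(1)) auto
      then show ?thesis using True by (simp add: chi_def)
    qed (simp add: chi_outside)
    then show "(\<lambda>m. chi (\<epsilon> m) x * D x) \<longlonglongrightarrow> indicator (convex hull C) x * D x"
      by (intro tendsto_intros)
  qed
qed

text \<open>The factor \<open>lam v\<close> tames the derivative of the cutoff: their product is
  bounded uniformly and tends to 0 at every point of the cell, so dominated convergence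
  applies.\<close>

lemma layer_vanish:
  assumes v: "v \<in> C" and B: "continuous_on UNIV B" "\<And>x. x \<in> convex hull C \<Longrightarrow> \<bar>B x\<bar> \<le> L * lam v x"
    and \<epsilon>: "\<epsilon> \<longlonglongrightarrow> 0" "\<And>m. 0 < \<epsilon> m"
  shows "(\<lambda>m. \<integral>x. layer (\<epsilon> m) v x * B x \<partial>lborel) \<longlonglongrightarrow> 0"
proof -
  have bound: "\<bar>layer (\<epsilon> m) v x * B x\<bar> \<le> L * (cut' (\<epsilon> m) (lam v x) * lam v x)" if "x \<in> convex hull C" for m x
  proof -
    have "\<bar>layer (\<epsilon> m) v x * B x\<bar> = layer (\<epsilon> m) v x * \<bar>B x\<bar>"
      using layer_bounds(1) by (simp add: abs_mult)
    also have "\<dots> \<le> cut' (\<epsilon> m) (lam v x) * (L * lam v x)"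
      using layer_bounds cut'_nonneg B(2)[OF that] by (intro mult_mono) auto
    finally show ?thesis by (simp add: mult_ac)
  qed
  \<comment> \<open>At the vertex \<open>v\<close> itself the coordinate is 1, so the bound there
    reads \<open>\<bar>B v\<bar> \<le> L\<close>.\<close>
  have L: "0 \<le> L"
    using B(2)[of v] hull_inc[OF v, of convex] v by (simp add: lam_vertex)
  have "(\<lambda>m. \<integral>x. layer (\<epsilon> m) v x * B x \<partial>lborel) \<longlonglongrightarrow> (\<integral>x. 0 \<partial>(lborel :: 'n euc measure))"
  proof (rule integral_dominated_convergence[where f = "\<lambda>x. 0" and s = "\<lambda>m x. layer (\<epsilon> m) v x * B x"
        and w = "\<lambda>x. indicator (convex hull C) x *\<^sub>R L"])
    show "(\<lambda>x. layer (\<epsilon> m) v x * B x) \<in> borel_measurable lborel" for m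
      using layer_integrable[OF \<epsilon>(2) v B(1)] by (rule borel_measurable_integrable)
    show "integrable lborel (\<lambda>x. indicator (convex hull C) x *\<^sub>R L)"
      using compact_cell by (intro borel_integrable_compact) auto
    show "AE x in lborel. norm (layer (\<epsilon> m) v x * B x) \<le> indicator (convex hull C) x *\<^sub>R L" for m
    proof (intro AE_I2)
      fix x
      show "norm (layer (\<epsilon> m) v x * B x) \<le> indicator (convex hull C) x *\<^sub>R L"
      proof (cases "x \<in> convex hull C")
        case True
        then have "0 \<le> lam v x" using v by (simp add: cell_eq)
        then have "L * (cut' (\<epsilon> m) (lam v x) * lam v x) \<le> L * 1"
          using L cut'_bound[OF \<epsilon>(2)] by (intro mult_left_mono) auto
        then show ?thesis using bound[OF True, of m] True by simp
      qed (simp add: layer_outside[OF v])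
    qed
    show "AE x in lborel. (\<lambda>m. layer (\<epsilon> m) v x * B x) \<longlonglongrightarrow> 0"
    proof (intro AE_I2)
      fix x
      show "(\<lambda>m. layer (\<epsilon> m) v x * B x) \<longlonglongrightarrow> 0"
      proof (cases "x \<in> convex hull C")
        case True
        have "(\<lambda>m. L * (cut' (\<epsilon> m) (lam v x) * lam v x)) \<longlonglongrightarrow> 0"
        proof (cases "lam v x = 0")
          case False
          then have "0 < lam v x" using True v by (auto simp: cell_eq less_le)
          from tendsto_mult_right_zero[OF cut_tendsto(2)[OF this \<epsilon>(1)], of L] show ?thesis .
        qed simp
        then show ?thesis
          by (rule Lim_null_comparison[rotated]) (use bound[OF True] in auto)
      qed (simp add: layer_outside[OF v])
    qed
  qed simp
  then show ?thesis by simp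
qed

text \<open>Project \<open>x\<close> from \<open>v\<close> to the point \<open>x'\<close> of the
  opposite facet. Then \<open>x - x'\<close> is \<open>lam v x\<close> times \<open>v - x'\<close>,
  and a Lipschitz estimate finishes because \<open>B x' = 0\<close>.\<close>

lemma layer_bound:
  assumes v: "v \<in> C" and B: "C1 B G" and zero: "\<And>x. x \<in> convex hull (C - {v}) \<Longrightarrow> B x = 0"
  shows "\<exists>L. \<forall>x\<in>convex hull C. \<bar>B x\<bar> \<le> L * lam v x"
proof -
  let ?T = "convex hull C" and ?K = "C - {v}"
  obtain N where N: "0 \<le> N" "\<And>x. x \<in> ?T \<Longrightarrow> norm (G x) \<le> N"
    using bounded_on_compact[OF C1_grad_continuous[OF B] compact_cell] by blast
  obtain d where d: "\<And>x. x \<in> ?T \<Longrightarrow> norm (v - x) \<le> d"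
  proof -
    have "continuous_on UNIV (\<lambda>x. v - x)" by (intro continuous_intros)
    then show ?thesis using bounded_on_compact[OF _ compact_cell] that by blast
  qed
  have "card ?K \<noteq> 0" using card_C v finite_C by simp
  then obtain w where w: "w \<in> ?K" by (metis card.empty ex_in_conv)
  have KC: "?K \<subseteq> C" by auto
  have "\<bar>B x\<bar> \<le> (N * d) * lam v x" if x: "x \<in> ?T" for x
  proof -
    let ?l = "lam v x"
    have l0: "0 \<le> ?l" using x v by (simp add: cell_eq)
    have sum: "(\<Sum>u\<in>?K. lam u x) = 1 - ?l" "(\<Sum>u\<in>?K. lam u x *\<^sub>R u) = x - ?l *\<^sub>R v"
      using barycentric[of x] v finite_C sum.remove[of C v "\<lambda>u. lam u x"] sum.remove[of C v "\<lambda>u. lam u x *\<^sub>R u"]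
      by (auto simp: algebra_simps)
    have nn: "0 \<le> lam u x" if "u \<in> C" for u using x that by (simp add: cell_eq)
    obtain x' where x': "x' \<in> convex hull ?K" "x - x' = ?l *\<^sub>R (v - x')"
    \<comment> \<open>At \<open>x = v\<close> the projection is undefined, and any point of the
      facet serves.\<close>
    proof (cases "?l = 1")
      case True
      then have "lam u x = 0" if "u \<in> ?K" for u
        using sum_nonneg_eq_0_iff[of ?K "\<lambda>u. lam u x"] sum(1) nn finite_C that by auto
      then have "x = v" using sum(2) True by simp
      then show ?thesis using that[of w] w True by (simp add: hull_inc)
    next
      case False
      have "(\<Sum>u\<in>?K. lam u x) \<ge> 0" using nn by (intro sum_nonneg) auto
      then have l1: "0 < 1 - ?l" using False sum(1) by simp
      define x' where "x' = (\<Sum>u\<in>?K. (lam u x / (1 - ?l)) *\<^sub>R u)"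
      have "x' = (1 / (1 - ?l)) *\<^sub>R (\<Sum>u\<in>?K. lam u x *\<^sub>R u)" by (simp add: x'_def scaleR_sum_right)
      then have "(1 - ?l) *\<^sub>R x' = x - ?l *\<^sub>R v" using l1 sum(2) by simp
      then have "x - x' = ?l *\<^sub>R (v - x')" by (simp add: algebra_simps)
      moreover have "x' \<in> convex hull ?K"
      proof -
        have "(\<Sum>u\<in>?K. lam u x / (1 - ?l)) = 1" using sum(1) l1 by (simp flip: sum_divide_distrib)
        then show ?thesis unfolding convex_hull_finite[OF finite_sub[OF KC]] x'_def
          using nn l1 by (auto intro!: exI[of _ "\<lambda>u. lam u x / (1 - ?l)"])
      qed
      ultimately show ?thesis using that by blast
    qed
    have x'T: "x' \<in> ?T" using x'(1) hull_mono[OF KC, of convex] by auto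
    have "\<bar>B x - B x'\<bar> \<le> N * norm (x - x')"
      by (rule C1_lipschitz[OF B convex_convex_hull N(2) x x'T])
    also have "\<dots> = N * (?l * norm (v - x'))" unfolding x'(2) using l0 by simp
    also have "\<dots> \<le> N * (?l * d)" using N(1) l0 d[OF x'T] by (intro mult_left_mono) auto
    finally show ?thesis using zero[OF x'(1)] by (simp add: mult_ac)
  qed
  then show ?thesis by blast
qed

end

section \<open>Shears\<close>

lemma det_identity_row:
  fixes v :: "real^'n"
  shows "det ((\<chi> i. if i = k then v else axis i 1) :: real^'n^'n) = v $ k"
proof -
  have "row i (mat 1 :: real^'n^'n) = axis i 1" for i
    by (simp add: row_def mat_def axis_def vec_eq_iff)
  then show ?thesis
    using cramer_lemma_transpose[of k v "mat 1 :: real^'n^'n"]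
    by (simp add: basis_expansion cong: if_cong)
qed

text \<open>The determinant is linear in each row, and two rows proportional to \<open>v\<close>
  annihilate it, so only the terms of order at most one in \<open>u\<close> survive.\<close>

lemma det_identity_plus_rank_one:
  fixes u v :: "real^'n"
  shows "det ((\<chi> i. axis i 1 + u $ i *s v) :: real^'n^'n) = 1 + v \<bullet> u"
proof -
  \<comment> \<open>\<open>M I\<close> has the rows in \<open>I\<close> already perturbed;
    \<open>N k I\<close> has in addition row \<open>k\<close> replaced by \<open>v\<close>.
    Perturbing one more row splits the determinant into these two kinds.\<close>
  define M where "M I = ((\<chi> i. if i \<in> I then axis i 1 + u $ i *s v else axis i 1) :: real^'n^'n)" for I
  define N where "N k I = ((\<chi> i. if i = k then v else if i \<in> I then axis i 1 + u $ i *s v else axis i 1) :: real^'n^'n)" for k I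
  have N: "det (N k I) = v $ k" if "finite I" "k \<notin> I" for k I
    using that
  proof (induction I rule: finite_induct)
    case empty
    have "N k {} = (\<chi> i. if i = k then v else axis i 1)" by (simp add: N_def cong: if_cong)
    then show ?case by (simp add: det_identity_row)
  next
    case (insert j I)
    have jk: "j \<noteq> k" using insert.prems by auto
    let ?c = "\<lambda>i. if i = k then v else if i \<in> I then axis i 1 + u $ i *s v else axis i 1"
    have "N k (insert j I) = (\<chi> i. if i = j then axis i 1 + u $ i *s v else ?c i)"
      using jk by (auto simp: N_def vec_eq_iff)
    then have "det (N k (insert j I)) =
        det ((\<chi> i. if i = j then axis i 1 else ?c i) :: real^'n^'n) +
        det ((\<chi> i. if i = j then u $ i *s v else ?c i) :: real^'n^'n)"
      by (simp only: det_row_add)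
    also have "(\<chi> i. if i = j then axis i 1 else ?c i) = N k I"
      using jk insert.hyps by (auto simp: N_def vec_eq_iff)
    also have "det ((\<chi> i. if i = j then u $ i *s v else ?c i) :: real^'n^'n) =
        u $ j * det ((\<chi> i. if i = j then v else ?c i) :: real^'n^'n)"
    proof -
      have "((\<chi> i. if i = j then u $ i *s v else ?c i) :: real^'n^'n) = (\<chi> i. if i = j then u $ j *s v else ?c i)"
        by (auto simp: vec_eq_iff)
      then show ?thesis by (simp only: det_row_mul)
    qed
    also have "det ((\<chi> i. if i = j then v else ?c i) :: real^'n^'n) = 0"
      using jk by (intro det_identical_rows[of j k]) (auto simp: row_def vec_eq_iff)
    finally show ?case using insert by simp
  qed
  have "det (M I) = 1 + (\<Sum>i\<in>I. u $ i * v $ i)" if "finite I" for I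
    using that
  proof (induction I rule: finite_induct)
    case empty
    have "M {} = mat 1" by (simp add: M_def mat_def axis_def vec_eq_iff)
    then show ?case by simp
  next
    case (insert k I)
    let ?c = "\<lambda>i. if i \<in> I then axis i 1 + u $ i *s v else axis i 1"
    have "M (insert k I) = (\<chi> i. if i = k then axis i 1 + u $ i *s v else ?c i)"
      by (auto simp: M_def vec_eq_iff)
    then have "det (M (insert k I)) =
        det ((\<chi> i. if i = k then axis i 1 else ?c i) :: real^'n^'n) +
        det ((\<chi> i. if i = k then u $ i *s v else ?c i) :: real^'n^'n)"
      by (simp only: det_row_add)
    also have "(\<chi> i. if i = k then axis i 1 else ?c i) = M I"
      using insert.hyps by (auto simp: M_def vec_eq_iff)
    also have "det ((\<chi> i. if i = k then u $ i *s v else ?c i) :: real^'n^'n) =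
        u $ k * det ((\<chi> i. if i = k then v else ?c i) :: real^'n^'n)"
    proof -
      have "((\<chi> i. if i = k then u $ i *s v else ?c i) :: real^'n^'n) = (\<chi> i. if i = k then u $ k *s v else ?c i)"
        by (auto simp: vec_eq_iff)
      then show ?thesis by (simp only: det_row_mul)
    qed
    also have "((\<chi> i. if i = k then v else ?c i) :: real^'n^'n) = N k I"
      by (auto simp: N_def vec_eq_iff)
    finally show ?case using insert N[OF insert.hyps] by simp
  qed
  from this[of UNIV] show ?thesis
    by (simp add: M_def inner_vec_def mult.commute)
qed

text \<open>The linear part is the identity plus a rank-one map and has determinant
  \<open>1 + \<gamma> \<bullet> u\<close>. The compact set \<open>S'\<close> provides integrability
  of the transformed function.\<close>

lemma integral_shear:
  fixes f :: "('n::{finite,wellorder}) euc \<Rightarrow> real" and u \<gamma> :: "'n euc"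
  assumes f: "continuous_on UNIV f" "compact S" "\<And>x. x \<notin> S \<Longrightarrow> f x = 0"
    and f': "compact S'" "\<And>x. x \<notin> S' \<Longrightarrow> f (x + (a + \<gamma> \<bullet> x) *\<^sub>R u) = 0" and \<mu>: "1 + \<gamma> \<bullet> u \<noteq> 0"
  shows "(\<integral>x. f x \<partial>lborel) = \<bar>1 + \<gamma> \<bullet> u\<bar> * (\<integral>x. f (x + (a + \<gamma> \<bullet> x) *\<^sub>R u) \<partial>lborel)"
proof -
  define A where "A x = x + (a + \<gamma> \<bullet> x) *\<^sub>R u" for x
  define L where "L h = h + (\<gamma> \<bullet> h) *\<^sub>R u" for h
  have A': "(A has_derivative L) (at x)" for x
    unfolding A_def[abs_def] L_def[abs_def] by (auto intro!: derivative_eq_intros)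
  have det: "det (matrix L) = 1 + \<gamma> \<bullet> u"
  proof -
    have "matrix L = (\<chi> i. axis i 1 + u $ i *s \<gamma>)"
      by (simp add: matrix_def L_def vec_eq_iff inner_axis) (simp add: axis_def)
    then show ?thesis using det_identity_plus_rank_one[of u \<gamma>] by simp
  qed
  \<comment> \<open>The last two terms cancel: the shear multiplies its affine coefficient by
    \<open>1 + \<gamma> \<bullet> u\<close>, hence is injective.\<close>
  have affA: "a + \<gamma> \<bullet> A x = a * (1 + \<gamma> \<bullet> u) + (\<gamma> \<bullet> x) * (1 + \<gamma> \<bullet> u) - a * (\<gamma> \<bullet> u) + a * (\<gamma> \<bullet> u)" for x
    by (simp add: A_def inner_add_right algebra_simps)
  have inj: "inj A"
  proof (rule injI)
    fix x y assume eq: "A x = A y"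
    then have "(a + \<gamma> \<bullet> x) * (1 + \<gamma> \<bullet> u) = (a + \<gamma> \<bullet> y) * (1 + \<gamma> \<bullet> u)"
      using affA[of x] affA[of y] by (simp add: algebra_simps)
    then have "\<gamma> \<bullet> x = \<gamma> \<bullet> y" using \<mu> by simp
    then show "x = y" using eq by (simp add: A_def)
  qed
  have surj: "range A = UNIV"
  proof -
    have "y \<in> range A" for y
    proof
      let ?s = "(a + \<gamma> \<bullet> y) / (1 + \<gamma> \<bullet> u)"
      have "a + \<gamma> \<bullet> (y - ?s *\<^sub>R u) = (a + \<gamma> \<bullet> y) - ?s * (\<gamma> \<bullet> u)" by (simp add: inner_diff_right)
      also have "\<dots> = ?s" using \<mu> by (simp add: field_simps)
      finally show "y = A (y - ?s *\<^sub>R u)" by (simp add: A_def)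
    qed simp
    then show ?thesis by auto
  qed
  have Ac: "continuous_on UNIV (\<lambda>x. f (A x))"
    unfolding A_def by (intro continuous_on_compose2[OF f(1)] continuous_intros) auto
  have i1: "integrable lborel f" by (rule integrable_compact_support[OF f])
  have i2: "integrable lborel (\<lambda>x. f (A x))"
    by (rule integrable_compact_support[OF Ac f'(1)]) (simp add: A_def f'(2))
  \<comment> \<open>The change of variables formula concerns vector-valued functions;
    \<open>e\<close> embeds the reals in \<open>real^1\<close>.\<close>
  define e where "e = (axis 1 1 :: real^1)"
  have ai: "(\<lambda>x. h x *\<^sub>R e) absolutely_integrable_on UNIV" if "integrable lborel h" for h :: "'n euc \<Rightarrow> real"
    using that integrable_completion[of "\<lambda>x. h x *\<^sub>R e" lborel]
    by (auto simp: set_integrable_def)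
  have int: "integral UNIV (\<lambda>x. h x *\<^sub>R e) = (\<integral>x. h x \<partial>lborel) *\<^sub>R e" if "integrable lborel h" for h :: "'n euc \<Rightarrow> real"
    using that by (subst integral_lborel) auto
  have "(\<lambda>x. f x *\<^sub>R e) absolutely_integrable_on (A ` UNIV) \<and> integral (A ` UNIV) (\<lambda>x. f x *\<^sub>R e) = (\<integral>x. f x \<partial>lborel) *\<^sub>R e"
    unfolding surj using ai[OF i1] int[OF i1] by simp
  then have "integral UNIV (\<lambda>x. \<bar>det (matrix L)\<bar> *\<^sub>R (f (A x) *\<^sub>R e)) = (\<integral>x. f x \<partial>lborel) *\<^sub>R e"
    using has_absolute_integral_change_of_variables[of UNIV A "\<lambda>_. L" "\<lambda>x. f x *\<^sub>R e"] A' inj by auto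
  then have "(\<bar>det (matrix L)\<bar> * (\<integral>x. f (A x) \<partial>lborel)) *\<^sub>R e = (\<integral>x. f x \<partial>lborel) *\<^sub>R e"
    using int[of "\<lambda>x. \<bar>det (matrix L)\<bar> * f (A x)"] i2 by simp
  moreover have "e \<noteq> 0" by (simp add: e_def axis_eq_0_iff)
  ultimately show ?thesis by (simp add: det A_def)
qed

section \<open>Adjacent cells\<close>

text \<open>Both coordinates are affine and vanish at the vertices of the common facet, so they are
  proportional; evaluation at \<open>v'\<close> gives the factor.\<close>

lemma adjacent_relation:
  fixes C C' :: "('n::{finite,wellorder}) euc set"
  assumes T: "barycentric C a g" and T': "barycentric C' a' g'"
    and v: "v \<in> C" "v' \<in> C'" and K: "C - {v} = C' - {v'}"
  shows "barycentric.lam a g v x = barycentric.lam a g v v' * barycentric.lam a' g' v' x"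
    and "g v = barycentric.lam a g v v' *\<^sub>R g' v'" and "barycentric.lam a g v v' \<noteq> 0"
proof -
  interpret T: barycentric C a g by fact
  interpret T': barycentric C' a' g' by fact
  have zero: "T.lam v w = 0" if "w \<in> C' - {v'}" for w
  proof -
    have "w \<in> C - {v}" using that by (simp only: K)
    then show ?thesis using T.lam_vertex[OF v(1), of w] by auto
  qed
  have rel: "T.lam v x = T.lam v v' * T'.lam v' x" for x
  proof -
    have "T.lam v x = T.lam v (\<Sum>w\<in>C'. T'.lam w x *\<^sub>R w)" by (simp add: T'.barycentric)
    also have "\<dots> = (\<Sum>w\<in>C'. T'.lam w x * T.lam v w)"
      using T'.barycentric(1)[of x]
      by (simp add: T.lam_def inner_sum_right distrib_left sum.distrib flip: sum_distrib_right)
    also have "\<dots> = T'.lam v' x * T.lam v v'"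
      using zero v T'.finite_C by (subst sum.remove[of _ v']) auto
    finally show ?thesis by simp
  qed
  then show "T.lam v x = T.lam v v' * T'.lam v' x" .
  have "g v \<bullet> u = (T.lam v v' *\<^sub>R g' v') \<bullet> u" for u
    using rel[of u] rel[of 0] by (simp add: T.lam_def T'.lam_def algebra_simps)
  then show "g v = T.lam v v' *\<^sub>R g' v'" by (metis vector_eq_rdot)
  show "T.lam v v' \<noteq> 0" using rel[of v] T.lam_vertex[OF v(1) v(1)] by auto
qed

text \<open>The shear fixing the common facet and mapping \<open>v\<close> to \<open>v'\<close> matches the two layers; its
  determinant \<open>lam v v' < 0\<close> is also the ratio of the gradients, so the two layer integrals cancel
  up to the jump of the normal component, which vanishes on the facet.\<close>
lemma adjacent_layers_cancel:
  fixes C C' :: "('n::{finite,wellorder}) euc set"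
  assumes T: "barycentric C a g" and T': "barycentric C' a' g'"
    and v: "v \<in> C" "v' \<in> C'" and K: "C - {v} = C' - {v'}"
    and neg: "barycentric.lam a g v v' < 0"
    and F: "\<And>i. C1 (F i) (G i)" "\<And>i. C1 (F' i) (G' i)"
    and jump: "\<And>x. x \<in> convex hull (C - {v}) \<Longrightarrow>
      (\<Sum>i\<in>UNIV. g v $ i * F i x) = (\<Sum>i\<in>UNIV. g v $ i * F' i x)"
    and \<epsilon>: "\<epsilon> \<longlonglongrightarrow> 0" "\<And>m. 0 < \<epsilon> m"
  shows "(\<lambda>m. (\<integral>x. barycentric.layer C a g (\<epsilon> m) v x * (\<Sum>i\<in>UNIV. g v $ i * F i x) \<partial>lborel) +
    (\<integral>x. barycentric.layer C' a' g' (\<epsilon> m) v' x * (\<Sum>i\<in>UNIV. g' v' $ i * F' i x) \<partial>lborel)) \<longlonglongrightarrow> 0"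
proof -
  interpret T: barycentric C a g by fact
  interpret T': barycentric C' a' g' by fact
  define \<mu> where "\<mu> = T.lam v v'"
  define A where "A x = x + (a v + g v \<bullet> x) *\<^sub>R (v' - v)" for x
  have vv: "T.lam v v = 1" using v by (simp add: T.lam_vertex)
  have \<mu>_eq: "1 + g v \<bullet> (v' - v) = \<mu>" using vv by (simp add: \<mu>_def T.lam_def inner_diff_right)
  have A_bary: "A x = (\<Sum>w\<in>C - {v}. T.lam w x *\<^sub>R w) + T.lam v x *\<^sub>R v'" for x
    using T.barycentric(2)[of x] v T.finite_C sum.remove[of C v "\<lambda>w. T.lam w x *\<^sub>R w"]
    by (simp add: A_def T.lam_def[symmetric] algebra_simps)
  have vK: "v' \<notin> C - {v}" using K by auto
  have C': "C' = insert v' (C - {v})" unfolding K using v by auto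
  \<comment> \<open>The shear keeps all barycentric coordinates and merely replaces the vertex
    \<open>v\<close> by \<open>v'\<close>; this is why it carries one layer to the other.\<close>
  have lam'_eq: "T'.lam w (A x) = (if w = v' then T.lam v x else T.lam w x)" if w: "w \<in> C'" for w x
  proof -
    define t where "t u = (if u = v' then T.lam v x else T.lam u x)" for u
    have tK: "t u = T.lam u x" if "u \<in> C - {v}" for u using that vK by (auto simp: t_def)
    have "sum t C' = T.lam v x + (\<Sum>u\<in>C - {v}. T.lam u x)"
      unfolding C' using vK T.finite_C tK by (simp add: t_def)
    also have "\<dots> = 1" using T.barycentric(1)[of x] v T.finite_C sum.remove[of C v "\<lambda>w. T.lam w x"] by simp
    finally have sum1: "sum t C' = 1" .
    have "(\<Sum>u\<in>C'. t u *\<^sub>R u) = T.lam v x *\<^sub>R v' + (\<Sum>u\<in>C - {v}. T.lam u x *\<^sub>R u)"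
      unfolding C' using vK T.finite_C tK by (simp add: t_def)
    then have A_eq: "A x = (\<Sum>u\<in>C'. t u *\<^sub>R u)" unfolding A_bary by simp
    show ?thesis
      unfolding A_eq using T'.lam_comb[OF subset_refl sum1 w] w by (simp add: t_def)
  qed
  have lam'_A: "T'.lam w (A x) = T.lam w x" if "w \<in> C - {v}" for w x
    using lam'_eq[of w x] that vK by (auto simp: C')
  have lam'_Av: "T'.lam v' (A x) = T.lam v x" for x using lam'_eq[of v' x] v by simp
  have layerA: "T'.layer e v' (A x) = T.layer e v x" for e x
    unfolding T'.layer_def T.layer_def lam'_Av K[symmetric]
    using lam'_A by (intro arg_cong2[where f = "(*)"] prod.cong) auto
  define F'' where "F'' x = (\<Sum>i\<in>UNIV. g' v' $ i * F' i x)" for x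
  have F''c: "continuous_on UNIV F''"
    unfolding F''_def using C1_continuous[OF F(2)] by (intro continuous_intros) auto
  have trans: "(\<integral>x. T'.layer e v' x * F'' x \<partial>lborel) = \<bar>\<mu>\<bar> * (\<integral>x. T.layer e v x * F'' (A x) \<partial>lborel)"
    if "0 < e" for e
  proof -
    have "(\<integral>x. T'.layer e v' x * F'' x \<partial>lborel) =
       \<bar>1 + g v \<bullet> (v' - v)\<bar> * (\<integral>x. T'.layer e v' (A x) * F'' (A x) \<partial>lborel)"
      unfolding A_def
    proof (rule integral_shear[OF _ T'.compact_cell _ T.compact_cell])
      show "continuous_on UNIV (\<lambda>x. T'.layer e v' x * F'' x)"
        by (intro continuous_intros T'.layer_continuous that F''c)
      show "T'.layer e v' x * F'' x = 0" if "x \<notin> convex hull C'" for x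
        using T'.layer_outside[OF v(2) that] by simp
      show "T'.layer e v' (x + (a v + g v \<bullet> x) *\<^sub>R (v' - v)) * F'' (x + (a v + g v \<bullet> x) *\<^sub>R (v' - v)) = 0"
        if "x \<notin> convex hull C" for x
        using T.layer_outside[OF v(1) that] layerA[of e x] by (simp add: A_def)
      show "1 + g v \<bullet> (v' - v) \<noteq> 0" using \<mu>_eq neg by (simp add: \<mu>_def)
    qed
    then show ?thesis by (simp add: layerA \<mu>_eq)
  qed
  \<comment> \<open>The jump of the flux, transported to the first cell. The shear is the identity
    on the facet, so \<open>jump\<close> makes \<open>B\<close> vanish there.\<close>
  define B where "B x = (\<Sum>i\<in>UNIV. g v $ i * F i x) + (- 1) * (\<Sum>i\<in>UNIV. g v $ i * F' i (A x))" for x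
  have c1: "C1 (\<lambda>x. \<Sum>i\<in>UNIV. g v $ i * F i x) (\<lambda>x. \<Sum>i\<in>UNIV. g v $ i *\<^sub>R G i x)"
    by (intro C1_sum C1_scale F)
  define H' where "H' i x = G' i (A x) + (G' i (A x) \<bullet> (v' - v)) *\<^sub>R g v" for i x
  have c2: "C1 (\<lambda>x. \<Sum>i\<in>UNIV. g v $ i * F' i (A x)) (\<lambda>x. \<Sum>i\<in>UNIV. g v $ i *\<^sub>R H' i x)"
    unfolding A_def H'_def by (intro C1_sum C1_scale C1_compose_shear F)
  obtain H where H: "C1 B H"
    using C1_add[OF c1 C1_scale[OF c2, of "- 1"]] unfolding B_def[abs_def] by blast
  have "B x = 0" if x: "x \<in> convex hull (C - {v})" for x
  proof -
    have "T.lam v x = 0" using x v T.hull_eq[of "C - {v}"] by auto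
    then have "A x = x" by (simp add: A_def T.lam_def)
    then show ?thesis using jump[OF x] by (simp add: B_def)
  qed
  from T.layer_bound[OF v(1) H this]
  obtain L where L: "\<And>x. x \<in> convex hull C \<Longrightarrow> \<bar>B x\<bar> \<le> L * T.lam v x" by blast
  have lim: "(\<lambda>m. \<integral>x. T.layer (\<epsilon> m) v x * B x \<partial>lborel) \<longlonglongrightarrow> 0"
    by (rule T.layer_vanish[OF v(1) C1_continuous[OF H] L \<epsilon>])
  \<comment> \<open>With \<mu> negative and \<open>g v = \<mu> *\<^sub>R g' v'\<close>, the Jacobian
    absorbs the ratio of the gradients and leaves the minus sign in \<open>B\<close>.\<close>
  have "\<bar>\<mu>\<bar> * F'' (A x) = - (\<Sum>i\<in>UNIV. g v $ i * F' i (A x))" for x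
    using adjacent_relation(2)[OF T T' v K] neg
    by (simp add: F''_def \<mu>_def sum_distrib_left mult_ac flip: sum_negf)
  then have B_eq: "B x = (\<Sum>i\<in>UNIV. g v $ i * F i x) + \<bar>\<mu>\<bar> * F'' (A x)" for x by (simp add: B_def)
  have Ac: "continuous_on UNIV (\<lambda>x. F'' (A x))"
    unfolding A_def by (intro continuous_on_compose2[OF F''c] continuous_intros) auto
  have Fc: "continuous_on UNIV (\<lambda>x. \<Sum>i\<in>UNIV. g v $ i * F i x)"
    using C1_continuous[OF F(1)] by (intro continuous_intros) auto
  have "(\<integral>x. T.layer (\<epsilon> m) v x * (\<Sum>i\<in>UNIV. g v $ i * F i x) \<partial>lborel) + (\<integral>x. T'.layer (\<epsilon> m) v' x * F'' x \<partial>lborel)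
      = (\<integral>x. T.layer (\<epsilon> m) v x * B x \<partial>lborel)" for m
  proof -
    have "(\<integral>x. T.layer (\<epsilon> m) v x * B x \<partial>lborel) =
        (\<integral>x. T.layer (\<epsilon> m) v x * (\<Sum>i\<in>UNIV. g v $ i * F i x) + \<bar>\<mu>\<bar> * (T.layer (\<epsilon> m) v x * F'' (A x)) \<partial>lborel)"
      unfolding B_eq by (simp add: distrib_left mult_ac)
    also have "\<dots> = (\<integral>x. T.layer (\<epsilon> m) v x * (\<Sum>i\<in>UNIV. g v $ i * F i x) \<partial>lborel) +
        \<bar>\<mu>\<bar> * (\<integral>x. T.layer (\<epsilon> m) v x * F'' (A x) \<partial>lborel)"
      using T.layer_integrable[OF \<epsilon>(2) v(1) Fc] T.layer_integrable[OF \<epsilon>(2) v(1) Ac] by simp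
    finally show ?thesis using trans[OF \<epsilon>(2)] by simp
  qed
  then show ?thesis using lim by (simp add: F''_def)
qed

section \<open>Meshes\<close>

lemma (in barycentric) interior_cell:
  assumes "\<And>v. v \<in> C \<Longrightarrow> 0 < lam v x"
  shows "x \<in> rel_interior (convex hull C)"
proof -
  have "open (\<Inter>v\<in>C. {x. 0 < lam v x})"
    using finite_C lam_continuous by (intro open_INT ballI open_Collect_less continuous_intros) auto
  moreover have "(\<Inter>v\<in>C. {x. 0 < lam v x}) \<subseteq> convex hull C" by (auto simp: cell_eq less_imp_le)
  ultimately have "x \<in> interior (convex hull C)"
    using assms by (intro interiorI[of "\<Inter>v\<in>C. {x. 0 < lam v x}"]) auto
  then show ?thesis using interior_subset_rel_interior by blast
qed

locale adapted_mesh =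
  fixes \<Omega> :: "('n::{finite,wellorder}) euc set" and \<T> :: "'n euc set set"
    and y z :: "'n euc set \<Rightarrow> 'n \<Rightarrow> 'n euc" and dyh :: "'n euc set \<Rightarrow> 'n \<Rightarrow> 'n form" and k r :: nat
    and C :: "'n euc set \<Rightarrow> 'n euc set" and a :: "'n euc set \<Rightarrow> 'n euc \<Rightarrow> real"
    and g :: "'n euc set \<Rightarrow> 'n euc \<Rightarrow> 'n euc"
  assumes \<Omega>: "domain \<Omega>" "bounded \<Omega>" and mesh: "conforming_mesh \<T> \<Omega>"
    and elem: "\<And>T. T \<in> \<T> \<Longrightarrow> element (C T) (a T) (g T) k r y z dyh"
    and hull: "\<And>T. T \<in> \<T> \<Longrightarrow> convex hull (C T) = T"
begin

abbreviation lamT :: "'n euc set \<Rightarrow> 'n euc \<Rightarrow> 'n euc \<Rightarrow> real" where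
  "lamT T \<equiv> barycentric.lam (a T) (g T)"

lemma bary: "T \<in> \<T> \<Longrightarrow> barycentric (C T) (a T) (g T)"
  using elem element.axioms(1) by blast

lemma finite_mesh: "finite \<T>"
  using mesh by (simp add: conforming_mesh_def triangulation_def)

lemma mesh_face: "T \<in> \<T> \<Longrightarrow> T' \<in> \<T> \<Longrightarrow> (T \<inter> T') face_of T"
  using mesh by (simp add: conforming_mesh_def triangulation_def)

lemma open_domain: "open \<Omega>"
  using \<Omega> by (simp add: domain_def)

lemma domain_cover: "\<Omega> \<subseteq> \<Union>\<T>"
  using mesh closure_subset by (auto simp: conforming_mesh_def)

lemma compact_cells: "T \<in> \<T> \<Longrightarrow> compact T"
  using barycentric.compact_cell[OF bary] hull by metis

lemma cell_iff: "T \<in> \<T> \<Longrightarrow> x \<in> T \<longleftrightarrow> (\<forall>v\<in>C T. 0 \<le> lamT T v x)"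
proof -
  assume T: "T \<in> \<T>"
  show ?thesis using barycentric.cell_eq[OF bary[OF T]] hull[OF T] by auto
qed

lemma cell_subset_eq:
  assumes T: "T \<in> \<T>" "T' \<in> \<T>" and "T \<subseteq> T'"
  shows "T = T'"
proof (rule ccontr)
  assume ne: "T \<noteq> T'"
  have s: "int CARD('n) simplex T" "int CARD('n) simplex T'" using T mesh by (auto simp: conforming_mesh_def)
  have "T face_of T'" using mesh_face[OF T(2,1)] assms(3) by (simp add: Int_absorb1)
  then have "aff_dim T < aff_dim T'" using ne convex_simplex[OF s(2)] by (intro face_of_aff_dim_lt)
  then show False using aff_dim_simplex[OF s(1)] aff_dim_simplex[OF s(2)] by simp
qed

text \<open>The intersection is a face of \<open>T\<close> that meets its relative interior, hence
  all of \<open>T\<close>; and no cell is properly contained in another.\<close>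

lemma cell_unique:
  assumes T: "T \<in> \<T>" "T' \<in> \<T>" and x: "x \<in> T'" "\<And>v. v \<in> C T \<Longrightarrow> 0 < lamT T v x"
  shows "T = T'"
proof -
  have "x \<in> rel_interior T" using barycentric.interior_cell[OF bary[OF T(1)]] x(2) hull[OF T(1)] by metis
  moreover have "x \<in> T" using x(2) by (simp add: cell_iff[OF T(1)] less_imp_le)
  ultimately have "T \<inter> T' = T"
    using face_of_disjoint_rel_interior[OF mesh_face[OF T]] x(1) by blast
  then show ?thesis using cell_subset_eq[OF T] by blast
qed

text \<open>Otherwise a small step from the barycenter of the common facet towards \<open>v'\<close>
  would make all coordinates of \<open>T\<close> positive while staying in \<open>T'\<close>, so
  that \<open>T'\<close> would contain an interior point of \<open>T\<close>.\<close>

lemma opposite_side: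
  assumes T: "T \<in> \<T>" "T' \<in> \<T>" "T \<noteq> T'" and v: "v \<in> C T" "v' \<in> C T'"
    and K: "C T - {v} = C T' - {v'}"
  shows "lamT T v v' < 0"
proof (rule ccontr)
  assume "\<not> lamT T v v' < 0"
  then have pos: "0 < lamT T v v'"
    using adjacent_relation(3)[OF bary[OF T(1)] bary[OF T(2)] v K] by simp
  interpret T: barycentric "C T" "a T" "g T" by (rule bary[OF T(1)])
  interpret T': barycentric "C T'" "a T'" "g T'" by (rule bary[OF T(2)])
  let ?K = "C T - {v}"
  have cK: "card ?K = CARD('n)" using T.card_C T.finite_C v by simp
  define b where "b = (\<Sum>w\<in>?K. (1 / real CARD('n)) *\<^sub>R w)"
  have sum1: "(\<Sum>w\<in>?K. 1 / real CARD('n)) = 1" using cK by simp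
  have lb: "T.lam w b = (if w \<in> ?K then 1 / real CARD('n) else 0)" if "w \<in> C T" for w
    unfolding b_def by (rule T.lam_comb[OF _ sum1 that]) auto
  have KC: "?K \<subseteq> C T" "?K \<subseteq> C T'" using K by auto
  have "b \<in> convex hull ?K"
    using lb by (auto simp: T.hull_eq[OF KC(1)])
  then have bT': "b \<in> T'" using hull_mono[OF KC(2), of convex] hull[OF T(2)] by blast
  have v'T': "v' \<in> T'" using v(2) hull[OF T(2)] hull_inc by metis
  define x where "x \<delta> = (1 - \<delta>) *\<^sub>R b + \<delta> *\<^sub>R v'" for \<delta> :: real
  have lx: "T.lam w (x \<delta>) = (1 - \<delta>) * T.lam w b + \<delta> * T.lam w v'" for w \<delta>
    unfolding x_def by (rule T.lam_affine) simp
  have "\<forall>\<^sub>F \<delta> in at_right 0. 0 < T.lam w (x \<delta>)" if "w \<in> ?K" for w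
  proof -
    have "((\<lambda>\<delta>. T.lam w (x \<delta>)) \<longlongrightarrow> (1 - 0) * T.lam w b + 0 * T.lam w v') (at_right 0)"
      unfolding lx by (intro tendsto_intros)
    then show ?thesis by (rule order_tendstoD(1)) (use that lb in auto)
  qed
  then have "\<forall>\<^sub>F \<delta> in at_right 0. \<forall>w\<in>?K. 0 < T.lam w (x \<delta>)"
    using T.finite_C by (intro eventually_ball_finite) auto
  moreover have "\<forall>\<^sub>F \<delta> in at_right 0. \<delta> < (1::real)" by (rule order_tendstoD(2)[OF tendsto_ident_at]) simp
  moreover have "\<forall>\<^sub>F \<delta> in at_right 0. (0::real) < \<delta>" by (rule eventually_at_right_less)
  ultimately have "\<forall>\<^sub>F \<delta> in at_right 0. (\<forall>w\<in>?K. 0 < T.lam w (x \<delta>)) \<and> \<delta> < 1 \<and> 0 < \<delta>"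
    by (intro eventually_conj)
  from eventually_happens'[OF _ this] obtain \<delta> where \<delta>: "\<And>w. w \<in> ?K \<Longrightarrow> 0 < T.lam w (x \<delta>)" "\<delta> < 1" "0 < \<delta>"
    by auto
  have "0 < T.lam v (x \<delta>)" using pos \<delta>(3) lb[OF v(1)] by (simp add: lx)
  then have all: "0 < T.lam w (x \<delta>)" if "w \<in> C T" for w using \<delta>(1)[of w] that by (cases "w = v") auto
  have "convex T'" using hull[OF T(2)] convex_convex_hull by metis
  then have "x \<delta> \<in> T'" using bT' v'T' \<delta> by (auto simp: x_def convex_def)
  from cell_unique[OF T(1,2) this all] show False using T(3) by simp
qed

text \<open>Points of \<Omega> just beyond the facet lie in other cells. There are finitely many and
  they are closed, so \<open>x\<close> lies in one of them too. By conformity the intersection with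
  it is a face of \<open>T\<close>; since \<open>x\<close> is relatively interior to the facet, this
  face contains the whole facet, and it is not \<open>T\<close>.\<close>

lemma neighbour_exists:
  assumes T: "T \<in> \<T>" and v: "v \<in> C T" and x: "x \<in> convex hull (C T - {v})" "x \<in> \<Omega>"
    and pos: "\<And>w. w \<in> C T - {v} \<Longrightarrow> 0 < lamT T w x"
  shows "\<exists>T'\<in>\<T>. \<exists>v'\<in>C T'. T' \<noteq> T \<and> C T' - {v'} = C T - {v}"
proof -
  interpret T: barycentric "C T" "a T" "g T" by (rule bary[OF T])
  let ?K = "C T - {v}"
  have KC: "?K \<subseteq> C T" by auto
  have lvx: "T.lam v x = 0" using x(1) v by (auto simp: T.hull_eq[OF KC])
  define U where "U = \<Union>(\<T> - {T})"
  have "closed U" unfolding U_def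
    using finite_mesh compact_cells by (intro closed_Union) (auto simp: compact_imp_closed)
  define t where "t m = 1 / real (Suc m)" for m
  have t0: "t \<longlonglongrightarrow> 0" unfolding t_def using LIMSEQ_inverse_real_of_nat by (simp add: inverse_eq_divide)
  \<comment> \<open>On the line from \<open>v\<close> through \<open>x\<close>, beyond
    \<open>x\<close>; the coordinate at \<open>v\<close> is \<open>- t m\<close>.\<close>
  define X where "X m = (1 + t m) *\<^sub>R x + (- t m) *\<^sub>R v" for m
  have "X \<longlonglongrightarrow> (1 + 0) *\<^sub>R x + (- 0) *\<^sub>R v" unfolding X_def by (intro tendsto_intros t0)
  then have Xlim: "X \<longlonglongrightarrow> x" by simp
  have "\<forall>\<^sub>F m in sequentially. X m \<in> \<Omega>" by (rule topological_tendstoD[OF Xlim open_domain x(2)])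
  moreover have "X m \<in> U" if "X m \<in> \<Omega>" for m
  proof -
    have "T.lam v (X m) = (1 + t m) * T.lam v x + (- t m) * T.lam v v"
      unfolding X_def by (rule T.lam_affine) simp
    then have "T.lam v (X m) < 0" using lvx T.lam_vertex[OF v v] by (simp add: t_def)
    then have "X m \<notin> T" using v by (auto simp: cell_iff[OF T] not_le intro!: bexI[of _ v])
    then show ?thesis using that domain_cover by (auto simp: U_def)
  qed
  ultimately have "\<forall>\<^sub>F m in sequentially. X m \<in> U" by (auto elim: eventually_mono)
  then have "x \<in> U" by (rule Lim_in_closed_set[OF \<open>closed U\<close> _ sequentially_bot Xlim])
  then obtain T' where T': "T' \<in> \<T>" "T' \<noteq> T" "x \<in> T'" by (auto simp: U_def)
  interpret T': barycentric "C T'" "a T'" "g T'" by (rule bary[OF T'(1)])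
  have "(T \<inter> T') face_of convex hull (C T)" using mesh_face[OF T T'(1)] hull[OF T] by simp
  then obtain M where M: "M \<subseteq> C T" "T \<inter> T' = convex hull M"
    using face_of_convex_hull_affine_independent[OF T.indep] by auto
  have "x \<in> T" using x(1) hull_mono[OF KC, of convex] hull[OF T] by blast
  then have xM: "x \<in> convex hull M" using T'(3) M(2) by blast
  have "?K \<subseteq> M"
  proof
    fix w assume w: "w \<in> ?K"
    show "w \<in> M"
    proof (rule ccontr)
      assume "w \<notin> M"
      then have "T.lam w x = 0" using xM w by (auto simp: T.hull_eq[OF M(1)])
      then show False using pos[OF w] by simp
    qed
  qed
  moreover have "v \<notin> M"
  proof
    assume "v \<in> M"
    then have "M = C T" using \<open>?K \<subseteq> M\<close> M(1) by auto
    then have "T \<subseteq> T'" using M(2) hull[OF T] by auto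
    then show False using cell_subset_eq[OF T T'(1)] T'(2) by simp
  qed
  ultimately have MK: "M = ?K" using M(1) by auto
  have "(T \<inter> T') face_of convex hull (C T')"
    using mesh_face[OF T'(1) T] hull[OF T'(1)] by (simp add: Int_commute)
  then obtain M' where M': "M' \<subseteq> C T'" "T \<inter> T' = convex hull M'"
    using face_of_convex_hull_affine_independent[OF T'.indep] by auto
  \<comment> \<open>The vertices of the common face are its extreme points, hence the same for both
    cells.\<close>
  have "u \<in> M \<longleftrightarrow> u \<in> M'" for u
    using extreme_point_of_convex_hull_affine_independent[of M u] extreme_point_of_convex_hull_affine_independent[of M' u]
      affine_independent_subset[OF T.indep M(1)] affine_independent_subset[OF T'.indep M'(1)] M(2) M'(2) by simp
  then have M'K: "M' = ?K" using MK by auto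
  have "card (C T' - ?K) = 1"
    using T'.card_C T.card_C T.finite_C v M'(1) M'K by (subst card_Diff_subset) auto
  then obtain v' where v': "C T' - ?K = {v'}" by (auto simp: card_Suc_eq)
  then have "v' \<in> C T'" "C T' - {v'} = ?K" using M'(1) M'K by auto
  then show ?thesis using T' by blast
qed

text \<open>The layers at a facet cancel: it either lies in two cells, on opposite sides, or the test
  function vanishes on it.\<close>
lemma divergence_sum_zero:
  assumes A: "\<And>T i. T \<in> \<T> \<Longrightarrow> C1 (A T i) (GA T i)" and \<phi>: "C1 \<phi> \<Phi>" and supp: "\<And>x. x \<notin> \<Omega> \<Longrightarrow> \<phi> x = 0"
    and jump: "\<And>T T' v v' x. T \<in> \<T> \<Longrightarrow> T' \<in> \<T> \<Longrightarrow> v \<in> C T \<Longrightarrow> v' \<in> C T' \<Longrightarrow> C T - {v} = C T' - {v'} \<Longrightarrow>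
      x \<in> convex hull (C T - {v}) \<Longrightarrow> (\<Sum>i\<in>UNIV. g T v $ i * A T i x) = (\<Sum>i\<in>UNIV. g T v $ i * A T' i x)"
  shows "(\<Sum>T\<in>\<T>. \<integral>x. indicator T x * (\<Sum>i\<in>UNIV. \<phi> x * GA T i x $ i + A T i x * \<Phi> x $ i) \<partial>lborel) = 0"
proof -
  define F where "F T i x = \<phi> x * A T i x" for T i x
  define G where "G T i x = \<phi> x *\<^sub>R GA T i x + A T i x *\<^sub>R \<Phi> x" for T i x
  have F: "C1 (F T i) (G T i)" if "T \<in> \<T>" for T i
    unfolding F_def[abs_def] G_def[abs_def] by (rule C1_mult[OF \<phi> A[OF that]])
  define \<epsilon> where "\<epsilon> m = 1 / real (Suc m)" for m
  have \<epsilon>: "\<epsilon> \<longlonglongrightarrow> 0" "0 < \<epsilon> m" for m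
    unfolding \<epsilon>_def using LIMSEQ_inverse_real_of_nat by (simp_all add: inverse_eq_divide)
  define J where "J m p = (\<integral>x. barycentric.layer (C (fst p)) (a (fst p)) (g (fst p)) (\<epsilon> m) (snd p) x *
      (\<Sum>i\<in>UNIV. g (fst p) (snd p) $ i * F (fst p) i x) \<partial>lborel)" for m p
  define I where "I = (SIGMA T:\<T>. C T)"
  \<comment> \<open>A facet is identified by its vertex set. The fibres of \<kappa> collect the
    layers meeting at one facet, and the limit is taken fibre by fibre.\<close>
  define \<kappa> where "\<kappa> p = C (fst p) - {snd p}" for p :: "'n euc set \<times> 'n euc"
  have finI: "finite I" unfolding I_def using finite_mesh barycentric.finite_C[OF bary] by auto
  have fiber: "(\<lambda>m. \<Sum>p\<in>{p \<in> I. \<kappa> p = K}. J m p) \<longlonglongrightarrow> 0" if "K \<in> \<kappa> ` I" for K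
  proof -
    obtain T v where Tv: "T \<in> \<T>" "v \<in> C T" "K = C T - {v}" using \<open>K \<in> \<kappa> ` I\<close> by (auto simp: I_def \<kappa>_def)
    interpret T: barycentric "C T" "a T" "g T" by (rule bary[OF Tv(1)])
    have in_fiber: "T' \<in> \<T> \<and> v' \<in> C T' \<and> C T - {v} = C T' - {v'}" if "(T', v') \<in> {p \<in> I. \<kappa> p = K}" for T' v'
      using that Tv by (auto simp: I_def \<kappa>_def)
    have p_in: "(T, v) \<in> {p \<in> I. \<kappa> p = K}" using Tv by (simp add: I_def \<kappa>_def)
    have same_cell: "v1 = v2" if "(T', v1) \<in> {p \<in> I. \<kappa> p = K}" "(T', v2) \<in> {p \<in> I. \<kappa> p = K}" for T' v1 v2
    proof -
      have "v1 \<in> C T'" "C T' - {v1} = C T' - {v2}" using in_fiber[OF that(1)] in_fiber[OF that(2)] by auto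
      then show ?thesis by auto
    qed
    show ?thesis
    proof (cases "{p \<in> I. \<kappa> p = K} = {(T, v)}")
      case True
      have KC: "K \<subseteq> C T" and Kne: "K \<noteq> {}" 
      proof -
        show "K \<subseteq> C T" using Tv by auto
        have "card K = CARD('n)" using Tv T.card_C T.finite_C by simp
        then show "K \<noteq> {}" by (metis card.empty zero_less_card_finite less_irrefl)
      qed
      \<comment> \<open>A point of the facet with nonzero bubble is relatively interior. If \<phi>
        were nonzero there, the point would lie in \<Omega> and \<open>neighbour_exists\<close>
        would add a second cell to the fibre. Density then gives \<phi> = 0 on the whole
        facet.\<close>
      have "T.bubble K x * \<phi> x = 0" if x: "x \<in> convex hull K" for x
      proof (rule ccontr)
        assume ne: "T.bubble K x * \<phi> x \<noteq> 0"
        then have "x \<in> \<Omega>" using supp by auto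
        have "0 < T.lam w x" if w: "w \<in> K" for w
        proof -
          have "T.lam w x \<noteq> 0" using ne w T.finite_sub[OF KC] by (auto simp: T.bubble_def)
          moreover have "0 \<le> T.lam w x" using x w KC by (auto simp: T.hull_eq[OF KC])
          ultimately show ?thesis by simp
        qed
        then have "\<exists>T'\<in>\<T>. \<exists>v'\<in>C T'. T' \<noteq> T \<and> C T' - {v'} = C T - {v}"
          using x Tv(3) by (intro neighbour_exists[OF Tv(1,2) _ \<open>x \<in> \<Omega>\<close>]) auto
        then obtain T' v' where *: "T' \<in> \<T>" "v' \<in> C T'" "T' \<noteq> T" "C T' - {v'} = C T - {v}"
          by blast
        then have "(T', v') \<in> {p \<in> I. \<kappa> p = K}" using Tv(3) by (simp add: I_def \<kappa>_def)
        then show False using True *(3) by auto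
      qed
      then have \<phi>0: "\<phi> x = 0" if "x \<in> convex hull K" for x
        using T.zero_by_density[OF KC Kne C1_continuous[OF \<phi>]] that by blast
      have B: "C1 (\<lambda>x. \<Sum>i\<in>UNIV. g T v $ i * F T i x) (\<lambda>x. \<Sum>i\<in>UNIV. g T v $ i *\<^sub>R G T i x)"
        by (intro C1_sum C1_scale F[OF Tv(1)])
      obtain L where L: "\<And>x. x \<in> convex hull (C T) \<Longrightarrow> \<bar>\<Sum>i\<in>UNIV. g T v $ i * F T i x\<bar> \<le> L * T.lam v x"
        using T.layer_bound[OF Tv(2) B] \<phi>0 Tv(3) by (auto simp: F_def)
      show ?thesis
        unfolding True using T.layer_vanish[OF Tv(2) C1_continuous[OF B] L \<epsilon>] by (simp add: J_def)
    next
      case False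
      then obtain p where "p \<in> {p \<in> I. \<kappa> p = K}" "p \<noteq> (T, v)" using p_in by auto
      moreover obtain T' v' where "p = (T', v')" by (cases p)
      ultimately have p': "(T', v') \<in> {p \<in> I. \<kappa> p = K}" "(T', v') \<noteq> (T, v)" by auto
      have T': "T' \<in> \<T>" "v' \<in> C T'" and K': "C T - {v} = C T' - {v'}" using in_fiber[OF p'(1)] by auto
      have ne: "T \<noteq> T'" using same_cell[of T v v'] p_in p' by auto
      \<comment> \<open>There is no third cell: the coordinate of its opposite vertex would be
        negative, and also a product of two negative numbers.\<close>
      have "(T'', v'') \<in> {(T, v), (T', v')}" if p'': "(T'', v'') \<in> {p \<in> I. \<kappa> p = K}" for T'' v''
      proof (rule ccontr)
        assume "(T'', v'') \<notin> {(T, v), (T', v')}"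
        then have ne'': "T \<noteq> T''" "T' \<noteq> T''" using same_cell[of T v v''] same_cell[of T' v' v''] p_in p' p'' by auto
        have T'': "T'' \<in> \<T>" "v'' \<in> C T''" "C T - {v} = C T'' - {v''}" using in_fiber[OF p''] by auto
        have "lamT T v v' < 0" by (rule opposite_side[OF Tv(1) T'(1) ne Tv(2) T'(2) K'])
        moreover have "lamT T v v'' < 0" by (rule opposite_side[OF Tv(1) T''(1) ne''(1) Tv(2) T''(2,3)])
        moreover have "lamT T' v' v'' < 0"
          using K' T''(3) by (intro opposite_side[OF T'(1) T''(1) ne''(2) T'(2) T''(2)]) simp
        moreover have "lamT T v v'' = lamT T v v' * lamT T' v' v''"
          by (rule adjacent_relation(1)[OF bary[OF Tv(1)] bary[OF T'(1)] Tv(2) T'(2) K'])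
        ultimately show False using mult_neg_neg[of "lamT T v v'" "lamT T' v' v''"] by simp
      qed
      then have pair: "{p \<in> I. \<kappa> p = K} = {(T, v), (T', v')}" using p_in p'(1) by auto
      have "(\<lambda>m. J m (T, v) + J m (T', v')) \<longlonglongrightarrow> 0"
        unfolding J_def fst_conv snd_conv
      proof (rule adjacent_layers_cancel[OF bary[OF Tv(1)] bary[OF T'(1)] Tv(2) T'(2) K'
            opposite_side[OF Tv(1) T'(1) ne Tv(2) T'(2) K'] F[OF Tv(1)] F[OF T'(1)] _ \<epsilon>])
        fix x assume x: "x \<in> convex hull (C T - {v})"
        have "(\<Sum>i\<in>UNIV. g T v $ i * F S i x) = \<phi> x * (\<Sum>i\<in>UNIV. g T v $ i * A S i x)" for S
          by (simp add: F_def sum_distrib_left mult_ac)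
        then show "(\<Sum>i\<in>UNIV. g T v $ i * F T i x) = (\<Sum>i\<in>UNIV. g T v $ i * F T' i x)"
          using jump[OF Tv(1) T'(1) Tv(2) T'(2) K' x] by simp
      qed
      moreover have "(\<Sum>p\<in>{(T, v), (T', v')}. J m p) = J m (T, v) + J m (T', v')" for m
        using p'(2) by (subst sum.insert) auto
      ultimately show ?thesis unfolding pair by simp
    qed
  qed
  have "(\<lambda>m. \<Sum>K\<in>\<kappa> ` I. \<Sum>p\<in>{p \<in> I. \<kappa> p = K}. J m p) \<longlonglongrightarrow> (\<Sum>K\<in>\<kappa> ` I. 0)"
    by (intro tendsto_sum fiber)
  then have lim0: "(\<lambda>m. \<Sum>p\<in>I. J m p) \<longlonglongrightarrow> 0"
    by (simp flip: sum.image_gen[OF finI])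
  have cell: "(\<integral>x. barycentric.chi (C T) (a T) (g T) (\<epsilon> m) x * (\<Sum>i\<in>UNIV. G T i x $ i) \<partial>lborel) =
      - (\<Sum>v\<in>C T. J m (T, v))" if T: "T \<in> \<T>" for T m
    unfolding J_def fst_conv snd_conv by (rule barycentric.cell_divergence[OF bary[OF T] \<epsilon>(2) F[OF T]])
  have "(\<lambda>m. \<Sum>T\<in>\<T>. \<integral>x. barycentric.chi (C T) (a T) (g T) (\<epsilon> m) x * (\<Sum>i\<in>UNIV. G T i x $ i) \<partial>lborel)
      \<longlonglongrightarrow> (\<Sum>T\<in>\<T>. \<integral>x. indicator (convex hull (C T)) x * (\<Sum>i\<in>UNIV. G T i x $ i) \<partial>lborel)"
  proof (intro tendsto_sum barycentric.chi_limit bary \<epsilon>)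
    fix T assume T: "T \<in> \<T>"
    show "continuous_on UNIV (\<lambda>x. \<Sum>i\<in>UNIV. G T i x $ i)"
      using C1_grad_continuous[OF F[OF T]] by (intro continuous_intros) auto
  qed
  moreover have "(\<Sum>T\<in>\<T>. \<integral>x. barycentric.chi (C T) (a T) (g T) (\<epsilon> m) x * (\<Sum>i\<in>UNIV. G T i x $ i) \<partial>lborel) =
      - (\<Sum>p\<in>I. J m p)" for m
  proof -
    have "(\<Sum>p\<in>I. J m p) = (\<Sum>T\<in>\<T>. \<Sum>v\<in>C T. J m (T, v))"
      unfolding I_def using finite_mesh barycentric.finite_C[OF bary] by (subst sum.Sigma) auto
    then show ?thesis by (simp add: cell sum_negf)
  qed
  ultimately have "(\<lambda>m. - (\<Sum>p\<in>I. J m p))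
      \<longlonglongrightarrow> (\<Sum>T\<in>\<T>. \<integral>x. indicator (convex hull (C T)) x * (\<Sum>i\<in>UNIV. G T i x $ i) \<partial>lborel)" by simp
  then have "(\<Sum>T\<in>\<T>. \<integral>x. indicator (convex hull (C T)) x * (\<Sum>i\<in>UNIV. G T i x $ i) \<partial>lborel) = - 0"
    using tendsto_minus[OF lim0] by (rule LIMSEQ_unique)
  then show ?thesis
    by (simp add: G_def hull cong: sum.cong)
qed

text \<open>The two fields are polynomials on different cells, so their difference is formed on the
  common facet only. Its degrees of freedom on all subfaces vanish, and
  \<open>normal_trace_vanishes\<close> applies.\<close>

lemma normal_continuity:
  assumes p: "\<And>T. T \<in> \<T> \<Longrightarrow> p T \<in> PPX k (int r) T" and sv: "single_valued_dofs k (int r) dyh \<T> p"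
    and T: "T \<in> \<T>" "T' \<in> \<T>" and v: "v \<in> C T" "v' \<in> C T'" and K: "C T - {v} = C T' - {v'}"
    and x: "x \<in> convex hull (C T - {v})" and \<sigma>: "card \<sigma> = k"
  shows "row_trace k (p T x) \<sigma> (g T v) = row_trace k (p T' x) \<sigma> (g T v)"
proof -
  interpret T: element "C T" "a T" "g T" k r y z dyh by (rule elem[OF T(1)])
  let ?K = "C T - {v}"
  let ?f = "convex hull ?K"
  have KC: "?K \<subseteq> C T" by auto
  have KC': "?K \<subseteq> C T'" using K by auto
  have fT: "?f \<subseteq> T" using hull_mono[OF KC, of convex] hull[OF T(1)] by simp
  have fT': "?f \<subseteq> T'" using hull_mono[OF KC', of convex] hull[OF T(2)] by simp
  define P where "P S = (\<lambda>x ws vs. if x \<in> ?f then p S x ws vs else 0)" for S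
  have P: "P T \<in> PPX k (int r) ?f" "P T' \<in> PPX k (int r) ?f"
    unfolding P_def using PPX_restrict[OF p fT] PPX_restrict[OF p fT'] T by auto
  have P_eq: "P S x = p S x" if "x \<in> ?f" for S x using that by (simp add: P_def)
  define D where "D = (\<lambda>x ws vs. 1 * P T x ws vs + (- 1) * P T' x ws vs)"
  have card: "card ?K = CARD('n)" using T.card_C T.finite_C v by simp
  have Kne: "?K \<noteq> {}" using card by (metis card.empty zero_less_card_finite less_irrefl)
  have sub: "convex hull L \<in> mesh_subsimplices l \<T>" if "L \<subseteq> ?K" "card L = Suc l" for L l
  proof -
    have "convex hull L \<in> subsimplices l (convex hull (C T))"
      unfolding T.subsimplices_hull using that by auto
    then show ?thesis using T(1) hull[OF T(1)] by (auto simp: mesh_subsimplices_def)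
  qed
  have sv0: "p S u = p S' u" if "{u} \<in> mesh_subsimplices 0 \<T>" "S \<in> \<T>" "S' \<in> \<T>" "u \<in> S" "u \<in> S'" for u S S'
    using sv[unfolded single_valued_dofs_def, THEN conjunct1, rule_format, OF that(1-3)] that(4,5) by simp
  have sv1: "face_ip k l f (p S) \<eta> = face_ip k l f (p S') \<eta>"
    if "l \<in> {1..CARD('n) - 1}" "f \<in> mesh_subsimplices l \<T>" "S \<in> \<T>" "S' \<in> \<T>" "f \<subseteq> S" "f \<subseteq> S'"
      "\<eta> \<in> face_tests k (int r) l f (dyh f)" for l f S S' \<eta>
    using sv[unfolded single_valued_dofs_def, THEN conjunct2, rule_format, OF that(1-4) _ that(7)] that(5,6) by simp
  have "row_trace k (D x) \<sigma> (g T v) = 0"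
  proof (rule T.normal_trace_vanishes[OF KC _ _ _ subset_refl Kne _ _ x \<sigma>])
    show "D \<in> PPX k (int r) ?f" unfolding D_def by (rule PPX_lin[OF P])
    show "card ?K \<le> CARD('n)" using card by simp
    show "g T v \<bullet> u = 0" if "u \<in> tangent_space ?f" for u
      using v by (intro T.grad_normal[OF KC _ that]) simp
    show "D w = (\<lambda>ws vs. 0)" if w: "w \<in> ?K" for w
    proof -
      have wf: "w \<in> ?f" using w by (rule hull_inc)
      have "convex hull {w} \<in> mesh_subsimplices 0 \<T>" using w by (intro sub) auto
      then have "{w} \<in> mesh_subsimplices 0 \<T>" by simp
      from sv0[OF this T] have "p T w = p T' w" using wf fT fT' by auto
      then show ?thesis using wf by (simp add: D_def P_eq)
    qed
    fix L l \<eta>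
    assume L: "L \<subseteq> ?K" "card L = Suc l" and l: "1 \<le> l" "l \<le> CARD('n) - 1"
      and \<eta>: "\<eta> \<in> face_tests k (int r) l (convex hull L) (dyh (convex hull L))"
    have LC: "L \<subseteq> C T" using L by auto
    have Lf: "convex hull L \<subseteq> ?f" using L(1) by (rule hull_mono)
    have "face_ip k l (convex hull L) D \<eta> =
        1 * face_ip k l (convex hull L) (P T) \<eta> + (- 1) * face_ip k l (convex hull L) (P T') \<eta>"
      unfolding D_def by (rule T.face_ip_lin[OF LC L(2) l(2) P Lf \<eta>])
    moreover have "face_ip k l (convex hull L) (P S) \<eta> = face_ip k l (convex hull L) (p S) \<eta>" for S
      using Lf P_eq by (intro face_ip_cong T.face_full_support[OF LC L(2)]) auto
    moreover have "face_ip k l (convex hull L) (p T) \<eta> = face_ip k l (convex hull L) (p T') \<eta>"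
      using l T Lf fT fT' \<eta> by (intro sv1 sub[OF L]) auto
    ultimately show "face_ip k l (convex hull L) D \<eta> = 0" by simp
  qed
  moreover have "row_trace k (D x) \<sigma> (g T v) = row_trace k (p T x) \<sigma> (g T v) - row_trace k (p T' x) \<sigma> (g T v)"
  proof -
    have "D x = (\<lambda>ws vs. 1 * p T x ws vs + (- 1) * p T' x ws vs)" using x by (simp add: D_def P_eq)
    then show ?thesis
      by (simp only: row_trace_def coef_def Alt2_inner_lin_left) (simp add: algebra_simps sum_subtractf)
  qed
  ultimately show ?thesis by simp
qed

section \<open>Weak divergence on the domain\<close>

lemma AE_unique_cell: "AE x in lebesgue. \<forall>T\<in>\<T>. \<forall>v\<in>C T. lamT T v x \<noteq> 0"
  unfolding AE_completion_iff
  by (rule AE_finite_allI[OF finite_mesh]) (rule barycentric.AE_lam_nonzero[OF bary])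

lemma integral_domain:
  fixes u :: "'n euc \<Rightarrow> real"
  assumes "u \<in> borel_measurable borel" "\<And>x. x \<notin> \<Omega> \<Longrightarrow> u x = 0"
  shows "integral\<^sup>L (lebesgue_on \<Omega>) u = (\<integral>x. u x \<partial>lborel)"
proof -
  have \<Omega>L: "\<Omega> \<inter> space lebesgue \<in> sets lebesgue" using open_domain by (simp add: lmeasurable_open)
  have "integral\<^sup>L (lebesgue_on \<Omega>) u = (\<integral>x. indicator \<Omega> x *\<^sub>R u x \<partial>lebesgue)"
    by (rule integral_restrict_space[OF \<Omega>L])
  also have "(\<lambda>x. indicator \<Omega> x *\<^sub>R u x) = u"
    using assms(2) by (intro ext) (auto simp: indicator_def)
  also have "integral\<^sup>L lebesgue u = (\<integral>x. u x \<partial>lborel)"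
    using assms(1) by (intro integral_completion) simp
  finally show ?thesis .
qed

text \<open>Points outside \<Omega> have a neighbourhood off the closed support, so the derivatives
  vanish there as well.\<close>

lemma smooth_test_C1:
  assumes "\<phi> \<in> smooth_test \<Omega>"
  shows "C1 \<phi> (\<lambda>x. \<chi> i. partial_deriv i \<phi> x)" and "\<And>x. x \<notin> \<Omega> \<Longrightarrow> \<phi> x = 0"
    and "\<And>x i. x \<notin> \<Omega> \<Longrightarrow> partial_deriv i \<phi> x = 0"
proof -
  have C: "C_diff (Suc 0) \<phi>" and S: "closure {x. \<phi> x \<noteq> 0} \<subseteq> \<Omega>" using assms by (auto simp: smooth_test_def)
  have der: "(\<phi> has_derivative frechet_derivative \<phi> (at x)) (at x)" for x
    using C by (simp add: frechet_derivative_works)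
  show "C1 \<phi> (\<lambda>x. \<chi> i. partial_deriv i \<phi> x)"
    unfolding C1_def
  proof (intro conjI allI)
    fix x
    have lin: "linear (frechet_derivative \<phi> (at x))" using der has_derivative_linear by blast
    have "frechet_derivative \<phi> (at x) h = (\<chi> i. partial_deriv i \<phi> x) \<bullet> h" for h
    proof -
      have h: "h = (\<Sum>i\<in>UNIV. h $ i *\<^sub>R axis i 1)"
        using basis_expansion[of h] by (simp add: scalar_mult_eq_scaleR)
      have "frechet_derivative \<phi> (at x) h = (\<Sum>i\<in>UNIV. h $ i * frechet_derivative \<phi> (at x) (axis i 1))"
        by (subst h) (simp add: linear_sum[OF lin] linear_scale[OF lin])
      then show ?thesis by (simp add: inner_vec_def partial_deriv_def mult.commute)
    qed
    then have "frechet_derivative \<phi> (at x) = (\<lambda>h. (\<chi> i. partial_deriv i \<phi> x) \<bullet> h)" by (intro ext)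
    then show "(\<phi> has_derivative (\<lambda>h. (\<chi> i. partial_deriv i \<phi> x) \<bullet> h)) (at x)"
      using der[of x] by simp
    show "continuous_on UNIV (\<lambda>x. \<chi> i. partial_deriv i \<phi> x)"
      using C by (intro continuous_on_vec_lambda) auto
  qed
  have out: "\<phi> x = 0" if "x \<notin> closure {x. \<phi> x \<noteq> 0}" for x
    using that closure_subset[of "{x. \<phi> x \<noteq> 0}"] by auto
  show "\<phi> x = 0" if "x \<notin> \<Omega>" for x by (rule out) (use S that in blast)
  show "partial_deriv i \<phi> x = 0" if "x \<notin> \<Omega>" for x i
  proof -
    have "((\<lambda>x. 0) has_derivative (\<lambda>h. 0)) (at x)" by simp
    then have "(\<phi> has_derivative (\<lambda>h. 0)) (at x)"
    proof (rule has_derivative_transform_within_open[of _ _ _ _ "- closure {x. \<phi> x \<noteq> 0}"])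
      show "x \<in> - closure {x. \<phi> x \<noteq> 0}" using S that by blast
      show "0 = \<phi> u" if "u \<in> - closure {x. \<phi> x \<noteq> 0}" for u using out[of u] that by (metis ComplD)
    qed (simp_all add: open_Compl)
    then have "frechet_derivative \<phi> (at x) = (\<lambda>h. 0)" using der has_derivative_unique by blast
    then show ?thesis by (simp add: partial_deriv_def)
  qed
qed

theorem V_h_subset_Hdiv: "V_h k (int r) dyh \<T> \<Omega> \<subseteq> Hdiv k \<Omega>"
proof
  fix \<omega> assume "\<omega> \<in> V_h k (int r) dyh \<T> \<Omega>"
  then obtain p where \<omega>L2: "\<omega> \<in> L2X k \<Omega>" and p: "\<And>T. T \<in> \<T> \<Longrightarrow> p T \<in> PPX k (int r) T"
    and \<omega>p: "\<And>T. T \<in> \<T> \<Longrightarrow> AE x in lebesgue_on (T \<inter> \<Omega>). \<omega> x = p T x"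
    and sv: "single_valued_dofs k (int r) dyh \<T> p"
    by (auto simp: V_h_def)
  \<comment> \<open>Each coefficient is extended from its cell to a polynomial on the whole space,
    which can be differentiated on the boundary too.\<close>
  have "\<exists>q G. q \<in> Pol (int r) \<and> C1 q G \<and> (\<forall>x\<in>T. coef k (p T x) \<sigma> i = q x)"
    if "card \<sigma> = k" "T \<in> \<T>" for \<sigma> T i
  proof -
    have "(\<lambda>x. basis_coef (\<lambda>i. axis i 1) (p T x) \<sigma> i) \<in> PP (int r) T" by (rule basis_coef_PP[OF p[OF that(2)]])
    then obtain q where q: "q \<in> Pol (int r)"
      "(\<lambda>x. basis_coef (\<lambda>i. axis i 1) (p T x) \<sigma> i) = (\<lambda>x. if x \<in> T then q x else 0)" by (auto simp: PP_iff)
    have "coef k (p T x) \<sigma> i = q x" if "x \<in> T" for x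
      using coef_eq_basis_coef[OF XX_slices[OF PPX_XX[OF p[OF \<open>T \<in> \<T>\<close>]]] \<open>card \<sigma> = k\<close>] fun_cong[OF q(2), of x] that by simp
    then show ?thesis using q(1) Pol_C1[OF q(1)] by blast
  qed
  then have "\<forall>\<sigma> T i. \<exists>q G. card \<sigma> = k \<and> T \<in> \<T> \<longrightarrow> C1 q G \<and> (\<forall>x\<in>T. coef k (p T x) \<sigma> i = q x)" by blast
  then obtain A GA where A: "\<And>\<sigma> T i. card \<sigma> = k \<Longrightarrow> T \<in> \<T> \<Longrightarrow> C1 (A \<sigma> T i) (GA \<sigma> T i)"
    and A_eq: "\<And>\<sigma> T i x. card \<sigma> = k \<Longrightarrow> T \<in> \<T> \<Longrightarrow> x \<in> T \<Longrightarrow> coef k (p T x) \<sigma> i = A \<sigma> T i x"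
    unfolding choice_iff by blast
  define dv where "dv \<sigma> T x = (\<Sum>i\<in>UNIV. GA \<sigma> T i x $ i)" for \<sigma> T x
  \<comment> \<open>The weak divergence is the cellwise one; on common boundaries, a null set, the
    contributions are simply added.\<close>
  define gd where "gd \<sigma> x = (\<Sum>T\<in>\<T>. indicator T x * dv \<sigma> T x)" for \<sigma> x
  have dvc: "continuous_on UNIV (dv \<sigma> T)" if "card \<sigma> = k" "T \<in> \<T>" for \<sigma> T
    unfolding dv_def using C1_grad_continuous[OF A[OF that]] by (intro continuous_intros) auto
  have Tb: "T \<in> sets borel" if "T \<in> \<T>" for T using compact_cells[OF that] by (rule borel_compact)
  have gdm: "gd \<sigma> \<in> borel_measurable borel" if "card \<sigma> = k" for \<sigma>
    unfolding gd_def using borel_measurable_continuous_onI[OF dvc[OF that]] Tb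
    by (intro borel_measurable_sum borel_measurable_times borel_measurable_indicator) auto
  have \<Omega>l: "\<Omega> \<in> lmeasurable" using open_domain \<Omega>(2) by (simp add: lmeasurable_open)
  then have \<Omega>s: "\<Omega> \<in> sets lebesgue" by auto
  have leb: "u \<in> borel_measurable (lebesgue_on \<Omega>)" if "u \<in> borel_measurable borel" for u :: "'n euc \<Rightarrow> real"
    using that by (intro measurable_restrict_space1 measurable_completion) simp
  have "gd \<sigma> \<in> L2 \<Omega>" if \<sigma>: "card \<sigma> = k" for \<sigma>
  proof -
    have "\<exists>N\<ge>0. \<forall>x\<in>T. \<bar>dv \<sigma> T x\<bar> \<le> N" if T: "T \<in> \<T>" for T
      using bounded_on_compact[OF dvc[OF \<sigma> T] compact_cells[OF T]] by (metis real_norm_def)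
    then obtain N where N: "\<And>T. T \<in> \<T> \<Longrightarrow> 0 \<le> N T" "\<And>T x. T \<in> \<T> \<Longrightarrow> x \<in> T \<Longrightarrow> \<bar>dv \<sigma> T x\<bar> \<le> N T" by metis
    have "\<bar>gd \<sigma> x\<bar> \<le> (\<Sum>T\<in>\<T>. N T)" for x
      unfolding gd_def using N by (intro order_trans[OF sum_abs] sum_mono) (auto simp: indicator_def)
    then have "(gd \<sigma> x)\<^sup>2 \<le> (\<Sum>T\<in>\<T>. N T)\<^sup>2" for x by (metis abs_ge_zero power2_abs power_mono)
    moreover have "finite_measure (lebesgue_on \<Omega>)" using \<Omega>l by (rule finite_measure_lebesgue_on)
    ultimately have "integrable (lebesgue_on \<Omega>) (\<lambda>x. (gd \<sigma> x)\<^sup>2)"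
      using leb[OF gdm[OF \<sigma>]] by (intro finite_measure.integrable_const_bound[of _ _ "(\<Sum>T\<in>\<T>. N T)\<^sup>2"]) auto
    then show ?thesis using leb[OF gdm[OF \<sigma>]] by (simp add: L2_def)
  qed
  moreover have "weak_div k \<Omega> \<omega> gd"
    unfolding weak_div_def
  proof (intro allI impI ballI)
    fix \<sigma> :: "'n set" and \<phi> assume \<sigma>: "card \<sigma> = k" and \<phi>: "\<phi> \<in> smooth_test \<Omega>"
    define \<Phi> where "\<Phi> = (\<lambda>x. \<chi> i. partial_deriv i \<phi> x)"
    have \<phi>C: "C1 \<phi> \<Phi>" and \<phi>0: "\<And>x. x \<notin> \<Omega> \<Longrightarrow> \<phi> x = 0" and \<Phi>0: "\<And>x. x \<notin> \<Omega> \<Longrightarrow> \<Phi> x = 0"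
      using smooth_test_C1[OF \<phi>] by (auto simp: \<Phi>_def vec_eq_iff)
    define w where "w T x = (\<Sum>i\<in>UNIV. A \<sigma> T i x * \<Phi> x $ i)" for T x
    have wc: "continuous_on UNIV (w T)" if "T \<in> \<T>" for T
      unfolding w_def using C1_continuous[OF A[OF \<sigma> that]] C1_grad_continuous[OF \<phi>C]
      by (intro continuous_intros) auto
    have jump: "(\<Sum>i\<in>UNIV. g T v $ i * A \<sigma> T i x) = (\<Sum>i\<in>UNIV. g T v $ i * A \<sigma> T' i x)"
      if "T \<in> \<T>" "T' \<in> \<T>" "v \<in> C T" "v' \<in> C T'" "C T - {v} = C T' - {v'}" "x \<in> convex hull (C T - {v})"
      for T T' v v' x
    proof -
      have "x \<in> T" using that hull_mono[of "C T - {v}" "C T" convex] hull[of T] by blast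
      moreover have "x \<in> T'" using that hull_mono[of "C T' - {v'}" "C T'" convex] hull[of T'] by auto
      ultimately show ?thesis
        using normal_continuity[OF p sv that \<sigma>] A_eq[OF \<sigma>] that(1,2) by (simp add: row_trace_def mult.commute)
    qed
    have zero: "(\<Sum>T\<in>\<T>. \<integral>x. indicator T x * (\<Sum>i\<in>UNIV. \<phi> x * GA \<sigma> T i x $ i + A \<sigma> T i x * \<Phi> x $ i) \<partial>lborel) = 0"
      by (rule divergence_sum_zero[OF A[OF \<sigma>] \<phi>C \<phi>0 jump])
    have icell: "integrable lborel (\<lambda>x. indicator T x * h x)" if "T \<in> \<T>" "continuous_on UNIV h" for T and h :: "'n euc \<Rightarrow> real"
      using borel_integrable_compact[OF compact_cells[OF that(1)], of h] that(2) continuous_on_subset by fastforce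
    have i1: "integrable lborel (\<lambda>x. indicator T x * w T x)" if "T \<in> \<T>" for T
      by (rule icell[OF that wc[OF that]])
    have i2: "integrable lborel (\<lambda>x. indicator T x * (\<phi> x * dv \<sigma> T x))" if "T \<in> \<T>" for T
      using that C1_continuous[OF \<phi>C] dvc[OF \<sigma> that] by (intro icell continuous_intros)
    have "(\<Sum>T\<in>\<T>. \<integral>x. indicator T x * (\<Sum>i\<in>UNIV. \<phi> x * GA \<sigma> T i x $ i + A \<sigma> T i x * \<Phi> x $ i) \<partial>lborel) =
        (\<Sum>T\<in>\<T>. (\<integral>x. indicator T x * (\<phi> x * dv \<sigma> T x) \<partial>lborel) + (\<integral>x. indicator T x * w T x \<partial>lborel))"
    proof (intro sum.cong refl)
      fix T assume T: "T \<in> \<T>"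
      have "(\<integral>x. indicator T x * (\<Sum>i\<in>UNIV. \<phi> x * GA \<sigma> T i x $ i + A \<sigma> T i x * \<Phi> x $ i) \<partial>lborel) =
          (\<integral>x. indicator T x * (\<phi> x * dv \<sigma> T x) + indicator T x * w T x \<partial>lborel)"
        by (simp add: dv_def w_def sum.distrib sum_distrib_left distrib_left)
      then show "(\<integral>x. indicator T x * (\<Sum>i\<in>UNIV. \<phi> x * GA \<sigma> T i x $ i + A \<sigma> T i x * \<Phi> x $ i) \<partial>lborel) =
          (\<integral>x. indicator T x * (\<phi> x * dv \<sigma> T x) \<partial>lborel) + (\<integral>x. indicator T x * w T x \<partial>lborel)"
        using i1[OF T] i2[OF T] by simp
    qed
    then have balance: "(\<Sum>T\<in>\<T>. \<integral>x. indicator T x * w T x \<partial>lborel) =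
        - (\<Sum>T\<in>\<T>. \<integral>x. indicator T x * (\<phi> x * dv \<sigma> T x) \<partial>lborel)"
      using zero by (simp add: sum.distrib eq_neg_iff_add_eq_0 add.commute)
    have wm: "(\<lambda>x. \<Sum>T\<in>\<T>. indicator T x * w T x) \<in> borel_measurable borel"
      using borel_measurable_continuous_onI[OF wc] Tb
      by (intro borel_measurable_sum borel_measurable_times borel_measurable_indicator) auto
    \<comment> \<open>Almost every point avoids all facet hyperplanes, hence lies in exactly one
      cell, and the sum over cells has a single term there.\<close>
    have AE: "AE x in lebesgue_on \<Omega>. (\<Sum>i\<in>UNIV. coef k (\<omega> x) \<sigma> i * partial_deriv i \<phi> x) =
        (\<Sum>T\<in>\<T>. indicator T x * w T x)"
    proof -
      have "AE x in lebesgue. x \<in> T \<inter> \<Omega> \<longrightarrow> \<omega> x = p T x" if T: "T \<in> \<T>" for T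
      proof -
        have "T \<inter> \<Omega> \<in> sets lebesgue" using Tb[OF T] \<Omega>s by auto
        then show ?thesis using \<omega>p[OF T] by (simp add: AE_restrict_space_iff)
      qed
      then have "AE x in lebesgue. \<forall>T\<in>\<T>. x \<in> T \<inter> \<Omega> \<longrightarrow> \<omega> x = p T x"
        using finite_mesh by (intro AE_finite_allI) auto
      then have "AE x in lebesgue. x \<in> \<Omega> \<longrightarrow> (\<Sum>i\<in>UNIV. coef k (\<omega> x) \<sigma> i * partial_deriv i \<phi> x) =
        (\<Sum>T\<in>\<T>. indicator T x * w T x)"
        using AE_unique_cell
      proof (eventually_elim, intro impI)
        fix x assume \<omega>x: "\<forall>T\<in>\<T>. x \<in> T \<inter> \<Omega> \<longrightarrow> \<omega> x = p T x" and ne: "\<forall>T\<in>\<T>. \<forall>v\<in>C T. lamT T v x \<noteq> 0" and x: "x \<in> \<Omega>"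
        obtain T where T: "T \<in> \<T>" "x \<in> T" using x domain_cover by auto
        then have "0 < lamT T v x" if "v \<in> C T" for v using ne that by (auto simp: cell_iff less_le)
        then have only: "x \<notin> T'" if "T' \<in> \<T>" "T' \<noteq> T" for T'
          using cell_unique[OF T(1) that(1)] that(2) by auto
        have "(\<Sum>T'\<in>\<T>. indicator T' x * w T' x) = (\<Sum>T'\<in>\<T>. if T' = T then w T x else 0)"
          using only T by (intro sum.cong) (auto simp: indicator_def)
        then have "(\<Sum>T'\<in>\<T>. indicator T' x * w T' x) = w T x" using T finite_mesh by simp
        then show "(\<Sum>i\<in>UNIV. coef k (\<omega> x) \<sigma> i * partial_deriv i \<phi> x) = (\<Sum>T\<in>\<T>. indicator T x * w T x)"
          using \<omega>x T x A_eq[OF \<sigma> T] by (simp add: w_def \<Phi>_def)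
      qed
      then show ?thesis using \<Omega>s by (simp add: AE_restrict_space_iff)
    qed
    have "integral\<^sup>L (lebesgue_on \<Omega>) (\<lambda>x. \<Sum>i\<in>UNIV. coef k (\<omega> x) \<sigma> i * partial_deriv i \<phi> x) =
        integral\<^sup>L (lebesgue_on \<Omega>) (\<lambda>x. \<Sum>T\<in>\<T>. indicator T x * w T x)"
    proof (rule integral_cong_AE[OF _ leb[OF wm] AE])
      have "(\<lambda>x. coef k (\<omega> x) \<sigma> i) \<in> borel_measurable (lebesgue_on \<Omega>)" for i
        using \<omega>L2 \<sigma> by (auto simp: L2X_def L2_def)
      moreover have "partial_deriv i \<phi> \<in> borel_measurable (lebesgue_on \<Omega>)" for i
      proof -
        have "continuous_on UNIV (\<lambda>x. \<Phi> x $ i)" using C1_grad_continuous[OF \<phi>C] by (intro continuous_intros)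
        then show ?thesis using leb[OF borel_measurable_continuous_onI, of "partial_deriv i \<phi>"] by (simp add: \<Phi>_def)
      qed
      ultimately show "(\<lambda>x. \<Sum>i\<in>UNIV. coef k (\<omega> x) \<sigma> i * partial_deriv i \<phi> x) \<in> borel_measurable (lebesgue_on \<Omega>)"
        by (intro borel_measurable_sum borel_measurable_times)
    qed
    also have "\<dots> = (\<integral>x. (\<Sum>T\<in>\<T>. indicator T x * w T x) \<partial>lborel)"
      using \<Phi>0 by (intro integral_domain[OF wm]) (simp add: w_def)
    also have "\<dots> = (\<Sum>T\<in>\<T>. \<integral>x. indicator T x * w T x \<partial>lborel)"
      by (rule Bochner_Integration.integral_sum[OF i1])
    also have "\<dots> = - (\<Sum>T\<in>\<T>. \<integral>x. indicator T x * (\<phi> x * dv \<sigma> T x) \<partial>lborel)" by (rule balance)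
    also have "(\<Sum>T\<in>\<T>. \<integral>x. indicator T x * (\<phi> x * dv \<sigma> T x) \<partial>lborel) =
        (\<integral>x. (\<Sum>T\<in>\<T>. indicator T x * (\<phi> x * dv \<sigma> T x)) \<partial>lborel)"
      by (rule Bochner_Integration.integral_sum[OF i2, symmetric])
    also have "\<dots> = (\<integral>x. gd \<sigma> x * \<phi> x \<partial>lborel)"
      by (simp add: gd_def sum_distrib_left sum_distrib_right mult_ac)
    also have "\<dots> = integral\<^sup>L (lebesgue_on \<Omega>) (\<lambda>x. gd \<sigma> x * \<phi> x)"
      using \<phi>0 gdm[OF \<sigma>] borel_measurable_continuous_onI[OF C1_continuous[OF \<phi>C]]
      by (intro integral_domain[symmetric]) auto
    finally show "integral\<^sup>L (lebesgue_on \<Omega>) (\<lambda>x. \<Sum>i\<in>UNIV. coef k (\<omega> x) \<sigma> i * partial_deriv i \<phi> x) =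
        - integral\<^sup>L (lebesgue_on \<Omega>) (\<lambda>x. gd \<sigma> x * \<phi> x)" .
  qed
  ultimately show "\<omega> \<in> Hdiv k \<Omega>" using \<omega>L2 unfolding Hdiv_def by blast
qed

end

theorem theorem6p5:
  fixes \<Omega> :: "('n::{finite,wellorder}) euc set"
    and \<T> :: "'n euc set set"
    and y :: "'n euc set \<Rightarrow> 'n \<Rightarrow> 'n euc"
    and dyh :: "'n euc set \<Rightarrow> 'n \<Rightarrow> 'n form"
    and k r :: nat
  assumes "2 \<le> CARD('n)" and "1 \<le> k" and "k \<le> CARD('n) - 1" and "1 \<le> r"
    and "domain \<Omega>" and "bounded \<Omega>"
    and "conforming_mesh \<T> \<Omega>"
    and "\<And>l f. l \<le> CARD('n) - 1 \<Longrightarrow> f \<in> mesh_subsimplices l \<T> \<Longrightarrow> tn_basis l f (y f)"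
    and "\<And>l f. l \<le> CARD('n) - 1 \<Longrightarrow> f \<in> mesh_subsimplices l \<T> \<Longrightarrow>
           dual_family (\<lambda>i. covector (y f i)) (dyh f)"
  shows "(\<forall>T\<in>\<T>. unisolvent k (int r) dyh T) \<and>
         V_h k (int r) dyh \<T> \<Omega> \<subseteq> Hdiv k \<Omega>"
proof -
  \<comment> \<open>Nothing is assumed about \<open>dyh f\<close> unless \<open>f\<close> is a face
    of the mesh, so the choice of representing vectors is guarded.\<close>
  have "\<forall>f. \<exists>z. (\<exists>l\<le>CARD('n) - 1. f \<in> mesh_subsimplices l \<T>) \<longrightarrow>
      dyh f = (\<lambda>i. covector (z i)) \<and> (\<forall>i j. y f i \<bullet> z j = (if i = j then 1 else 0))"
  proof
    fix f
    show "\<exists>z. (\<exists>l\<le>CARD('n) - 1. f \<in> mesh_subsimplices l \<T>) \<longrightarrow>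
      dyh f = (\<lambda>i. covector (z i)) \<and> (\<forall>i j. y f i \<bullet> z j = (if i = j then 1 else 0))"
    proof (cases "\<exists>l\<le>CARD('n) - 1. f \<in> mesh_subsimplices l \<T>")
      case True
      then obtain l where "l \<le> CARD('n) - 1" "f \<in> mesh_subsimplices l \<T>" by blast
      from dual_family_covector[OF assms(9)[OF this]] obtain w where
        "dyh f = (\<lambda>i. covector (w i))" "\<And>i j. y f i \<bullet> w j = (if i = j then 1 else 0)" by blast
      then show ?thesis by (intro exI[of _ w]) simp
    qed blast
  qed
  then obtain z where z: "\<And>f l. l \<le> CARD('n) - 1 \<Longrightarrow> f \<in> mesh_subsimplices l \<T> \<Longrightarrow>
      dyh f = (\<lambda>i. covector (z f i)) \<and> (\<forall>i j. y f i \<bullet> z f j = (if i = j then 1 else 0))"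
    unfolding choice_iff by blast
  have "\<forall>T. \<exists>C a g. T \<in> \<T> \<longrightarrow> barycentric C a g \<and> T = convex hull C"
  proof
    fix T
    show "\<exists>C a g. T \<in> \<T> \<longrightarrow> barycentric C a g \<and> T = convex hull C"
    proof (cases "T \<in> \<T>")
      case True
      then have "int CARD('n) simplex T" using assms(7) by (simp add: conforming_mesh_def)
      from barycentric_exists[OF this] obtain C a g where "barycentric C a g" "T = convex hull C" .
      then show ?thesis by blast
    qed simp
  qed
  \<comment> \<open>Packed into one tuple, so that a single choice function yields the vertices and
    coordinates of each cell.\<close>
  then have "\<forall>T. \<exists>h. T \<in> \<T> \<longrightarrow> barycentric (fst h) (fst (snd h)) (snd (snd h)) \<and> T = convex hull (fst h)"
    by (metis fst_conv snd_conv)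
  from choice[OF this] obtain h where h: "\<forall>T. T \<in> \<T> \<longrightarrow>
    barycentric (fst (h T)) (fst (snd (h T))) (snd (snd (h T))) \<and> T = convex hull (fst (h T))" ..
  define C where "C T = fst (h T)" for T
  define a where "a T = fst (snd (h T))" for T
  define g where "g T = snd (snd (h T))" for T
  have bary: "barycentric (C T) (a T) (g T)" and hull: "T = convex hull (C T)" if "T \<in> \<T>" for T
    using h that unfolding C_def a_def g_def by blast+
  have elem: "element (C T) (a T) (g T) k r y z dyh" if T: "T \<in> \<T>" for T
  proof -
    interpret barycentric "C T" "a T" "g T" by (rule bary[OF T])
    have face: "convex hull K \<in> mesh_subsimplices l \<T>" if "K \<subseteq> C T" "card K = Suc l" for K l
    proof -
      have "convex hull K \<in> subsimplices l (convex hull (C T))" unfolding subsimplices_hull using that by auto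
      then have "convex hull K \<in> subsimplices l T" by (simp only: hull[OF T, symmetric])
      then show ?thesis unfolding mesh_subsimplices_def using T by blast
    qed
    show ?thesis
    proof
      fix K l assume K: "K \<subseteq> C T" "card K = Suc l" and l: "l \<le> CARD('n) - 1"
      show "tn_basis l (convex hull K) (y (convex hull K))" using assms(8)[OF l face[OF K]] .
      show "dyh (convex hull K) = (\<lambda>i. covector (z (convex hull K) i))" using z[OF l face[OF K]] by simp
      show "y (convex hull K) i \<bullet> z (convex hull K) j = (if i = j then 1 else 0)" for i j
        using z[OF l face[OF K]] by simp
    qed (use assms in auto)
  qed
  have "unisolvent k (int r) dyh T" if T: "T \<in> \<T>" for T
    using element.unisolvent[OF elem[OF T]] hull[OF T, symmetric] by simp
  moreover have "adapted_mesh \<Omega> \<T> y z dyh k r C a g"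
    by (rule adapted_mesh.intro[OF assms(5-7) elem hull[symmetric]])
  ultimately show ?thesis using adapted_mesh.V_h_subset_Hdiv by blast
qed

end
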